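(* Let $n\ge 1$ be an integer, $s\in(0,1)$, $p\ge 2$, $ps<n<2ps$, $p_s^*=\frac{np}{n-ps}$, $1<q<p$, and $r\in(2p,p_s^* )$. Let $\Omega\subset\mathbb{R}^n$ be a bounded domain with smooth boundary, let $a,b>0$, $M(t)=a+bt$, and let $f\in L^{\frac{r}{r-q}}(\Omega)$ and $g\in L^\infty(\Omega)$ be (possibly sign-changing) functions with $f^+=\max\{f,0\}\not\equiv 0$ and $g^+=\max\{g,0\}\not\equiv 0$. Then there exists $\lambda_0>0$, having the property that the Nehari set $\mathcal N_\lambda$ is a $C^1$ manifold for every $\lambda\in(0,\lambda_0)$, such that for every $\lambda\in(0,\lambda_0)$ the problem $$(P_\lambda)\quad M(\|u\|_{X_0}^p)(-\Delta)_p^su=\lambda f(x)|u|^{q-2}u+g(x)|u|^{r-2}u,\ \ u\ge0,\ u\not\equiv0\ \text{ in }\Omega,\qquad u=0\ \text{ in }\mathbb{R}^n\setminus\Omega,$$ has at least two solutions.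
   Context: Let $\mathcal C\Omega=\mathbb{R}^n\setminus\Omega$ and $Q=\mathbb{R}^{2n}\setminus(\mathcal C\Omega\times\mathcal C\Omega)$. $X$ is the space of measurable $u:\mathbb{R}^n\to\mathbb{R}$ with $u|_\Omega\in L^p(\Omega)$ and $\frac{u(x)-u(y)}{|x-y|^{n/p+s}}\in L^p(Q)$, with norm $\|u\|_X=\big(\|u\|_{L^p(\Omega)}^p+\int_Q\frac{|u(x)-u(y)|^p}{|x-y|^{n+ps}}dx\,dy\big)^{1/p}$. $X_0$ is the closure of $C_0^\infty(\Omega)$ in $X$, a Banach space normed by $\|u\|_{X_0}=\big(\int_Q\frac{|u(x)-u(y)|^p}{|x-y|^{n+ps}}dx\,dy\big)^{1/p}$; since $u=0$ a.e. in $\mathbb{R}^n\setminus\Omega$, the integral may be taken over $\mathbb{R}^{2n}$. The fractional $p$-Laplacian is $(-\Delta)_p^su(x)=-2\int_{\mathbb{R}^n}\frac{|u(y)-u(x)|^{p-2}(u(y)-u(x))}{|x-y|^{n+ps}}dy$. A solution of $(P_\lambda)$ is a weak solution: $u\in X_0$, $u\ge0$, $u\not\equiv0$, with $$M(\|u\|_{X_0}^p)\int_{\mathbb{R}^{2n}}\frac{|u(x)-u(y)|^{p-2}(u(x)-u(y))(\varphi(x)-\varphi(y))}{|x-y|^{n+ps}}dx\,dy=\lambda\int_\Omega f|u|^{q-2}u\varphi\,dx+\int_\Omega g|u|^{r-2}u\varphi\,dx\quad\forall\varphi\in X_0.$$ The Nehari set is $\mathcal N_\lambda=\{u\in X_0\setminus\{0\}: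 a\|u\|_{X_0}^p+b\|u\|_{X_0}^{2p}-\lambda\int_\Omega f|u|^q\,dx-\int_\Omega g|u|^r\,dx=0\}$. *)

theory Defs
  imports "HOL-Analysis.Analysis"
begin

section \<open>Smooth functions and smooth domains\<close>

primrec Ck :: "nat \<Rightarrow> ('a::euclidean_space \<Rightarrow> real) \<Rightarrow> bool" where
  "Ck 0 \<phi> \<longleftrightarrow> continuous_on UNIV \<phi>"
| "Ck (Suc k) \<phi> \<longleftrightarrow> (\<forall>x. \<phi> differentiable (at x)) \<and>
     (\<forall>v. Ck k (\<lambda>x. frechet_derivative \<phi> (at x) v))"

definition smooth :: "('a::euclidean_space \<Rightarrow> real) \<Rightarrow> bool" where
  "smooth \<phi> \<longleftrightarrow> (\<forall>k. Ck k \<phi>)"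

definition test_functions :: "'a::euclidean_space set \<Rightarrow> ('a \<Rightarrow> real) set" where
  "test_functions \<Omega> =
     {\<phi>. smooth \<phi> \<and> compact (closure {x. \<phi> x \<noteq> 0}) \<and> closure {x. \<phi> x \<noteq> 0} \<subseteq> \<Omega>}"

text \<open>Near each boundary point the set is the part of a ball lying above a smooth graph, after
  choosing a unit vector \<open>e\<close> as the vertical direction. The point \<open>x - (x \<bullet> e) *\<^sub>R e\<close> is the
  projection of \<open>x\<close> to the hyperplane orthogonal to \<open>e\<close>, so only the values of \<open>\<gamma>\<close> on this
  hyperplane matter.\<close>

definition smooth_boundary :: "'a::euclidean_space set \<Rightarrow> bool" where
  "smooth_boundary \<Omega> \<longleftrightarrow>
     (\<forall>z\<in>frontier \<Omega>. \<exists>\<rho>>0. \<exists>e \<gamma>. norm e = 1 \<and> smooth \<gamma> \<and>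
        \<Omega> \<inter> ball z \<rho> = {x \<in> ball z \<rho>. x \<bullet> e > \<gamma> (x - (x \<bullet> e) *\<^sub>R e)})"

definition bounded_smooth_domain :: "'a::euclidean_space set \<Rightarrow> bool" where
  "bounded_smooth_domain \<Omega> \<longleftrightarrow>
     open \<Omega> \<and> connected \<Omega> \<and> \<Omega> \<noteq> {} \<and> bounded \<Omega> \<and> smooth_boundary \<Omega>"


section \<open>Lebesgue and fractional Sobolev spaces\<close>

text \<open>Functions are not identified almost everywhere; equality and non-triviality of elements of
  these spaces are therefore always stated almost everywhere.\<close>

definition Lp_on :: "real \<Rightarrow> 'a::euclidean_space set \<Rightarrow> ('a \<Rightarrow> real) set" where
  "Lp_on t S = {u. set_borel_measurable lebesgue S u \<and>
     set_integrable lebesgue S (\<lambda>x. \<bar>u x\<bar> powr t)}"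

definition Linf_on :: "'a::euclidean_space set \<Rightarrow> ('a \<Rightarrow> real) set" where
  "Linf_on S = {u. set_borel_measurable lebesgue S u \<and>
     (\<exists>C. AE x in lebesgue. x \<in> S \<longrightarrow> \<bar>u x\<bar> \<le> C)}"

definition Qset :: "'a set \<Rightarrow> ('a \<times> 'a) set" where
  "Qset \<Omega> = UNIV - (UNIV - \<Omega>) \<times> (UNIV - \<Omega>)"

text \<open>The integral over \<open>Q\<close> appearing in both norms. The order is \<open>s\<close>, the exponent \<open>p\<close>.\<close>

definition gagliardo :: "real \<Rightarrow> real \<Rightarrow> 'a::euclidean_space set \<Rightarrow> ('a \<Rightarrow> real) \<Rightarrow> real" where
  "gagliardo s p \<Omega> u =
     (LINT z:Qset \<Omega>|lebesgue.
        \<bar>u (fst z) - u (snd z)\<bar> powr p / norm (fst z - snd z) powr (real DIM('a) + p * s))"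

definition X_space :: "real \<Rightarrow> real \<Rightarrow> 'a::euclidean_space set \<Rightarrow> ('a \<Rightarrow> real) set" where
  "X_space s p \<Omega> = {u. u \<in> borel_measurable lebesgue \<and> u \<in> Lp_on p \<Omega> \<and>
     (\<lambda>z. (u (fst z) - u (snd z)) / norm (fst z - snd z) powr (real DIM('a) / p + s))
       \<in> Lp_on p (Qset \<Omega>)}"

definition X_norm :: "real \<Rightarrow> real \<Rightarrow> 'a::euclidean_space set \<Rightarrow> ('a \<Rightarrow> real) \<Rightarrow> real" where
  "X_norm s p \<Omega> u =
     ((LINT x:\<Omega>|lebesgue. \<bar>u x\<bar> powr p) + gagliardo s p \<Omega> u) powr (1 / p)"

definition X0_space :: "real \<Rightarrow> real \<Rightarrow> 'a::euclidean_space set \<Rightarrow> ('a \<Rightarrow> real) set" where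
  "X0_space s p \<Omega> = {u \<in> X_space s p \<Omega>.
     \<forall>\<epsilon>>0. \<exists>\<phi>\<in>test_functions \<Omega>. X_norm s p \<Omega> (\<lambda>x. u x - \<phi> x) < \<epsilon>}"

definition X0_norm :: "real \<Rightarrow> real \<Rightarrow> 'a::euclidean_space set \<Rightarrow> ('a \<Rightarrow> real) \<Rightarrow> real" where
  "X0_norm s p \<Omega> u = gagliardo s p \<Omega> u powr (1 / p)"


section \<open>\<open>C\<^sup>1\<close> submanifolds of a normed space of functions\<close>

text \<open>Here \<open>V\<close> is a linear space of real functions and \<open>N\<close> a seminorm on it; the normed space
  meant is \<open>V\<close> modulo \<open>{u. N u = 0}\<close>. For \<open>X0_space\<close> and \<open>X0_norm\<close> this quotient is the
  identification of functions that agree almost everywhere. Accordingly, all identities between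
  elements of \<open>V\<close> are required modulo functions with \<open>N u = 0\<close>.\<close>

definition sn_eq :: "(('a \<Rightarrow> real) \<Rightarrow> real) \<Rightarrow> ('a \<Rightarrow> real) \<Rightarrow> ('a \<Rightarrow> real) \<Rightarrow> bool" where
  "sn_eq N u v \<longleftrightarrow> N (\<lambda>x. u x - v x) = 0"

definition sn_open ::
  "('a \<Rightarrow> real) set \<Rightarrow> (('a \<Rightarrow> real) \<Rightarrow> real) \<Rightarrow> ('a \<Rightarrow> real) set \<Rightarrow> bool" where
  "sn_open V N U \<longleftrightarrow> U \<subseteq> V \<and>
     (\<forall>u\<in>U. \<exists>\<epsilon>>0. \<forall>v\<in>V. N (\<lambda>x. v x - u x) < \<epsilon> \<longrightarrow> v \<in> U)"

definition sn_bounded_linear ::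
  "('a \<Rightarrow> real) set \<Rightarrow> (('a \<Rightarrow> real) \<Rightarrow> real) \<Rightarrow> (('a \<Rightarrow> real) \<Rightarrow> 'a \<Rightarrow> real) \<Rightarrow> bool" where
  "sn_bounded_linear V N L \<longleftrightarrow>
     (\<forall>u\<in>V. L u \<in> V) \<and>
     (\<forall>u\<in>V. \<forall>v\<in>V. sn_eq N (L (\<lambda>x. u x + v x)) (\<lambda>x. L u x + L v x)) \<and>
     (\<forall>c. \<forall>u\<in>V. sn_eq N (L (\<lambda>x. c * u x)) (\<lambda>x. c * L u x)) \<and>
     (\<exists>C. \<forall>u\<in>V. N (L u) \<le> C * N u)"

definition sn_has_derivative ::
  "('a \<Rightarrow> real) set \<Rightarrow> (('a \<Rightarrow> real) \<Rightarrow> real) \<Rightarrow> ('a \<Rightarrow> real) set \<Rightarrow>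
   (('a \<Rightarrow> real) \<Rightarrow> 'a \<Rightarrow> real) \<Rightarrow> (('a \<Rightarrow> real) \<Rightarrow> 'a \<Rightarrow> real) \<Rightarrow> ('a \<Rightarrow> real) \<Rightarrow> bool" where
  "sn_has_derivative V N U F L u \<longleftrightarrow>
     sn_bounded_linear V N L \<and>
     (\<forall>\<epsilon>>0. \<exists>\<delta>>0. \<forall>v\<in>U. N (\<lambda>x. v x - u x) < \<delta> \<longrightarrow>
        N (\<lambda>x. F v x - F u x - L (\<lambda>y. v y - u y) x) \<le> \<epsilon> * N (\<lambda>x. v x - u x))"

text \<open>The last conjunct is continuity of the derivative in the operator norm.\<close>

definition sn_C1 ::
  "('a \<Rightarrow> real) set \<Rightarrow> (('a \<Rightarrow> real) \<Rightarrow> real) \<Rightarrow> ('a \<Rightarrow> real) set \<Rightarrow>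
   (('a \<Rightarrow> real) \<Rightarrow> 'a \<Rightarrow> real) \<Rightarrow> bool" where
  "sn_C1 V N U F \<longleftrightarrow> (\<exists>D.
     (\<forall>u\<in>U. sn_has_derivative V N U F (D u) u) \<and>
     (\<forall>u\<in>U. \<forall>\<epsilon>>0. \<exists>\<delta>>0. \<forall>v\<in>U. N (\<lambda>x. v x - u x) < \<delta> \<longrightarrow>
        (\<forall>h\<in>V. N (\<lambda>x. D v h x - D u h x) \<le> \<epsilon> * N h)))"

definition sn_C1_diffeo ::
  "('a \<Rightarrow> real) set \<Rightarrow> (('a \<Rightarrow> real) \<Rightarrow> real) \<Rightarrow> ('a \<Rightarrow> real) set \<Rightarrow> ('a \<Rightarrow> real) set \<Rightarrow>
   (('a \<Rightarrow> real) \<Rightarrow> 'a \<Rightarrow> real) \<Rightarrow> bool" where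
  "sn_C1_diffeo V N U W F \<longleftrightarrow>
     F ` U \<subseteq> W \<and> sn_C1 V N U F \<and>
     (\<exists>G. G ` W \<subseteq> U \<and> sn_C1 V N W G \<and>
        (\<forall>u\<in>U. sn_eq N (G (F u)) u) \<and> (\<forall>w\<in>W. sn_eq N (F (G w)) w))"

text \<open>A subset \<open>S\<close> is a \<open>C\<^sup>1\<close> submanifold if, near each of its points, a \<open>C\<^sup>1\<close> diffeomorphism
  between open sets of \<open>V\<close> straightens it to a fixed closed complemented subspace, the model
  space. Such a subspace is the set of fixed points of a bounded linear projection \<open>P\<close>.\<close>

definition C1_submanifold ::
  "('a \<Rightarrow> real) set \<Rightarrow> (('a \<Rightarrow> real) \<Rightarrow> real) \<Rightarrow> ('a \<Rightarrow> real) set \<Rightarrow> bool" where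
  "C1_submanifold V N S \<longleftrightarrow> S \<subseteq> V \<and>
     (\<exists>P. sn_bounded_linear V N P \<and> (\<forall>u\<in>V. sn_eq N (P (P u)) (P u)) \<and>
        (\<forall>u\<in>S. \<exists>U W F. u \<in> U \<and> sn_open V N U \<and> sn_open V N W \<and> sn_C1_diffeo V N U W F \<and>
           (\<forall>v\<in>U. v \<in> S \<longleftrightarrow> sn_eq N (P (F v)) (F v))))"


section \<open>The Kirchhoff problem\<close>

definition kirchhoff :: "real \<Rightarrow> real \<Rightarrow> real \<Rightarrow> real" where
  "kirchhoff a b t = a + b * t"

definition nehari ::
  "real \<Rightarrow> real \<Rightarrow> real \<Rightarrow> real \<Rightarrow> real \<Rightarrow> real \<Rightarrow> 'a::euclidean_space set \<Rightarrow>
   ('a \<Rightarrow> real) \<Rightarrow> ('a \<Rightarrow> real) \<Rightarrow> real \<Rightarrow> ('a \<Rightarrow> real) set" where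
  "nehari s p q r a b \<Omega> f g lam = {u \<in> X0_space s p \<Omega>.
     \<not> (AE x in lebesgue. u x = 0) \<and>
     a * X0_norm s p \<Omega> u powr p + b * X0_norm s p \<Omega> u powr (2 * p)
       - lam * (LINT x:\<Omega>|lebesgue. f x * \<bar>u x\<bar> powr q)
       - (LINT x:\<Omega>|lebesgue. g x * \<bar>u x\<bar> powr r) = 0}"

text \<open>The boundary condition is contained in \<open>u \<in> X0_space s p \<Omega>\<close>: such functions vanish almost
  everywhere outside \<open>\<Omega>\<close>.\<close>

definition weak_solution ::
  "real \<Rightarrow> real \<Rightarrow> real \<Rightarrow> real \<Rightarrow> real \<Rightarrow> real \<Rightarrow> 'a::euclidean_space set \<Rightarrow>
   ('a \<Rightarrow> real) \<Rightarrow> ('a \<Rightarrow> real) \<Rightarrow> real \<Rightarrow> ('a \<Rightarrow> real) \<Rightarrow> bool" where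
  "weak_solution s p q r a b \<Omega> f g lam u \<longleftrightarrow>
     u \<in> X0_space s p \<Omega> \<and>
     (AE x in lebesgue. x \<in> \<Omega> \<longrightarrow> u x \<ge> 0) \<and>
     \<not> (AE x in lebesgue. x \<in> \<Omega> \<longrightarrow> u x = 0) \<and>
     (\<forall>\<phi>\<in>X0_space s p \<Omega>.
        kirchhoff a b (X0_norm s p \<Omega> u powr p) *
          (LINT z|lebesgue.
             \<bar>u (fst z) - u (snd z)\<bar> powr (p - 2) * (u (fst z) - u (snd z)) * (\<phi> (fst z) - \<phi> (snd z))
               / norm (fst z - snd z) powr (real DIM('a) + p * s))
        = lam * (LINT x:\<Omega>|lebesgue. f x * \<bar>u x\<bar> powr (q - 2) * u x * \<phi> x)
          + (LINT x:\<Omega>|lebesgue. g x * \<bar>u x\<bar> powr (r - 2) * u x * \<phi> x))"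

end

theory Submission
  imports Defs "HOL-Library.Diagonal_Subsequence"
begin

text \<open>
  Below a threshold \<open>\<rho>\<close> for the norm the superlinear term is dominated by
  \<open>a \<parallel>u\<parallel>\<^sup>p\<close>, and for small \<open>lam\<close> so is the sublinear term on the sphere of radius \<open>\<rho>\<close>. The energy is
  therefore positive on this sphere, while it takes negative values inside because \<open>f\<close> is positive
  somewhere; its minimum over the ball is the first solution. The second one minimises
  \<open>max\<^sub>t energy (t u)\<close> over the \<open>u\<close> for which the integral of \<open>g \<bar>u\<bar>\<^sup>r\<close> is positive. It is
  critical because the maximum along a ray is attained at one point only. Replacing \<open>u\<close> by
  \<open>\<bar>u\<bar>\<close> makes both solutions nonnegative, and the signs of their energies distinguish them.

  Minimisers exist without reflexivity or weak convergence: bounded sequences have subsequences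
  that converge almost everywhere, by comparison with averages over dyadic cells; such limits stay
  in \<open>X0_space\<close> by Clarkson's inequality, the norm is lower semicontinuous by Fatou's lemma, and
  a subcritical Sobolev inequality, obtained by iterating a level set estimate, makes the
  nonlinear terms converge.

  On the Nehari set the functional \<open>\<Psi>\<close> defining it satisfies \<open>\<Psi>'(u) u \<noteq> 0\<close> when \<open>lam\<close> is small. Adding
  \<open>(\<Psi> v - l v) d\<close> to \<open>v\<close>, for a fixed bounded functional \<open>l\<close> and a suitable direction
  \<open>d\<close> with \<open>l d = 1\<close>, makes \<open>\<Psi>\<close> a coordinate; since only one direction is changed, this chart is inverted
  by one-dimensional monotonicity.
\<close>


section \<open>Differentiable functionals and level sets\<close>

text \<open>The abstract part assumes no completeness of the seminormed space: each argument about
  charts or critical points is reduced to a real variable, where mean values and intermediate values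
  suffice. The coefficients may change sign, so the energy along a ray can have several critical
  points, and a minimum over a part of the Nehari set would still have to be shown to be free of the
  constraint. The second solution is therefore obtained without Lagrange multipliers: its
  competitors are global maxima along rays, and such a maximum is compared directly with the maximum
  along a perturbed ray. The radius \<rho> serves two purposes. It separates the two solutions by an
  energy barrier, and it splits the Nehari set into a part where the superlinear term cannot cancel
  the leading one and a part where the sublinear term cannot; \<open>lam0\<close> is the minimum of
  the two bounds imposed by these purposes.\<close>

definition bounded_functional ::
  "('a \<Rightarrow> real) set \<Rightarrow> (('a \<Rightarrow> real) \<Rightarrow> real) \<Rightarrow> (('a \<Rightarrow> real) \<Rightarrow> real) \<Rightarrow> bool" where
  "bounded_functional V N A \<longleftrightarrow>
     (\<forall>u\<in>V. \<forall>v\<in>V. A (\<lambda>x. u x + v x) = A u + A v) \<and>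
     (\<forall>c. \<forall>u\<in>V. A (\<lambda>x. c * u x) = c * A u) \<and>
     (\<exists>C\<ge>0. \<forall>u\<in>V. \<bar>A u\<bar> \<le> C * N u)"

text \<open>The real-valued counterpart of \<open>sn_C1\<close>. The charts constructed below differ
  from the identity by a multiple of one fixed function, so the derivatives of functionals determine
  theirs. Boundedness in terms of \<open>N\<close> makes \<open>D u\<close> vanish on functions with
  \<open>N h = 0\<close>, so that it descends to the quotient.\<close>

definition C1_functional ::
  "('a \<Rightarrow> real) set \<Rightarrow> (('a \<Rightarrow> real) \<Rightarrow> real) \<Rightarrow> ('a \<Rightarrow> real) set \<Rightarrow>
   (('a \<Rightarrow> real) \<Rightarrow> real) \<Rightarrow> (('a \<Rightarrow> real) \<Rightarrow> ('a \<Rightarrow> real) \<Rightarrow> real) \<Rightarrow> bool" where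
  "C1_functional V N U \<Phi> D \<longleftrightarrow>
     (\<forall>u\<in>U. bounded_functional V N (D u)) \<and>
     (\<forall>u\<in>U. \<forall>\<epsilon>>0. \<exists>\<delta>>0. \<forall>v\<in>U. N (\<lambda>x. v x - u x) < \<delta> \<longrightarrow>
        \<bar>\<Phi> v - \<Phi> u - D u (\<lambda>x. v x - u x)\<bar> \<le> \<epsilon> * N (\<lambda>x. v x - u x)) \<and>
     (\<forall>u\<in>U. \<forall>\<epsilon>>0. \<exists>\<delta>>0. \<forall>v\<in>U. N (\<lambda>x. v x - u x) < \<delta> \<longrightarrow>
        (\<forall>h\<in>V. \<bar>D v h - D u h\<bar> \<le> \<epsilon> * N h))"

lemma bounded_functional_bound:
  assumes "bounded_functional V N A"
  obtains C where "C \<ge> 0" "\<And>u. u \<in> V \<Longrightarrow> \<bar>A u\<bar> \<le> C * N u"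
  using assms[unfolded bounded_functional_def, THEN conjunct2, THEN conjunct2] by blast

lemma C1_functionalD:
  assumes "C1_functional V N U \<Phi> D" "u \<in> U"
  shows C1_functional_bounded: "bounded_functional V N (D u)"
    and C1_functional_remainder: "\<epsilon> > 0 \<Longrightarrow> \<exists>\<delta>>0. \<forall>v\<in>U. N (\<lambda>x. v x - u x) < \<delta> \<longrightarrow>
        \<bar>\<Phi> v - \<Phi> u - D u (\<lambda>x. v x - u x)\<bar> \<le> \<epsilon> * N (\<lambda>x. v x - u x)"
    and C1_functional_continuous: "\<epsilon> > 0 \<Longrightarrow> \<exists>\<delta>>0. \<forall>v\<in>U. N (\<lambda>x. v x - u x) < \<delta> \<longrightarrow>
        (\<forall>h\<in>V. \<bar>D v h - D u h\<bar> \<le> \<epsilon> * N h)"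
  using assms unfolding C1_functional_def by blast+

locale seminormed_functions =
  fixes V :: "('a \<Rightarrow> real) set" and N :: "('a \<Rightarrow> real) \<Rightarrow> real"
  assumes zero_mem: "(\<lambda>x. 0) \<in> V"
    and add_mem: "u \<in> V \<Longrightarrow> v \<in> V \<Longrightarrow> (\<lambda>x. u x + v x) \<in> V"
    and scale_mem: "u \<in> V \<Longrightarrow> (\<lambda>x. c * u x) \<in> V"
    and N_nonneg: "0 \<le> N u"
    and N_triangle: "u \<in> V \<Longrightarrow> v \<in> V \<Longrightarrow> N (\<lambda>x. u x + v x) \<le> N u + N v"
    and N_scale: "u \<in> V \<Longrightarrow> N (\<lambda>x. c * u x) = \<bar>c\<bar> * N u"
begin

lemma diff_mem: "u \<in> V \<Longrightarrow> v \<in> V \<Longrightarrow> (\<lambda>x. u x - v x) \<in> V"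
  using add_mem[of u "\<lambda>x. -1 * v x"] scale_mem[of v "-1"] by simp

lemma add_scale_mem: "u \<in> V \<Longrightarrow> v \<in> V \<Longrightarrow> (\<lambda>x. u x + c * v x) \<in> V"
  by (intro add_mem scale_mem)

lemma N_zero [simp]: "N (\<lambda>x. 0) = 0"
  using N_scale[OF zero_mem, of 0] by simp

lemma N_minus_commute: "u \<in> V \<Longrightarrow> v \<in> V \<Longrightarrow> N (\<lambda>x. u x - v x) = N (\<lambda>x. v x - u x)"
  using N_scale[OF diff_mem, of u v "-1"] by simp

lemma N_le_diff: "u \<in> V \<Longrightarrow> v \<in> V \<Longrightarrow> N u \<le> N v + N (\<lambda>x. u x - v x)"
  using N_triangle[OF _ diff_mem, of v u v] by simp

lemma N_add_scale: "u \<in> V \<Longrightarrow> v \<in> V \<Longrightarrow> N (\<lambda>x. u x + c * v x) \<le> N u + \<bar>c\<bar> * N v"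
  using N_triangle[OF _ scale_mem, of u v c] by (simp add: N_scale)

lemma bounded_functional_add:
  "bounded_functional V N A \<Longrightarrow> u \<in> V \<Longrightarrow> v \<in> V \<Longrightarrow> A (\<lambda>x. u x + v x) = A u + A v"
  and bounded_functional_scale: "bounded_functional V N A \<Longrightarrow> u \<in> V \<Longrightarrow> A (\<lambda>x. c * u x) = c * A u"
  unfolding bounded_functional_def by blast+

lemma bounded_functional_add_scale:
  assumes "bounded_functional V N A" "u \<in> V" "v \<in> V"
  shows "A (\<lambda>x. u x + c * v x) = A u + c * A v"
  using bounded_functional_add[OF assms(1,2) scale_mem[OF assms(3)], of c]
    bounded_functional_scale[OF assms(1,3)] by simp

lemma bounded_functional_diff:
  assumes "bounded_functional V N A" "u \<in> V" "v \<in> V"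
  shows "A (\<lambda>x. u x - v x) = A u - A v"
  using bounded_functional_add_scale[OF assms, of "-1"] by simp

lemma bounded_functional_lincomb:
  assumes "bounded_functional V N A" "bounded_functional V N B"
  shows "bounded_functional V N (\<lambda>h. \<alpha> * A h + \<beta> * B h)"
proof -
  obtain C1 where C1: "C1 \<ge> 0" "\<And>u. u \<in> V \<Longrightarrow> \<bar>A u\<bar> \<le> C1 * N u"
    using assms(1) by (rule bounded_functional_bound) blast
  obtain C2 where C2: "C2 \<ge> 0" "\<And>u. u \<in> V \<Longrightarrow> \<bar>B u\<bar> \<le> C2 * N u"
    using assms(2) by (rule bounded_functional_bound) blast
  note C = C1 C2
  have "\<bar>\<alpha> * A u + \<beta> * B u\<bar> \<le> (\<bar>\<alpha>\<bar> * C1 + \<bar>\<beta>\<bar> * C2) * N u" if "u \<in> V" for u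
  proof -
    have "\<bar>\<alpha> * A u + \<beta> * B u\<bar> \<le> \<bar>\<alpha>\<bar> * \<bar>A u\<bar> + \<bar>\<beta>\<bar> * \<bar>B u\<bar>"
      by (metis abs_mult abs_triangle_ineq)
    also have "\<dots> \<le> \<bar>\<alpha>\<bar> * (C1 * N u) + \<bar>\<beta>\<bar> * (C2 * N u)"
      using C that by (intro add_mono mult_left_mono) auto
    finally show ?thesis by (simp add: algebra_simps)
  qed
  moreover have "\<bar>\<alpha>\<bar> * C1 + \<bar>\<beta>\<bar> * C2 \<ge> 0" using C by simp
  ultimately have "\<exists>C\<ge>0. \<forall>u\<in>V. \<bar>\<alpha> * A u + \<beta> * B u\<bar> \<le> C * N u" by blast
  then show ?thesis
    unfolding bounded_functional_def
    using bounded_functional_add[OF assms(1)] bounded_functional_add[OF assms(2)]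
      bounded_functional_scale[OF assms(1)] bounded_functional_scale[OF assms(2)]
    by (simp add: distrib_left mult.left_commute)
qed

lemma C1_functional_isCont:
  assumes C: "C1_functional V N U \<Phi> D" and "U \<subseteq> V" "u \<in> U" "\<epsilon> > 0"
  shows "\<exists>\<delta>>0. \<forall>v\<in>U. N (\<lambda>x. v x - u x) < \<delta> \<longrightarrow> \<bar>\<Phi> v - \<Phi> u\<bar> < \<epsilon>"
proof -
  obtain \<delta> where d: "\<delta> > 0" "\<And>v. v \<in> U \<Longrightarrow> N (\<lambda>x. v x - u x) < \<delta> \<Longrightarrow>
      \<bar>\<Phi> v - \<Phi> u - D u (\<lambda>x. v x - u x)\<bar> \<le> 1 * N (\<lambda>x. v x - u x)"
    using C1_functional_remainder[OF C \<open>u \<in> U\<close>, of 1] by auto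
  obtain K where K: "K \<ge> 0" "\<And>h. h \<in> V \<Longrightarrow> \<bar>D u h\<bar> \<le> K * N h"
    using C1_functional_bounded[OF C \<open>u \<in> U\<close>] by (rule bounded_functional_bound) blast
  have "\<bar>\<Phi> v - \<Phi> u\<bar> < \<epsilon>" if v: "v \<in> U" "N (\<lambda>x. v x - u x) < min \<delta> (\<epsilon> / (K + 1))" for v
  proof -
    have "\<bar>D u (\<lambda>x. v x - u x)\<bar> \<le> K * N (\<lambda>x. v x - u x)"
      using K(2) diff_mem assms v by blast
    then have "\<bar>\<Phi> v - \<Phi> u\<bar> \<le> (K + 1) * N (\<lambda>x. v x - u x)"
      using d(2)[OF v(1)] v by (simp add: algebra_simps)
    also have "\<dots> < (K + 1) * (\<epsilon> / (K + 1))"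
      using v K by (intro mult_strict_left_mono) auto
    finally show ?thesis using K by simp
  qed
  moreover have "min \<delta> (\<epsilon> / (K + 1)) > 0" using d K \<open>\<epsilon> > 0\<close> by simp
  ultimately show ?thesis by blast
qed

text \<open>Every later use of mean values or local extrema passes through lines; the Frechet
  remainder, applied to the increment \<open>(s - t) * h x\<close>, is the remainder of a real
  derivative.\<close>

lemma C1_functional_line_DERIV:
  assumes C: "C1_functional V N V \<Phi> D" and "u \<in> V" "h \<in> V"
  shows "((\<lambda>t. \<Phi> (\<lambda>x. u x + t * h x)) has_real_derivative D (\<lambda>x. u x + t * h x) h) (at t)"
proof -
  let ?w = "\<lambda>t x. u x + t * h x"
  have V: "?w s \<in> V" for s using assms by (simp add: add_scale_mem)
  have eq: "(\<lambda>x. ?w s x - ?w t x) = (\<lambda>x. (s - t) * h x)" for s by (auto simp: algebra_simps)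
  have Dlin: "D (?w t) (\<lambda>x. c * h x) = c * D (?w t) h" for c
    using C1_functional_bounded[OF C V[of t]] \<open>h \<in> V\<close> unfolding bounded_functional_def by blast
  have "\<exists>d>0. \<forall>y. \<bar>y - t\<bar> < d \<longrightarrow> \<bar>\<Phi> (?w y) - \<Phi> (?w t) - D (?w t) h * (y - t)\<bar> \<le> e * \<bar>y - t\<bar>"
    if "e > 0" for e
  proof -
    \<comment> \<open>\<open>N h\<close> may vanish, hence the divisor \<open>N h + 1\<close> in
      place of \<open>N h\<close>; the same device recurs wherever a tolerance is divided by a
      seminorm.\<close>
    have e: "e / (N h + 1) > 0" using that N_nonneg[of h] by simp
    obtain \<delta> where d: "\<delta> > 0" "\<And>v. v \<in> V \<Longrightarrow> N (\<lambda>x. v x - ?w t x) < \<delta> \<Longrightarrow>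
        \<bar>\<Phi> v - \<Phi> (?w t) - D (?w t) (\<lambda>x. v x - ?w t x)\<bar> \<le> e / (N h + 1) * N (\<lambda>x. v x - ?w t x)"
      using C1_functional_remainder[OF C V[of t] e] by blast
    have "\<bar>\<Phi> (?w y) - \<Phi> (?w t) - D (?w t) h * (y - t)\<bar> \<le> e * \<bar>y - t\<bar>" if "\<bar>y - t\<bar> < \<delta> / (N h + 1)" for y
    proof -
      have Nh: "N (\<lambda>x. ?w y x - ?w t x) = \<bar>y - t\<bar> * N h"
        unfolding eq using N_scale[OF \<open>h \<in> V\<close>] by simp
      have "\<bar>y - t\<bar> * N h \<le> \<bar>y - t\<bar> * (N h + 1)" by (intro mult_left_mono) auto
      also have "\<dots> < \<delta>" using that N_nonneg[of h] by (simp add: pos_less_divide_eq add_nonneg_pos)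
      finally have "N (\<lambda>x. ?w y x - ?w t x) < \<delta>" using Nh by simp
      from d(2)[OF V this] have "\<bar>\<Phi> (?w y) - \<Phi> (?w t) - D (?w t) h * (y - t)\<bar> \<le> e / (N h + 1) * (\<bar>y - t\<bar> * N h)"
        unfolding eq Dlin N_scale[OF \<open>h \<in> V\<close>] by (simp only: mult.commute)
      also have "\<dots> = e * \<bar>y - t\<bar> * (N h / (N h + 1))" by simp
      also have "\<dots> \<le> e * \<bar>y - t\<bar> * 1"
        using \<open>e > 0\<close> N_nonneg[of h] by (intro mult_left_mono) auto
      finally show ?thesis by simp
    qed
    moreover have "\<delta> / (N h + 1) > 0" using d N_nonneg[of h] by simp
    ultimately show ?thesis by blast
  qed
  then show ?thesis
    unfolding has_field_derivative_def has_derivative_at_alt by (auto simp: bounded_linear_mult_right)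
qed

lemma C1_functional_lincomb:
  assumes C: "C1_functional V N U \<Phi> D" and C': "C1_functional V N U \<Phi>' D'" and "U \<subseteq> V"
  shows "C1_functional V N U (\<lambda>u. \<alpha> * \<Phi> u + \<beta> * \<Phi>' u) (\<lambda>u h. \<alpha> * D u h + \<beta> * D' u h)"
  unfolding C1_functional_def
proof (intro conjI ballI allI impI)
  fix u assume u: "u \<in> U"
  show "bounded_functional V N (\<lambda>h. \<alpha> * D u h + \<beta> * D' u h)"
    using u C C' by (intro bounded_functional_lincomb) (auto simp: C1_functional_def)
  fix \<epsilon> :: real assume "\<epsilon> > 0"
  define e where "e = \<epsilon> / (\<bar>\<alpha>\<bar> + \<bar>\<beta>\<bar> + 1)"
  have e: "e > 0" using \<open>\<epsilon> > 0\<close> by (simp add: e_def add_nonneg_pos)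
  have e': "(\<bar>\<alpha>\<bar> + \<bar>\<beta>\<bar>) * e \<le> \<epsilon>"
  proof -
    have "(\<bar>\<alpha>\<bar> + \<bar>\<beta>\<bar>) * e \<le> (\<bar>\<alpha>\<bar> + \<bar>\<beta>\<bar> + 1) * e" using e by (intro mult_right_mono) auto
    also have "\<dots> = \<epsilon>" unfolding e_def by (simp add: add_nonneg_pos[THEN less_imp_neq, THEN not_sym])
    finally show ?thesis .
  qed
  have comb: "\<bar>\<alpha> * x + \<beta> * y\<bar> \<le> \<epsilon> * n" if "\<bar>x\<bar> \<le> e * n" "\<bar>y\<bar> \<le> e * n" "n \<ge> 0" for x y n
  proof -
    have "\<bar>\<alpha> * x + \<beta> * y\<bar> \<le> \<bar>\<alpha>\<bar> * \<bar>x\<bar> + \<bar>\<beta>\<bar> * \<bar>y\<bar>" by (metis abs_mult abs_triangle_ineq)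
    also have "\<dots> \<le> \<bar>\<alpha>\<bar> * (e * n) + \<bar>\<beta>\<bar> * (e * n)" using that by (intro add_mono mult_left_mono) auto
    also have "\<dots> = ((\<bar>\<alpha>\<bar> + \<bar>\<beta>\<bar>) * e) * n" by (simp add: algebra_simps)
    also have "\<dots> \<le> \<epsilon> * n" using e' that by (intro mult_right_mono)
    finally show ?thesis .
  qed
  {
    obtain d where d: "d > 0" "\<And>v. v \<in> U \<Longrightarrow> N (\<lambda>x. v x - u x) < d \<Longrightarrow>
        \<bar>\<Phi> v - \<Phi> u - D u (\<lambda>x. v x - u x)\<bar> \<le> e * N (\<lambda>x. v x - u x)"
      using C1_functional_remainder[OF C u e] by blast
    obtain d' where d': "d' > 0" "\<And>v. v \<in> U \<Longrightarrow> N (\<lambda>x. v x - u x) < d' \<Longrightarrow>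
        \<bar>\<Phi>' v - \<Phi>' u - D' u (\<lambda>x. v x - u x)\<bar> \<le> e * N (\<lambda>x. v x - u x)"
      using C1_functional_remainder[OF C' u e] by blast
    show "\<exists>\<delta>>0. \<forall>v\<in>U. N (\<lambda>x. v x - u x) < \<delta> \<longrightarrow> \<bar>\<alpha> * \<Phi> v + \<beta> * \<Phi>' v - (\<alpha> * \<Phi> u + \<beta> * \<Phi>' u)
        - (\<alpha> * D u (\<lambda>x. v x - u x) + \<beta> * D' u (\<lambda>x. v x - u x))\<bar> \<le> \<epsilon> * N (\<lambda>x. v x - u x)"
    proof (intro exI[of _ "min d d'"] conjI ballI impI)
      fix v assume v: "v \<in> U" "N (\<lambda>x. v x - u x) < min d d'"
      show "\<bar>\<alpha> * \<Phi> v + \<beta> * \<Phi>' v - (\<alpha> * \<Phi> u + \<beta> * \<Phi>' u)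
        - (\<alpha> * D u (\<lambda>x. v x - u x) + \<beta> * D' u (\<lambda>x. v x - u x))\<bar> \<le> \<epsilon> * N (\<lambda>x. v x - u x)"
        using comb[OF d(2)[OF v(1)] d'(2)[OF v(1)] N_nonneg] v by (simp add: algebra_simps)
    qed (use d d' in auto)
  }
  {
    obtain d where d: "d > 0" "\<And>v h. v \<in> U \<Longrightarrow> N (\<lambda>x. v x - u x) < d \<Longrightarrow> h \<in> V \<Longrightarrow>
        \<bar>D v h - D u h\<bar> \<le> e * N h"
      using C1_functional_continuous[OF C u e] by blast
    obtain d' where d': "d' > 0" "\<And>v h. v \<in> U \<Longrightarrow> N (\<lambda>x. v x - u x) < d' \<Longrightarrow> h \<in> V \<Longrightarrow>
        \<bar>D' v h - D' u h\<bar> \<le> e * N h"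
      using C1_functional_continuous[OF C' u e] by blast
    show "\<exists>\<delta>>0. \<forall>v\<in>U. N (\<lambda>x. v x - u x) < \<delta> \<longrightarrow> (\<forall>h\<in>V. \<bar>\<alpha> * D v h + \<beta> * D' v h
        - (\<alpha> * D u h + \<beta> * D' u h)\<bar> \<le> \<epsilon> * N h)"
    proof (intro exI[of _ "min d d'"] conjI ballI impI)
      fix v h assume v: "v \<in> U" "N (\<lambda>x. v x - u x) < min d d'" "h \<in> V"
      show "\<bar>\<alpha> * D v h + \<beta> * D' v h - (\<alpha> * D u h + \<beta> * D' u h)\<bar> \<le> \<epsilon> * N h"
        using comb[OF d(2)[OF v(1)] d'(2)[OF v(1)] N_nonneg] v by (simp add: algebra_simps)
    qed (use d d' in auto)
  }
qed

text \<open>The derivative at \<open>u\<close> sends \<open>h\<close> to \<open>h + A u h d\<close>.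
  All errors are multiples of \<open>d\<close>, whose seminorm is the modulus of the factor times
  \<open>N d\<close>, so the remainder and the continuity estimate reduce to those of \<theta> with
  tolerance \<open>\<epsilon> / (N d + 1)\<close>. The chart and its inverse both have this
  form.\<close>

lemma sn_C1_rank_one:
  assumes C: "C1_functional V N U \<theta> A" and "U \<subseteq> V" "d \<in> V"
  shows "sn_C1 V N U (\<lambda>v x. v x + \<theta> v * d x)"
  unfolding sn_C1_def
proof (intro exI[of _ "\<lambda>u h x. h x + A u h * d x"] conjI ballI allI impI)
  fix u assume u: "u \<in> U"
  have A: "bounded_functional V N (A u)" using C1_functional_bounded[OF C u] .
  obtain K where K: "K \<ge> 0" "\<And>h. h \<in> V \<Longrightarrow> \<bar>A u h\<bar> \<le> K * N h"
    using A by (rule bounded_functional_bound) blast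
  have lin: "sn_bounded_linear V N (\<lambda>h x. h x + A u h * d x)"
    unfolding sn_bounded_linear_def
  proof (intro conjI ballI allI exI[of _ "1 + K * N d"])
    show "(\<lambda>x. h x + A u h * d x) \<in> V" if "h \<in> V" for h using that assms by (simp add: add_scale_mem)
    show "sn_eq N (\<lambda>x. h x + k x + A u (\<lambda>x. h x + k x) * d x)
       (\<lambda>x. h x + A u h * d x + (k x + A u k * d x))" if "h \<in> V" "k \<in> V" for h k
    proof -
      have "A u (\<lambda>x. h x + k x) = A u h + A u k" using A that unfolding bounded_functional_def by blast
      then show ?thesis by (simp add: sn_eq_def algebra_simps)
    qed
    show "sn_eq N (\<lambda>x. c * h x + A u (\<lambda>x. c * h x) * d x) (\<lambda>x. c * (h x + A u h * d x))" if "h \<in> V" for c h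
    proof -
      have "A u (\<lambda>x. c * h x) = c * A u h" using A that unfolding bounded_functional_def by blast
      then show ?thesis by (simp add: sn_eq_def algebra_simps)
    qed
    show "N (\<lambda>x. h x + A u h * d x) \<le> (1 + K * N d) * N h" if "h \<in> V" for h
    proof -
      have "N (\<lambda>x. h x + A u h * d x) \<le> N h + \<bar>A u h\<bar> * N d" using that assms by (intro N_add_scale)
      also have "\<dots> \<le> N h + (K * N h) * N d" using K(2)[OF that] by (intro add_mono mult_right_mono N_nonneg) auto
      finally show ?thesis by (simp add: algebra_simps)
    qed
  qed
  have small: "\<epsilon> / (N d + 1) > 0" "\<bar>y\<bar> \<le> \<epsilon> / (N d + 1) * n \<Longrightarrow> n \<ge> 0 \<Longrightarrow> \<bar>y\<bar> * N d \<le> \<epsilon> * n"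
    if "\<epsilon> > 0" for \<epsilon> y n
  proof -
    show "\<epsilon> / (N d + 1) > 0" using that N_nonneg[of d] by simp
    assume y: "\<bar>y\<bar> \<le> \<epsilon> / (N d + 1) * n" "n \<ge> 0"
    have "\<bar>y\<bar> * N d \<le> (\<epsilon> / (N d + 1) * n) * (N d + 1)"
      using y N_nonneg[of d] by (intro mult_mono) auto
    also have "\<dots> = \<epsilon> * n" using N_nonneg[of d] by (simp add: add_nonneg_eq_0_iff)
    finally show "\<bar>y\<bar> * N d \<le> \<epsilon> * n" .
  qed
  show "sn_has_derivative V N U (\<lambda>v x. v x + \<theta> v * d x) (\<lambda>h x. h x + A u h * d x) u"
    unfolding sn_has_derivative_def
  proof (intro conjI allI impI lin)
    fix \<epsilon> :: real assume "\<epsilon> > 0"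
    obtain \<delta> where \<delta>: "\<delta> > 0" "\<And>v. v \<in> U \<Longrightarrow> N (\<lambda>x. v x - u x) < \<delta> \<Longrightarrow>
        \<bar>\<theta> v - \<theta> u - A u (\<lambda>x. v x - u x)\<bar> \<le> \<epsilon> / (N d + 1) * N (\<lambda>x. v x - u x)"
      using C1_functional_remainder[OF C u small(1)[OF \<open>\<epsilon> > 0\<close>]] by blast
    have "N (\<lambda>x. v x + \<theta> v * d x - (u x + \<theta> u * d x) - (v x - u x + A u (\<lambda>y. v y - u y) * d x))
      \<le> \<epsilon> * N (\<lambda>x. v x - u x)" if v: "v \<in> U" "N (\<lambda>x. v x - u x) < \<delta>" for v
    proof -
      have "N (\<lambda>x. v x + \<theta> v * d x - (u x + \<theta> u * d x) - (v x - u x + A u (\<lambda>y. v y - u y) * d x))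
         = N (\<lambda>x. (\<theta> v - \<theta> u - A u (\<lambda>y. v y - u y)) * d x)" by (simp add: algebra_simps)
      also have "\<dots> = \<bar>\<theta> v - \<theta> u - A u (\<lambda>y. v y - u y)\<bar> * N d" using assms by (simp add: N_scale)
      finally show ?thesis using small(2)[OF \<open>\<epsilon> > 0\<close> \<delta>(2)[OF v] N_nonneg] by simp
    qed
    then show "\<exists>\<delta>>0. \<forall>v\<in>U. N (\<lambda>x. v x - u x) < \<delta> \<longrightarrow>
        N (\<lambda>x. v x + \<theta> v * d x - (u x + \<theta> u * d x) - (v x - u x + A u (\<lambda>y. v y - u y) * d x))
        \<le> \<epsilon> * N (\<lambda>x. v x - u x)" using \<delta>(1) by blast
  qed
  fix \<epsilon> :: real assume "\<epsilon> > 0"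
  obtain \<delta> where \<delta>: "\<delta> > 0" "\<And>v h. v \<in> U \<Longrightarrow> N (\<lambda>x. v x - u x) < \<delta> \<Longrightarrow> h \<in> V \<Longrightarrow>
      \<bar>A v h - A u h\<bar> \<le> \<epsilon> / (N d + 1) * N h"
    using C1_functional_continuous[OF C u small(1)[OF \<open>\<epsilon> > 0\<close>]] by blast
  have "N (\<lambda>x. h x + A v h * d x - (h x + A u h * d x)) \<le> \<epsilon> * N h"
    if v: "v \<in> U" "N (\<lambda>x. v x - u x) < \<delta>" "h \<in> V" for v h
  proof -
    have "N (\<lambda>x. h x + A v h * d x - (h x + A u h * d x)) = N (\<lambda>x. (A v h - A u h) * d x)"
      by (simp add: algebra_simps)
    also have "\<dots> = \<bar>A v h - A u h\<bar> * N d" using assms by (simp add: N_scale)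
    finally show ?thesis using small(2)[OF \<open>\<epsilon> > 0\<close> \<delta>(2)[OF v] N_nonneg] by simp
  qed
  then show "\<exists>\<delta>>0. \<forall>v\<in>U. N (\<lambda>x. v x - u x) < \<delta> \<longrightarrow>
      (\<forall>h\<in>V. N (\<lambda>x. h x + A v h * d x - (h x + A u h * d x)) \<le> \<epsilon> * N h)" using \<delta>(1) by blast
qed

end


section \<open>Straightening a regular level set\<close>

context seminormed_functions
begin

lemma pos_divide_mult_cancel: "m > 0 \<Longrightarrow> x / m * m = x" for x m :: real
  by simp

lemma C1_functional_subset:
  assumes C: "C1_functional V N U \<Phi> D" and "B \<subseteq> U"
  shows "C1_functional V N B \<Phi> D"
  unfolding C1_functional_def
proof (intro conjI ballI allI impI)
  fix u assume "u \<in> B"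
  then have u: "u \<in> U" using assms by blast
  show "bounded_functional V N (D u)" using C1_functional_bounded[OF C u] .
  fix \<epsilon> :: real assume e: "\<epsilon> > 0"
  show "\<exists>\<delta>>0. \<forall>v\<in>B. N (\<lambda>x. v x - u x) < \<delta> \<longrightarrow>
      \<bar>\<Phi> v - \<Phi> u - D u (\<lambda>x. v x - u x)\<bar> \<le> \<epsilon> * N (\<lambda>x. v x - u x)"
    using C1_functional_remainder[OF C u e] assms(2) by blast
  show "\<exists>\<delta>>0. \<forall>v\<in>B. N (\<lambda>x. v x - u x) < \<delta> \<longrightarrow> (\<forall>h\<in>V. \<bar>D v h - D u h\<bar> \<le> \<epsilon> * N h)"
    using C1_functional_continuous[OF C u e] assms(2) by blast
qed

text \<open>Because \<open>l d = 1\<close>, adding \<open>(\<Psi> v - l v) d\<close> to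
  \<open>v\<close> makes \<open>l\<close> take the value \<open>\<Psi> v\<close>. Inverting this map
  at \<open>w\<close> amounts to finding \<open>t\<close> with
  \<open>\<Psi> (w + t d) = l w\<close>. Near \<open>u0\<close> the derivative in direction
  \<open>d\<close> is at least \<open>c > 0\<close>, so such a \<open>t\<close> is unique and, by
  the intermediate value theorem, persists for nearby \<open>w\<close>. The bound \<open>R\<close>
  keeps the domain inside a prescribed ball.\<close>

lemma level_set_chart:
  assumes C: "C1_functional V N V \<Psi> D" and l: "bounded_functional V N l"
    and u0: "u0 \<in> V" and dV: "d \<in> V" and ld: "l d = 1" and pos: "D u0 d > 0" and "R > 0"
  shows "\<exists>U W F. u0 \<in> U \<and> U \<subseteq> {v\<in>V. N (\<lambda>x. v x - u0 x) < R} \<and> sn_open V N U \<and> sn_open V N W \<and>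
     sn_C1_diffeo V N U W F \<and> (\<forall>v\<in>U. F v \<in> V \<and> l (F v) = \<Psi> v)"
proof -
  \<comment> \<open>Half of the derivative at \<open>u0\<close>: continuity of \<open>D\<close> then
    leaves at least \<open>c\<close> on the whole of the ball \<open>B\<close>.\<close>
  define c where "c = D u0 d / 2"
  have c: "c > 0" using pos by (simp add: c_def)
  have Nd1: "N d + 1 > 0" using N_nonneg[of d] by simp
  obtain \<delta>0 where \<delta>0: "\<delta>0 > 0" "\<And>v h. v \<in> V \<Longrightarrow> N (\<lambda>x. v x - u0 x) < \<delta>0 \<Longrightarrow> h \<in> V \<Longrightarrow>
      \<bar>D v h - D u0 h\<bar> \<le> c / (N d + 1) * N h"
    using C1_functional_continuous[OF C u0, of "c / (N d + 1)"] c Nd1 by auto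
  define \<delta> where "\<delta> = min \<delta>0 R"
  have \<delta>: "\<delta> > 0" using \<delta>0 \<open>R > 0\<close> by (simp add: \<delta>_def)
  define B where "B = {v\<in>V. N (\<lambda>x. v x - u0 x) < \<delta>}"
  have BV: "B \<subseteq> V" by (auto simp: B_def)
  have Dd: "D v d \<ge> c" if "v \<in> B" for v
  proof -
    have "\<bar>D v d - D u0 d\<bar> \<le> c / (N d + 1) * N d"
      using \<delta>0(2)[of v d] that dV by (auto simp: B_def \<delta>_def)
    also have "\<dots> \<le> c / (N d + 1) * (N d + 1)" using c Nd1 by (intro mult_left_mono) auto
    also have "\<dots> = c" using Nd1 by simp
    finally show ?thesis unfolding c_def by linarith
  qed
  have lbd: "bounded_functional V N (D v)" if "v \<in> V" for v
    using C1_functional_bounded[OF C that] .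
  obtain Cl where Cl: "Cl \<ge> 0" "\<And>h. h \<in> V \<Longrightarrow> \<bar>l h\<bar> \<le> Cl * N h"
    using l by (rule bounded_functional_bound) blast
  let ?p = "\<lambda>w t x. w x + t * d x"
  have pV: "?p w t \<in> V" if "w \<in> V" for w t using that dV by (rule add_scale_mem)
  \<comment> \<open>A seminorm ball is convex, so two points of \<open>B\<close> on a line in
    direction \<open>d\<close> enclose only points of \<open>B\<close>; the mean value theorem
    applies between them.\<close>
  have convB: "?p w t \<in> B" if w: "w \<in> V" and t: "t1 \<le> t" "t \<le> t2" and B: "?p w t1 \<in> B" "?p w t2 \<in> B" for w t t1 t2
  proof (cases "t1 = t2")
    case True then show ?thesis using t B by simp
  next
    case False
    define \<theta> where "\<theta> = (t - t1) / (t2 - t1)"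
    have lt: "t1 < t2" using False t by simp
    have th: "0 \<le> \<theta>" "\<theta> \<le> 1" using t lt by (auto simp: \<theta>_def)
    have "\<theta> * (t2 - t1) = t - t1" using lt by (simp add: \<theta>_def)
    then have te: "t = (1 - \<theta>) * t1 + \<theta> * t2" by (simp add: algebra_simps)
    let ?a = "\<lambda>x. ?p w t1 x - u0 x" and ?b = "\<lambda>x. ?p w t2 x - u0 x"
    have V: "?a \<in> V" "?b \<in> V" using pV[OF w] u0 by (auto intro: diff_mem)
    have "(\<lambda>x. ?p w t x - u0 x) = (\<lambda>x. (1 - \<theta>) * ?a x + \<theta> * ?b x)"
      unfolding te by (auto simp: algebra_simps)
    then have "N (\<lambda>x. ?p w t x - u0 x) \<le> N (\<lambda>x. (1 - \<theta>) * ?a x) + \<bar>\<theta>\<bar> * N ?b"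
      using N_add_scale[OF scale_mem[OF V(1)] V(2), of "1 - \<theta>" \<theta>] by simp
    also have "\<dots> = (1 - \<theta>) * N ?a + \<theta> * N ?b" using th N_scale[OF V(1), of "1 - \<theta>"] by simp
    also have "\<dots> < \<delta>" using B th convex_bound_lt[of "N ?a" \<delta> "N ?b" "1 - \<theta>" \<theta>] by (auto simp: B_def)
    finally show ?thesis using pV[OF w] by (simp add: B_def)
  qed
  have mono: "\<Psi> (?p w t2) - \<Psi> (?p w t1) \<ge> c * (t2 - t1)"
    if w: "w \<in> V" and t: "t1 < t2" and B: "?p w t1 \<in> B" "?p w t2 \<in> B" for w t1 t2
  proof -
    obtain z where z: "t1 < z" "z < t2" "\<Psi> (?p w t2) - \<Psi> (?p w t1) = (t2 - t1) * D (?p w z) d"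
      using MVT2[OF t, of "\<lambda>t. \<Psi> (?p w t)" "\<lambda>t. D (?p w t) d"] C1_functional_line_DERIV[OF C w dV] by blast
    have "D (?p w z) d \<ge> c" using convB[OF w _ _ B, of z] z by (intro Dd) auto
    then have "(t2 - t1) * c \<le> (t2 - t1) * D (?p w z) d" using t by (intro mult_left_mono) auto
    then show ?thesis using z by (simp add: mult.commute)
  qed
  \<comment> \<open>\<open>S w t\<close> says that moving \<open>w\<close> by \<open>t d\<close>
    gives a preimage of \<open>w\<close> in \<open>B\<close>; \<open>W\<close> will be the set of
    those \<open>w\<close> that have one, and \<open>tt w\<close> the parameter.\<close>
  define S where "S = (\<lambda>w t. ?p w t \<in> B \<and> \<Psi> (?p w t) = l w)"
  have S_unique: "t1 = t2" if "w \<in> V" "S w t1" "S w t2" for w t1 t2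
  proof (rule ccontr)
    assume ne: "t1 \<noteq> t2"
    have "\<not> t1 < t2" "\<not> t2 < t1"
      using mono[of w t1 t2] mono[of w t2 t1] that c unfolding S_def by (auto simp: mult_le_0_iff)
    then show False using ne by simp
  qed
  define W where "W = {w\<in>V. \<exists>t. S w t}"
  define tt where "tt = (\<lambda>w. SOME t. S w t)"
  have S_tt: "S w (tt w)" if "w \<in> W" for w
    using that someI_ex[of "S w"] unfolding W_def tt_def by blast
  \<comment> \<open>Openness of \<open>W\<close> and continuity of \<open>tt\<close> in one
    statement. At \<open>tt w + h\<close> and \<open>tt w - h\<close> the value of \<Psi> misses
    \<open>l w\<close> by at least \<open>c h\<close> on either side; a perturbation of
    \<open>w\<close> that moves \<Psi> and \<open>l\<close> by less than half of this margin keeps a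
    crossing between the two parameters.\<close>
  have S_stable: "\<exists>\<delta>'>0. \<forall>w'\<in>V. N (\<lambda>x. w' x - w x) < \<delta>' \<longrightarrow> w' \<in> W \<and> \<bar>tt w' - tt w\<bar> < \<eta>"
    if w: "w \<in> W" and \<eta>: "\<eta> > 0" for w \<eta>
  proof -
    have wV: "w \<in> V" using w by (simp add: W_def)
    let ?t = "tt w" and ?v = "?p w (tt w)"
    have St: "?v \<in> B" "\<Psi> ?v = l w" using S_tt[OF w] by (auto simp: S_def)
    define \<kappa> where "\<kappa> = \<delta> - N (\<lambda>x. ?v x - u0 x)"
    have \<kappa>: "\<kappa> > 0" using St by (simp add: \<kappa>_def B_def)
    have nearB: "v' \<in> B" if "v' \<in> V" "N (\<lambda>x. v' x - ?v x) < \<kappa>" for v'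
    proof -
      have "N (\<lambda>x. v' x - u0 x) \<le> N (\<lambda>x. ?v x - u0 x) + N (\<lambda>x. (v' x - u0 x) - (?v x - u0 x))"
        using that pV[OF wV] u0 by (intro N_le_diff diff_mem)
      also have "(\<lambda>x. (v' x - u0 x) - (?v x - u0 x)) = (\<lambda>x. v' x - ?v x)" by auto
      finally show ?thesis using that unfolding B_def \<kappa>_def by simp
    qed
    \<comment> \<open>\<kappa> is the distance left to the boundary of \<open>B\<close>. The choice
      of \<open>h\<close> keeps the parameters within \<eta> and, for a shift of \<open>w\<close> by
      less than \<open>\<kappa> / 2\<close>, the moved points inside \<open>B\<close>.\<close>
    define h where "h = min (\<eta> / 2) (\<kappa> / (2 * (N d + 1)))"
    have h: "h > 0" "h < \<eta>" using \<eta> \<kappa> Nd1 by (auto simp: h_def)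
    have hN: "h * N d < \<kappa> / 2"
    proof -
      have "h * N d < h * (N d + 1)" using h by simp
      also have "\<dots> \<le> \<kappa> / (2 * (N d + 1)) * (N d + 1)" using Nd1 by (intro mult_right_mono) (auto simp: h_def)
      also have "\<dots> = \<kappa> / 2"
      proof -
        have "\<kappa> / (2 * m) * m = \<kappa> / 2" if "m > 0" for m using that by simp
        from this[OF Nd1] show ?thesis .
      qed
      finally show ?thesis .
    qed
    have pB: "?p w' t' \<in> B" if w': "w' \<in> V" "N (\<lambda>x. w' x - w x) < \<kappa> / 2" and t': "\<bar>t' - ?t\<bar> \<le> h" for w' t'
    proof (rule nearB)
      have "(\<lambda>x. ?p w' t' x - ?v x) = (\<lambda>x. (w' x - w x) + (t' - ?t) * d x)" by (auto simp: algebra_simps)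
      then have "N (\<lambda>x. ?p w' t' x - ?v x) \<le> N (\<lambda>x. w' x - w x) + \<bar>t' - ?t\<bar> * N d"
        using N_add_scale[OF diff_mem[OF w'(1) wV] dV, of "t' - ?t"] by simp
      also have "\<dots> < \<kappa> / 2 + \<kappa> / 2"
        using w' mult_right_mono[OF t' N_nonneg[of d]] hN by (intro add_strict_mono) auto
      finally show "N (\<lambda>x. ?p w' t' x - ?v x) < \<kappa>" by simp
    qed (rule pV[OF w'(1)])
    have wB: "?p w t' \<in> B" if "\<bar>t' - ?t\<bar> \<le> h" for t' using pB[OF wV _ that] \<kappa> by simp
    have hi: "\<Psi> (?p w (?t + h)) \<ge> l w + c * h"
      using mono[OF wV, of ?t "?t + h"] wB[of ?t] wB[of "?t + h"] h St by simp
    have lo: "\<Psi> (?p w (?t - h)) \<le> l w - c * h"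
      using mono[OF wV, of "?t - h" ?t] wB[of ?t] wB[of "?t - h"] h St by simp
    have ch: "c * h / 2 > 0" using c h by simp
    obtain e1 where e1: "e1 > 0" "\<And>v'. v' \<in> V \<Longrightarrow> N (\<lambda>x. v' x - ?p w (?t + h) x) < e1 \<Longrightarrow>
        \<bar>\<Psi> v' - \<Psi> (?p w (?t + h))\<bar> < c * h / 2"
      using C1_functional_isCont[OF C subset_refl pV[OF wV] ch] by blast
    obtain e2 where e2: "e2 > 0" "\<And>v'. v' \<in> V \<Longrightarrow> N (\<lambda>x. v' x - ?p w (?t - h) x) < e2 \<Longrightarrow>
        \<bar>\<Psi> v' - \<Psi> (?p w (?t - h))\<bar> < c * h / 2"
      using C1_functional_isCont[OF C subset_refl pV[OF wV] ch] by blast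
    define \<delta>' where "\<delta>' = Min {e1, e2, \<kappa> / 2, c * h / 2 / (Cl + 1)}"
    have \<delta>': "\<delta>' > 0" using e1 e2 \<kappa> ch Cl by (simp add: \<delta>'_def)
    have "w' \<in> W \<and> \<bar>tt w' - ?t\<bar> < \<eta>" if w': "w' \<in> V" "N (\<lambda>x. w' x - w x) < \<delta>'" for w'
    proof -
      have small: "N (\<lambda>x. w' x - w x) < e1" "N (\<lambda>x. w' x - w x) < e2" "N (\<lambda>x. w' x - w x) < \<kappa> / 2"
        "N (\<lambda>x. w' x - w x) < c * h / 2 / (Cl + 1)" using w'(2) by (auto simp: \<delta>'_def)
      have "\<bar>l w' - l w\<bar> \<le> Cl * N (\<lambda>x. w' x - w x)"
        using Cl(2)[OF diff_mem[OF w'(1) wV]] bounded_functional_diff[OF l w'(1) wV] by simp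
      also have "\<dots> \<le> (Cl + 1) * N (\<lambda>x. w' x - w x)" using N_nonneg by (intro mult_right_mono) auto
      also have "\<dots> < c * h / 2"
        using small(4) Cl by (simp add: pos_less_divide_eq algebra_simps)
      finally have l': "\<bar>l w' - l w\<bar> < c * h / 2" .
      have "\<bar>\<Psi> (?p w' (?t + h)) - \<Psi> (?p w (?t + h))\<bar> < c * h / 2"
        using e1(2)[OF pV[OF w'(1)], of "?t + h"] small by simp
      then have hi': "\<Psi> (?p w' (?t + h)) > l w'" using hi l' by linarith
      have "\<bar>\<Psi> (?p w' (?t - h)) - \<Psi> (?p w (?t - h))\<bar> < c * h / 2"
        using e2(2)[OF pV[OF w'(1)], of "?t - h"] small by simp
      then have lo': "\<Psi> (?p w' (?t - h)) < l w'" using lo l' by linarith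
      have "\<exists>x\<ge>?t - h. x \<le> ?t + h \<and> \<Psi> (?p w' x) = l w'"
        using lo' hi' h DERIV_isCont[OF C1_functional_line_DERIV[OF C w'(1) dV]]
        by (intro IVT) auto
      then obtain t' where t': "?t - h \<le> t'" "t' \<le> ?t + h" "\<Psi> (?p w' t') = l w'" by blast
      have "S w' t'" using t' pB[OF w'(1) small(3), of t'] by (auto simp: S_def)
      then have "w' \<in> W" "tt w' = t'" using w' S_unique[OF w'(1) S_tt] by (auto simp: W_def)
      then show ?thesis using t' h by auto
    qed
    then show ?thesis using \<delta>' by blast
  qed
  define F where "F = (\<lambda>v x. v x + (\<Psi> v - l v) * d x)"
  define G where "G = (\<lambda>w x. w x + tt w * d x)"
  have FV: "F v \<in> V" if "v \<in> V" for v using that dV unfolding F_def by (rule add_scale_mem)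
  have lF: "l (F v) = \<Psi> v" if "v \<in> V" for v
    unfolding F_def using bounded_functional_add_scale[OF l that dV, of "\<Psi> v - l v"] ld by simp
  have SF: "S (F v) (- (\<Psi> v - l v))" if "v \<in> B" for v
  proof -
    have "?p (F v) (- (\<Psi> v - l v)) = v" by (auto simp: F_def algebra_simps)
    then show ?thesis using that lF BV unfolding S_def by auto
  qed
  have FW: "F v \<in> W" if "v \<in> B" for v using SF[OF that] FV BV that by (auto simp: W_def)
  have GF: "G (F v) = v" if "v \<in> B" for v
  proof -
    have "tt (F v) = - (\<Psi> v - l v)" using S_unique[OF _ S_tt[OF FW[OF that]] SF[OF that]] FV BV that by auto
    then have "G (F v) = ?p (F v) (- (\<Psi> v - l v))" unfolding G_def by simp
    also have "\<dots> = v" by (auto simp: F_def algebra_simps)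
    finally show ?thesis .
  qed
  have GB: "G w \<in> B" "\<Psi> (G w) = l w" if "w \<in> W" for w using S_tt[OF that] by (auto simp: G_def S_def)
  have FG: "F (G w) = w" if "w \<in> W" for w
  proof -
    have "l (G w) = l w + tt w" unfolding G_def
      using bounded_functional_add_scale[OF l _ dV, of w "tt w"] ld that by (simp add: W_def)
    then show ?thesis using GB(2)[OF that] by (auto simp: F_def G_def algebra_simps)
  qed
  have "sn_open V N B"
    unfolding sn_open_def
  proof (intro conjI BV ballI)
    fix u assume u: "u \<in> B"
    have "v \<in> B" if "v \<in> V" "N (\<lambda>x. v x - u x) < \<delta> - N (\<lambda>x. u x - u0 x)" for v
    proof -
      have "N (\<lambda>x. v x - u0 x) \<le> N (\<lambda>x. u x - u0 x) + N (\<lambda>x. (v x - u0 x) - (u x - u0 x))"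
        using that u u0 BV by (intro N_le_diff diff_mem) auto
      then show ?thesis using that by (simp add: B_def)
    qed
    then show "\<exists>\<epsilon>>0. \<forall>v\<in>V. N (\<lambda>x. v x - u x) < \<epsilon> \<longrightarrow> v \<in> B"
      using u by (intro exI[of _ "\<delta> - N (\<lambda>x. u x - u0 x)"]) (auto simp: B_def)
  qed
  moreover have "sn_open V N W"
    unfolding sn_open_def
  proof (intro conjI ballI)
    fix w assume "w \<in> W"
    from S_stable[OF this zero_less_one] show "\<exists>\<epsilon>>0. \<forall>v\<in>V. N (\<lambda>x. v x - w x) < \<epsilon> \<longrightarrow> v \<in> W" by blast
  qed (auto simp: W_def)
  moreover have "sn_C1 V N B F"
  proof -
    have lC: "C1_functional V N V l (\<lambda>_. l)"
      unfolding C1_functional_def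
    proof (intro conjI ballI allI impI l)
      fix u :: "'a \<Rightarrow> real" and \<epsilon> :: real assume u: "u \<in> V" and e: "\<epsilon> > 0"
      show "\<exists>\<delta>>0. \<forall>v\<in>V. N (\<lambda>x. v x - u x) < \<delta> \<longrightarrow>
          \<bar>l v - l u - l (\<lambda>x. v x - u x)\<bar> \<le> \<epsilon> * N (\<lambda>x. v x - u x)"
        using bounded_functional_diff[OF l _ u] e N_nonneg
        by (intro exI[of _ 1]) auto
      show "\<exists>\<delta>>0. \<forall>v\<in>V. N (\<lambda>x. v x - u x) < \<delta> \<longrightarrow> (\<forall>h\<in>V. \<bar>l h - l h\<bar> \<le> \<epsilon> * N h)"
        using e N_nonneg by (intro exI[of _ 1]) auto
    qed
    have "C1_functional V N V (\<lambda>u. 1 * \<Psi> u + (-1) * l u) (\<lambda>u h. 1 * D u h + (-1) * l h)"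
      by (rule C1_functional_lincomb[OF C lC subset_refl])
    then have "C1_functional V N B (\<lambda>u. \<Psi> u - l u) (\<lambda>u h. D u h - l h)"
      using C1_functional_subset[OF _ BV] by simp
    then show ?thesis unfolding F_def using BV dV by (rule sn_C1_rank_one)
  qed
  moreover have "sn_C1 V N W G"
  proof -
    \<comment> \<open>Differentiating \<open>\<Psi> (w + tt w d) = l w\<close> in direction
      \<open>h\<close>, with \<open>A = D (G w)\<close>, gives
      \<open>A h + \<tau> A d = l h\<close>; solving for \<tau> yields the stated derivative, and
      \<open>A d \<ge> c\<close> keeps the denominator away from zero.\<close>
    have "C1_functional V N W tt (\<lambda>w h. (l h - D (G w) h) / D (G w) d)"
      unfolding C1_functional_def
    proof (intro conjI ballI allI impI)
      fix w assume w: "w \<in> W"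
      define A where "A = D (G w)"
      have wV: "w \<in> V" using w by (simp add: W_def)
      have GV: "G w' \<in> V" if "w' \<in> W" for w' using GB(1)[OF that] BV by blast
      have A: "bounded_functional V N A" unfolding A_def using lbd[OF GV[OF w]] .
      obtain CA where CA: "CA \<ge> 0" "\<And>h. h \<in> V \<Longrightarrow> \<bar>A h\<bar> \<le> CA * N h"
        using A by (rule bounded_functional_bound) blast
      have Ad: "A d \<ge> c" unfolding A_def using Dd[OF GB(1)[OF w]] .
      have Ad0: "A d > 0" using Ad c by simp
      have lA: "\<bar>l h - A h\<bar> \<le> (Cl + CA) * N h" if "h \<in> V" for h
        using Cl(2)[OF that] CA(2)[OF that] by (simp add: distrib_right)
      have "bounded_functional V N (\<lambda>h. (1 / A d) * l h + (- 1 / A d) * A h)"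
        by (rule bounded_functional_lincomb[OF l A])
      then show "bounded_functional V N (\<lambda>h. (l h - D (G w) h) / D (G w) d)"
        by (simp add: diff_divide_distrib A_def)
      have G_diff: "(\<lambda>x. G w' x - G w x) = (\<lambda>x. (w' x - w x) + (tt w' - tt w) * d x)" for w'
        by (auto simp: G_def algebra_simps)
      have N_G: "N (\<lambda>x. G w' x - G w x) \<le> N (\<lambda>x. w' x - w x) + \<bar>tt w' - tt w\<bar> * N d" if "w' \<in> W" for w'
        unfolding G_diff using that wV dV by (intro N_add_scale diff_mem) (auto simp: W_def)
      have G_near: "\<exists>\<delta>'>0. \<forall>w'\<in>W. N (\<lambda>x. w' x - w x) < \<delta>' \<longrightarrow> N (\<lambda>x. G w' x - G w x) < \<eta>" if "\<eta> > 0" for \<eta>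
      proof -
        obtain \<delta>' where \<delta>': "\<delta>' > 0" "\<And>w'. w' \<in> V \<Longrightarrow> N (\<lambda>x. w' x - w x) < \<delta>' \<Longrightarrow> \<bar>tt w' - tt w\<bar> < \<eta> / 2 / (N d + 1)"
          using S_stable[OF w divide_pos_pos[OF half_gt_zero[OF \<open>\<eta> > 0\<close>] Nd1]] by blast
        have "N (\<lambda>x. G w' x - G w x) < \<eta>" if w': "w' \<in> W" "N (\<lambda>x. w' x - w x) < min \<delta>' (\<eta> / 2)" for w'
        proof -
          have "\<bar>tt w' - tt w\<bar> < \<eta> / 2 / (N d + 1)" using \<delta>'(2)[of w'] w' by (auto simp: W_def)
          then have "\<bar>tt w' - tt w\<bar> * N d \<le> \<eta> / 2 / (N d + 1) * (N d + 1)"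
            using N_nonneg[of d] by (intro mult_mono) auto
          also have "\<dots> = \<eta> / 2" using Nd1 by (rule pos_divide_mult_cancel)
          finally show ?thesis using N_G[OF w'(1)] w' by simp
        qed
        then show ?thesis using \<delta>'(1) \<open>\<eta> > 0\<close> by (intro exI[of _ "min \<delta>' (\<eta> / 2)"]) auto
      qed
      fix \<epsilon> :: real assume \<epsilon>: "\<epsilon> > 0"
      \<comment> \<open>A Lipschitz constant for \<open>tt\<close> at \<open>w\<close>. The error
        term \<open>e * N k\<close> contains \<tau> again, with factor at most
        \<open>e * N d\<close>; the second entry of the minimum defining \<open>e\<close> makes this
        factor at most \<open>c / 2\<close>, so that it is absorbed on the left. The third entry
        then turns the Lipschitz bound into the remainder estimate.\<close>
      define L where "L = 2 * ((Cl + CA) / c + 1)"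
      have L: "L > 0" using Cl CA c by (simp add: L_def add_nonneg_pos)
      have LN: "(1 + L * N d) \<ge> 1" using L N_nonneg[of d] by simp
      define e where "e = Min {c, c / (2 * (N d + 1)), \<epsilon> * c / (1 + L * N d)}"
      have e: "e > 0" using c Nd1 \<epsilon> LN by (simp add: e_def)
      have e1: "e \<le> c" "e \<le> c / (2 * (N d + 1))" "e \<le> \<epsilon> * c / (1 + L * N d)" by (auto simp: e_def)
      have e2: "e * N d \<le> c / 2"
      proof -
        have "e * N d \<le> c / (2 * (N d + 1)) * (N d + 1)" using e1 e N_nonneg[of d] by (intro mult_mono) auto
        also have "\<dots> = c / 2" using pos_divide_mult_cancel[OF Nd1, of "c / 2"] by (simp add: divide_divide_eq_left)
        finally show ?thesis .
      qed
      obtain \<delta>1 where \<delta>1: "\<delta>1 > 0" "\<And>v. v \<in> V \<Longrightarrow> N (\<lambda>x. v x - G w x) < \<delta>1 \<Longrightarrow>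
          \<bar>\<Psi> v - \<Psi> (G w) - A (\<lambda>x. v x - G w x)\<bar> \<le> e * N (\<lambda>x. v x - G w x)"
        using C1_functional_remainder[OF C GV[OF w] e] unfolding A_def by blast
      obtain \<delta>2 where \<delta>2: "\<delta>2 > 0" "\<And>w'. w' \<in> W \<Longrightarrow> N (\<lambda>x. w' x - w x) < \<delta>2 \<Longrightarrow> N (\<lambda>x. G w' x - G w x) < \<delta>1"
        using G_near[OF \<delta>1(1)] by blast
      have "\<bar>tt w' - tt w - (l (\<lambda>x. w' x - w x) - D (G w) (\<lambda>x. w' x - w x)) / D (G w) d\<bar>
          \<le> \<epsilon> * N (\<lambda>x. w' x - w x)" if w': "w' \<in> W" "N (\<lambda>x. w' x - w x) < \<delta>2" for w'
      proof -
        define h where "h = (\<lambda>x. w' x - w x)"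
        define \<tau> where "\<tau> = tt w' - tt w"
        define k where "k = (\<lambda>x. G w' x - G w x)"
        have w'V: "w' \<in> V" using w' by (simp add: W_def)
        have hV: "h \<in> V" unfolding h_def using w'V wV by (rule diff_mem)
        have kd: "k = (\<lambda>x. h x + \<tau> * d x)" unfolding k_def G_diff h_def \<tau>_def ..
        have Ak: "A k = A h + \<tau> * A d" unfolding kd by (rule bounded_functional_add_scale[OF A hV dV])
        have lh: "\<Psi> (G w') - \<Psi> (G w) = l h"
          using GB(2)[OF w] GB(2)[OF w'(1)] bounded_functional_diff[OF l w'V wV] by (simp add: h_def)
        have "\<bar>l h - A k\<bar> \<le> e * N k"
          using \<delta>1(2)[OF GV[OF w'(1)] \<delta>2(2)[OF w']] lh unfolding k_def by simp
        then have r: "\<bar>\<tau> * A d - (l h - A h)\<bar> \<le> e * N k" unfolding Ak by (simp add: abs_minus_commute algebra_simps)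
        have Nk: "N k \<le> N h + \<bar>\<tau>\<bar> * N d" unfolding k_def h_def \<tau>_def by (rule N_G[OF w'(1)])
        have "c * \<bar>\<tau>\<bar> \<le> \<bar>\<tau> * A d\<bar>" using Ad Ad0 by (simp add: abs_mult mult.commute mult_right_mono)
        also have "\<dots> \<le> (Cl + CA) * N h + e * N k" using r lA[OF hV] by linarith
        also have "\<dots> \<le> (Cl + CA) * N h + e * (N h + \<bar>\<tau>\<bar> * N d)" using Nk e by simp
        also have "\<dots> = (Cl + CA) * N h + e * N h + (e * N d) * \<bar>\<tau>\<bar>" by (simp add: algebra_simps)
        also have "\<dots> \<le> (Cl + CA) * N h + c * N h + c / 2 * \<bar>\<tau>\<bar>"
          using e1 e2 N_nonneg[of h] by (intro add_mono mult_right_mono) auto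
        finally have "c * \<bar>\<tau>\<bar> \<le> 2 * (Cl + CA + c) * N h" by (simp add: algebra_simps)
        also have "2 * (Cl + CA + c) = c * L"
        proof -
          have "c * L = 2 * (c * ((Cl + CA) / c) + c)" by (simp add: L_def distrib_left)
          also have "c * ((Cl + CA) / c) = Cl + CA" using c by simp
          finally show ?thesis by simp
        qed
        finally have "c * \<bar>\<tau>\<bar> \<le> c * (L * N h)" by (simp only: mult.assoc)
        then have tL: "\<bar>\<tau>\<bar> \<le> L * N h" using c by simp
        have "N k \<le> N h + (L * N h) * N d" using Nk mult_right_mono[OF tL N_nonneg[of d]] by simp
        then have "e * N k \<le> \<epsilon> * c / (1 + L * N d) * ((1 + L * N d) * N h)"
          using e1 e LN N_nonneg \<epsilon> c by (intro mult_mono) (auto simp: algebra_simps)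
        also have "\<dots> = \<epsilon> * c * N h" using LN by simp
        finally have "\<bar>\<tau> * A d - (l h - A h)\<bar> \<le> (\<epsilon> * N h) * c" using r by (simp add: mult.commute mult.left_commute)
        also have "\<dots> \<le> (\<epsilon> * N h) * A d" using Ad \<epsilon> N_nonneg[of h] by (intro mult_left_mono) auto
        finally have "\<bar>\<tau> * A d - (l h - A h)\<bar> / A d \<le> \<epsilon> * N h" using Ad0 by (simp add: pos_divide_le_eq)
        moreover have "\<bar>\<tau> * A d - (l h - A h)\<bar> / A d = \<bar>\<tau> - (l h - A h) / A d\<bar>"
        proof -
          have "\<bar>\<tau> * A d - (l h - A h)\<bar> / A d = \<bar>(\<tau> * A d - (l h - A h)) / A d\<bar>" using Ad0 by (simp add: abs_divide)
          also have "(\<tau> * A d - (l h - A h)) / A d = \<tau> - (l h - A h) / A d" using Ad0 by (simp add: diff_divide_distrib)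
          finally show ?thesis .
        qed
        ultimately show ?thesis unfolding \<tau>_def h_def A_def by simp
      qed
      then show "\<exists>\<delta>>0. \<forall>w'\<in>W. N (\<lambda>x. w' x - w x) < \<delta> \<longrightarrow>
          \<bar>tt w' - tt w - (l (\<lambda>x. w' x - w x) - D (G w) (\<lambda>x. w' x - w x)) / D (G w) d\<bar>
          \<le> \<epsilon> * N (\<lambda>x. w' x - w x)" using \<delta>2(1) by blast
      \<comment> \<open>The difference of the two quotients has a numerator of size at most
        \<open>e' * (CA * N d + (Cl + CA) * N d) * N h\<close> and a denominator of at least
        \<open>c * c\<close>; \<open>e'\<close> is solved from this, with 1 added to keep the
        divisor positive.\<close>
      define e' where "e' = \<epsilon> * c\<^sup>2 / (CA * N d + (Cl + CA) * N d + 1)"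
      have den: "CA * N d + (Cl + CA) * N d + 1 > 0" using Cl CA N_nonneg[of d] by (intro add_nonneg_pos add_nonneg_nonneg mult_nonneg_nonneg) auto
      have e': "e' > 0" using \<epsilon> c den by (simp add: e'_def)
      obtain \<delta>3 where \<delta>3: "\<delta>3 > 0" "\<And>v h. v \<in> V \<Longrightarrow> N (\<lambda>x. v x - G w x) < \<delta>3 \<Longrightarrow> h \<in> V \<Longrightarrow>
          \<bar>D v h - A h\<bar> \<le> e' * N h"
        using C1_functional_continuous[OF C GV[OF w] e'] unfolding A_def by blast
      obtain \<delta>4 where \<delta>4: "\<delta>4 > 0" "\<And>w'. w' \<in> W \<Longrightarrow> N (\<lambda>x. w' x - w x) < \<delta>4 \<Longrightarrow> N (\<lambda>x. G w' x - G w x) < \<delta>3"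
        using G_near[OF \<delta>3(1)] by blast
      have "\<bar>(l h - D (G w') h) / D (G w') d - (l h - D (G w) h) / D (G w) d\<bar> \<le> \<epsilon> * N h"
        if w': "w' \<in> W" "N (\<lambda>x. w' x - w x) < \<delta>4" and h: "h \<in> V" for w' h
      proof -
        define A' where "A' = D (G w')"
        have A'd: "A' d \<ge> c" unfolding A'_def using Dd[OF GB(1)[OF w'(1)]] .
        have cl: "\<bar>A' k - A k\<bar> \<le> e' * N k" if "k \<in> V" for k
          unfolding A'_def using \<delta>3(2)[OF GV[OF w'(1)] \<delta>4(2)[OF w'] that] .
        have pos: "A' d > 0" using A'd c by simp
        have "(l h - A' h) / A' d - (l h - A h) / A d = (- (A' h - A h) * A d - (l h - A h) * (A' d - A d)) / (A' d * A d)"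
          using pos Ad0 by (simp add: field_simps)
        then have "\<bar>(l h - A' h) / A' d - (l h - A h) / A d\<bar>
            = \<bar>- (A' h - A h) * A d - (l h - A h) * (A' d - A d)\<bar> / (A' d * A d)"
          using pos Ad0 by (simp add: abs_mult)
        also have "\<dots> \<le> (\<bar>A' h - A h\<bar> * \<bar>A d\<bar> + \<bar>l h - A h\<bar> * \<bar>A' d - A d\<bar>) / (A' d * A d)"
        proof (intro divide_right_mono)
          show "\<bar>- (A' h - A h) * A d - (l h - A h) * (A' d - A d)\<bar> \<le> \<bar>A' h - A h\<bar> * \<bar>A d\<bar> + \<bar>l h - A h\<bar> * \<bar>A' d - A d\<bar>"
            using abs_triangle_ineq4[of "- (A' h - A h) * A d" "(l h - A h) * (A' d - A d)"]
            unfolding abs_mult abs_minus_cancel by linarith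
        qed (use pos Ad0 in auto)
        also have "\<dots> \<le> ((e' * N h) * (CA * N d) + ((Cl + CA) * N h) * (e' * N d)) / (A' d * A d)"
          using pos Ad0 cl[OF h] cl[OF dV] CA(2)[OF dV] lA[OF h] e' N_nonneg CA Cl
          by (intro divide_right_mono add_mono mult_mono) auto
        also have "\<dots> = e' * (CA * N d + (Cl + CA) * N d) * N h / (A' d * A d)" by (simp add: algebra_simps)
        also have "\<dots> \<le> e' * (CA * N d + (Cl + CA) * N d + 1) * N h / (c * c)"
          using A'd Ad c pos Ad0 e' N_nonneg CA Cl
          by (intro frac_le mult_mono mult_right_mono mult_left_mono mult_nonneg_nonneg add_nonneg_nonneg) auto
        also have "\<dots> = \<epsilon> * N h" using den c unfolding e'_def by (simp add: power2_eq_square)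
        finally show ?thesis unfolding A'_def A_def .
      qed
      then show "\<exists>\<delta>>0. \<forall>w'\<in>W. N (\<lambda>x. w' x - w x) < \<delta> \<longrightarrow>
          (\<forall>h\<in>V. \<bar>(l h - D (G w') h) / D (G w') d - (l h - D (G w) h) / D (G w) d\<bar> \<le> \<epsilon> * N h)"
        using \<delta>4(1) by blast
    qed
    moreover have "W \<subseteq> V" by (auto simp: W_def)
    ultimately show ?thesis unfolding G_def using dV by (intro sn_C1_rank_one) (simp_all add: G_def)
  qed
  moreover have "u0 \<in> B" using u0 \<delta> by (simp add: B_def)
  moreover have "B \<subseteq> {v\<in>V. N (\<lambda>x. v x - u0 x) < R}" by (auto simp: B_def \<delta>_def)
  ultimately show ?thesis
    using FW GB GF FG lF FV BV
    by (intro exI[of _ B] exI[of _ W] exI[of _ F] conjI)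
      (auto simp: sn_C1_diffeo_def sn_eq_def intro!: exI[of _ G])
qed

text \<open>The model space is the kernel of \<open>l\<close>, the range of the projection that
  subtracts \<open>l u\<close> times \<open>e\<close>, and it is the same for all points although
  the chart direction varies. A chart turns \<Phi> into a nonzero multiple of \<open>l\<close>, so
  the level set goes to this kernel. The regularity hypothesis concerns only the radial direction,
  the one in which the Nehari functional can be differentiated explicitly.\<close>

theorem level_set_C1_submanifold:
  assumes C: "C1_functional V N V \<Phi> D" and l: "bounded_functional V N l" and e: "e \<in> V" "l e = 1"
    and reg: "\<And>u. u \<in> V \<Longrightarrow> N u > 0 \<Longrightarrow> \<Phi> u = 0 \<Longrightarrow> D u u \<noteq> 0"
  shows "C1_submanifold V N {u\<in>V. N u > 0 \<and> \<Phi> u = 0}"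
proof -
  let ?S = "{u\<in>V. N u > 0 \<and> \<Phi> u = 0}"
  define P where "P = (\<lambda>u x. u x + - l u * e x)"
  obtain Cl where Cl: "Cl \<ge> 0" "\<And>u. u \<in> V \<Longrightarrow> \<bar>l u\<bar> \<le> Cl * N u"
    using l by (rule bounded_functional_bound) blast
  have Ne: "N e > 0"
  proof (rule ccontr)
    assume "\<not> N e > 0"
    then have "N e = 0" using N_nonneg[of e] by simp
    then show False using Cl(2)[OF e(1)] e by simp
  qed
  have PV: "P u \<in> V" if "u \<in> V" for u using that e(1) unfolding P_def by (rule add_scale_mem)
  have lP: "l (P u) = 0" if "u \<in> V" for u
    unfolding P_def using bounded_functional_add_scale[OF l that e(1), of "- l u"] e by simp
  have P_iff: "sn_eq N (P u) u \<longleftrightarrow> l u = 0" for u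
  proof -
    have "N (\<lambda>x. P u x - u x) = \<bar>- l u\<bar> * N e" using N_scale[OF e(1), of "- l u"] by (simp add: P_def)
    then show ?thesis using Ne by (simp add: sn_eq_def)
  qed
  have "sn_bounded_linear V N P"
    unfolding sn_bounded_linear_def
  proof (intro conjI ballI allI exI[of _ "1 + Cl * N e"])
    show "sn_eq N (P (\<lambda>x. u x + v x)) (\<lambda>x. P u x + P v x)" if "u \<in> V" "v \<in> V" for u v
      using bounded_functional_add[OF l that] by (simp add: sn_eq_def P_def algebra_simps)
    show "sn_eq N (P (\<lambda>x. c * u x)) (\<lambda>x. c * P u x)" if "u \<in> V" for c u
      using bounded_functional_scale[OF l that] by (simp add: sn_eq_def P_def algebra_simps)
    show "N (P u) \<le> (1 + Cl * N e) * N u" if "u \<in> V" for u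
    proof -
      have "N (P u) \<le> N u + \<bar>- l u\<bar> * N e" unfolding P_def using that e by (intro N_add_scale)
      also have "\<dots> \<le> N u + (Cl * N u) * N e" using Cl(2)[OF that] Ne by simp
      finally show ?thesis by (simp add: algebra_simps)
    qed
  qed (rule PV)
  moreover have "\<forall>u\<in>V. sn_eq N (P (P u)) (P u)" using P_iff lP by blast
  moreover have "\<exists>U W F. u \<in> U \<and> sn_open V N U \<and> sn_open V N W \<and> sn_C1_diffeo V N U W F \<and>
      (\<forall>v\<in>U. v \<in> ?S \<longleftrightarrow> sn_eq N (P (F v)) (F v))" if u: "u \<in> ?S" for u
  proof -
    have uV: "u \<in> V" "N u > 0" "D u u \<noteq> 0" using u reg by auto
    have Du: "bounded_functional V N (D u)" using C1_functional_bounded[OF C uV(1)] .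
    \<comment> \<open>The kernels of two nonzero functionals do not cover the space: if
      \<open>u\<close> and \<open>e\<close> both fail, then \<open>l u = 0\<close> and
      \<open>D u e = 0\<close>, and \<open>u + e\<close> succeeds.\<close>
    have "\<exists>d\<in>V. l d \<noteq> 0 \<and> D u d \<noteq> 0"
    proof (cases "l u \<noteq> 0 \<or> D u e \<noteq> 0")
      case True
      then show ?thesis using uV e by (metis zero_neq_one)
    next
      case False
      then show ?thesis using uV e bounded_functional_add_scale[OF l uV(1) e(1), of 1]
          bounded_functional_add_scale[OF Du uV(1) e(1), of 1] add_scale_mem[OF uV(1) e(1), of 1]
        by (intro bexI[of _ "\<lambda>x. u x + 1 * e x"]) auto
    qed
    then obtain d0 where d0: "d0 \<in> V" "l d0 \<noteq> 0" "D u d0 \<noteq> 0" by blast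
    define d where "d = (\<lambda>x. (1 / l d0) * d0 x)"
    have d: "d \<in> V" "l d = 1" "D u d \<noteq> 0"
      unfolding d_def using d0 scale_mem[OF d0(1), of "1 / l d0"] bounded_functional_scale[OF l d0(1), of "1 / l d0"]
        bounded_functional_scale[OF Du d0(1), of "1 / l d0"] by auto
    \<comment> \<open>The chart asks for a positive derivative in direction \<open>d\<close>;
      multiplying \<Phi> by the sign leaves its zero set unchanged.\<close>
    define \<sigma> where "\<sigma> = sgn (D u d)"
    have \<sigma>: "\<sigma> \<noteq> 0" "\<sigma> * D u d > 0" using d(3) by (auto simp: \<sigma>_def sgn_if)
    have C': "C1_functional V N V (\<lambda>v. \<sigma> * \<Phi> v) (\<lambda>v h. \<sigma> * D v h)"
      using C1_functional_lincomb[OF C C subset_refl, of \<sigma> 0] by simp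
    \<comment> \<open>Within distance \<open>N u\<close> of \<open>u\<close> the seminorm stays
      positive, so the side condition \<open>N v > 0\<close> of the level set holds throughout the
      chart.\<close>
    obtain U W F where chart: "u \<in> U" "U \<subseteq> {v\<in>V. N (\<lambda>x. v x - u x) < N u}" "sn_open V N U" "sn_open V N W"
        "sn_C1_diffeo V N U W F" "\<And>v. v \<in> U \<Longrightarrow> F v \<in> V \<and> l (F v) = \<sigma> * \<Phi> v"
      using level_set_chart[OF C' l uV(1) d(1,2) \<sigma>(2) uV(2)] by blast
    have "v \<in> ?S \<longleftrightarrow> sn_eq N (P (F v)) (F v)" if v: "v \<in> U" for v
    proof -
      have v': "v \<in> V" "N (\<lambda>x. v x - u x) < N u" using chart(2) v by auto
      have "N u \<le> N v + N (\<lambda>x. u x - v x)" using uV(1) v'(1) by (rule N_le_diff)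
      then have "N v > 0" using v' N_minus_commute[OF uV(1) v'(1)] by simp
      then show ?thesis using v' P_iff chart(6)[OF v] \<sigma> by simp
    qed
    then show ?thesis using chart by blast
  qed
  ultimately show ?thesis unfolding C1_submanifold_def by blast
qed

end


section \<open>Power functionals\<close>

lemma abs_powr_mult_self: "\<bar>\<bar>x\<bar> powr (t - 2) * x\<bar> = \<bar>x\<bar> powr (t - 1)" for x t :: real
proof (cases "x = 0")
  case False
  then show ?thesis using powr_add[of "\<bar>x\<bar>" "t - 2" 1] by (simp add: abs_mult)
qed simp

lemma powr_minus_one_mult: "x \<ge> 0 \<Longrightarrow> x powr (t - 1) * x = x powr t" for x t :: real
  using powr_add[of x "t - 1" 1] by (cases "x = 0") auto

lemma powr_mult_le_sum:
  fixes x y :: real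
  assumes "x \<ge> 0" "y \<ge> 0" "t > 1"
  shows "x powr (t - 1) * y \<le> x powr t + y powr t"
proof (cases "x \<le> y")
  case True
  then have "x powr (t - 1) * y \<le> y powr (t - 1) * y" using assms by (intro mult_right_mono powr_mono2) auto
  then show ?thesis using powr_minus_one_mult[of y t] assms by (simp add: add_increasing)
next
  case False
  then have "x powr (t - 1) * y \<le> x powr (t - 1) * x" using assms by (intro mult_left_mono) auto
  then show ?thesis using powr_minus_one_mult[of x t] assms by (simp add: add_increasing2)
qed

text \<open>Young's inequality with the conjugate exponents \<open>t / (t - 1)\<close> and
  \<open>t\<close> bounds the mixed term, and this is the tangent line inequality of the convex
  power after collecting the terms in \<open>x\<close> alone.\<close>

lemma powr_tangent:
  fixes x y :: real
  assumes "t > 1"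
  shows "t * (\<bar>x\<bar> powr (t - 2) * x) * (y - x) \<le> \<bar>y\<bar> powr t - \<bar>x\<bar> powr t"
proof -
  have Young: "\<bar>x\<bar> powr (t - 1) * \<bar>y\<bar> \<le> (1 - 1 / t) * \<bar>x\<bar> powr t + (1 / t) * \<bar>y\<bar> powr t"
  proof -
    have "(\<bar>x\<bar> powr (t - 1)) * \<bar>y\<bar> \<le> (\<bar>x\<bar> powr (t - 1)) powr (t / (t - 1)) / (t / (t - 1)) + \<bar>y\<bar> powr t / t"
      using assms by (intro Youngs_inequality) (auto simp: field_simps)
    also have "(\<bar>x\<bar> powr (t - 1)) powr (t / (t - 1)) = \<bar>x\<bar> powr t" using assms by (simp add: powr_powr)
    also have "\<bar>x\<bar> powr t / (t / (t - 1)) = (1 - 1 / t) * \<bar>x\<bar> powr t" using assms by (simp add: field_simps)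
    finally show ?thesis by simp
  qed
  have "\<bar>x\<bar> powr (t - 2) * x * y \<le> \<bar>\<bar>x\<bar> powr (t - 2) * x\<bar> * \<bar>y\<bar>" by (metis abs_ge_self abs_mult)
  then have "t * (\<bar>x\<bar> powr (t - 2) * x * y) \<le> t * ((1 - 1 / t) * \<bar>x\<bar> powr t + (1 / t) * \<bar>y\<bar> powr t)"
    using Young assms unfolding abs_powr_mult_self by (intro mult_left_mono) auto
  also have "\<dots> = (t - 1) * \<bar>x\<bar> powr t + \<bar>y\<bar> powr t" using assms by (simp add: field_simps)
  finally have 1: "t * (\<bar>x\<bar> powr (t - 2) * x * y) \<le> (t - 1) * \<bar>x\<bar> powr t + \<bar>y\<bar> powr t" .
  have "\<bar>x\<bar> powr (t - 2) * x * x = \<bar>\<bar>x\<bar> powr (t - 2) * x\<bar> * \<bar>x\<bar>" by (simp add: abs_mult mult.assoc)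
  also have "\<dots> = \<bar>x\<bar> powr t" unfolding abs_powr_mult_self by (simp add: powr_minus_one_mult)
  finally have 2: "\<bar>x\<bar> powr (t - 2) * x * x = \<bar>x\<bar> powr t" .
  have "t * (\<bar>x\<bar> powr (t - 2) * x) * (y - x) = t * (\<bar>x\<bar> powr (t - 2) * x * y) - t * (\<bar>x\<bar> powr (t - 2) * x * x)"
    by (simp add: algebra_simps)
  also have "\<dots> \<le> ((t - 1) * \<bar>x\<bar> powr t + \<bar>y\<bar> powr t) - t * \<bar>x\<bar> powr t"
    unfolding 2 using 1 by (rule diff_right_mono)
  also have "\<dots> = \<bar>y\<bar> powr t - \<bar>x\<bar> powr t" by (simp add: algebra_simps)
  finally show ?thesis .
qed

text \<open>The tangent inequalities at \<open>x\<close> and at \<open>y\<close> enclose the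
  remainder between 0 and the increment of the derivative times \<open>y - x\<close>.
  Differentiability of the functional thus rests on the modulus of continuity of the signed power,
  for every exponent above 1.\<close>

lemma powr_remainder:
  fixes x y :: real
  assumes "t > 1"
  shows "\<bar>\<bar>y\<bar> powr t - \<bar>x\<bar> powr t - t * (\<bar>x\<bar> powr (t - 2) * x) * (y - x)\<bar>
     \<le> t * \<bar>\<bar>y\<bar> powr (t - 2) * y - \<bar>x\<bar> powr (t - 2) * x\<bar> * \<bar>y - x\<bar>"
proof -
  have "\<bar>y\<bar> powr t - \<bar>x\<bar> powr t - t * (\<bar>x\<bar> powr (t - 2) * x) * (y - x) \<ge> 0"
    using powr_tangent[OF assms, of x y] by simp
  moreover have "\<bar>y\<bar> powr t - \<bar>x\<bar> powr t - t * (\<bar>x\<bar> powr (t - 2) * x) * (y - x)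
      \<le> t * (\<bar>y\<bar> powr (t - 2) * y - \<bar>x\<bar> powr (t - 2) * x) * (y - x)"
    using powr_tangent[OF assms, of y x] by (simp add: algebra_simps)
  moreover have "\<dots> \<le> t * \<bar>\<bar>y\<bar> powr (t - 2) * y - \<bar>x\<bar> powr (t - 2) * x\<bar> * \<bar>y - x\<bar>"
    unfolding mult.assoc using assms by (intro mult_left_mono) (metis abs_ge_self abs_mult, simp)
  ultimately show ?thesis by linarith
qed

text \<open>Near the diagonal the estimate follows from continuity at \<open>1\<close> and homogeneity, elsewhere
  \<open>\<bar>x\<bar>\<close> is controlled by \<open>\<bar>y - x\<bar>\<close>.\<close>

lemma multiplicative_modulus:
  fixes \<psi> :: "real \<Rightarrow> real"
  assumes mult: "\<And>x y. \<psi> (x * y) = \<psi> x * \<psi> y" and abs: "\<And>x. \<bar>\<psi> x\<bar> = \<bar>x\<bar> powr \<beta>"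
    and cont: "isCont \<psi> 1" and "\<beta> > 0" "e > 0"
  shows "\<exists>C\<ge>0. \<forall>x y. \<bar>\<psi> y - \<psi> x\<bar> \<le> e * \<bar>x\<bar> powr \<beta> + C * \<bar>y - x\<bar> powr \<beta>"
proof -
  obtain \<eta> where \<eta>: "\<eta> > 0" "\<And>y. \<bar>y - 1\<bar> < \<eta> \<Longrightarrow> \<bar>\<psi> y - \<psi> 1\<bar> < e"
    using cont \<open>e > 0\<close> unfolding continuous_at_eps_delta dist_real_def by blast
  define k where "k = 1 + 1 / \<eta>"
  have k: "k > 0" using \<eta> by (simp add: k_def add_pos_pos)
  have "\<bar>\<psi> y - \<psi> x\<bar> \<le> e * \<bar>x\<bar> powr \<beta> + 2 * k powr \<beta> * \<bar>y - x\<bar> powr \<beta>" for x y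
  proof (cases "\<bar>y - x\<bar> < \<eta> * \<bar>x\<bar>")
    case True
    then have x: "x \<noteq> 0" by auto
    have "\<bar>y / x - 1\<bar> = \<bar>y - x\<bar> / \<bar>x\<bar>" using x by (simp add: diff_divide_distrib flip: abs_divide)
    also have "\<dots> < \<eta>" using True x by (simp add: pos_divide_less_eq)
    finally have "\<bar>\<psi> (y / x) - \<psi> 1\<bar> \<le> e" using \<eta>(2) by fastforce
    moreover have "\<psi> y - \<psi> x = \<psi> x * (\<psi> (y / x) - \<psi> 1)"
      using mult[of x "y / x"] mult[of x 1] x by (simp add: right_diff_distrib)
    ultimately have "\<bar>\<psi> y - \<psi> x\<bar> \<le> \<bar>x\<bar> powr \<beta> * e"
      by (simp add: abs_mult abs mult_left_mono)
    then show ?thesis by (simp add: mult.commute add_increasing2)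
  next
    case False
    have x: "\<bar>x\<bar> \<le> (1 / \<eta>) * \<bar>y - x\<bar>" using False \<eta> by (simp add: field_simps)
    then have "\<bar>x\<bar> \<le> k * \<bar>y - x\<bar>" "\<bar>y\<bar> \<le> k * \<bar>y - x\<bar>"
      unfolding k_def distrib_right mult_1 by auto
    then have "\<bar>x\<bar> powr \<beta> \<le> (k * \<bar>y - x\<bar>) powr \<beta>" "\<bar>y\<bar> powr \<beta> \<le> (k * \<bar>y - x\<bar>) powr \<beta>"
      using \<open>\<beta> > 0\<close> by (auto intro: powr_mono2)
    then have "\<bar>\<psi> y - \<psi> x\<bar> \<le> 2 * (k * \<bar>y - x\<bar>) powr \<beta>"
      using abs_triangle_ineq4[of "\<psi> y" "\<psi> x"] unfolding abs by linarith
    also have "\<dots> = 2 * k powr \<beta> * \<bar>y - x\<bar> powr \<beta>" using k by (simp add: powr_mult)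
    finally show ?thesis using \<open>e > 0\<close> by (simp add: add_increasing)
  qed
  then show ?thesis by (intro exI[of _ "2 * k powr \<beta>"]) simp
qed

text \<open>The small factor \<open>e\<close> meets the power of the fixed function, and the large
  \<open>C\<close> only the power of the increment, which is small in norm. In this form the
  estimate can be integrated against a direction.\<close>

lemma signed_powr_modulus:
  assumes "t > 1" "e > 0"
  shows "\<exists>C\<ge>0. \<forall>x y :: real. \<bar>\<bar>y\<bar> powr (t - 2) * y - \<bar>x\<bar> powr (t - 2) * x\<bar>
     \<le> e * \<bar>x\<bar> powr (t - 1) + C * \<bar>y - x\<bar> powr (t - 1)"
proof (rule multiplicative_modulus)
  show "isCont (\<lambda>y. \<bar>y\<bar> powr (t - 2) * y) (1::real)" by (intro continuous_intros) auto
  show "\<bar>\<bar>x\<bar> powr (t - 2) * x\<bar> = \<bar>x\<bar> powr (t - 1)" for x :: real by (rule abs_powr_mult_self)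
qed (use assms in \<open>auto simp: abs_mult powr_mult\<close>)

lemma abs_powr_modulus:
  assumes "t > 0" "e > 0"
  shows "\<exists>C\<ge>0. \<forall>x y :: real. \<bar>\<bar>y\<bar> powr t - \<bar>x\<bar> powr t\<bar> \<le> e * \<bar>x\<bar> powr t + C * \<bar>y - x\<bar> powr t"
proof (rule multiplicative_modulus)
  show "isCont (\<lambda>y. \<bar>y\<bar> powr t) (1::real)" by (intro continuous_intros) auto
qed (use assms in \<open>auto simp: abs_mult powr_mult\<close>)

text \<open>One locale serves the energy and both nonlinear terms. For the energy, \<open>z\<close>
  runs over pairs, \<open>w\<close> is the kernel and \<open>T u z\<close> the difference of two
  values; for the others \<open>T\<close> is the identity and \<open>w\<close> the coefficient
  extended by zero. As \<open>w\<close> may change sign, the bound is imposed on its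
  modulus.\<close>

locale power_functional = seminormed_functions V N
  for V :: "('a \<Rightarrow> real) set" and N +
  fixes M :: "'z measure" and w :: "'z \<Rightarrow> real" and T :: "('a \<Rightarrow> real) \<Rightarrow> 'z \<Rightarrow> real" and t C :: real
  assumes t: "t > 1" and C: "C \<ge> 0"
    and T_add: "T (\<lambda>x. u x + v x) z = T u z + T v z"
    and T_scale: "T (\<lambda>x. c * u x) z = c * T u z"
    and w_measurable: "w \<in> borel_measurable M"
    and T_measurable: "u \<in> V \<Longrightarrow> T u \<in> borel_measurable M"
    and integrable_power: "u \<in> V \<Longrightarrow> integrable M (\<lambda>z. w z * \<bar>T u z\<bar> powr t)"
    and power_bound: "u \<in> V \<Longrightarrow> (LINT z|M. \<bar>w z\<bar> * \<bar>T u z\<bar> powr t) \<le> C * N u powr t"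
begin

definition \<Phi> :: "('a \<Rightarrow> real) \<Rightarrow> real" where
  "\<Phi> u = (LINT z|M. w z * \<bar>T u z\<bar> powr t)"

definition D\<Phi> :: "('a \<Rightarrow> real) \<Rightarrow> ('a \<Rightarrow> real) \<Rightarrow> real" where
  "D\<Phi> u h = t * (LINT z|M. w z * (\<bar>T u z\<bar> powr (t - 2) * T u z) * T h z)"

lemma T_diff: "T (\<lambda>x. u x - v x) z = T u z - T v z"
  using T_add[of u "\<lambda>x. - 1 * v x"] T_scale[of "-1" v] by simp

lemma integrable_abs_power: "u \<in> V \<Longrightarrow> integrable M (\<lambda>z. \<bar>w z\<bar> * \<bar>T u z\<bar> powr t)"
  using integrable_abs[OF integrable_power] by (simp add: abs_mult)

lemma abs_\<Phi>_le: "u \<in> V \<Longrightarrow> \<bar>\<Phi> u\<bar> \<le> C * N u powr t"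
proof -
  assume u: "u \<in> V"
  have "\<bar>\<Phi> u\<bar> \<le> (LINT z|M. \<bar>w z * \<bar>T u z\<bar> powr t\<bar>)" unfolding \<Phi>_def by (rule integral_abs_bound)
  also have "\<dots> = (LINT z|M. \<bar>w z\<bar> * \<bar>T u z\<bar> powr t)" by (simp add: abs_mult)
  finally show ?thesis using power_bound[OF u] by linarith
qed

lemma \<Phi>_scale: "\<Phi> (\<lambda>x. c * u x) = \<bar>c\<bar> powr t * \<Phi> u"
proof -
  have "w z * \<bar>T (\<lambda>x. c * u x) z\<bar> powr t = \<bar>c\<bar> powr t * (w z * \<bar>T u z\<bar> powr t)" for z
    unfolding T_scale abs_mult by (simp add: powr_mult mult_ac)
  then show ?thesis unfolding \<Phi>_def by (simp only: integral_mult_right_zero)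
qed

lemma integrable_mixed:
  assumes "u \<in> V" "h \<in> V"
  shows "integrable M (\<lambda>z. \<bar>w z\<bar> * (\<bar>T u z\<bar> powr (t - 1) * \<bar>T h z\<bar>))"
proof (rule Bochner_Integration.integrable_bound)
  show "integrable M (\<lambda>z. \<bar>w z\<bar> * \<bar>T u z\<bar> powr t + \<bar>w z\<bar> * \<bar>T h z\<bar> powr t)"
    using assms by (intro Bochner_Integration.integrable_add integrable_abs_power)
  show "(\<lambda>z. \<bar>w z\<bar> * (\<bar>T u z\<bar> powr (t - 1) * \<bar>T h z\<bar>)) \<in> borel_measurable M"
    using w_measurable T_measurable[OF assms(1)] T_measurable[OF assms(2)] by measurable
  show "AE z in M. norm (\<bar>w z\<bar> * (\<bar>T u z\<bar> powr (t - 1) * \<bar>T h z\<bar>))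
      \<le> norm (\<bar>w z\<bar> * \<bar>T u z\<bar> powr t + \<bar>w z\<bar> * \<bar>T h z\<bar> powr t)"
    using t powr_mult_le_sum[of "\<bar>T u z\<bar>" "\<bar>T h z\<bar>" t for z]
    by (auto simp: abs_mult intro!: mult_left_mono simp flip: distrib_left)
qed

text \<open>A substitute for Hoelder's inequality: after normalisation it is the pointwise bound
  \<open>x powr (t - 1) * y \<le> x powr t + y powr t\<close>.\<close>

lemma mixed_bound:
  assumes "u \<in> V" "h \<in> V"
  shows "(LINT z|M. \<bar>w z\<bar> * (\<bar>T u z\<bar> powr (t - 1) * \<bar>T h z\<bar>)) \<le> 2 * C * N u powr (t - 1) * N h"
proof -
  let ?I = "LINT z|M. \<bar>w z\<bar> * (\<bar>T u z\<bar> powr (t - 1) * \<bar>T h z\<bar>)"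
  have *: "?I \<le> 2 * C * \<alpha> powr (t - 1) * \<beta>" if a: "\<alpha> > 0" "N u \<le> \<alpha>" and b: "\<beta> > 0" "N h \<le> \<beta>" for \<alpha> \<beta>
  proof -
    have pw: "\<bar>w z\<bar> * (\<bar>T u z\<bar> powr (t - 1) * \<bar>T h z\<bar>)
        \<le> \<alpha> powr (t - 1) * \<beta> * (\<bar>w z\<bar> * \<bar>T u z\<bar> powr t / \<alpha> powr t + \<bar>w z\<bar> * \<bar>T h z\<bar> powr t / \<beta> powr t)" for z
    proof -
      have "\<bar>T u z\<bar> powr (t - 1) * \<bar>T h z\<bar> = \<alpha> powr (t - 1) * \<beta> * ((\<bar>T u z\<bar> / \<alpha>) powr (t - 1) * (\<bar>T h z\<bar> / \<beta>))"
        using a b by (simp add: powr_divide)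
      also have "\<dots> \<le> \<alpha> powr (t - 1) * \<beta> * ((\<bar>T u z\<bar> / \<alpha>) powr t + (\<bar>T h z\<bar> / \<beta>) powr t)"
        using a b t by (intro mult_left_mono powr_mult_le_sum) auto
      also have "\<dots> = \<alpha> powr (t - 1) * \<beta> * (\<bar>T u z\<bar> powr t / \<alpha> powr t + \<bar>T h z\<bar> powr t / \<beta> powr t)"
        using a b by (simp add: powr_divide)
      finally have "\<bar>w z\<bar> * (\<bar>T u z\<bar> powr (t - 1) * \<bar>T h z\<bar>) \<le>
          \<bar>w z\<bar> * (\<alpha> powr (t - 1) * \<beta> * (\<bar>T u z\<bar> powr t / \<alpha> powr t + \<bar>T h z\<bar> powr t / \<beta> powr t))"
        by (intro mult_left_mono) auto
      then show ?thesis by (simp add: algebra_simps)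
    qed
    have "?I \<le> (LINT z|M. \<alpha> powr (t - 1) * \<beta> * (\<bar>w z\<bar> * \<bar>T u z\<bar> powr t / \<alpha> powr t + \<bar>w z\<bar> * \<bar>T h z\<bar> powr t / \<beta> powr t))"
      using assms by (intro integral_mono pw integrable_mixed integrable_mult_right Bochner_Integration.integrable_add
          integrable_divide integrable_abs_power)
    also have "\<dots> = \<alpha> powr (t - 1) * \<beta> * ((LINT z|M. \<bar>w z\<bar> * \<bar>T u z\<bar> powr t) / \<alpha> powr t
        + (LINT z|M. \<bar>w z\<bar> * \<bar>T h z\<bar> powr t) / \<beta> powr t)"
      using assms integrable_abs_power by simp
    also have "\<dots> \<le> \<alpha> powr (t - 1) * \<beta> * (C + C)"
    proof (intro mult_left_mono add_mono)
      have "C * N u powr t \<le> C * \<alpha> powr t" "C * N h powr t \<le> C * \<beta> powr t"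
        using a b C t N_nonneg by (auto intro!: mult_left_mono powr_mono2)
      then show "(LINT z|M. \<bar>w z\<bar> * \<bar>T u z\<bar> powr t) / \<alpha> powr t \<le> C"
        "(LINT z|M. \<bar>w z\<bar> * \<bar>T h z\<bar> powr t) / \<beta> powr t \<le> C"
        using power_bound[OF assms(1)] power_bound[OF assms(2)] a b by (auto simp: pos_divide_le_eq)
    qed (use b in auto)
    finally show ?thesis by (simp add: algebra_simps)
  qed
  \<comment> \<open>\<open>N u\<close> and \<open>N h\<close> may vanish, so the normalised bound is
    established for all larger positive numbers and passed to the limit from the right.\<close>
  have "((\<lambda>k. 2 * C * (N u + k) powr (t - 1) * (N h + k)) \<longlongrightarrow> 2 * C * (N u + 0) powr (t - 1) * (N h + 0)) (at_right 0)"
    using t N_nonneg[of u] eventually_at_right_less[of "0::real"]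
    by (intro tendsto_intros tendsto_powr') (auto elim!: eventually_mono)
  moreover have "\<forall>\<^sub>F k in at_right 0. ?I \<le> 2 * C * (N u + k) powr (t - 1) * (N h + k)"
    using eventually_at_right_less[of "0::real"] N_nonneg[of u] N_nonneg[of h]
    by (auto elim!: eventually_mono intro!: *)
  ultimately show ?thesis using tendsto_lowerbound[of _ _ "at_right (0::real)" ?I] by simp
qed

lemma mixed_measurable:
  assumes "u \<in> V" "h \<in> V"
  shows "(\<lambda>z. w z * (\<bar>T u z\<bar> powr (t - 2) * T u z) * T h z) \<in> borel_measurable M"
  using w_measurable T_measurable[OF assms(1)] T_measurable[OF assms(2)] by measurable

lemma integrable_D\<Phi>:
  assumes "u \<in> V" "h \<in> V"
  shows "integrable M (\<lambda>z. w z * (\<bar>T u z\<bar> powr (t - 2) * T u z) * T h z)"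
  by (rule Bochner_Integration.integrable_bound[OF integrable_mixed[OF assms] mixed_measurable[OF assms]])
    (simp add: abs_mult flip: abs_powr_mult_self)

text \<open>By \<open>powr_remainder\<close>, the remainder of \<Phi> and the variation of its
  derivative are both bounded by the same kind of integral, that of the increment of the signed
  power against a direction; \<open>key\<close> bounds it by \<epsilon> times the seminorm of the
  direction.\<close>

lemma C1_\<Phi>: "C1_functional V N V \<Phi> D\<Phi>"
  unfolding C1_functional_def
proof (intro conjI ballI allI impI)
  fix u assume u: "u \<in> V"
  define A where "A = N u powr (t - 1)"
  have A: "A \<ge> 0" by (simp add: A_def)
  show "bounded_functional V N (D\<Phi> u)"
    unfolding bounded_functional_def
  proof (intro conjI ballI allI exI[of _ "t * (2 * C * A)"])
    show "D\<Phi> u (\<lambda>x. h x + k x) = D\<Phi> u h + D\<Phi> u k" if "h \<in> V" "k \<in> V" for h k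
      unfolding D\<Phi>_def T_add using integrable_D\<Phi>[OF u that(1)] integrable_D\<Phi>[OF u that(2)]
      by (simp add: distrib_left)
    show "D\<Phi> u (\<lambda>x. c * h x) = c * D\<Phi> u h" if "h \<in> V" for c h
      unfolding D\<Phi>_def T_scale by (simp add: mult.left_commute)
    show "\<bar>D\<Phi> u h\<bar> \<le> t * (2 * C * A) * N h" if h: "h \<in> V" for h
    proof -
      have "\<bar>LINT z|M. w z * (\<bar>T u z\<bar> powr (t - 2) * T u z) * T h z\<bar>
          \<le> (LINT z|M. \<bar>w z * (\<bar>T u z\<bar> powr (t - 2) * T u z) * T h z\<bar>)" by (rule integral_abs_bound)
      also have "\<dots> = (LINT z|M. \<bar>w z\<bar> * (\<bar>T u z\<bar> powr (t - 1) * \<bar>T h z\<bar>))"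
        by (simp add: abs_mult mult.assoc flip: abs_powr_mult_self)
      also have "\<dots> \<le> 2 * C * A * N h" unfolding A_def by (rule mixed_bound[OF u h])
      finally show ?thesis unfolding D\<Phi>_def abs_mult using t by simp
    qed
  qed (use t C A in auto)
  fix \<epsilon> :: real assume \<epsilon>: "\<epsilon> > 0"
  \<comment> \<open>Half of \<epsilon> is reserved for the part of the modulus involving
    \<open>u\<close>, which \<open>mixed_bound\<close> estimates with the factor
    \<open>2 * C * A\<close>; the other half goes to the increment and fixes \<delta> through
    \<open>\<delta> powr (t - 1)\<close>.\<close>
  define e where "e = \<epsilon> / (4 * t * C * (A + 1) + 1)"
  have den: "4 * t * C * (A + 1) + 1 > 0" using t C A by (simp add: add_nonneg_pos)
  have e: "e > 0" using \<epsilon> den by (simp add: e_def)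
  have e2: "t * (e * (2 * C * A)) \<le> \<epsilon> / 2"
  proof -
    have "t * (e * (2 * C * A)) = e * (4 * t * C * A) / 2" by simp
    also have "\<dots> \<le> e * (4 * t * C * (A + 1) + 1) / 2"
      using e t C A by (intro divide_right_mono mult_left_mono) (auto simp: distrib_left)
    also have "\<dots> = \<epsilon> / 2" using den by (simp add: e_def)
    finally show ?thesis .
  qed
  obtain K where K: "K \<ge> 0" "\<And>x y :: real. \<bar>\<bar>y\<bar> powr (t - 2) * y - \<bar>x\<bar> powr (t - 2) * x\<bar>
     \<le> e * \<bar>x\<bar> powr (t - 1) + K * \<bar>y - x\<bar> powr (t - 1)"
    using signed_powr_modulus[OF t e] by blast
  define \<delta> where "\<delta> = (\<epsilon> / 2 / (2 * t * C * K + 1)) powr (1 / (t - 1))"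
  have den2: "2 * t * C * K + 1 > 0" using t C K by (simp add: add_nonneg_pos)
  have \<delta>: "\<delta> > 0" using \<epsilon> den2 by (simp add: \<delta>_def)
  have small: "t * (K * (2 * C * n powr (t - 1))) \<le> \<epsilon> / 2" if "n < \<delta>" "n \<ge> 0" for n
  proof -
    have "n powr (t - 1) \<le> \<delta> powr (t - 1)" using that t by (intro powr_mono2) auto
    also have "\<dots> = \<epsilon> / 2 / (2 * t * C * K + 1)" using t \<epsilon> den2 by (simp add: \<delta>_def powr_powr)
    finally have "(2 * t * C * K) * n powr (t - 1) \<le> (2 * t * C * K + 1) * (\<epsilon> / 2 / (2 * t * C * K + 1))"
      using t C K \<epsilon> den2 by (intro mult_mono) auto
    also have "\<dots> = \<epsilon> / 2"
    proof -
      have "m * (\<epsilon> / 2 / m) = \<epsilon> / 2" if "m > 0" for m using that by simp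
      from this[OF den2] show ?thesis .
    qed
    finally show ?thesis by (simp add: mult_ac)
  qed
  have key: "(LINT z|M. \<bar>w z\<bar> * (\<bar>\<bar>T v z\<bar> powr (t - 2) * T v z - \<bar>T u z\<bar> powr (t - 2) * T u z\<bar> * \<bar>T k z\<bar>)) * t \<le> \<epsilon> * N k \<and>
      integrable M (\<lambda>z. \<bar>w z\<bar> * (\<bar>\<bar>T v z\<bar> powr (t - 2) * T v z - \<bar>T u z\<bar> powr (t - 2) * T u z\<bar> * \<bar>T k z\<bar>))"
    (is "integral\<^sup>L M ?f * t \<le> _ \<and> _")
    if v: "v \<in> V" "N (\<lambda>x. v x - u x) < \<delta>" and k: "k \<in> V" for v k
  proof
    define h where "h = (\<lambda>x. v x - u x)"
    have h: "h \<in> V" "N h < \<delta>" "T h z = T v z - T u z" for z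
      using v u by (auto simp: h_def T_diff intro: diff_mem)
    let ?g = "\<lambda>z. e * (\<bar>w z\<bar> * (\<bar>T u z\<bar> powr (t - 1) * \<bar>T k z\<bar>)) + K * (\<bar>w z\<bar> * (\<bar>T h z\<bar> powr (t - 1) * \<bar>T k z\<bar>))"
    have fg: "?f z \<le> ?g z" for z
    proof -
      have "\<bar>w z\<bar> * (\<bar>\<bar>T v z\<bar> powr (t - 2) * T v z - \<bar>T u z\<bar> powr (t - 2) * T u z\<bar> * \<bar>T k z\<bar>)
          \<le> \<bar>w z\<bar> * ((e * \<bar>T u z\<bar> powr (t - 1) + K * \<bar>T h z\<bar> powr (t - 1)) * \<bar>T k z\<bar>)"
        unfolding h(3) by (intro mult_left_mono mult_right_mono K(2)) auto
      then show ?thesis by (simp add: algebra_simps)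
    qed
    have g: "integrable M ?g" using u h k
      by (intro Bochner_Integration.integrable_add integrable_mult_right integrable_mixed)
    show f: "integrable M ?f"
    proof (rule Bochner_Integration.integrable_bound[OF g])
      show "?f \<in> borel_measurable M"
        using w_measurable T_measurable[OF u] T_measurable[OF v(1)] T_measurable[OF k] by measurable
      have "0 \<le> ?f z" for z by simp
      then show "AE z in M. norm (?f z) \<le> norm (?g z)" using fg by (smt (verit) AE_I2 real_norm_def)
    qed
    have "integral\<^sup>L M ?f \<le> integral\<^sup>L M ?g" by (intro integral_mono f g fg)
    also have "\<dots> = e * (LINT z|M. \<bar>w z\<bar> * (\<bar>T u z\<bar> powr (t - 1) * \<bar>T k z\<bar>))
        + K * (LINT z|M. \<bar>w z\<bar> * (\<bar>T h z\<bar> powr (t - 1) * \<bar>T k z\<bar>))"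
      using integrable_mixed[OF u k] integrable_mixed[OF h(1) k] by simp
    also have "\<dots> \<le> e * (2 * C * A * N k) + K * (2 * C * N h powr (t - 1) * N k)"
      unfolding A_def using e K u h k by (intro add_mono mult_left_mono mixed_bound) auto
    finally have "integral\<^sup>L M ?f * t \<le> (e * (2 * C * A * N k) + K * (2 * C * N h powr (t - 1) * N k)) * t"
      using t by (intro mult_right_mono) auto
    also have "\<dots> = (t * (e * (2 * C * A)) + t * (K * (2 * C * N h powr (t - 1)))) * N k"
      by (simp add: algebra_simps)
    also have "\<dots> \<le> (\<epsilon> / 2 + \<epsilon> / 2) * N k"
      using e2 small[OF h(2) N_nonneg] N_nonneg by (intro mult_right_mono add_mono)
    finally show "integral\<^sup>L M ?f * t \<le> \<epsilon> * N k" by simp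
  qed
  have "\<bar>\<Phi> v - \<Phi> u - D\<Phi> u (\<lambda>x. v x - u x)\<bar> \<le> \<epsilon> * N (\<lambda>x. v x - u x)"
    if v: "v \<in> V" "N (\<lambda>x. v x - u x) < \<delta>" for v
  proof -
    define h where "h = (\<lambda>x. v x - u x)"
    have h: "h \<in> V" "T h z = T v z - T u z" for z
      using v u by (auto simp: h_def T_diff intro: diff_mem)
    let ?r = "\<lambda>z. w z * (\<bar>T v z\<bar> powr t - \<bar>T u z\<bar> powr t - t * (\<bar>T u z\<bar> powr (t - 2) * T u z) * T h z)"
    have r_eq: "?r = (\<lambda>z. w z * \<bar>T v z\<bar> powr t - w z * \<bar>T u z\<bar> powr t - t * (w z * (\<bar>T u z\<bar> powr (t - 2) * T u z) * T h z))"
      by (auto simp: algebra_simps)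
    have r_int: "integrable M ?r" unfolding r_eq using u v h
      by (intro Bochner_Integration.integrable_diff integrable_mult_right integrable_power integrable_D\<Phi>)
    have "\<bar>\<Phi> v - \<Phi> u - D\<Phi> u h\<bar> = \<bar>integral\<^sup>L M ?r\<bar>"
      unfolding r_eq \<Phi>_def D\<Phi>_def using integrable_power[OF u] integrable_power[OF v(1)] integrable_D\<Phi>[OF u h(1)] by simp
    also have "\<dots> \<le> (LINT z|M. \<bar>?r z\<bar>)" by (rule integral_abs_bound)
    also have "\<dots> \<le> (LINT z|M. t * (\<bar>w z\<bar> * (\<bar>\<bar>T v z\<bar> powr (t - 2) * T v z - \<bar>T u z\<bar> powr (t - 2) * T u z\<bar> * \<bar>T h z\<bar>)))"
    proof (rule integral_mono)
      show "integrable M (\<lambda>z. \<bar>?r z\<bar>)" using r_int by (rule integrable_abs)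
      show "integrable M (\<lambda>z. t * (\<bar>w z\<bar> * (\<bar>\<bar>T v z\<bar> powr (t - 2) * T v z - \<bar>T u z\<bar> powr (t - 2) * T u z\<bar> * \<bar>T h z\<bar>)))"
        by (rule integrable_mult_right[OF conjunct2[OF key[OF v h(1)]]])
      show "\<bar>?r z\<bar> \<le> t * (\<bar>w z\<bar> * (\<bar>\<bar>T v z\<bar> powr (t - 2) * T v z - \<bar>T u z\<bar> powr (t - 2) * T u z\<bar> * \<bar>T h z\<bar>))" for z
      proof -
        have "\<bar>?r z\<bar> \<le> \<bar>w z\<bar> * (t * \<bar>\<bar>T v z\<bar> powr (t - 2) * T v z - \<bar>T u z\<bar> powr (t - 2) * T u z\<bar> * \<bar>T h z\<bar>)"
          unfolding abs_mult[of "w z"] h(2) by (rule mult_left_mono[OF powr_remainder[OF t]]) simp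
        then show ?thesis by (simp only: mult.assoc mult.left_commute[of "\<bar>w z\<bar>"])
      qed
    qed
    also have "\<dots> = (LINT z|M. \<bar>w z\<bar> * (\<bar>\<bar>T v z\<bar> powr (t - 2) * T v z - \<bar>T u z\<bar> powr (t - 2) * T u z\<bar> * \<bar>T h z\<bar>)) * t"
      unfolding integral_mult_right_zero by (rule mult.commute)
    also have "\<dots> \<le> \<epsilon> * N h" by (rule conjunct1[OF key[OF v h(1)]])
    finally show ?thesis unfolding h_def .
  qed
  then show "\<exists>\<delta>>0. \<forall>v\<in>V. N (\<lambda>x. v x - u x) < \<delta> \<longrightarrow>
      \<bar>\<Phi> v - \<Phi> u - D\<Phi> u (\<lambda>x. v x - u x)\<bar> \<le> \<epsilon> * N (\<lambda>x. v x - u x)" using \<delta> by blast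
  have "\<bar>D\<Phi> v k - D\<Phi> u k\<bar> \<le> \<epsilon> * N k" if v: "v \<in> V" "N (\<lambda>x. v x - u x) < \<delta>" and k: "k \<in> V" for v k
  proof -
    let ?r = "\<lambda>z. w z * (\<bar>T v z\<bar> powr (t - 2) * T v z - \<bar>T u z\<bar> powr (t - 2) * T u z) * T k z"
    have r_eq: "?r = (\<lambda>z. w z * (\<bar>T v z\<bar> powr (t - 2) * T v z) * T k z - w z * (\<bar>T u z\<bar> powr (t - 2) * T u z) * T k z)"
      by (auto simp: algebra_simps)
    have "\<bar>D\<Phi> v k - D\<Phi> u k\<bar> = \<bar>t * integral\<^sup>L M ?r\<bar>"
      unfolding r_eq D\<Phi>_def using integrable_D\<Phi>[OF u k] integrable_D\<Phi>[OF v(1) k] by (simp add: right_diff_distrib)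
    also have "\<dots> = t * \<bar>integral\<^sup>L M ?r\<bar>" unfolding abs_mult using t by simp
    also have "\<dots> \<le> t * (LINT z|M. \<bar>?r z\<bar>)"
      by (rule mult_left_mono[OF integral_abs_bound]) (use t in simp)
    also have "\<dots> = (LINT z|M. \<bar>w z\<bar> * (\<bar>\<bar>T v z\<bar> powr (t - 2) * T v z - \<bar>T u z\<bar> powr (t - 2) * T u z\<bar> * \<bar>T k z\<bar>)) * t"
      by (simp only: abs_mult[of "w _"] abs_mult[of _ "T k _"] mult.assoc mult.commute[of t] abs_idempotent)
    also have "\<dots> \<le> \<epsilon> * N k" by (rule conjunct1[OF key[OF v k]])
    finally show ?thesis .
  qed
  then show "\<exists>\<delta>>0. \<forall>v\<in>V. N (\<lambda>x. v x - u x) < \<delta> \<longrightarrow> (\<forall>h\<in>V. \<bar>D\<Phi> v h - D\<Phi> u h\<bar> \<le> \<epsilon> * N h)"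
    using \<delta> by blast
qed

end


section \<open>Critical points of Kirchhoff functionals\<close>

text \<open>Between two equal maxima of the energy along a ray lies a third critical point, and dividing the
  derivative by suitable powers leaves a strictly monotone function with at most one zero, which
  contradicts Rolle's theorem.\<close>

lemma ray_maximum_unique:
  fixes A B L G p q r T :: real
  defines "f \<equiv> \<lambda>s. A / p * s powr p + B / (2 * p) * s powr (2 * p) - L / q * s powr q - G / r * s powr r"
  assumes "0 < q" "q < p" "2 * p < r" "A > 0" "B \<ge> 0" and "T > 1" and eq: "f T = f 1"
    and max: "\<And>s. s > 0 \<Longrightarrow> f s \<le> f 1"
  shows False
proof -
  \<comment> \<open>The derivative of \<open>f\<close> is \<open>s powr (q - 1) * \<phi> s\<close>,
    that of \<phi> is \<open>s powr (r - q - 1) * \<zeta> s\<close>. The powers left in \<zeta> have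
    negative exponents and nonnegative coefficients, the first one positive, so \<zeta> decreases
    strictly whatever the signs of \<open>L\<close> and \<open>G\<close>.\<close>
  define \<phi> where "\<phi> = (\<lambda>s. A * s powr (p - q) + B * s powr (2 * p - q) - L - G * s powr (r - q))"
  define \<zeta> where "\<zeta> = (\<lambda>s. A * (p - q) * s powr (p - r) + B * (2 * p - q) * s powr (2 * p - r) - G * (r - q))"
  have df: "(f has_real_derivative s powr (q - 1) * \<phi> s) (at s)" if "s > 0" for s
  proof -
    have "(f has_real_derivative A / p * (p * s powr (p - 1)) + B / (2 * p) * (2 * p * s powr (2 * p - 1))
        - L / q * (q * s powr (q - 1)) - G / r * (r * s powr (r - 1))) (at s)"
      unfolding f_def using that
      by (intro DERIV_diff DERIV_add DERIV_cmult has_real_derivative_powr)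
    moreover have "A / p * (p * s powr (p - 1)) + B / (2 * p) * (2 * p * s powr (2 * p - 1))
        - L / q * (q * s powr (q - 1)) - G / r * (r * s powr (r - 1)) = s powr (q - 1) * \<phi> s"
    proof -
      have "s powr (p - 1) = s powr (q - 1) * s powr (p - q)" "s powr (2 * p - 1) = s powr (q - 1) * s powr (2 * p - q)"
        "s powr (r - 1) = s powr (q - 1) * s powr (r - q)" by (simp_all flip: powr_add)
      then show ?thesis using assms by (simp add: \<phi>_def algebra_simps)
    qed
    ultimately show ?thesis by simp
  qed
  have d\<phi>: "(\<phi> has_real_derivative s powr (r - q - 1) * \<zeta> s) (at s)" if "s > 0" for s
  proof -
    have "(\<phi> has_real_derivative A * ((p - q) * s powr (p - q - 1)) + B * ((2 * p - q) * s powr (2 * p - q - 1))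
        - 0 - G * ((r - q) * s powr (r - q - 1))) (at s)"
      unfolding \<phi>_def using that
      by (intro DERIV_diff DERIV_add DERIV_cmult has_real_derivative_powr DERIV_const)
    moreover have "A * ((p - q) * s powr (p - q - 1)) + B * ((2 * p - q) * s powr (2 * p - q - 1))
        - 0 - G * ((r - q) * s powr (r - q - 1)) = s powr (r - q - 1) * \<zeta> s"
    proof -
      have "s powr (p - q - 1) = s powr (r - q - 1) * s powr (p - r)"
        "s powr (2 * p - q - 1) = s powr (r - q - 1) * s powr (2 * p - r)"
        using powr_add[of s "r - q - 1" "p - r"] powr_add[of s "r - q - 1" "2 * p - r"]
        by (simp_all add: algebra_simps)
      then show ?thesis by (simp add: \<zeta>_def algebra_simps)
    qed
    ultimately show ?thesis by simp
  qed
  have crit: "\<phi> s = 0" if s: "s > 0" and m: "\<And>y. \<bar>s - y\<bar> < d \<Longrightarrow> f y \<le> f s" "d > 0" for s d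
  proof -
    have "s powr (q - 1) * \<phi> s = 0"
      using DERIV_local_max[OF df[OF s] m(2)] m(1) by blast
    then show ?thesis using s by simp
  qed
  have "\<phi> 1 = 0" by (rule crit[of 1 1]) (auto intro!: max)
  moreover have "\<phi> T = 0" by (rule crit[of T T]) (use \<open>T > 1\<close> eq max in auto)
  moreover obtain y where y: "1 < y" "y < T" "\<phi> y = 0"
  proof -
    obtain y where y: "1 < y" "y < T" "f T - f 1 = (T - 1) * (y powr (q - 1) * \<phi> y)"
      using MVT2[OF \<open>T > 1\<close>, of f "\<lambda>s. s powr (q - 1) * \<phi> s"] df by force
    then show ?thesis using that[of y] eq by auto
  qed
  moreover obtain z1 where z1: "1 < z1" "z1 < y" "\<phi> y - \<phi> 1 = (y - 1) * (z1 powr (r - q - 1) * \<zeta> z1)"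
    using MVT2[OF y(1), of \<phi> "\<lambda>s. s powr (r - q - 1) * \<zeta> s"] d\<phi> by force
  moreover obtain z2 where z2: "y < z2" "z2 < T" "\<phi> T - \<phi> y = (T - y) * (z2 powr (r - q - 1) * \<zeta> z2)"
    using MVT2[OF y(2), of \<phi> "\<lambda>s. s powr (r - q - 1) * \<zeta> s"] d\<phi> y by force
  ultimately have "\<zeta> z1 = 0" "\<zeta> z2 = 0" by auto
  moreover have "\<zeta> z2 < \<zeta> z1"
  proof -
    have "z2 powr (p - r) < z1 powr (p - r)" using z1 z2 assms by (intro powr_less_mono2_neg) auto
    then have "A * (p - q) * z2 powr (p - r) < A * (p - q) * z1 powr (p - r)"
      using assms by (intro mult_strict_left_mono) auto
    moreover have "z2 powr (2 * p - r) < z1 powr (2 * p - r)" using z1 z2 assms by (intro powr_less_mono2_neg) auto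
    then have "B * (2 * p - q) * z2 powr (2 * p - r) \<le> B * (2 * p - q) * z1 powr (2 * p - r)"
      using assms by (intro mult_left_mono) auto
    ultimately show ?thesis unfolding \<zeta>_def by linarith
  qed
  ultimately show False by simp
qed

section \<open>Squares of functionals and Euler's identity\<close>

context seminormed_functions
begin

lemma C1_functional_cong:
  assumes "C1_functional V N U \<Phi> D" "\<And>u. \<Phi> u = \<Phi>' u" "\<And>u h. D u h = D' u h"
  shows "C1_functional V N U \<Phi>' D'"
proof -
  have "\<Phi> = \<Phi>'" "D = D'" using assms(2,3) by (auto intro!: ext)
  then show ?thesis using assms(1) by simp
qed

text \<open>Supplies the Kirchhoff term: \<open>N u powr (2 * p)\<close> is the square of
  \<open>N u powr p\<close>, from which it inherits its differentiability.\<close>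

lemma C1_functional_square:
  assumes C: "C1_functional V N V \<Phi> D"
  shows "C1_functional V N V (\<lambda>u. (\<Phi> u)\<^sup>2) (\<lambda>u h. 2 * \<Phi> u * D u h)"
  unfolding C1_functional_def
proof (intro conjI ballI allI impI)
  fix u assume u: "u \<in> V"
  have Du: "bounded_functional V N (D u)" using C1_functional_bounded[OF C u] .
  show "bounded_functional V N (\<lambda>h. 2 * \<Phi> u * D u h)"
    using bounded_functional_lincomb[OF Du Du, of "2 * \<Phi> u" 0] by simp
  obtain K where K: "K \<ge> 0" "\<And>h. h \<in> V \<Longrightarrow> \<bar>D u h\<bar> \<le> K * N h" using Du by (rule bounded_functional_bound) blast
  fix \<epsilon> :: real assume \<epsilon>: "\<epsilon> > 0"
  define m where "m = K + 1 + 2 * \<bar>\<Phi> u\<bar>"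
  have m: "m > 0" using K by (simp add: m_def add_nonneg_pos)
  define e where "e = min 1 (\<epsilon> / 2 / (m + 1))"
  have "e * (m + 1) \<le> (\<epsilon> / 2 / (m + 1)) * (m + 1)" using m by (intro mult_right_mono) (auto simp: e_def)
  also have "\<dots> = \<epsilon> / 2" using m by (intro pos_divide_mult_cancel) simp
  finally have e: "e > 0" "e \<le> 1" "e * (m + 1) \<le> \<epsilon> / 2" using \<epsilon> m by (auto simp: e_def)
  obtain \<delta>1 where \<delta>1: "\<delta>1 > 0" "\<And>v. v \<in> V \<Longrightarrow> N (\<lambda>x. v x - u x) < \<delta>1 \<Longrightarrow>
      \<bar>\<Phi> v - \<Phi> u - D u (\<lambda>x. v x - u x)\<bar> \<le> e * N (\<lambda>x. v x - u x)"
    using C1_functional_remainder[OF C u e(1)] by blast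
  obtain \<delta>2 where \<delta>2: "\<delta>2 > 0" "\<And>v. v \<in> V \<Longrightarrow> N (\<lambda>x. v x - u x) < \<delta>2 \<Longrightarrow> \<bar>\<Phi> v - \<Phi> u\<bar> < e"
    using C1_functional_isCont[OF C subset_refl u e(1)] by blast
  obtain \<delta>3 where \<delta>3: "\<delta>3 > 0" "\<And>v h. v \<in> V \<Longrightarrow> N (\<lambda>x. v x - u x) < \<delta>3 \<Longrightarrow> h \<in> V \<Longrightarrow> \<bar>D v h - D u h\<bar> \<le> e * N h"
    using C1_functional_continuous[OF C u e(1)] by blast
  define \<delta> where "\<delta> = Min {\<delta>1, \<delta>2, \<delta>3}"
  have \<delta>: "\<delta> > 0" using \<delta>1 \<delta>2 \<delta>3 by (simp add: \<delta>_def)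
  have less: "x < \<delta>1" "x < \<delta>2" "x < \<delta>3" if "x < \<delta>" for x using that by (auto simp: \<delta>_def)
  have "\<bar>(\<Phi> v)\<^sup>2 - (\<Phi> u)\<^sup>2 - 2 * \<Phi> u * D u (\<lambda>x. v x - u x)\<bar> \<le> \<epsilon> * N (\<lambda>x. v x - u x)"
    if v: "v \<in> V" "N (\<lambda>x. v x - u x) < \<delta>" for v
  proof -
    let ?h = "\<lambda>x. v x - u x"
    have h: "?h \<in> V" using v u by (simp add: diff_mem)
    have R: "\<bar>\<Phi> v - \<Phi> u - D u ?h\<bar> \<le> e * N ?h" using \<delta>1(2)[OF v(1)] less[OF v(2)] by blast
    have sm: "\<bar>\<Phi> v - \<Phi> u\<bar> \<le> e" using \<delta>2(2)[OF v(1)] less[OF v(2)] by (simp add: less_imp_le)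
    have "e * N ?h \<le> 1 * N ?h" using e N_nonneg by (intro mult_right_mono)
    then have lip: "\<bar>\<Phi> v - \<Phi> u\<bar> \<le> (K + 1) * N ?h" using R K(2)[OF h] unfolding distrib_right by linarith
    have "(\<Phi> v)\<^sup>2 - (\<Phi> u)\<^sup>2 - 2 * \<Phi> u * D u ?h = (\<Phi> v - \<Phi> u) * (\<Phi> v - \<Phi> u) + (2 * \<Phi> u) * (\<Phi> v - \<Phi> u - D u ?h)"
      by (simp add: power2_eq_square algebra_simps)
    then have "\<bar>(\<Phi> v)\<^sup>2 - (\<Phi> u)\<^sup>2 - 2 * \<Phi> u * D u ?h\<bar> \<le> \<bar>\<Phi> v - \<Phi> u\<bar> * \<bar>\<Phi> v - \<Phi> u\<bar> + \<bar>2 * \<Phi> u\<bar> * \<bar>\<Phi> v - \<Phi> u - D u ?h\<bar>"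
      unfolding abs_mult[symmetric] by (simp only: abs_triangle_ineq)
    also have "\<dots> \<le> e * ((K + 1) * N ?h) + \<bar>2 * \<Phi> u\<bar> * (e * N ?h)"
      using R sm lip e by (intro add_mono mult_mono) auto
    also have "\<dots> = (e * m) * N ?h" by (simp add: m_def algebra_simps abs_mult)
    also have "\<dots> \<le> \<epsilon> * N ?h"
      using e \<epsilon> N_nonneg by (intro mult_right_mono) (auto simp: algebra_simps)
    finally show ?thesis .
  qed
  then show "\<exists>\<delta>>0. \<forall>v\<in>V. N (\<lambda>x. v x - u x) < \<delta> \<longrightarrow>
      \<bar>(\<Phi> v)\<^sup>2 - (\<Phi> u)\<^sup>2 - 2 * \<Phi> u * D u (\<lambda>x. v x - u x)\<bar> \<le> \<epsilon> * N (\<lambda>x. v x - u x)"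
    using \<delta> by blast
  have "\<bar>2 * \<Phi> v * D v h - 2 * \<Phi> u * D u h\<bar> \<le> \<epsilon> * N h" if v: "v \<in> V" "N (\<lambda>x. v x - u x) < \<delta>" "h \<in> V" for v h
  proof -
    have sm: "\<bar>\<Phi> v - \<Phi> u\<bar> \<le> e" using \<delta>2(2)[OF v(1)] less[OF v(2)] by (simp add: less_imp_le)
    have R: "\<bar>D v h - D u h\<bar> \<le> e * N h" using \<delta>3(2)[OF v(1)] less[OF v(2)] v by blast
    have "e * N h \<le> 1 * N h" using e N_nonneg by (intro mult_right_mono)
    then have "\<bar>D v h\<bar> \<le> (K + 1) * N h" using R K(2)[OF v(3)] unfolding distrib_right by linarith
    moreover have "2 * \<Phi> v * D v h - 2 * \<Phi> u * D u h = 2 * ((\<Phi> v - \<Phi> u) * D v h) + 2 * (\<Phi> u * (D v h - D u h))"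
      by (simp add: algebra_simps)
    then have "\<bar>2 * \<Phi> v * D v h - 2 * \<Phi> u * D u h\<bar> \<le> 2 * (\<bar>\<Phi> v - \<Phi> u\<bar> * \<bar>D v h\<bar>) + 2 * (\<bar>\<Phi> u\<bar> * \<bar>D v h - D u h\<bar>)"
      unfolding abs_mult[symmetric] by linarith
    moreover have "\<bar>\<Phi> v - \<Phi> u\<bar> * \<bar>D v h\<bar> \<le> e * ((K + 1) * N h)"
      using sm calculation(1) e by (intro mult_mono) auto
    moreover have "\<bar>\<Phi> u\<bar> * \<bar>D v h - D u h\<bar> \<le> \<bar>\<Phi> u\<bar> * (e * N h)" using R by (intro mult_left_mono) auto
    ultimately have "\<bar>2 * \<Phi> v * D v h - 2 * \<Phi> u * D u h\<bar> \<le> 2 * (e * ((K + 1) * N h)) + 2 * (\<bar>\<Phi> u\<bar> * (e * N h))"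
      by linarith
    also have "\<dots> = (2 * (e * (K + 1 + \<bar>\<Phi> u\<bar>))) * N h" by (simp add: algebra_simps)
    also have "\<dots> \<le> \<epsilon> * N h"
    proof (rule mult_right_mono[OF _ N_nonneg])
      have "e * (K + 1 + \<bar>\<Phi> u\<bar>) \<le> e * (m + 1)" using e by (intro mult_left_mono) (auto simp: m_def)
      then show "2 * (e * (K + 1 + \<bar>\<Phi> u\<bar>)) \<le> \<epsilon>" using e by linarith
    qed
    finally show ?thesis .
  qed
  then show "\<exists>\<delta>>0. \<forall>v\<in>V. N (\<lambda>x. v x - u x) < \<delta> \<longrightarrow> (\<forall>h\<in>V. \<bar>2 * \<Phi> v * D v h - 2 * \<Phi> u * D u h\<bar> \<le> \<epsilon> * N h)"
    using \<delta> by blast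
qed

text \<open>Euler's identity for homogeneous functionals, read off from the derivative of
  \<open>\<bar>1 + s\<bar> powr t\<close> at 0; near 0 the modulus is \<open>1 + s\<close>.\<close>

lemma C1_functional_homogeneous:
  assumes C: "C1_functional V N V \<Phi> D" and u: "u \<in> V" and hom: "\<And>c. \<Phi> (\<lambda>x. c * u x) = \<bar>c\<bar> powr t * \<Phi> u"
  shows "D u u = t * \<Phi> u"
proof -
  have "((\<lambda>s. \<Phi> (\<lambda>x. u x + s * u x)) has_real_derivative D u u) (at 0)"
    using C1_functional_line_DERIV[OF C u u, of 0] by simp
  moreover have "(\<lambda>s. \<Phi> (\<lambda>x. u x + s * u x)) = (\<lambda>s. \<bar>1 + s\<bar> powr t * \<Phi> u)"
    using hom[of "1 + s" for s] by (simp add: distrib_right)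
  ultimately have "((\<lambda>s. \<bar>1 + s\<bar> powr t * \<Phi> u) has_real_derivative D u u) (at 0)" by simp
  moreover have "((\<lambda>s. \<bar>1 + s\<bar> powr t * \<Phi> u) has_real_derivative t * \<Phi> u) (at 0)"
  proof (rule DERIV_cong_ev[THEN iffD1])
    show "((\<lambda>s. (1 + s) powr t * \<Phi> u) has_real_derivative t * \<Phi> u) (at 0)"
      by (auto intro!: derivative_eq_intros)
    show "\<forall>\<^sub>F s in nhds 0. (1 + s) powr t * \<Phi> u = \<bar>1 + s\<bar> powr t * \<Phi> u"
      by (rule eventually_nhds_metric[THEN iffD2]) (auto intro!: exI[of _ 1] simp: dist_real_def)
  qed auto
  ultimately show ?thesis by (rule DERIV_unique)
qed

end

text \<open>All that the variational argument uses of the problem. The assumption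
  \<open>compact\<close> stands in for weak compactness: a bounded sequence has a subsequence along
  which the seminorms converge to a number not below the seminorm of the limit, and along which both
  nonlinear terms converge. The constants \<open>Cf\<close> and \<open>Cg\<close> are positive
  because they occur as divisors.\<close>

locale kirchhoff_functional = seminormed_functions V N
  for V :: "('a \<Rightarrow> real) set" and N +
  fixes F G DE DF DG and p q r a b Cf Cg :: real
  assumes exponents: "1 < q" "q < p" "2 * p < r" and ab: "a > 0" "b > 0" and CfCg: "Cf > 0" "Cg > 0"
    and C1_E: "C1_functional V N V (\<lambda>u. N u powr p) DE"
    and C1_F: "C1_functional V N V F DF" and C1_G: "C1_functional V N V G DG"
    and F_scale: "F (\<lambda>x. c * u x) = \<bar>c\<bar> powr q * F u"
    and G_scale: "G (\<lambda>x. c * u x) = \<bar>c\<bar> powr r * G u"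
    and F_le: "u \<in> V \<Longrightarrow> \<bar>F u\<bar> \<le> Cf * N u powr q"
    and G_le: "u \<in> V \<Longrightarrow> \<bar>G u\<bar> \<le> Cg * N u powr r"
    and compact: "(\<And>k::nat. U k \<in> V) \<Longrightarrow> (\<And>k. N (U k) \<le> B) \<Longrightarrow>
      \<exists>u\<in>V. \<exists>\<sigma> l. strict_mono \<sigma> \<and> (\<lambda>k. N (U (\<sigma> k))) \<longlonglongrightarrow> l \<and> N u \<le> l \<and>
        (\<lambda>k. F (U (\<sigma> k))) \<longlonglongrightarrow> F u \<and> (\<lambda>k. G (U (\<sigma> k))) \<longlonglongrightarrow> G u"
    and abs_mem: "u \<in> V \<Longrightarrow> (\<lambda>x. \<bar>u x\<bar>) \<in> V" and N_abs: "u \<in> V \<Longrightarrow> N (\<lambda>x. \<bar>u x\<bar>) \<le> N u"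
    and F_abs: "F (\<lambda>x. \<bar>u x\<bar>) = F u" and G_abs: "G (\<lambda>x. \<bar>u x\<bar>) = G u"
    and F_pos: "\<exists>u\<in>V. F u > 0" and G_pos: "\<exists>u\<in>V. G u > 0"
begin

lemma powers: "p > 0" "q > 0" "r > 0" "p > 1" "q < r" "p < r" using exponents by auto

definition energy :: "real \<Rightarrow> ('a \<Rightarrow> real) \<Rightarrow> real" where
  "energy lam u = a / p * N u powr p + b / (2 * p) * N u powr (2 * p) - lam / q * F u - 1 / r * G u"

definition Denergy :: "real \<Rightarrow> ('a \<Rightarrow> real) \<Rightarrow> ('a \<Rightarrow> real) \<Rightarrow> real" where
  "Denergy lam u h = (a + b * N u powr p) / p * DE u h - lam / q * DF u h - 1 / r * DG u h"

definition nehari_functional :: "real \<Rightarrow> ('a \<Rightarrow> real) \<Rightarrow> real" where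
  "nehari_functional lam u = a * N u powr p + b * N u powr (2 * p) - lam * F u - G u"

definition Dnehari :: "real \<Rightarrow> ('a \<Rightarrow> real) \<Rightarrow> ('a \<Rightarrow> real) \<Rightarrow> real" where
  "Dnehari lam u h = (a + 2 * b * N u powr p) * DE u h - lam * DF u h - DG u h"

lemma powr_double: "x powr (2 * p) = (x powr p)\<^sup>2" for x :: real
  by (simp only: power2_eq_square mult_2 powr_add)

lemma C1_energy: "C1_functional V N V (energy lam) (Denergy lam)"
proof (rule C1_functional_cong)
  show "C1_functional V N V
      (\<lambda>u. 1 * (a / p * N u powr p + b / (2 * p) * (N u powr p)\<^sup>2) + 1 * (- (lam / q) * F u + - (1 / r) * G u))
      (\<lambda>u h. 1 * (a / p * DE u h + b / (2 * p) * (2 * N u powr p * DE u h)) + 1 * (- (lam / q) * DF u h + - (1 / r) * DG u h))"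
    by (rule C1_functional_lincomb[OF C1_functional_lincomb[OF C1_E C1_functional_square[OF C1_E] subset_refl]
        C1_functional_lincomb[OF C1_F C1_G subset_refl] subset_refl])
qed (simp_all add: energy_def powr_double Denergy_def add_divide_distrib distrib_right)

lemma C1_nehari: "C1_functional V N V (nehari_functional lam) (Dnehari lam)"
proof (rule C1_functional_cong)
  show "C1_functional V N V
      (\<lambda>u. 1 * (a * N u powr p + b * (N u powr p)\<^sup>2) + 1 * (- lam * F u + - 1 * G u))
      (\<lambda>u h. 1 * (a * DE u h + b * (2 * N u powr p * DE u h)) + 1 * (- lam * DF u h + - 1 * DG u h))"
    by (rule C1_functional_lincomb[OF C1_functional_lincomb[OF C1_E C1_functional_square[OF C1_E] subset_refl]
        C1_functional_lincomb[OF C1_F C1_G subset_refl] subset_refl])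
qed (simp_all add: nehari_functional_def powr_double Dnehari_def distrib_right)

lemma energy_ray:
  assumes "u \<in> V" "t \<ge> 0"
  shows "energy lam (\<lambda>x. t * u x) = (a * N u powr p) / p * t powr p + (b * N u powr (2 * p)) / (2 * p) * t powr (2 * p)
     - (lam * F u) / q * t powr q - G u / r * t powr r"
  unfolding energy_def using assms
  by (simp add: N_scale F_scale G_scale powr_mult N_nonneg mult_ac)

text \<open>\<open>\<rho>\<close> is small enough for the superlinear term to be dominated on the sphere of radius
  \<open>\<rho>\<close>, and \<open>lam0\<close> for the sublinear one.\<close>

definition \<rho> :: real where
  "\<rho> = (min (a / 2) (a * (p - q) / (2 * (r - q))) / Cg) powr (1 / (r - p))"

definition lam0 :: real where
  "lam0 = min (a * q / (4 * p * Cf) * \<rho> powr (p - q)) (a * (r - p) / ((r - q) * Cf) * \<rho> powr (p - q))"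

definition \<delta>0 :: real where "\<delta>0 = a / (4 * p) * \<rho> powr p"

text \<open>The two entries of the minimum answer to two uses: \<open>a / 2\<close> leaves room in
  the energy on the sphere, and the other one, with its spare factor 2, gives the strict inequality
  behind the regularity of the Nehari set.\<close>

lemma \<rho>_powr: "\<rho> > 0" "Cg * \<rho> powr (r - p) \<le> a / 2" "(r - q) * (Cg * \<rho> powr (r - p)) < a * (p - q)"
proof -
  define m where "m = min (a / 2) (a * (p - q) / (2 * (r - q)))"
  have m: "m > 0" using ab exponents by (simp add: m_def)
  have m': "m \<le> a / 2" "m \<le> a * (p - q) / (2 * (r - q))" unfolding m_def by (rule min.cobounded1, rule min.cobounded2)
  show "\<rho> > 0" unfolding \<rho>_def m_def[symmetric] using m CfCg by simp
  have "\<rho> powr (r - p) = (m / Cg) powr 1" unfolding \<rho>_def m_def[symmetric] using powers by (simp add: powr_powr)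
  then have eq: "Cg * \<rho> powr (r - p) = m" using m CfCg by simp
  show "Cg * \<rho> powr (r - p) \<le> a / 2" unfolding eq by (rule m')
  have "(r - q) * m \<le> (r - q) * (a * (p - q) / (2 * (r - q)))" using powers m' by (intro mult_left_mono) auto
  also have "\<dots> = a * (p - q) / 2"
  proof -
    have "d * (x / (2 * d)) = x / 2" if "d > 0" for d x :: real using that by simp
    then show ?thesis using powers by (metis diff_gt_0_iff_gt)
  qed
  also have "\<dots> < a * (p - q)" using ab exponents by simp
  finally show "(r - q) * (Cg * \<rho> powr (r - p)) < a * (p - q)" unfolding eq .
qed

lemmas \<rho>_pos = \<rho>_powr(1)

lemma lam0_pos: "lam0 > 0"
  using ab CfCg powers exponents \<rho>_pos by (simp add: lam0_def)

lemma \<delta>0_pos: "\<delta>0 > 0" using ab powers \<rho>_pos by (simp add: \<delta>0_def)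

text \<open>On the sphere the sublinear term takes at most a quarter of
  \<open>a / p * \<rho> powr p\<close> and the superlinear one at most half; the quarter that is
  left is \<open>\<delta>0\<close>.\<close>

lemma energy_sphere:
  assumes "u \<in> V" "N u = \<rho>" "0 < lam" "lam < lam0"
  shows "energy lam u \<ge> \<delta>0"
proof -
  have "lam \<le> a * q / (4 * p * Cf) * \<rho> powr (p - q)" using assms by (simp add: lam0_def)
  then have l: "lam / q \<le> (a * q / (4 * p * Cf) * \<rho> powr (p - q)) / q"
    using powers by (intro divide_right_mono) auto
  have "F u \<le> Cf * \<rho> powr q" using F_le[OF assms(1)] assms(2) by simp
  then have "lam / q * F u \<le> lam / q * (Cf * \<rho> powr q)" using assms powers by (intro mult_left_mono) auto
  also have "\<dots> \<le> (a * q / (4 * p * Cf) * \<rho> powr (p - q)) / q * (Cf * \<rho> powr q)"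
    by (rule mult_right_mono[OF l]) (use CfCg in simp)
  also have "\<dots> = a / (4 * p) * (\<rho> powr (p - q) * \<rho> powr q)" using powers CfCg by simp
  also have "\<rho> powr (p - q) * \<rho> powr q = \<rho> powr p" by (simp flip: powr_add)
  finally have 1: "lam / q * F u \<le> a / (4 * p) * \<rho> powr p" .
  have "G u \<le> Cg * \<rho> powr r" using G_le[OF assms(1)] assms(2) by simp
  then have "1 / r * G u \<le> 1 / r * (Cg * \<rho> powr r)" using powers by (intro mult_left_mono) auto
  also have "\<dots> \<le> 1 / p * (Cg * \<rho> powr r)" using powers CfCg by (intro mult_right_mono frac_le) auto
  also have "\<rho> powr r = \<rho> powr (r - p) * \<rho> powr p" by (simp flip: powr_add)
  also have "1 / p * (Cg * (\<rho> powr (r - p) * \<rho> powr p)) \<le> 1 / p * (a / 2 * \<rho> powr p)"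
    using mult_right_mono[OF \<rho>_powr(2), of "\<rho> powr p"] powers by (intro mult_left_mono) (auto simp: mult.assoc)
  finally have 2: "1 / r * G u \<le> a / (2 * p) * \<rho> powr p" by simp
  have 3: "b / (2 * p) * \<rho> powr (2 * p) \<ge> 0" using ab powers by simp
  have 4: "a / p * \<rho> powr p = a / (4 * p) * \<rho> powr p + (a / (4 * p) * \<rho> powr p + a / (2 * p) * \<rho> powr p)"
    using powers by (simp add: field_simps)
  show ?thesis using 1 2 3 unfolding energy_def assms(2) \<delta>0_def 4 by linarith
qed

text \<open>On the Nehari set multiples of \<open>nehari_functional\<close> may be subtracted
  freely. Removing \<open>q\<close> times it eliminates \<open>F\<close> and leaves a positive value
  when \<open>N u \<le> \<rho>\<close>, where \<open>G\<close> is dominated; removing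
  \<open>r\<close> times it eliminates \<open>G\<close> and leaves a negative value when
  \<open>N u > \<rho>\<close>, where the smallness of \<open>lam\<close> controls
  \<open>F\<close>.\<close>

lemma nehari_regular:
  assumes u: "u \<in> V" "N u > 0" and nehari: "nehari_functional lam u = 0" and lam: "0 < lam" "lam < lam0"
  shows "Dnehari lam u u \<noteq> 0"
proof -
  have DE: "DE u u = p * N u powr p"
    by (rule C1_functional_homogeneous[OF C1_E u(1)]) (simp add: N_scale[OF u(1)] powr_mult N_nonneg)
  have DF: "DF u u = q * F u" by (rule C1_functional_homogeneous[OF C1_F u(1) F_scale])
  have DG: "DG u u = r * G u" by (rule C1_functional_homogeneous[OF C1_G u(1) G_scale])
  define X where "X = N u powr p"
  have X: "X > 0" using u by (simp add: X_def)
  have D: "Dnehari lam u u = a * p * X + 2 * p * b * X\<^sup>2 - lam * q * F u - r * G u"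
    unfolding Dnehari_def DE DF DG X_def by (simp add: power2_eq_square algebra_simps)
  have 0: "a * X + b * X\<^sup>2 - lam * F u - G u = 0" using nehari unfolding nehari_functional_def powr_double X_def .
  show ?thesis
  proof (cases "N u \<le> \<rho>")
    case True
    have "(r - q) * G u \<le> (r - q) * (Cg * N u powr r)" using G_le[OF u(1)] powers by (intro mult_left_mono) auto
    also have "N u powr r = N u powr (r - p) * X" unfolding X_def by (simp flip: powr_add)
    also have "(r - q) * (Cg * (N u powr (r - p) * X)) \<le> (r - q) * (Cg * (\<rho> powr (r - p) * X))"
      using True u powers CfCg X by (intro mult_left_mono mult_right_mono powr_mono2) auto
    also have "\<dots> = ((r - q) * (Cg * \<rho> powr (r - p))) * X" by simp
    also have "\<dots> < a * (p - q) * X" using \<rho>_powr(3) X by (intro mult_strict_right_mono)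
    finally have "(r - q) * G u < a * (p - q) * X" .
    moreover have "b * (2 * p - q) * X\<^sup>2 \<ge> 0" using ab powers exponents by simp
    moreover have "Dnehari lam u u = q * (a * X + b * X\<^sup>2 - lam * F u - G u) + a * (p - q) * X + b * (2 * p - q) * X\<^sup>2 - (r - q) * G u"
      unfolding D by (simp add: algebra_simps)
    ultimately show ?thesis unfolding 0 by linarith
  next
    case False
    have "lam < a * (r - p) / ((r - q) * Cf) * \<rho> powr (p - q)" using lam by (simp add: lam0_def)
    then have "lam * ((r - q) * Cf) < a * (r - p) / ((r - q) * Cf) * \<rho> powr (p - q) * ((r - q) * Cf)"
      using powers CfCg by (intro mult_strict_right_mono) auto
    also have "\<dots> = a * (r - p) * \<rho> powr (p - q)" using powers CfCg by simp
    finally have l: "lam * ((r - q) * Cf) < a * (r - p) * \<rho> powr (p - q)" .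
    have "lam * (r - q) * F u \<le> lam * (r - q) * (Cf * N u powr q)"
      using F_le[OF u(1)] powers lam by (intro mult_left_mono) auto
    also have "\<dots> = lam * ((r - q) * Cf) * N u powr q" by simp
    also have "\<dots> < a * (r - p) * \<rho> powr (p - q) * N u powr q" using l u by (intro mult_strict_right_mono) auto
    also have "\<dots> \<le> a * (r - p) * N u powr (p - q) * N u powr q"
      using False ab powers exponents \<rho>_pos by (intro mult_right_mono mult_left_mono powr_mono2) auto
    also have "\<dots> = a * (r - p) * X" unfolding X_def mult.assoc by (simp flip: powr_add)
    finally have "lam * (r - q) * F u < a * (r - p) * X" .
    moreover have "b * (r - 2 * p) * X\<^sup>2 \<ge> 0" using ab powers exponents by simp
    moreover have "Dnehari lam u u = r * (a * X + b * X\<^sup>2 - lam * F u - G u) - a * (r - p) * X - b * (r - 2 * p) * X\<^sup>2 + lam * (r - q) * F u"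
      unfolding D by (simp add: algebra_simps)
    ultimately show ?thesis unfolding 0 by linarith
  qed
qed

section \<open>Semicontinuity of the energy and maxima along rays\<close>

lemma energy_abs_le:
  assumes "u \<in> V" "t \<ge> 0"
  shows "energy lam (\<lambda>x. t * \<bar>u x\<bar>) \<le> energy lam (\<lambda>x. t * u x)"
proof -
  have "N (\<lambda>x. \<bar>u x\<bar>) powr p \<le> N u powr p" "N (\<lambda>x. \<bar>u x\<bar>) powr (2 * p) \<le> N u powr (2 * p)"
    using N_abs[OF assms(1)] N_nonneg powers by (auto intro!: powr_mono2)
  then show ?thesis
    unfolding energy_ray[OF assms] energy_ray[OF abs_mem[OF assms(1)] assms(2)] F_abs G_abs
    using ab powers by (intro diff_right_mono add_mono mult_right_mono divide_right_mono mult_left_mono) auto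
qed

text \<open>The seminorm enters with nonnegative coefficients, so replacing the limit
  \<open>l\<close> by the smaller \<open>N u\<close> can only lower the energy. The factor
  \<open>t\<close> allows the estimate at the maximising parameter of the limit, which may differ
  from that of the sequence.\<close>

lemma energy_lsc:
  assumes U: "\<And>k. U k \<in> V" "u \<in> V" "t \<ge> 0" and lim: "(\<lambda>k. N (U k)) \<longlonglongrightarrow> l" "N u \<le> l"
    "(\<lambda>k. F (U k)) \<longlonglongrightarrow> F u" "(\<lambda>k. G (U k)) \<longlonglongrightarrow> G u"
    and le: "\<And>k. energy lam (\<lambda>x. t * U k x) \<le> c k" and c: "c \<longlonglongrightarrow> c0"
  shows "energy lam (\<lambda>x. t * u x) \<le> c0"
proof -
  have l: "l \<ge> 0" using lim(2) N_nonneg[of u] by linarith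
  have "(\<lambda>k. energy lam (\<lambda>x. t * U k x)) \<longlonglongrightarrow> (a * l powr p) / p * t powr p + (b * l powr (2 * p)) / (2 * p) * t powr (2 * p)
     - (lam * F u) / q * t powr q - G u / r * t powr r" (is "_ \<longlonglongrightarrow> ?L")
    unfolding energy_ray[OF U(1) U(3)] using powers l
    by (intro tendsto_intros tendsto_powr' lim) (auto simp: N_nonneg)
  then have "?L \<le> c0" using le by (intro LIMSEQ_le[OF _ c]) auto
  moreover have "energy lam (\<lambda>x. t * u x) \<le> ?L"
    unfolding energy_ray[OF U(2,3)] using ab powers lim(2) N_nonneg
    by (intro diff_right_mono add_mono mult_right_mono divide_right_mono mult_left_mono powr_mono2) auto
  ultimately show ?thesis by linarith
qed

text \<open>Ray maxima, normalised so that the maximising parameter is 1. Where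
  \<open>G u > 0\<close> the energy tends to minus infinity along the ray, so maxima exist; no sign
  of \<open>F u\<close> is imposed.\<close>

definition peak :: "real \<Rightarrow> ('a \<Rightarrow> real) \<Rightarrow> bool" where
  "peak lam u \<longleftrightarrow> u \<in> V \<and> G u > 0 \<and> (\<forall>t>0. energy lam (\<lambda>x. t * u x) \<le> energy lam u)"

lemma N_pos: "u \<in> V \<Longrightarrow> G u > 0 \<Longrightarrow> N u > 0"
  using G_le[of u] N_nonneg[of u] powers by (cases "N u = 0") auto

text \<open>Division by \<open>t powr r\<close> leaves powers with negative exponents, which tend to
  0, against the constant \<open>- g\<close>.\<close>

lemma ray_tendsto:
  assumes "g > 0"
  shows "\<exists>T>0. \<forall>t\<ge>T. A * t powr p + B * t powr (2 * p) + L * t powr q - g * t powr r < 0"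
proof -
  have ev: "((\<lambda>t. A * t powr (p - r) + B * t powr (2 * p - r) + L * t powr (q - r)) \<longlongrightarrow> A * 0 + B * 0 + L * 0) at_top"
    using powers exponents by (intro tendsto_intros tendsto_neg_powr filterlim_ident) auto
  then have "\<forall>\<^sub>F t in at_top. A * t powr (p - r) + B * t powr (2 * p - r) + L * t powr (q - r) < g"
    using assms by (intro order_tendstoD(2)[OF ev]) simp
  then obtain T where T: "\<And>t. t \<ge> T \<Longrightarrow> A * t powr (p - r) + B * t powr (2 * p - r) + L * t powr (q - r) < g"
    by (auto simp: eventually_at_top_linorder)
  have "A * t powr p + B * t powr (2 * p) + L * t powr q - g * t powr r < 0" if t: "t \<ge> max T 1" for t
  proof -
    have "t powr p = t powr (p - r) * t powr r" "t powr (2 * p) = t powr (2 * p - r) * t powr r"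
      "t powr q = t powr (q - r) * t powr r" by (simp_all flip: powr_add)
    then have "A * t powr p + B * t powr (2 * p) + L * t powr q - g * t powr r
        = (A * t powr (p - r) + B * t powr (2 * p - r) + L * t powr (q - r) - g) * t powr r"
      by (simp add: algebra_simps)
    also have "\<dots> < 0" using T[of t] t by (intro mult_neg_pos) auto
    finally show ?thesis .
  qed
  then show ?thesis by (intro exI[of _ "max T 1"]) auto
qed

lemma energy_zero: "energy lam (\<lambda>x. 0 * u x) = 0"
  using F_scale[of 0 u] G_scale[of 0 u] powers by (simp add: energy_def)

lemma energy_ray_sphere:
  assumes "u \<in> V" "N u > 0" "0 < lam" "lam < lam0"
  shows "\<exists>t>0. energy lam (\<lambda>x. t * u x) \<ge> \<delta>0"
  using assms \<rho>_pos N_scale[OF assms(1), of "\<rho> / N u"] scale_mem[OF assms(1), of "\<rho> / N u"]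
  by (intro exI[of _ "\<rho> / N u"] conjI energy_sphere) auto

text \<open>Along the ray the energy starts at 0, is at least \<open>\<delta>0 > 0\<close> where the
  ray meets the sphere of radius \<rho>, and is negative beyond some \<open>T\<close>. Hence the
  maximum over \<open>{0..T}\<close> is attained at a positive parameter and is a maximum over the
  whole ray.\<close>

lemma exists_peak:
  assumes u: "u \<in> V" "G u > 0" and lam: "0 < lam" "lam < lam0"
  shows "\<exists>t>0. peak lam (\<lambda>x. t * u x)"
proof -
  define f where "f = (\<lambda>t. energy lam (\<lambda>x. t * u x))"
  obtain T where T: "T > 0" "\<And>t. t \<ge> T \<Longrightarrow> f t < 0"
  proof -
    obtain T where T: "T > 0" "\<forall>t\<ge>T. (a * N u powr p) / p * t powr p + (b * N u powr (2 * p)) / (2 * p) * t powr (2 * p)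
     + (- (lam * F u) / q) * t powr q - G u / r * t powr r < 0"
      using ray_tendsto[of "G u / r" "a * N u powr p / p" "b * N u powr (2 * p) / (2 * p)" "- (lam * F u) / q"]
        divide_pos_pos[OF u(2) powers(3)] by blast
    show ?thesis
    proof (rule that[OF T(1)])
      fix t assume "t \<ge> T"
      then show "f t < 0" unfolding f_def using T energy_ray[OF u(1), of t lam] by simp
    qed
  qed
  have "isCont f t" for t
    using DERIV_isCont[OF C1_functional_line_DERIV[OF C1_energy zero_mem u(1), of lam t]] by (simp add: f_def)
  then have "continuous_on {0..T} f" by (simp add: continuous_at_imp_continuous_on)
  then obtain t0 where t0: "t0 \<in> {0..T}" "\<And>t. t \<in> {0..T} \<Longrightarrow> f t \<le> f t0"
    using continuous_attains_sup[of "{0..T}" f] T(1) by auto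
  obtain t1 where t1: "t1 > 0" "f t1 \<ge> \<delta>0" using energy_ray_sphere[OF u(1) N_pos[OF u] lam] unfolding f_def by blast
  have "t1 < T" using T(2)[of t1] t1 \<delta>0_pos by linarith
  then have ft0: "f t0 \<ge> \<delta>0" using t0(2)[of t1] t1 by simp
  then have "t0 \<noteq> 0" using energy_zero[of lam u] \<delta>0_pos unfolding f_def by auto
  then have t0_pos: "t0 > 0" using t0 by simp
  have max: "f t \<le> f t0" if "t > 0" for t
    using t0(2)[of t] T(2)[of t] ft0 \<delta>0_pos that by (cases "t \<le> T") auto
  have "peak lam (\<lambda>x. t0 * u x)"
    unfolding peak_def
  proof (intro conjI allI impI)
    show "(\<lambda>x. t0 * u x) \<in> V" using u by (simp add: scale_mem)
    show "0 < G (\<lambda>x. t0 * u x)" unfolding G_scale using t0_pos u by simp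
    fix t :: real assume "t > 0"
    then show "energy lam (\<lambda>x. t * (t0 * u x)) \<le> energy lam (\<lambda>x. t0 * u x)"
      using max[of "t * t0"] t0_pos unfolding f_def by (simp add: mult.assoc)
  qed
  then show ?thesis using t0_pos by blast
qed

lemma peak_ge: "peak lam u \<Longrightarrow> 0 < lam \<Longrightarrow> lam < lam0 \<Longrightarrow> energy lam u \<ge> \<delta>0"
  using energy_ray_sphere[of u lam] N_pos[of u] unfolding peak_def by force

text \<open>At a ray maximum the radial derivative of the energy vanishes, and by Euler's identity
  this derivative is the Nehari functional.\<close>

lemma peak_nehari:
  assumes "peak lam u"
  shows "nehari_functional lam u = 0"
proof -
  have u: "u \<in> V" and max: "\<And>t. t > 0 \<Longrightarrow> energy lam (\<lambda>x. t * u x) \<le> energy lam u"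
    using assms by (auto simp: peak_def)
  have "Denergy lam u u = 0"
  proof (rule DERIV_local_max)
    show "((\<lambda>t. energy lam (\<lambda>x. u x + t * u x)) has_real_derivative Denergy lam u u) (at 0)"
      using C1_functional_line_DERIV[OF C1_energy u u, of lam 0] by simp
    show "\<forall>y. \<bar>0 - y\<bar> < 1 \<longrightarrow> energy lam (\<lambda>x. u x + y * u x) \<le> energy lam (\<lambda>x. u x + 0 * u x)"
    proof (intro allI impI)
      fix y :: real assume "\<bar>0 - y\<bar> < 1"
      then show "energy lam (\<lambda>x. u x + y * u x) \<le> energy lam (\<lambda>x. u x + 0 * u x)"
        using max[of "1 + y"] by (simp add: distrib_right)
    qed
  qed simp
  moreover have "DE u u = p * N u powr p"
    by (rule C1_functional_homogeneous[OF C1_E u]) (simp add: N_scale[OF u] powr_mult N_nonneg)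
  moreover have "DF u u = q * F u" by (rule C1_functional_homogeneous[OF C1_F u F_scale])
  moreover have "DG u u = r * G u" by (rule C1_functional_homogeneous[OF C1_G u G_scale])
  moreover have "nehari_functional lam u = Denergy lam u u" if "DE u u = p * N u powr p" "DF u u = q * F u" "DG u u = r * G u"
    unfolding nehari_functional_def Denergy_def that powr_double using powers
    by (simp add: power2_eq_square field_simps)
  ultimately show ?thesis by simp
qed

lemma peak_unique:
  assumes w: "peak lam w" and t: "t > 0" and eq: "energy lam (\<lambda>x. t * w x) = energy lam w"
  shows "t = 1"
proof -
  have False if w: "peak lam w" and t: "t > 1" and eq: "energy lam (\<lambda>x. t * w x) = energy lam w" for w t
  proof -
    have wV: "w \<in> V" "G w > 0" and max: "\<And>t. t > 0 \<Longrightarrow> energy lam (\<lambda>x. t * w x) \<le> energy lam w"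
      using w by (auto simp: peak_def)
    have e1: "energy lam w = (a * N w powr p) / p * 1 powr p + (b * N w powr (2 * p)) / (2 * p) * 1 powr (2 * p)
     - (lam * F w) / q * 1 powr q - G w / r * 1 powr r"
      using energy_ray[OF wV(1), of 1 lam] by simp
    show False
    proof (rule ray_maximum_unique[where A = "a * N w powr p" and B = "b * N w powr (2 * p)" and L = "lam * F w"
          and G = "G w" and p = p and q = q and r = r and T = t])
      show "a * N w powr p > 0" "b * N w powr (2 * p) \<ge> 0" using ab N_pos[OF wV] by auto
      show "(a * N w powr p) / p * t powr p + (b * N w powr (2 * p)) / (2 * p) * t powr (2 * p)
     - (lam * F w) / q * t powr q - G w / r * t powr r = (a * N w powr p) / p * 1 powr p + (b * N w powr (2 * p)) / (2 * p) * 1 powr (2 * p)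
     - (lam * F w) / q * 1 powr q - G w / r * 1 powr r"
        using eq e1 energy_ray[OF wV(1), of t lam] t by simp
      show "(a * N w powr p) / p * s powr p + (b * N w powr (2 * p)) / (2 * p) * s powr (2 * p)
     - (lam * F w) / q * s powr q - G w / r * s powr r \<le> (a * N w powr p) / p * 1 powr p + (b * N w powr (2 * p)) / (2 * p) * 1 powr (2 * p)
     - (lam * F w) / q * 1 powr q - G w / r * 1 powr r" if "s > 0" for s
        using max[OF that] e1 energy_ray[OF wV(1), of s lam] that by simp
    qed (use powers exponents t in auto)
  qed note * = this
  have "\<not> t > 1" using *[OF w _ eq] by blast
  moreover have "\<not> t < 1"
  proof
    assume "t < 1"
    \<comment> \<open>\<open>ray_maximum_unique\<close> treats parameters above 1. For
      \<open>t < 1\<close> the function \<open>t w\<close> is itself a peak, and \<open>w\<close> is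
      its multiple by \<open>1 / t > 1\<close> with the same energy.\<close>
    define v where "v = (\<lambda>x. t * w x)"
    have "peak lam v"
      unfolding peak_def
    proof (intro conjI allI impI)
      show "v \<in> V" "G v > 0" using w t scale_mem G_scale[of t w] by (auto simp: v_def peak_def)
      fix s :: real assume "s > 0"
      then have "energy lam (\<lambda>x. (s * t) * w x) \<le> energy lam w" using w t by (simp add: peak_def)
      then show "energy lam (\<lambda>x. s * v x) \<le> energy lam v" unfolding eq[folded v_def] by (simp add: v_def mult.assoc)
    qed
    moreover have "(\<lambda>x. 1 / t * v x) = w" using t by (simp add: v_def)
    then have "energy lam (\<lambda>x. 1 / t * v x) = energy lam v" using eq by (simp add: v_def)
    moreover have "1 / t > 1" using t \<open>t < 1\<close> by simp
    ultimately show False using * by blast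
  qed
  ultimately show ?thesis by simp
qed

section \<open>The two minimisers and their criticality\<close>

lemma exists_local_minimum:
  assumes lam: "0 < lam" "lam < lam0"
  shows "\<exists>u\<in>V. (\<forall>x. u x \<ge> 0) \<and> energy lam u < 0 \<and> (\<forall>h\<in>V. Denergy lam u h = 0)"
proof -
  define S where "S = energy lam ` {u\<in>V. N u \<le> \<rho>}"
  have S_ne: "S \<noteq> {}" using zero_mem \<rho>_pos by (auto simp: S_def intro!: exI[of _ "\<lambda>x. 0"])
  have S_bdd: "bdd_below S"
  proof -
    have "energy lam u \<ge> - (lam / q * (Cf * \<rho> powr q)) - 1 / r * (Cg * \<rho> powr r)" if u: "u \<in> V" "N u \<le> \<rho>" for u
    proof -
      have "F u \<le> Cf * \<rho> powr q"
      proof -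
        have "Cf * N u powr q \<le> Cf * \<rho> powr q"
          using powers CfCg N_nonneg u(2) by (intro mult_left_mono powr_mono2) auto
        then show ?thesis using F_le[OF u(1)] by linarith
      qed
      then have "lam / q * F u \<le> lam / q * (Cf * \<rho> powr q)" using lam powers by (intro mult_left_mono) auto
      moreover have "G u \<le> Cg * \<rho> powr r"
      proof -
        have "Cg * N u powr r \<le> Cg * \<rho> powr r"
          using powers CfCg N_nonneg u(2) by (intro mult_left_mono powr_mono2) auto
        then show ?thesis using G_le[OF u(1)] by linarith
      qed
      then have "1 / r * G u \<le> 1 / r * (Cg * \<rho> powr r)" using powers by (intro mult_left_mono) auto
      moreover have "a / p * N u powr p \<ge> 0" "b / (2 * p) * N u powr (2 * p) \<ge> 0" using ab powers by auto
      ultimately show ?thesis unfolding energy_def by linarith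
    qed
    then show ?thesis unfolding S_def by (intro bdd_belowI) blast
  qed
  define m where "m = Inf S"
  have "\<exists>u. u \<in> V \<and> N u \<le> \<rho> \<and> energy lam u < m + 1 / Suc k" for k
    using cInf_lessD[OF S_ne, of "m + 1 / Suc k"] unfolding m_def S_def by auto
  then obtain U where U: "\<And>k. U k \<in> V" "\<And>k. N (U k) \<le> \<rho>" "\<And>k. energy lam (U k) < m + 1 / Suc k" by metis
  obtain u \<sigma> l where u: "u \<in> V" "strict_mono \<sigma>" "(\<lambda>k. N (U (\<sigma> k))) \<longlonglongrightarrow> l" "N u \<le> l"
      "(\<lambda>k. F (U (\<sigma> k))) \<longlonglongrightarrow> F u" "(\<lambda>k. G (U (\<sigma> k))) \<longlonglongrightarrow> G u"
    using compact[where U = U and B = \<rho>, OF U(1,2)] by blast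
  have "l \<le> \<rho>" using U(2) by (intro LIMSEQ_le_const2[OF u(3)]) auto
  have "(\<lambda>k. m + 1 / Suc (\<sigma> k)) \<longlonglongrightarrow> m + 0"
    by (intro tendsto_intros LIMSEQ_subseq_LIMSEQ[OF LIMSEQ_Suc[OF lim_1_over_n] u(2), unfolded o_def])
  then have "energy lam (\<lambda>x. 1 * u x) \<le> m + 0"
    using U(3) by (intro energy_lsc[OF U(1) u(1) _ u(3-6)]) (auto intro: less_imp_le)
  then have Iu: "energy lam u \<le> m" by simp
  define v where "v = (\<lambda>x. \<bar>u x\<bar>)"
  have v: "v \<in> V" "N v \<le> \<rho>" "\<forall>x. v x \<ge> 0" "energy lam v \<le> m"
    using abs_mem[OF u(1)] N_abs[OF u(1)] u(4) \<open>l \<le> \<rho>\<close> energy_abs_le[OF u(1), of 1 lam] Iu by (auto simp: v_def)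
  have min: "energy lam v \<le> energy lam w" if "w \<in> V" "N w \<le> \<rho>" for w
    using cInf_lower[OF _ S_bdd, of "energy lam w"] that v(4) unfolding S_def m_def by fastforce
  have neg: "energy lam v < 0"
  proof -
    obtain u1 where u1: "u1 \<in> V" "F u1 > 0" using F_pos by blast
    \<comment> \<open>After division by \<open>t powr q\<close> the energy of \<open>t u1\<close>
      tends to \<open>- lam * F u1 / q < 0\<close> as \<open>t\<close> decreases to 0, because the
      sublinear exponent is the smallest.\<close>
    have lim: "((\<lambda>t. (a * N u1 powr p) / p * t powr (p - q) + (b * N u1 powr (2 * p)) / (2 * p) * t powr (2 * p - q)
       - (lam * F u1) / q - G u1 / r * t powr (r - q)) \<longlongrightarrow>
       (a * N u1 powr p) / p * 0 powr (p - q) + (b * N u1 powr (2 * p)) / (2 * p) * 0 powr (2 * p - q)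
       - (lam * F u1) / q - G u1 / r * 0 powr (r - q)) (at_right 0)"
      using powers exponents eventually_at_right_less[of "0::real"]
      by (intro tendsto_intros tendsto_powr') (auto elim: eventually_mono)
    have "(a * N u1 powr p) / p * 0 powr (p - q) + (b * N u1 powr (2 * p)) / (2 * p) * 0 powr (2 * p - q)
       - (lam * F u1) / q - G u1 / r * 0 powr (r - q) < 0" using lam u1 powers by simp
    then have ev1: "\<forall>\<^sub>F t in at_right 0. (a * N u1 powr p) / p * t powr (p - q) + (b * N u1 powr (2 * p)) / (2 * p) * t powr (2 * p - q)
       - (lam * F u1) / q - G u1 / r * t powr (r - q) < 0" by (rule order_tendstoD(2)[OF lim])
    have "((\<lambda>t. t * N u1) \<longlongrightarrow> 0 * N u1) (at_right 0)" by (intro tendsto_intros)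
    then have ev2: "\<forall>\<^sub>F t in at_right 0. t * N u1 < \<rho>" using \<rho>_pos by (intro order_tendstoD(2)) auto
    obtain t where t: "t > 0" "t * N u1 < \<rho>" "(a * N u1 powr p) / p * t powr (p - q) + (b * N u1 powr (2 * p)) / (2 * p) * t powr (2 * p - q)
       - (lam * F u1) / q - G u1 / r * t powr (r - q) < 0"
      using eventually_happens'[OF _ eventually_conj[OF eventually_at_right_less[of "0::real"] eventually_conj[OF ev2 ev1]]] by auto
    have "t powr p = t powr (p - q) * t powr q" "t powr (2 * p) = t powr (2 * p - q) * t powr q"
      "t powr r = t powr (r - q) * t powr q" by (simp_all flip: powr_add)
    then have "energy lam (\<lambda>x. t * u1 x) = ((a * N u1 powr p) / p * t powr (p - q) + (b * N u1 powr (2 * p)) / (2 * p) * t powr (2 * p - q)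
       - (lam * F u1) / q - G u1 / r * t powr (r - q)) * t powr q"
      using energy_ray[OF u1(1), of t lam] t(1) by (simp add: algebra_simps)
    also have "\<dots> < 0" using t by (intro mult_neg_pos) auto
    finally have "energy lam (\<lambda>x. t * u1 x) < 0" .
    moreover have "energy lam v \<le> energy lam (\<lambda>x. t * u1 x)"
      using t u1 by (intro min scale_mem) (auto simp: N_scale)
    ultimately show ?thesis by linarith
  qed
  have inner: "N v < \<rho>"
  proof (rule ccontr)
    assume "\<not> N v < \<rho>"
    then have "N v = \<rho>" using v(2) by simp
    then show False using energy_sphere[OF v(1) _ lam] neg \<delta>0_pos by simp
  qed
  have "Denergy lam v h = 0" if h: "h \<in> V" for h
  proof (rule DERIV_local_min)
    show "((\<lambda>t. energy lam (\<lambda>x. v x + t * h x)) has_real_derivative Denergy lam v h) (at 0)"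
      using C1_functional_line_DERIV[OF C1_energy v(1) h, of lam 0] by simp
    define d where "d = (\<rho> - N v) / (N h + 1)"
    have Nh1: "N h + 1 > 0" using N_nonneg[of h] by linarith
    show "d > 0" using inner Nh1 by (simp add: d_def)
    show "\<forall>y. \<bar>0 - y\<bar> < d \<longrightarrow> energy lam (\<lambda>x. v x + 0 * h x) \<le> energy lam (\<lambda>x. v x + y * h x)"
    proof (intro allI impI)
      fix y :: real assume y: "\<bar>0 - y\<bar> < d"
      have "\<bar>y\<bar> * N h \<le> d * (N h + 1)" using y N_nonneg[of h] by (intro mult_mono) auto
      also have "\<dots> = \<rho> - N v" unfolding d_def using Nh1 by (rule pos_divide_mult_cancel)
      finally have "N (\<lambda>x. v x + y * h x) \<le> \<rho>" using N_add_scale[OF v(1) h, of y] by linarith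
      then show "energy lam (\<lambda>x. v x + 0 * h x) \<le> energy lam (\<lambda>x. v x + y * h x)"
        using min[OF add_scale_mem[OF v(1) h]] by simp
    qed
  qed
  then show ?thesis using v neg by blast
qed

text \<open>Subtracting \<open>1 / r\<close> times the vanishing Nehari functional removes
  \<open>G\<close> from the energy. What remains is at least \<alpha> N^p - \<beta> N^q with
  \<alpha> > 0, and since p > q a bound on the energy bounds the seminorm. The Kirchhoff term keeps
  a favourable sign because r > 2p.\<close>

lemma peak_bounded:
  assumes "peak lam u" "energy lam u \<le> c" "c \<ge> 0" "0 < lam"
  shows "N u \<le> max 1 (((lam * (1 / q - 1 / r) * Cf + c + 1) / ((1 / p - 1 / r) * a) + 1) powr (1 / (p - q)))"
proof (rule ccontr)
  define \<alpha> where "\<alpha> = (1 / p - 1 / r) * a"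
  define \<beta> where "\<beta> = lam * (1 / q - 1 / r) * Cf"
  have u: "u \<in> V" using assms by (simp add: peak_def)
  have \<alpha>: "\<alpha> > 0" using powers ab by (simp add: \<alpha>_def frac_less2)
  have qr: "1 / q - 1 / r > 0" using powers by (simp add: frac_less2)
  have \<beta>: "\<beta> \<ge> 0" using qr CfCg assms by (simp add: \<beta>_def)
  assume "\<not> ?thesis"
  then have N1: "N u > 1" and Nb: "N u > ((\<beta> + c + 1) / \<alpha> + 1) powr (1 / (p - q))"
    by (auto simp: \<alpha>_def \<beta>_def)
  have base: "(\<beta> + c + 1) / \<alpha> + 1 > 0" using \<alpha> \<beta> assms by (simp add: add_nonneg_pos)
  have "(\<beta> + c + 1) / \<alpha> + 1 = (((\<beta> + c + 1) / \<alpha> + 1) powr (1 / (p - q))) powr (p - q)"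
    using base exponents by (simp add: powr_powr)
  also have "\<dots> \<le> N u powr (p - q)" using Nb exponents by (intro powr_mono2) auto
  finally have "\<alpha> * ((\<beta> + c + 1) / \<alpha> + 1) \<le> \<alpha> * N u powr (p - q)" using \<alpha> by (intro mult_left_mono) auto
  moreover have "\<alpha> * (y / \<alpha> + 1) = y + \<alpha>" for y using \<alpha> by (simp add: distrib_left)
  ultimately have "\<beta> + c + 1 \<le> \<alpha> * N u powr (p - q)" using \<alpha> by simp
  then have "(\<beta> + c + 1) * N u powr q \<le> \<alpha> * N u powr (p - q) * N u powr q" by (intro mult_right_mono) auto
  also have "\<dots> = \<alpha> * N u powr p" unfolding mult.assoc by (simp flip: powr_add)
  finally have 1: "(\<beta> + c + 1) * N u powr q \<le> \<alpha> * N u powr p" .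
  have "1 \<le> N u powr q" using N1 powers by (intro ge_one_powr_ge_zero) auto
  then have "(c + 1) * 1 \<le> (c + 1) * N u powr q" using assms by (intro mult_left_mono) auto
  then have 2: "c + 1 \<le> \<alpha> * N u powr p - \<beta> * N u powr q" using 1 by (simp add: distrib_right)
  have "energy lam u = energy lam u - 1 / r * nehari_functional lam u" using peak_nehari[OF assms(1)] by simp
  also have "\<dots> = \<alpha> * N u powr p + (1 / (2 * p) - 1 / r) * b * N u powr (2 * p) - lam * (1 / q - 1 / r) * F u"
    unfolding energy_def nehari_functional_def \<alpha>_def by (simp add: algebra_simps)
  also have "\<dots> \<ge> \<alpha> * N u powr p - \<beta> * N u powr q"
  proof -
    have "(1 / (2 * p) - 1 / r) * b * N u powr (2 * p) \<ge> 0"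
      using powers exponents ab by (simp add: frac_le)
    moreover have "lam * (1 / q - 1 / r) * F u \<le> lam * (1 / q - 1 / r) * (Cf * N u powr q)"
      using F_le[OF u] qr assms by (intro mult_left_mono) auto
    ultimately show ?thesis by (simp add: \<beta>_def mult.assoc)
  qed
  finally show False using 2 assms by linarith
qed

lemma exists_minimal_peak:
  assumes lam: "0 < lam" "lam < lam0"
  shows "\<exists>w. peak lam w \<and> (\<forall>x. w x \<ge> 0) \<and> (\<forall>u. peak lam u \<longrightarrow> energy lam w \<le> energy lam u)"
proof -
  define S where "S = energy lam ` {u. peak lam u}"
  have "\<exists>u. peak lam u" using G_pos exists_peak[OF _ _ lam] by blast
  then have S_ne: "S \<noteq> {}" by (auto simp: S_def)
  have S_bdd: "bdd_below S" using peak_ge[OF _ lam] by (intro bdd_belowI[of _ \<delta>0]) (auto simp: S_def)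
  define m where "m = Inf S"
  have m: "m \<ge> \<delta>0" unfolding m_def using peak_ge[OF _ lam] by (intro cInf_greatest[OF S_ne]) (auto simp: S_def)
  have m_le: "m \<le> energy lam u" if "peak lam u" for u
    unfolding m_def using that by (intro cInf_lower S_bdd) (simp add: S_def)
  have "\<exists>u. peak lam u \<and> energy lam u < m + 1 / Suc k" for k
    using cInf_lessD[OF S_ne, of "m + 1 / Suc k"] unfolding m_def S_def by auto
  then obtain U where U: "\<And>k. peak lam (U k)" "\<And>k. energy lam (U k) < m + 1 / Suc k" by metis
  have UV: "U k \<in> V" "G (U k) > 0" for k using U(1) by (auto simp: peak_def)
  have Ule: "energy lam (U k) \<le> m + 1" for k
  proof -
    have "1 / real (Suc k) \<le> 1" by simp
    then show ?thesis using U(2)[of k] by linarith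
  qed
  have m1: "m + 1 \<ge> 0" using m \<delta>0_pos by linarith
  obtain B where B: "\<And>k. N (U k) \<le> B" using peak_bounded[OF U(1) Ule m1 lam(1)] by blast
  obtain u \<sigma> l where u: "u \<in> V" "strict_mono \<sigma>" "(\<lambda>k. N (U (\<sigma> k))) \<longlonglongrightarrow> l" "N u \<le> l"
      "(\<lambda>k. F (U (\<sigma> k))) \<longlonglongrightarrow> F u" "(\<lambda>k. G (U (\<sigma> k))) \<longlonglongrightarrow> G u"
    using compact[where U = U and B = B, OF UV(1) B] by blast
  have l: "l \<ge> 0" using u(4) N_nonneg[of u] by linarith
  have lim: "(\<lambda>k. m + 1 / Suc (\<sigma> k)) \<longlonglongrightarrow> m + 0"
    by (intro tendsto_intros LIMSEQ_subseq_LIMSEQ[OF LIMSEQ_Suc[OF lim_1_over_n] u(2), unfolded o_def])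
  \<comment> \<open>Peaks require a positive value of \<open>G\<close>, so \<open>G u = 0\<close>
    must be excluded. There the Nehari identity would pass to the limit as lam F u = a l^p + b
    l^(2p), and the limit of the energies would be at most 0 because q < p, against
    \<open>m \<ge> \<delta>0\<close>.\<close>
  have Gu: "G u > 0"
  proof (rule ccontr)
    assume "\<not> G u > 0"
    moreover have "G u \<ge> 0" using UV(2) by (intro LIMSEQ_le_const[OF u(6)]) (auto intro: less_imp_le)
    ultimately have G0: "G u = 0" by simp
    have "(\<lambda>k. energy lam (U (\<sigma> k))) \<longlonglongrightarrow> a / p * l powr p + b / (2 * p) * l powr (2 * p) - lam / q * F u - 1 / r * G u"
      unfolding energy_def using powers l by (intro tendsto_intros tendsto_powr' u) (auto simp: N_nonneg)
    then have "m \<le> a / p * l powr p + b / (2 * p) * l powr (2 * p) - lam / q * F u - 1 / r * G u"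
      using m_le[OF U(1)] by (intro LIMSEQ_le_const) auto
    then have 1: "a / p * l powr p + b / (2 * p) * l powr (2 * p) - 1 / q * (lam * F u) > 0"
      using m \<delta>0_pos G0 by simp
    have "(\<lambda>k. nehari_functional lam (U (\<sigma> k))) \<longlonglongrightarrow> a * l powr p + b * l powr (2 * p) - lam * F u - G u"
      unfolding nehari_functional_def using powers l by (intro tendsto_intros tendsto_powr' u) (auto simp: N_nonneg)
    then have "(\<lambda>k. 0) \<longlonglongrightarrow> a * l powr p + b * l powr (2 * p) - lam * F u - G u"
      using peak_nehari[OF U(1)] by simp
    from LIMSEQ_unique[OF this tendsto_const] have "a * l powr p + b * l powr (2 * p) - lam * F u - G u = 0" .
    then have "lam * F u = a * l powr p + b * l powr (2 * p)" using G0 by simp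
    then have "(1 / p - 1 / q) * (a * l powr p) + (1 / (2 * p) - 1 / q) * (b * l powr (2 * p)) > 0"
      using 1 by (simp add: algebra_simps)
    moreover have "1 / p - 1 / q \<le> 0" "1 / (2 * p) - 1 / q \<le> 0" using powers exponents by (auto simp: frac_le)
    then have "(1 / p - 1 / q) * (a * l powr p) \<le> 0" "(1 / (2 * p) - 1 / q) * (b * l powr (2 * p)) \<le> 0"
      using ab by (auto intro!: mult_nonpos_nonneg)
    ultimately show False by linarith
  qed
  define v where "v = (\<lambda>x. \<bar>u x\<bar>)"
  have v: "v \<in> V" "G v > 0" using abs_mem[OF u(1)] Gu G_abs[of u] by (auto simp: v_def)
  \<comment> \<open>The function \<open>v\<close> need not be a peak; it is moved along its ray to
    its own maximum. At that parameter each \<open>U k\<close> has energy at most that of its peak,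
    so lower semicontinuity gives at most \<open>m\<close>.\<close>
  obtain t where t: "t > 0" "peak lam (\<lambda>x. t * v x)" using exists_peak[OF v lam] by blast
  have "energy lam (\<lambda>x. t * v x) \<le> energy lam (\<lambda>x. t * u x)"
    unfolding v_def using energy_abs_le[OF u(1), of t lam] t by simp
  also have "\<dots> \<le> m + 0"
  proof (rule energy_lsc[OF UV(1) u(1) _ u(3-6) _ lim])
    show "energy lam (\<lambda>x. t * U (\<sigma> k) x) \<le> m + 1 / Suc (\<sigma> k)" for k
      using U(1)[of "\<sigma> k"] U(2)[of "\<sigma> k"] t(1) unfolding peak_def by force
  qed (use t in simp)
  finally have "energy lam (\<lambda>x. t * v x) \<le> m" by simp
  then show ?thesis using t m_le by (intro exI[of _ "\<lambda>x. t * v x"]) (force simp: v_def)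
qed

text \<open>An envelope argument. Let \<open>t k\<close> be the peak parameter of \<open>w\<close>
  perturbed in direction \<open>h\<close>. The perturbed peak has at least the energy of
  \<open>w\<close>, and \<open>w\<close> at least that of \<open>t k w\<close>. The segment from
  \<open>t k w\<close> to the perturbed peak has direction \<open>h\<close>, so the mean value
  theorem yields a point on it with nonnegative derivative along \<open>h\<close>; these points tend
  to \<open>w\<close> once the parameters tend to 1 along a subsequence.\<close>

lemma minimal_peak_critical:
  assumes lam: "0 < lam" "lam < lam0" and w: "peak lam w"
    and min: "\<And>u. peak lam u \<Longrightarrow> energy lam w \<le> energy lam u" and h: "h \<in> V"
  shows "Denergy lam w h \<ge> 0"
proof -
  have wV: "w \<in> V" "G w > 0" using w by (auto simp: peak_def)
  define \<epsilon> where "\<epsilon> = (\<lambda>k. 1 / real (Suc k))"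
  have \<epsilon>: "\<epsilon> \<longlonglongrightarrow> 0" "\<And>k. \<epsilon> k > 0" "\<And>k. \<epsilon> k \<le> 1"
    unfolding \<epsilon>_def using LIMSEQ_Suc[OF lim_1_over_n] by auto
  define U where "U = (\<lambda>k x. w x + \<epsilon> k * h x)"
  have UV: "U k \<in> V" for k unfolding U_def using wV h by (simp add: add_scale_mem)
  have line: "(\<lambda>k. \<Psi> (U k)) \<longlonglongrightarrow> \<Psi> w" if "C1_functional V N V \<Psi> D" for \<Psi> D
  proof -
    have "isCont (\<lambda>t. \<Psi> (\<lambda>x. w x + t * h x)) 0"
      using DERIV_isCont[OF C1_functional_line_DERIV[OF that wV(1) h]] .
    then show ?thesis using isCont_tendsto_compose[OF _ \<epsilon>(1)] by (fastforce simp: U_def)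
  qed
  have limE: "(\<lambda>k. N (U k) powr p) \<longlonglongrightarrow> N w powr p" by (rule line[OF C1_E])
  have limF: "(\<lambda>k. F (U k)) \<longlonglongrightarrow> F w" by (rule line[OF C1_F])
  have limG: "(\<lambda>k. G (U k)) \<longlonglongrightarrow> G w" by (rule line[OF C1_G])
  have "\<forall>\<^sub>F k in sequentially. G (U k) > G w / 2" using order_tendstoD(1)[OF limG, of "G w / 2"] wV by simp
  then obtain K where K: "\<And>k. k \<ge> K \<Longrightarrow> G (U k) > G w / 2" by (auto simp: eventually_sequentially)
  have "\<exists>t>0. peak lam (\<lambda>x. t * U (k + K) x)" for k
    using exists_peak[OF UV _ lam, of "k + K"] K[of "k + K"] wV by force
  then obtain t where t: "\<And>k. t k > 0" "\<And>k. peak lam (\<lambda>x. t k * U (k + K) x)" by metis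
  define n where "n = N w + N h"
  have NU: "N (U k) \<le> n" for k
  proof -
    have "N (U k) \<le> N w + \<epsilon> k * N h" unfolding U_def using N_add_scale[OF wV(1) h, of "\<epsilon> k"] \<epsilon>(2)[of k] by simp
    also have "\<epsilon> k * N h \<le> 1 * N h" using \<epsilon>(3) N_nonneg by (intro mult_right_mono)
    finally show ?thesis by (simp add: n_def)
  qed
  \<comment> \<open>A bound for the peak parameters that is uniform in \<open>k\<close>:
    \<open>n\<close> dominates the seminorms of all \<open>U k\<close>, and \<open>K\<close> was
    chosen so that \<open>G\<close> stays above half of \<open>G w\<close>.\<close>
  obtain T where T: "T > 0" "\<And>s. s \<ge> T \<Longrightarrow> (a * n powr p) / p * s powr p + (b * n powr (2 * p)) / (2 * p) * s powr (2 * p)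
     + (lam * (Cf * n powr q)) / q * s powr q - G w / 2 / r * s powr r < 0"
    using ray_tendsto[of "G w / 2 / r" "a * n powr p / p" "b * n powr (2 * p) / (2 * p)" "lam * (Cf * n powr q) / q"]
      divide_pos_pos[OF half_gt_zero[OF wV(2)] powers(3)] by blast
  have tT: "t k < T" for k
  proof (rule ccontr)
    assume "\<not> t k < T"
    then have neg: "(a * n powr p) / p * t k powr p + (b * n powr (2 * p)) / (2 * p) * t k powr (2 * p)
     + (lam * (Cf * n powr q)) / q * t k powr q - G w / 2 / r * t k powr r < 0" using T(2)[of "t k"] by simp
    let ?u = "U (k + K)"
    have "\<bar>F ?u\<bar> \<le> Cf * n powr q"
      using F_le[OF UV, of "k + K"] mult_left_mono[OF powr_mono2[OF _ N_nonneg NU, of q "k + K"], of Cf] powers CfCg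
      by linarith
    then have Fle: "- (lam * F ?u) \<le> lam * (Cf * n powr q)"
      using lam mult_left_mono[of "- F ?u" "Cf * n powr q" lam] by simp
    have "\<delta>0 \<le> energy lam (\<lambda>x. t k * ?u x)" using peak_ge[OF t(2) lam] .
    also have "\<dots> = (a * N ?u powr p) / p * t k powr p + (b * N ?u powr (2 * p)) / (2 * p) * t k powr (2 * p)
     + (- (lam * F ?u)) / q * t k powr q - G ?u / r * t k powr r"
      using energy_ray[OF UV, of "t k"] t(1)[of k] by simp
    also have "\<dots> \<le> (a * n powr p) / p * t k powr p + (b * n powr (2 * p)) / (2 * p) * t k powr (2 * p)
     + (lam * (Cf * n powr q)) / q * t k powr q - G w / 2 / r * t k powr r"
      using NU N_nonneg powers ab Fle K[of "k + K"]
      by (intro diff_mono add_mono mult_right_mono divide_right_mono mult_left_mono powr_mono2) auto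
    finally show False using neg \<delta>0_pos by linarith
  qed
  have "bounded (range t)" unfolding bounded_iff using t(1) tT by (intro exI[of _ T]) (auto simp: abs_of_pos intro: less_imp_le)
  then obtain t0 \<sigma> where \<sigma>: "strict_mono \<sigma>" "(\<lambda>k. t (\<sigma> k)) \<longlonglongrightarrow> t0"
    using bounded_imp_convergent_subsequence[of t] by (auto simp: o_def)
  have t0: "t0 \<ge> 0" using t(1) by (intro LIMSEQ_le_const[OF \<sigma>(2)]) (auto intro: less_imp_le)
  have sub: "(\<lambda>k. X (\<sigma> k + K)) \<longlonglongrightarrow> L" if "X \<longlonglongrightarrow> L" for X :: "nat \<Rightarrow> real" and L
    using LIMSEQ_subseq_LIMSEQ[OF LIMSEQ_ignore_initial_segment[OF that, of K] \<sigma>(1)] by (simp add: o_def)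
  have "(\<lambda>k. energy lam (\<lambda>x. t (\<sigma> k) * U (\<sigma> k + K) x)) \<longlonglongrightarrow> energy lam (\<lambda>x. t0 * w x)"
  proof -
    have "(\<lambda>k. (a * x k) / p * y k powr p + (b * (x k)\<^sup>2) / (2 * p) * y k powr (2 * p)
       - (lam * z k) / q * y k powr q - g k / r * y k powr r) \<longlonglongrightarrow>
       (a * x0) / p * y0 powr p + (b * x0\<^sup>2) / (2 * p) * y0 powr (2 * p)
       - (lam * z0) / q * y0 powr q - g0 / r * y0 powr r"
      if "x \<longlonglongrightarrow> x0" "z \<longlonglongrightarrow> z0" "g \<longlonglongrightarrow> g0" "y \<longlonglongrightarrow> y0" "y0 \<ge> 0" "\<And>k. y k > 0"
      for x y z g :: "nat \<Rightarrow> real" and x0 y0 z0 g0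
    proof -
      have "(\<lambda>k. y k powr e) \<longlonglongrightarrow> y0 powr e" if "e > 0" for e
        by (rule tendsto_powr'[OF \<open>y \<longlonglongrightarrow> y0\<close> tendsto_const])
          (use \<open>e > 0\<close> \<open>\<And>k. y k > 0\<close> in \<open>auto simp: less_imp_le\<close>)
      note Y = this
      show ?thesis using powers
        by (intro tendsto_diff tendsto_add tendsto_mult tendsto_divide tendsto_power tendsto_const Y that(1-3)) auto
    qed
    note this[OF sub[OF limE] sub[OF limF] sub[OF limG] \<sigma>(2) t0 t(1)]
    then show ?thesis
      unfolding energy_ray[OF UV less_imp_le[OF t(1)]] energy_ray[OF wV(1) t0] powr_double .
  qed
  \<comment> \<open>The limit parameter maximises on the ray of \<open>w\<close> as well, its energy
    being at least that of \<open>w\<close>. The value 0 is impossible since the energy there is 0,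
    and uniqueness leaves 1.\<close>
  then have ge: "energy lam w \<le> energy lam (\<lambda>x. t0 * w x)" using min[OF t(2)] by (intro LIMSEQ_le_const) auto
  have "t0 \<noteq> 0" using ge energy_zero[of lam w] peak_ge[OF w lam] \<delta>0_pos by auto
  then have t0_pos: "t0 > 0" using t0 by simp
  then have "energy lam (\<lambda>x. t0 * w x) = energy lam w" using ge w unfolding peak_def by (intro antisym) auto
  then have t0_1: "t0 = 1" by (rule peak_unique[OF w t0_pos])
  have "\<exists>\<theta>. 0 < \<theta> \<and> \<theta> < t k * \<epsilon> (k + K) \<and> Denergy lam (\<lambda>x. t k * w x + \<theta> * h x) h \<ge> 0" for k
  proof -
    let ?s = "t k * \<epsilon> (k + K)"
    have s: "?s > 0" using t \<epsilon> by simp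
    have tw: "(\<lambda>x. t k * w x) \<in> V" using wV by (simp add: scale_mem)
    obtain \<theta> where \<theta>: "0 < \<theta>" "\<theta> < ?s" "energy lam (\<lambda>x. t k * w x + ?s * h x) - energy lam (\<lambda>x. t k * w x + 0 * h x)
        = (?s - 0) * Denergy lam (\<lambda>x. t k * w x + \<theta> * h x) h"
      using MVT2[OF s, of "\<lambda>s. energy lam (\<lambda>x. t k * w x + s * h x)" "\<lambda>\<theta>. Denergy lam (\<lambda>x. t k * w x + \<theta> * h x) h"]
        C1_functional_line_DERIV[OF C1_energy tw h] by blast
    have "(\<lambda>x. t k * w x + ?s * h x) = (\<lambda>x. t k * U (k + K) x)" by (auto simp: U_def algebra_simps)
    then have "energy lam (\<lambda>x. t k * w x + ?s * h x) \<ge> energy lam w" using min[OF t(2)[of k]] by simp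
    moreover have "energy lam (\<lambda>x. t k * w x + 0 * h x) \<le> energy lam w" using w t(1)[of k] by (simp add: peak_def)
    ultimately have "?s * Denergy lam (\<lambda>x. t k * w x + \<theta> * h x) h \<ge> 0" using \<theta>(3) by simp
    then show ?thesis using \<theta> s zero_le_mult_iff[of ?s] by fastforce
  qed
  then obtain \<theta> where \<theta>: "\<And>k. 0 < \<theta> k" "\<And>k. \<theta> k < t k * \<epsilon> (k + K)" "\<And>k. Denergy lam (\<lambda>x. t k * w x + \<theta> k * h x) h \<ge> 0"
    by metis
  show ?thesis
  proof (rule ccontr)
    assume neg: "\<not> ?thesis"
    define e where "e = - Denergy lam w h / (2 * (N h + 1))"
    have Nh1: "N h + 1 > 0" using N_nonneg[of h] by linarith
    have e: "e > 0" using neg Nh1 by (simp add: e_def divide_neg_pos)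
    have eN: "e * N h < - Denergy lam w h"
    proof -
      have "e * N h < e * (N h + 1)" using e by simp
      also have "\<dots> = - Denergy lam w h / 2" using pos_divide_mult_cancel[OF Nh1, of "- Denergy lam w h / 2"] by (simp add: e_def)
      finally show ?thesis using neg by linarith
    qed
    obtain \<delta> where \<delta>: "\<delta> > 0" "\<And>v. v \<in> V \<Longrightarrow> N (\<lambda>x. v x - w x) < \<delta> \<Longrightarrow> \<bar>Denergy lam v h - Denergy lam w h\<bar> \<le> e * N h"
      using C1_functional_continuous[OF C1_energy wV(1) e] h by blast
    have "(\<lambda>k. \<bar>t (\<sigma> k) - 1\<bar> * N w + t (\<sigma> k) * \<epsilon> (\<sigma> k + K) * N h) \<longlonglongrightarrow> \<bar>1 - 1\<bar> * N w + 1 * 0 * N h"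
      using \<sigma>(2) unfolding t0_1 by (intro tendsto_intros sub[OF \<epsilon>(1)])
    then have "\<forall>\<^sub>F k in sequentially. \<bar>t (\<sigma> k) - 1\<bar> * N w + t (\<sigma> k) * \<epsilon> (\<sigma> k + K) * N h < \<delta>"
      using \<delta>(1) by (intro order_tendstoD(2)) auto
    then obtain k where k: "\<bar>t (\<sigma> k) - 1\<bar> * N w + t (\<sigma> k) * \<epsilon> (\<sigma> k + K) * N h < \<delta>"
      by (auto simp: eventually_sequentially)
    let ?v = "\<lambda>x. t (\<sigma> k) * w x + \<theta> (\<sigma> k) * h x"
    have vV: "?v \<in> V" using wV h by (intro add_mem scale_mem)
    have "(\<lambda>x. ?v x - w x) = (\<lambda>x. (t (\<sigma> k) - 1) * w x + \<theta> (\<sigma> k) * h x)" by (auto simp: algebra_simps)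
    then have "N (\<lambda>x. ?v x - w x) \<le> \<bar>t (\<sigma> k) - 1\<bar> * N w + \<theta> (\<sigma> k) * N h"
      using N_add_scale[OF scale_mem[OF wV(1)] h, of "t (\<sigma> k) - 1" "\<theta> (\<sigma> k)"] N_scale[OF wV(1)] \<theta>(1)[of "\<sigma> k"] by simp
    also have "\<theta> (\<sigma> k) * N h \<le> t (\<sigma> k) * \<epsilon> (\<sigma> k + K) * N h"
      using \<theta>(2)[of "\<sigma> k"] N_nonneg by (intro mult_right_mono) auto
    finally have "N (\<lambda>x. ?v x - w x) < \<delta>" using k by simp
    from \<delta>(2)[OF vV this] \<theta>(3)[of "\<sigma> k"] eN show False by linarith
  qed
qed

theorem two_critical_points:
  assumes lam: "0 < lam" "lam < lam0"
  shows "\<exists>u\<in>V. \<exists>v\<in>V. (\<forall>x. u x \<ge> 0) \<and> (\<forall>x. v x \<ge> 0) \<and> energy lam u < 0 \<and> energy lam v > 0 \<and>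
    (\<forall>h\<in>V. Denergy lam u h = 0) \<and> (\<forall>h\<in>V. Denergy lam v h = 0)"
proof -
  obtain u where u: "u \<in> V" "\<forall>x. u x \<ge> 0" "energy lam u < 0" "\<forall>h\<in>V. Denergy lam u h = 0"
    using exists_local_minimum[OF lam] by blast
  obtain w where w: "peak lam w" "\<forall>x. w x \<ge> 0" "\<And>u. peak lam u \<Longrightarrow> energy lam w \<le> energy lam u"
    using exists_minimal_peak[OF lam] by blast
  have wV: "w \<in> V" using w by (simp add: peak_def)
  \<comment> \<open>The one-sided inequality, applied to \<open>h\<close> and to \<open>-h\<close>,
    gives equality.\<close>
  have "Denergy lam w h = 0" if h: "h \<in> V" for h
  proof -
    have "Denergy lam w (\<lambda>x. -1 * h x) = -1 * Denergy lam w h"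
      by (rule bounded_functional_scale[OF C1_functional_bounded[OF C1_energy wV] h])
    then show ?thesis using minimal_peak_critical[OF lam w(1,3) h] minimal_peak_critical[OF lam w(1,3) scale_mem[OF h, of "-1"]]
      by simp
  qed
  moreover have "energy lam w > 0" using peak_ge[OF w(1) lam] \<delta>0_pos by linarith
  ultimately show ?thesis using u w(2) wV by blast
qed

end


section \<open>Smooth functions and test functions\<close>

lemma Ck_mono: "Ck (Suc k) \<phi> \<Longrightarrow> Ck k \<phi>"
proof (induction k arbitrary: \<phi>)
  case 0
  then show ?case by (auto simp: continuous_at_imp_continuous_on differentiable_imp_continuous_within)
next
  case (Suc k)
  then have "\<forall>v. Ck (Suc k) (\<lambda>x. frechet_derivative \<phi> (at x) v)" "\<forall>x. \<phi> differentiable (at x)"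
    using Ck.simps(2) by blast+
  then show ?case unfolding Ck.simps(2)[of k \<phi>] using Suc.IH by blast
qed

lemma Ck_SucI:
  assumes "\<And>x. (\<phi> has_derivative D x) (at x)" and "\<And>v. Ck k (\<lambda>x. D x v)"
  shows "Ck (Suc k) \<phi>"
proof -
  have "frechet_derivative \<phi> (at x) = D x" for x using frechet_derivative_at[OF assms(1)] by simp
  then show ?thesis using assms by (auto simp: differentiable_def)
qed

lemma Ck_SucD:
  assumes "Ck (Suc k) \<phi>"
  shows "(\<phi> has_derivative frechet_derivative \<phi> (at x)) (at x)" "Ck k (\<lambda>x. frechet_derivative \<phi> (at x) v)"
  using assms frechet_derivative_works by auto

lemma Ck_const: "Ck k (\<lambda>x. c)"
proof (induction k arbitrary: c)
  case (Suc k)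
  then show ?case by (intro Ck_SucI[where D = "\<lambda>x v. 0"]) (auto intro!: derivative_eq_intros)
qed simp

lemma Ck_add: "Ck k \<phi> \<Longrightarrow> Ck k \<psi> \<Longrightarrow> Ck k (\<lambda>x. \<phi> x + \<psi> x)"
proof (induction k arbitrary: \<phi> \<psi>)
  case (Suc k)
  show ?case
    by (rule Ck_SucI[where D = "\<lambda>x v. frechet_derivative \<phi> (at x) v + frechet_derivative \<psi> (at x) v"])
      (intro has_derivative_add Suc.IH Ck_SucD[OF Suc.prems(1)] Ck_SucD[OF Suc.prems(2)])+
qed (auto intro: continuous_intros)

lemma Ck_mult: "Ck k \<phi> \<Longrightarrow> Ck k \<psi> \<Longrightarrow> Ck k (\<lambda>x. \<phi> x * \<psi> x)"
proof (induction k arbitrary: \<phi> \<psi>)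
  case (Suc k)
  show ?case
  proof (rule Ck_SucI)
    show "((\<lambda>x. \<phi> x * \<psi> x) has_derivative
        (\<lambda>v. \<phi> x * frechet_derivative \<psi> (at x) v + frechet_derivative \<phi> (at x) v * \<psi> x)) (at x)" for x
      by (rule has_derivative_mult[OF Ck_SucD(1)[OF Suc.prems(1)] Ck_SucD(1)[OF Suc.prems(2)]])
    show "Ck k (\<lambda>x. \<phi> x * frechet_derivative \<psi> (at x) v + frechet_derivative \<phi> (at x) v * \<psi> x)" for v
      by (intro Ck_add Suc.IH Ck_mono[OF Suc.prems(1)] Ck_mono[OF Suc.prems(2)] Ck_SucD(2)[OF Suc.prems(1)] Ck_SucD(2)[OF Suc.prems(2)])
  qed
qed (auto intro: continuous_intros)

lemma Ck_linear:
  assumes "bounded_linear L"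
  shows "Ck k L"
proof (cases k)
  case 0
  then show ?thesis by (simp add: linear_continuous_on[OF assms])
next
  case (Suc j)
  then show ?thesis using Ck_SucI[OF bounded_linear_imp_has_derivative[OF assms] Ck_const] by blast
qed

lemma smooth_const: "smooth (\<lambda>x. c)"
  and smooth_add: "smooth \<phi> \<Longrightarrow> smooth \<psi> \<Longrightarrow> smooth (\<lambda>x. \<phi> x + \<psi> x)"
  and smooth_mult: "smooth \<phi> \<Longrightarrow> smooth \<psi> \<Longrightarrow> smooth (\<lambda>x. \<phi> x * \<psi> x)"
  and smooth_linear: "bounded_linear L \<Longrightarrow> smooth L"
  by (simp_all add: smooth_def Ck_const Ck_add Ck_mult Ck_linear)

lemma smooth_diff: "smooth \<phi> \<Longrightarrow> smooth \<psi> \<Longrightarrow> smooth (\<lambda>x. \<phi> x - \<psi> x)"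
  using smooth_add[OF _ smooth_mult[OF smooth_const[of "-1"]], of \<phi> \<psi>] by simp

text \<open>The family (1/t)^m exp(-1/t), extended by 0, is closed under differentiation up to
  linear combinations, which allows one induction on the order of differentiability for all
  \<open>m\<close> at once; \<open>m = 0\<close> is the classical flat function.\<close>

definition exp_bump :: "nat \<Rightarrow> real \<Rightarrow> real" where
  "exp_bump m t = (if t > 0 then (1 / t) ^ m * exp (- (1 / t)) else 0)"

lemma exp_bump_tendsto: "(exp_bump m \<longlongrightarrow> 0) (at_right 0)"
proof -
  have "((\<lambda>x::real. x ^ m / exp x) \<longlongrightarrow> 0) at_top" by (rule tendsto_power_div_exp_0)
  then have "((\<lambda>t::real. (inverse t) ^ m / exp (inverse t)) \<longlongrightarrow> 0) (at_right 0)"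
    by (rule filterlim_compose[OF _ filterlim_inverse_at_top_right])
  moreover have "\<forall>\<^sub>F t in at_right 0. (inverse t) ^ m / exp (inverse t) = exp_bump m (t::real)"
    using eventually_at_right_less[of "0::real"]
    by (rule eventually_mono) (simp add: exp_bump_def exp_minus divide_inverse)
  ultimately show ?thesis by (rule Lim_transform_eventually)
qed

lemma exp_bump_DERIV:
  "(exp_bump m has_real_derivative exp_bump (m + 2) t - real m * exp_bump (m + 1) t) (at t)"
proof -
  consider "t > 0" | "t < 0" | "t = 0" by linarith
  then show ?thesis
  proof cases
    case 1
    have "((\<lambda>t. (1 / t) ^ m * exp (- (1 / t))) has_real_derivative
      (1 / t) ^ (m + 2) * exp (- (1 / t)) - real m * ((1 / t) ^ (m + 1) * exp (- (1 / t)))) (at t)"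
    proof -
      have g: "((\<lambda>x. x ^ m * exp (- x)) has_real_derivative real m * x ^ (m - 1) * exp (- x) - x ^ m * exp (- x)) (at x)" for x :: real
        by (auto intro!: derivative_eq_intros)
      have i: "((\<lambda>t. 1 / t) has_real_derivative - ((1 / t) * (1 / t))) (at t)"
        using 1 by (auto intro!: derivative_eq_intros simp: power2_eq_square)
      have eq: "(real m * x ^ (m - 1) * exp (- x) - x ^ m * exp (- x)) * - (x * x)
          = x ^ (m + 2) * exp (- x) - real m * (x ^ (m + 1) * exp (- x))" for x :: real
        by (cases m) (simp_all add: algebra_simps)
      show ?thesis using DERIV_chain2[OF g[of "1 / t"] i] unfolding eq .
    qed
    then have "((\<lambda>t. (1 / t) ^ m * exp (- (1 / t))) has_real_derivative exp_bump (m + 2) t - real m * exp_bump (m + 1) t) (at t)"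
      using 1 by (simp add: exp_bump_def)
    then show ?thesis
    proof (rule DERIV_cong_ev[THEN iffD1, rotated -1])
      show "\<forall>\<^sub>F x in nhds t. (1 / x) ^ m * exp (- (1 / x)) = exp_bump m x"
        using eventually_nhds_in_open[of "{0<..}" t] 1 by (auto simp: exp_bump_def elim: eventually_mono)
    qed auto
  next
    case 2
    have "((\<lambda>t. 0) has_real_derivative exp_bump (m + 2) t - real m * exp_bump (m + 1) t) (at t)"
      using 2 by (simp add: exp_bump_def)
    then show ?thesis
    proof (rule DERIV_cong_ev[THEN iffD1, rotated -1])
      show "\<forall>\<^sub>F x in nhds t. 0 = exp_bump m x"
        using eventually_nhds_in_open[of "{..<0}" t] 2 by (auto simp: exp_bump_def elim: eventually_mono)
    qed auto
  next
    case 3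
    \<comment> \<open>For \<open>h > 0\<close> the difference quotient at 0 is the next member of
      the family, which tends to 0; on the left it is 0.\<close>
    have "((\<lambda>h. exp_bump m h / h) \<longlongrightarrow> 0) (at_right 0)"
    proof (rule Lim_transform_eventually[OF exp_bump_tendsto[of "Suc m"]])
      show "\<forall>\<^sub>F h in at_right 0. exp_bump (Suc m) h = exp_bump m h / h"
        using eventually_at_right_less[of "0::real"] by (rule eventually_mono) (simp add: exp_bump_def)
    qed
    moreover have "((\<lambda>h. exp_bump m h / h) \<longlongrightarrow> 0) (at_left 0)"
    proof (rule Lim_transform_eventually[OF tendsto_const])
      show "\<forall>\<^sub>F h in at_left 0. 0 = exp_bump m h / (h::real)"
        by (auto simp: eventually_at_left_field exp_bump_def intro!: exI[of _ "-1"])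
    qed
    ultimately have "((\<lambda>h. exp_bump m h / h) \<longlongrightarrow> 0) (at 0)" by (simp add: filterlim_split_at_real)
    then show ?thesis using 3 by (simp add: DERIV_def exp_bump_def)
  qed
qed

lemma Ck_exp_bump: "Ck k \<phi> \<Longrightarrow> Ck k (\<lambda>x. exp_bump m (\<phi> x))"
proof (induction k arbitrary: m)
  case 0
  have "isCont (exp_bump m) t" for t using DERIV_isCont[OF exp_bump_DERIV] .
  then have "continuous_on UNIV (exp_bump m)" by (simp add: continuous_at_imp_continuous_on)
  then show ?case using continuous_on_compose2[of UNIV "exp_bump m" UNIV \<phi>] 0 by simp
next
  case (Suc k)
  show ?case
  proof (rule Ck_SucI)
    show "((\<lambda>x. exp_bump m (\<phi> x)) has_derivative
      (\<lambda>v. (exp_bump (m + 2) (\<phi> x) + (- real m) * exp_bump (m + 1) (\<phi> x)) * frechet_derivative \<phi> (at x) v)) (at x)" for x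
      using has_derivative_compose[OF Ck_SucD(1)[OF Suc.prems] exp_bump_DERIV[of m "\<phi> x", unfolded has_field_derivative_def]]
      by simp
    show "Ck k (\<lambda>x. (exp_bump (m + 2) (\<phi> x) + (- real m) * exp_bump (m + 1) (\<phi> x)) * frechet_derivative \<phi> (at x) v)" for v
      by (intro Ck_mult Ck_add Ck_const Suc.IH Ck_mono[OF Suc.prems] Ck_SucD(2)[OF Suc.prems])
  qed
qed

lemma smooth_exp_bump: "smooth \<phi> \<Longrightarrow> smooth (\<lambda>x. exp_bump m (\<phi> x))"
  by (simp add: smooth_def Ck_exp_bump)

text \<open>The reciprocal \<open>w\<close> of the root suits the induction better than the root:
  its derivative is -\<phi> w^3 times that of \<phi>, a product of functions already covered. The
  root is recovered in \<open>smooth_sqrt\<close> by multiplying \<open>w\<close> with the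
  radicand.\<close>

lemma Ck_inverse_sqrt:
  assumes "\<delta> > 0"
  shows "Ck k \<phi> \<Longrightarrow> Ck k (\<lambda>x. 1 / sqrt ((\<phi> x)\<^sup>2 + \<delta>\<^sup>2))"
proof (induction k)
  case 0
  have "(\<phi> x)\<^sup>2 + \<delta>\<^sup>2 \<noteq> 0" for x using assms by (simp add: add_nonneg_pos less_imp_neq[THEN not_sym])
  then show ?case using 0 by (auto intro!: continuous_intros)
next
  case (Suc k)
  let ?w = "\<lambda>x. 1 / sqrt ((\<phi> x)\<^sup>2 + \<delta>\<^sup>2)"
  show ?case
  proof (rule Ck_SucI)
    fix x
    have pos: "t\<^sup>2 + \<delta>\<^sup>2 > 0" for t :: real using assms by (simp add: add_nonneg_pos)
    have "((\<lambda>t. 1 / sqrt (t\<^sup>2 + \<delta>\<^sup>2)) has_real_derivative - (t * (1 / sqrt (t\<^sup>2 + \<delta>\<^sup>2) * (1 / sqrt (t\<^sup>2 + \<delta>\<^sup>2) * (1 / sqrt (t\<^sup>2 + \<delta>\<^sup>2)))))) (at t)" for t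
      using pos[of t] by (auto intro!: derivative_eq_intros simp: field_simps)
    from has_derivative_compose[OF Ck_SucD(1)[OF Suc.prems] this[of "\<phi> x", unfolded has_field_derivative_def]]
    show "(?w has_derivative (\<lambda>v. ((-1) * (\<phi> x * (?w x * (?w x * ?w x)))) * frechet_derivative \<phi> (at x) v)) (at x)" by simp
    show "Ck k (\<lambda>x. ((-1) * (\<phi> x * (?w x * (?w x * ?w x)))) * frechet_derivative \<phi> (at x) v)" for v
      by (intro Ck_mult Ck_const Suc.IH Ck_mono[OF Suc.prems] Ck_SucD(2)[OF Suc.prems])
  qed
qed

lemma smooth_sqrt:
  assumes "\<delta> > 0" "smooth \<phi>"
  shows "smooth (\<lambda>x. sqrt ((\<phi> x)\<^sup>2 + \<delta>\<^sup>2))"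
proof -
  have pos: "t\<^sup>2 + \<delta>\<^sup>2 > 0" for t :: real using assms by (simp add: add_nonneg_pos)
  have "smooth (\<lambda>x. (\<phi> x * \<phi> x + \<delta>\<^sup>2) * (1 / sqrt ((\<phi> x)\<^sup>2 + \<delta>\<^sup>2)))"
    using assms by (intro smooth_mult smooth_add smooth_const) (simp_all add: smooth_def Ck_inverse_sqrt)
  moreover have "(\<phi> x * \<phi> x + \<delta>\<^sup>2) * (1 / sqrt ((\<phi> x)\<^sup>2 + \<delta>\<^sup>2)) = sqrt ((\<phi> x)\<^sup>2 + \<delta>\<^sup>2)" for x
    using pos[of "\<phi> x"] by (simp add: power2_eq_square[of "\<phi> x", symmetric] real_div_sqrt)
  ultimately show ?thesis by simp
qed

section \<open>Test functions\<close>

lemma smooth_continuous: "smooth \<phi> \<Longrightarrow> continuous_on UNIV \<phi>"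
  unfolding smooth_def using Ck.simps(1) by blast

lemma test_functionsI:
  assumes "smooth \<phi>" "compact K" "K \<subseteq> \<Omega>" "\<And>x. x \<notin> K \<Longrightarrow> \<phi> x = 0"
  shows "\<phi> \<in> test_functions \<Omega>"
proof -
  have "closure {x. \<phi> x \<noteq> 0} \<subseteq> K" using assms by (intro closure_minimal compact_imp_closed) auto
  then have "K \<inter> closure {x. \<phi> x \<noteq> 0} = closure {x. \<phi> x \<noteq> 0}" by blast
  then have "compact (closure {x. \<phi> x \<noteq> 0})" using compact_Int_closed[OF assms(2) closed_closure] by metis
  then show ?thesis unfolding test_functions_def using assms \<open>closure {x. \<phi> x \<noteq> 0} \<subseteq> K\<close> by auto
qed

lemma test_functionsD:
  assumes "\<phi> \<in> test_functions \<Omega>"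
  obtains K where "smooth \<phi>" "compact K" "K \<subseteq> \<Omega>" "\<And>x. x \<notin> K \<Longrightarrow> \<phi> x = 0"
  using assms closure_subset[of "{x. \<phi> x \<noteq> 0}"] unfolding test_functions_def by blast

lemma test_functions_add: "\<phi> \<in> test_functions \<Omega> \<Longrightarrow> \<psi> \<in> test_functions \<Omega> \<Longrightarrow> (\<lambda>x. \<phi> x + \<psi> x) \<in> test_functions \<Omega>"
proof (elim test_functionsD)
  fix K L
  assume "smooth \<phi>" "compact K" "K \<subseteq> \<Omega>" "\<And>x. x \<notin> K \<Longrightarrow> \<phi> x = 0"
    and "smooth \<psi>" "compact L" "L \<subseteq> \<Omega>" "\<And>x. x \<notin> L \<Longrightarrow> \<psi> x = 0"
  then show ?thesis by (intro test_functionsI[of _ "K \<union> L"] smooth_add) auto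
qed

lemma test_functions_mult_smooth: "\<phi> \<in> test_functions \<Omega> \<Longrightarrow> smooth \<psi> \<Longrightarrow> (\<lambda>x. \<psi> x * \<phi> x) \<in> test_functions \<Omega>"
  by (elim test_functionsD) (rule test_functionsI[OF smooth_mult], auto)

lemma test_functions_scale: "\<phi> \<in> test_functions \<Omega> \<Longrightarrow> (\<lambda>x. c * \<phi> x) \<in> test_functions \<Omega>"
  using test_functions_mult_smooth[OF _ smooth_const] by blast

lemma test_functions_zero: "(\<lambda>x. 0) \<in> test_functions \<Omega>"
  by (rule test_functionsI[OF smooth_const compact_empty]) auto

text \<open>Subtracting \<delta> makes this smooth substitute for the modulus vanish wherever \<phi>
  does, so the compact support is kept.\<close>

lemma test_functions_sqrt:
  assumes "\<delta> > 0" "\<phi> \<in> test_functions \<Omega>"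
  shows "(\<lambda>x. sqrt ((\<phi> x)\<^sup>2 + \<delta>\<^sup>2) - \<delta>) \<in> test_functions \<Omega>"
  using assms(2) by (rule test_functionsD)
    (rule test_functionsI[OF smooth_diff[OF smooth_sqrt smooth_const]], use assms(1) in auto)

text \<open>The function and its partial derivatives are continuous and vanish off a compact set,
  hence are bounded; summing over the basis bounds the operator norm of the derivative.\<close>

lemma test_functions_lipschitz:
  assumes "\<phi> \<in> test_functions \<Omega>"
  shows "\<exists>L\<ge>0. \<exists>M\<ge>0. \<forall>x y. \<bar>\<phi> x - \<phi> y\<bar> \<le> L * norm (x - y) \<and> \<bar>\<phi> x\<bar> \<le> M"
proof -
  obtain K where K: "smooth \<phi>" "compact K" "\<And>x. x \<notin> K \<Longrightarrow> \<phi> x = 0" using assms by (rule test_functionsD) blast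
  have C1: "Ck (Suc (Suc 0)) \<phi>" using K(1) unfolding smooth_def by blast
  define D where "D = (\<lambda>x. frechet_derivative \<phi> (at x))"
  have D: "(\<phi> has_derivative D x) (at x)" for x unfolding D_def by (rule Ck_SucD(1)[OF C1])
  have Dcont: "continuous_on UNIV (\<lambda>x. D x v)" for v
    using Ck_mono[OF Ck_SucD(2)[OF C1]] unfolding D_def by simp
  have D0: "D x v = 0" if "x \<notin> K" for x v
  proof -
    have "open (- K)" using K(2) by (simp add: compact_imp_closed open_Compl)
    then have "((\<lambda>x. 0) has_derivative D x) (at x)"
      using has_derivative_transform_within_open[OF D, of "- K" x "\<lambda>x. 0"] K(3) that by auto
    then have "D x = (\<lambda>v. 0)" using has_derivative_unique has_derivative_const by blast
    then show ?thesis by simp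
  qed
  have bd: "\<exists>B. \<forall>x. \<bar>g x\<bar> \<le> B" if "continuous_on UNIV g" "\<And>x. x \<notin> K \<Longrightarrow> g x = 0" for g :: "'a \<Rightarrow> real"
  proof -
    have "bounded (g ` K)" using that(1) K(2) by (intro compact_imp_bounded compact_continuous_image) (auto intro: continuous_on_subset)
    then obtain B where "\<And>x. x \<in> K \<Longrightarrow> \<bar>g x\<bar> \<le> B" unfolding bounded_iff by auto
    then have "\<bar>g x\<bar> \<le> max B 0" for x using that(2)[of x] by (cases "x \<in> K") (auto intro: max.coboundedI1)
    then show ?thesis by blast
  qed
  obtain M where M: "\<And>x. \<bar>\<phi> x\<bar> \<le> M" using bd[OF smooth_continuous[OF K(1)] K(3)] by blast
  have "\<forall>b. \<exists>B. \<forall>x. \<bar>D x b\<bar> \<le> B" using bd[OF Dcont D0] by blast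
  then obtain B where B: "\<And>b x. \<bar>D x b\<bar> \<le> B b" by metis
  define L where "L = (\<Sum>b\<in>Basis. B b)"
  have onorm: "onorm (D x) \<le> L" for x
  proof (rule onorm_bound)
    show "0 \<le> L" unfolding L_def using B abs_ge_zero order_trans by (intro sum_nonneg) blast
    fix v
    have lin: "linear (D x)" using D has_derivative_linear by blast
    have "D x v = (\<Sum>b\<in>Basis. (v \<bullet> b) * D x b)"
      using linear_sum[OF lin, of "\<lambda>b. (v \<bullet> b) *\<^sub>R b" Basis] by (simp add: euclidean_representation linear_scale[OF lin])
    also have "\<bar>\<dots>\<bar> \<le> (\<Sum>b\<in>Basis. norm v * B b)"
      using B Basis_le_norm[of _ v] by (intro order_trans[OF sum_abs] sum_mono) (auto simp: abs_mult intro!: mult_mono)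
    finally show "norm (D x v) \<le> L * norm v" by (simp add: L_def sum_distrib_left mult.commute)
  qed
  have "norm (\<phi> x - \<phi> y) \<le> L * norm (x - y)" for x y
    by (rule differentiable_bound[of UNIV \<phi> D]) (use D onorm in \<open>auto intro: has_derivative_at_withinI\<close>)
  moreover have "L \<ge> 0" unfolding L_def using B abs_ge_zero order_trans by (intro sum_nonneg) blast
  moreover have "M \<ge> 0" using M abs_ge_zero order_trans by blast
  ultimately show ?thesis using M by (intro exI[of _ L] exI[of _ M] conjI allI) auto
qed


section \<open>Fractional Sobolev estimates\<close>

text \<open>The singular weight of the energy. On the diagonal its value is 0, by the conventions
  \<open>0 powr x = 0\<close> and \<open>1 / 0 = 0\<close>; hence the hypothesis
  \<open>x \<noteq> y\<close> in the lower bound below.\<close>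

definition riesz_kernel :: "real \<Rightarrow> real \<Rightarrow> 'a::euclidean_space \<times> 'a \<Rightarrow> real" where
  "riesz_kernel s p z = 1 / norm (fst z - snd z) powr (real DIM('a) + p * s)"

text \<open>Taken over all pairs and extended-valued, so that it can be manipulated before
  finiteness is known. For functions vanishing almost everywhere outside \<Omega> the integrand is
  zero almost everywhere off \<open>Qset \<Omega>\<close>.\<close>

definition gagliardo_nn :: "real \<Rightarrow> real \<Rightarrow> ('a::euclidean_space \<Rightarrow> real) \<Rightarrow> ennreal" where
  "gagliardo_nn s p u = (\<integral>\<^sup>+z. ennreal (\<bar>u (fst z) - u (snd z)\<bar> powr p * riesz_kernel s p z) \<partial>lborel)"

lemma riesz_kernel_nonneg: "riesz_kernel s p z \<ge> 0"
  by (simp add: riesz_kernel_def)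

lemma fst_borel_measurable [measurable]: "fst \<in> borel_measurable (borel :: ('a::euclidean_space \<times> 'a) measure)"
  and snd_borel_measurable [measurable]: "snd \<in> borel_measurable (borel :: ('a::euclidean_space \<times> 'a) measure)"
  by (intro borel_measurable_continuous_onI continuous_intros)+

lemma riesz_kernel_measurable [measurable]: "riesz_kernel s p \<in> borel_measurable borel"
proof -
  have "(\<lambda>z::'a \<times> 'a. norm (fst z - snd z)) \<in> borel_measurable borel"
    by (intro borel_measurable_continuous_onI continuous_intros)
  then show ?thesis unfolding riesz_kernel_def[abs_def]
    by (intro borel_measurable_divide powr_real_measurable borel_measurable_const)
qed

lemma difference_borel_measurable [measurable]:
  fixes u :: "'a::euclidean_space \<Rightarrow> real"
  assumes "u \<in> borel_measurable borel"
  shows "(\<lambda>z. u (fst z) - u (snd z)) \<in> borel_measurable borel"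
  by (intro borel_measurable_diff measurable_compose[OF _ assms] fst_borel_measurable snd_borel_measurable)

lemma riesz_kernel_ge:
  fixes x y :: "'a::euclidean_space"
  assumes "norm (x - y) \<le> R" "x \<noteq> y" "p > 0" "s > 0"
  shows "riesz_kernel s p (x, y) \<ge> R powr - (real DIM('a) + p * s)"
proof -
  have "norm (x - y) powr (real DIM('a) + p * s) \<le> R powr (real DIM('a) + p * s)"
    using assms by (intro powr_mono2) auto
  moreover have "norm (x - y) powr (real DIM('a) + p * s) > 0" using assms by simp
  moreover have "0 < R" using assms(1,2) by (simp add: less_le_trans[of 0 "norm (x - y)"])
  ultimately show ?thesis unfolding riesz_kernel_def powr_minus_divide fst_conv snd_conv by (intro divide_left_mono) auto
qed

lemma gagliardo_nn_fubini:
  fixes u :: "'a::euclidean_space \<Rightarrow> real"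
  assumes [measurable]: "u \<in> borel_measurable borel"
  shows "gagliardo_nn s p u = (\<integral>\<^sup>+x. \<integral>\<^sup>+y. ennreal (\<bar>u x - u y\<bar> powr p * riesz_kernel s p (x, y)) \<partial>lborel \<partial>lborel)"
proof -
  have "(\<lambda>z::'a \<times> 'a. ennreal (\<bar>u (fst z) - u (snd z)\<bar> powr p * riesz_kernel s p z)) \<in> borel_measurable borel"
    by (intro measurable_compose[OF _ measurable_ennreal] borel_measurable_times powr_real_measurable borel_measurable_abs
        difference_borel_measurable riesz_kernel_measurable borel_measurable_const assms)
  then have [measurable]: "(\<lambda>z::'a \<times> 'a. ennreal (\<bar>u (fst z) - u (snd z)\<bar> powr p * riesz_kernel s p z)) \<in> borel_measurable (lborel \<Otimes>\<^sub>M lborel)"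
    unfolding lborel_prod by simp
  show ?thesis unfolding gagliardo_nn_def lborel_prod[symmetric]
    by (subst lborel.nn_integral_fst[symmetric]) auto
qed

section \<open>The subcritical Sobolev inequality\<close>

locale bounded_open_set =
  fixes \<Omega> :: "'a::euclidean_space set" and s p :: real
  assumes open_\<Omega>: "open \<Omega>" and bounded_\<Omega>: "bounded \<Omega>" and nonempty_\<Omega>: "\<Omega> \<noteq> {}"
    and s: "0 < s" "s < 1" and p: "2 \<le> p" and subcritical: "p * s < real DIM('a)"
begin

text \<open>In this notation \<open>p / (1 - \<theta>)\<close> is the critical exponent np/(n -
  ps).\<close>

definition \<theta> :: real where "\<theta> = p * s / real DIM('a)"

lemma dim_pos: "real DIM('a) > 0" by simp

lemma \<theta>: "0 < \<theta>" "\<theta> < 1" using s p subcritical by (auto simp: \<theta>_def)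

lemma measurable_\<Omega> [measurable]: "\<Omega> \<in> sets borel" "\<Omega> \<in> sets lebesgue"
  using open_\<Omega> by auto

lemma emeasure_\<Omega>: "emeasure lborel \<Omega> < \<infinity>" using bounded_\<Omega> emeasure_bounded_finite by blast

text \<open>Let B be the set where |u| > t/2 and fix \<open>x\<close> with |u x| > t. A ball around
  \<open>x\<close> with twice the measure of B contains at least as much measure outside B as B has
  itself; there u x and u y differ by at least t/2, and the kernel is bounded below by a power of
  the radius. Integrating over all such \<open>x\<close> bounds the energy from below.\<close>

lemma level_set_estimate:
  "\<exists>C>0. \<forall>u t. u \<in> borel_measurable borel \<longrightarrow> emeasure lborel {x. u x \<noteq> 0} < \<infinity> \<longrightarrow> gagliardo_nn s p u \<le> 1 \<longrightarrow> t > 0 \<longrightarrow>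
     measure lborel {x. \<bar>u x\<bar> > t} \<le> C * t powr - p * measure lborel {x::'a. \<bar>u x\<bar> > t / 2} powr \<theta>"
proof -
  define n where "n = real DIM('a)"
  define \<omega> where "\<omega> = unit_ball_vol n"
  have n: "n > 0" by (simp add: n_def)
  have \<omega>: "\<omega> > 0" by (simp add: \<omega>_def n_def)
  define c where "c = (2 / \<omega>) powr - (1 + \<theta>)"
  have c: "c > 0" using \<omega> by (simp add: c_def)
  have "measure lborel {x. \<bar>u x\<bar> > t} \<le> (2 powr p / c) * t powr - p * measure lborel {x. \<bar>u x\<bar> > t / 2} powr \<theta>"
    if u[measurable]: "u \<in> borel_measurable borel" and fin: "emeasure lborel {x. u x \<noteq> 0} < \<infinity>"
      and E: "gagliardo_nn s p u \<le> 1" and t: "t > 0" for u :: "'a \<Rightarrow> real" and t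
  proof -
    define A where "A = {x. \<bar>u x\<bar> > t}"
    define B where "B = {x. \<bar>u x\<bar> > t / 2}"
    have [measurable]: "A \<in> sets borel" "B \<in> sets borel" unfolding A_def B_def by measurable
    have AB: "A \<subseteq> B" using t by (auto simp: A_def B_def)
    have "emeasure lborel B \<le> emeasure lborel {x. u x \<noteq> 0}" using t by (intro emeasure_mono) (auto simp: B_def)
    then have Bfin: "emeasure lborel B < \<infinity>" using fin by (rule le_less_trans)
    have "emeasure lborel A \<le> emeasure lborel B" using AB by (intro emeasure_mono) auto
    then have Afin: "emeasure lborel A < \<infinity>" using Bfin by (rule le_less_trans)
    define m where "m = measure lborel B"
    have Bm: "emeasure lborel B = ennreal m" unfolding m_def using Bfin by (intro emeasure_eq_ennreal_measure) simp
    have Am: "emeasure lborel A = ennreal (measure lborel A)" using Afin by (intro emeasure_eq_ennreal_measure) simp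
    show ?thesis
    proof (cases "m = 0")
      case True
      have "measure lborel A \<le> m" unfolding m_def using AB Bfin by (intro measure_mono_fmeasurable) (auto simp: fmeasurable_def)
      then show ?thesis using True unfolding m_def A_def B_def by simp
    next
      case False
      then have m: "m > 0" unfolding m_def by (simp add: zero_less_measure_iff)
      \<comment> \<open>\<open>R\<close> is the radius at which a ball has measure
        \<open>2 * m\<close>, twice that of \<open>B\<close>.\<close>
      define R where "R = (2 * m / \<omega>) powr (1 / n)"
      have R: "R > 0" using m \<omega> by (simp add: R_def)
      have Rn: "R powr n = 2 * m / \<omega>" using m \<omega> n by (simp add: R_def powr_powr)
      define k where "k = (t / 2) powr p * R powr - (n + p * s)"
      have k: "k > 0" using t R by (simp add: k_def)
      have inner: "ennreal (k * m) \<le> (\<integral>\<^sup>+y. ennreal (\<bar>u x - u y\<bar> powr p * riesz_kernel s p (x, y)) \<partial>lborel)" if x: "x \<in> A" for x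
      proof -
        have "ennreal m \<le> emeasure lborel (ball x R - B)"
        proof -
          have "emeasure lborel (ball x R) = ennreal (\<omega> * R ^ DIM('a))"
            unfolding \<omega>_def n_def using R by (intro emeasure_ball) simp
          also have "\<omega> * R ^ DIM('a) = 2 * m" using Rn \<omega> R unfolding n_def by (simp add: powr_realpow field_simps)
          finally have "ennreal (2 * m) \<le> emeasure lborel ((ball x R - B) \<union> B)"
            by (metis Un_Diff_cancel2 Un_upper1 emeasure_mono sets.Un sets_lborel borel_open open_ball \<open>B \<in> sets borel\<close>)
          also have "\<dots> \<le> emeasure lborel (ball x R - B) + ennreal m"
            unfolding Bm[symmetric] by (intro emeasure_subadditive) auto
          finally show ?thesis
            using m by (cases "emeasure lborel (ball x R - B)") (auto simp flip: ennreal_plus)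
        qed
        then have "ennreal k * ennreal m \<le> ennreal k * emeasure lborel (ball x R - B)" by (intro mult_left_mono) auto
        also have "\<dots> = (\<integral>\<^sup>+y. ennreal k * indicator (ball x R - B) y \<partial>lborel)" by (simp add: nn_integral_cmult_indicator)
        also have "\<dots> \<le> (\<integral>\<^sup>+y. ennreal (\<bar>u x - u y\<bar> powr p * riesz_kernel s p (x, y)) \<partial>lborel)"
        proof (intro nn_integral_mono)
          fix y
          show "ennreal k * indicator (ball x R - B) y \<le> ennreal (\<bar>u x - u y\<bar> powr p * riesz_kernel s p (x, y))"
          proof (cases "y \<in> ball x R - B")
            case True
            then have y: "norm (x - y) \<le> R" "\<bar>u y\<bar> \<le> t / 2" by (auto simp: B_def dist_norm)
            have ux: "\<bar>u x\<bar> > t" using x by (simp add: A_def)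
            have "x \<noteq> y" using x AB True by auto
            then have "R powr - (n + p * s) \<le> riesz_kernel s p (x, y)" unfolding n_def using y s p by (intro riesz_kernel_ge) auto
            moreover have "t / 2 \<le> \<bar>u x - u y\<bar>" using ux y(2) by linarith
            then have "(t / 2) powr p \<le> \<bar>u x - u y\<bar> powr p" using t p by (intro powr_mono2) auto
            ultimately have "k \<le> \<bar>u x - u y\<bar> powr p * riesz_kernel s p (x, y)" unfolding k_def by (intro mult_mono) auto
            then show ?thesis using True by (simp add: ennreal_leI)
          qed simp
        qed
        finally show ?thesis using k m by (simp add: ennreal_mult)
      qed
      have "ennreal (k * m) * emeasure lborel A = (\<integral>\<^sup>+x. ennreal (k * m) * indicator A x \<partial>lborel)"
        by (simp add: nn_integral_cmult_indicator)
      also have "\<dots> \<le> gagliardo_nn s p u"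
        unfolding gagliardo_nn_fubini[OF u] using inner
        by (intro nn_integral_mono) (auto split: split_indicator)
      finally have "ennreal (k * m) * ennreal (measure lborel A) \<le> 1" using E unfolding Am by simp
      then have 1: "k * m * measure lborel A \<le> 1" using k m by (simp flip: ennreal_mult add: ennreal_le_1)
      \<comment> \<open>R^n is proportional to \<open>m\<close>, so the kernel factor R^-(n + ps) is
        proportional to m^-(1 + \<theta>); one factor \<open>m\<close> cancels.\<close>
      have "k * m = (t / 2) powr p * c * m powr - \<theta>"
      proof -
        have n\<theta>: "n * \<theta> = p * s" using n by (simp add: \<theta>_def n_def)
        have "- (n + p * s) = n * - (1 + \<theta>)" unfolding n\<theta>[symmetric] by (simp add: algebra_simps)
        then have "R powr - (n + p * s) = (R powr n) powr - (1 + \<theta>)" unfolding powr_powr by simp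
        also have "\<dots> = (2 / \<omega> * m) powr - (1 + \<theta>)" unfolding Rn by simp
        also have "\<dots> = c * m powr - (1 + \<theta>)" unfolding c_def using \<omega> m by (intro powr_mult)
        finally have "R powr - (n + p * s) * m = c * (m powr - (1 + \<theta>) * m powr 1)" using m by simp
        also have "m powr - (1 + \<theta>) * m powr 1 = m powr - \<theta>" using powr_add[of m "- (1 + \<theta>)" 1] by simp
        finally show ?thesis by (simp add: k_def)
      qed
      then have "(t / 2) powr p * c * m powr - \<theta> * measure lborel A \<le> 1" using 1 by simp
      then have "measure lborel A \<le> (2 powr p / c) * t powr - p * m powr \<theta>"
        using t c m by (simp add: powr_divide powr_minus_divide field_simps)
      then show ?thesis unfolding A_def m_def B_def .
    qed
  qed
  then show ?thesis using c by (intro exI[of _ "2 powr p / c"]) auto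
qed

definition admissible :: "('a \<Rightarrow> real) \<Rightarrow> bool" where
  "admissible u \<longleftrightarrow> u \<in> borel_measurable borel \<and> (AE x in lborel. x \<notin> \<Omega> \<longrightarrow> u x = 0) \<and> gagliardo_nn s p u \<le> 1"

lemma admissible_support: "admissible u \<Longrightarrow> emeasure lborel {x. u x \<noteq> 0} \<le> emeasure lborel \<Omega>"
  by (intro emeasure_mono_AE) (auto simp: admissible_def elim: AE_mp)

text \<open>Iterating the level set estimate improves the exponent \<open>\<mu>\<close> of the weak bound to
  \<open>p + \<theta> * \<mu>\<close>, starting from the trivial bound with \<open>\<mu> = 0\<close>.\<close>

lemma weak_bound_iterated:
  "\<exists>C>0. \<forall>u t. admissible u \<longrightarrow> t > 0 \<longrightarrow>
     measure lborel {x. \<bar>u x\<bar> > t} \<le> C * t powr - (p * (1 - \<theta> ^ k) / (1 - \<theta>))"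
proof (induction k)
  case 0
  have "measure lborel {x. \<bar>u x\<bar> > t} \<le> measure lborel \<Omega> + 1" if "admissible u" "t > 0" for u t
  proof -
    have [measurable]: "u \<in> borel_measurable borel" using that by (simp add: admissible_def)
    have "emeasure lborel {x. \<bar>u x\<bar> > t} \<le> emeasure lborel {x. u x \<noteq> 0}" using that by (intro emeasure_mono) auto
    also have "\<dots> \<le> emeasure lborel \<Omega>" using admissible_support[OF that(1)] .
    finally have "measure lborel {x. \<bar>u x\<bar> > t} \<le> measure lborel \<Omega>"
      unfolding measure_def using emeasure_\<Omega> by (intro enn2real_mono) auto
    then show ?thesis by simp
  qed
  moreover have "measure lborel \<Omega> + 1 > 0" by (simp add: add_nonneg_pos)
  ultimately show ?case by (intro exI[of _ "measure lborel \<Omega> + 1"]) auto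
next
  case (Suc k)
  then obtain C0 where C0: "C0 > 0" "\<And>u t. admissible u \<Longrightarrow> t > 0 \<Longrightarrow>
     measure lborel {x. \<bar>u x\<bar> > t} \<le> C0 * t powr - (p * (1 - \<theta> ^ k) / (1 - \<theta>))" by blast
  obtain C where C: "C > 0" "\<And>u t. u \<in> borel_measurable borel \<Longrightarrow> emeasure lborel {x. u x \<noteq> 0} < \<infinity> \<Longrightarrow> gagliardo_nn s p u \<le> 1 \<Longrightarrow> t > 0 \<Longrightarrow>
     measure lborel {x. \<bar>u x\<bar> > t} \<le> C * t powr - p * measure lborel {x::'a. \<bar>u x\<bar> > t / 2} powr \<theta>"
    using level_set_estimate by blast
  define \<mu> where "\<mu> = p * (1 - \<theta> ^ k) / (1 - \<theta>)"
  have step: "p * (1 - \<theta> ^ Suc k) / (1 - \<theta>) = p + \<theta> * \<mu>" using \<theta> by (simp add: \<mu>_def field_simps)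
  have "measure lborel {x. \<bar>u x\<bar> > t} \<le> (C * C0 powr \<theta> * 2 powr (\<mu> * \<theta>)) * t powr - (p + \<theta> * \<mu>)" if u: "admissible u" and t: "t > 0" for u t
  proof -
    have "emeasure lborel {x. u x \<noteq> 0} < \<infinity>" using admissible_support[OF u] emeasure_\<Omega> by (rule le_less_trans)
    then have "measure lborel {x. \<bar>u x\<bar> > t} \<le> C * t powr - p * measure lborel {x. \<bar>u x\<bar> > t / 2} powr \<theta>"
      using u t by (intro C(2)) (auto simp: admissible_def)
    also have "\<dots> \<le> C * t powr - p * (C0 * (t / 2) powr - \<mu>) powr \<theta>"
      using C0(2)[OF u, of "t / 2"] t C \<theta> by (intro mult_left_mono powr_mono2) (auto simp: \<mu>_def)
    also have "(C0 * (t / 2) powr - \<mu>) powr \<theta> = C0 powr \<theta> * ((t / 2) powr (- \<mu> * \<theta>))"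
      using C0 t by (simp add: powr_mult powr_powr)
    also have "(t / 2) powr (- \<mu> * \<theta>) = 2 powr (\<mu> * \<theta>) * t powr (- \<mu> * \<theta>)" using t by (simp add: powr_divide powr_minus_divide)
    also have "C * t powr - p * (C0 powr \<theta> * (2 powr (\<mu> * \<theta>) * t powr (- \<mu> * \<theta>))) =
        (C * C0 powr \<theta> * 2 powr (\<mu> * \<theta>)) * (t powr - p * t powr (- \<mu> * \<theta>))" by simp
    also have "t powr - p * t powr (- \<mu> * \<theta>) = t powr - (p + \<theta> * \<mu>)" by (simp add: mult.commute flip: powr_add)
    finally show ?thesis .
  qed
  moreover have "C * C0 powr \<theta> * 2 powr (\<mu> * \<theta>) > 0" using C C0 by simp
  ultimately show ?case unfolding step by blast
qed

text \<open>The exponents p (1 - \<theta>^k)/(1 - \<theta>) tend to the critical exponent, so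
  finitely many steps of the iteration pass any prescribed subcritical \<open>m\<close>.\<close>

lemma weak_bound:
  assumes "m < real DIM('a) * p / (real DIM('a) - p * s)"
  shows "\<exists>\<mu> C. m < \<mu> \<and> C > 0 \<and> (\<forall>u t. admissible u \<longrightarrow> t > 0 \<longrightarrow> measure lborel {x. \<bar>u x\<bar> > t} \<le> C * t powr - \<mu>)"
proof -
  have eq: "real DIM('a) * p / (real DIM('a) - p * s) = p * (1 - 0) / (1 - \<theta>)"
    using dim_pos subcritical by (simp add: \<theta>_def field_simps)
  have "(\<lambda>k. p * (1 - \<theta> ^ k) / (1 - \<theta>)) \<longlonglongrightarrow> p * (1 - 0) / (1 - \<theta>)"
    using \<theta> by (intro tendsto_intros LIMSEQ_power_zero) auto
  then have "\<forall>\<^sub>F k in sequentially. p * (1 - \<theta> ^ k) / (1 - \<theta>) > m" using assms unfolding eq by (rule order_tendstoD)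
  then obtain k where "p * (1 - \<theta> ^ k) / (1 - \<theta>) > m" by (auto simp: eventually_sequentially)
  then show ?thesis using weak_bound_iterated[of k] by blast
qed

text \<open>Integration over dyadic layers: by the weak bound with some \<mu> > m, the layer 2^j <
  |u| \<le> 2^(j+1) contributes at most a constant times 2^(j(m - \<mu>)), a convergent geometric
  series; nonzero values up to 1 contribute at most the measure of \<Omega>.\<close>

theorem sobolev_bound:
  assumes m: "0 \<le> m" "m < real DIM('a) * p / (real DIM('a) - p * s)"
  shows "\<exists>C>0. \<forall>u. admissible u \<longrightarrow> (\<integral>\<^sup>+x. ennreal (\<bar>u x\<bar> powr m) \<partial>lborel) \<le> ennreal C"
proof -
  obtain \<mu> C where \<mu>: "m < \<mu>" "C > 0" and weak: "\<And>u t. admissible u \<Longrightarrow> t > 0 \<Longrightarrow> measure lborel {x. \<bar>u x\<bar> > t} \<le> C * t powr - \<mu>"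
    using weak_bound[OF m(2)] by blast
  define \<kappa> where "\<kappa> = (2::real) powr (m - \<mu>)"
  have \<kappa>: "0 < \<kappa>" "\<kappa> < 1" using \<mu> powr_less_cancel_iff[of 2 "m - \<mu>" 0] by (auto simp: \<kappa>_def)
  define D where "D = measure lborel \<Omega> + C * 2 powr m / (1 - \<kappa>)"
  have "(\<integral>\<^sup>+x. ennreal (\<bar>u x\<bar> powr m) \<partial>lborel) \<le> ennreal D" if u: "admissible u" for u
  proof -
    have [measurable]: "u \<in> borel_measurable borel" using u by (simp add: admissible_def)
    \<comment> \<open>The value at the upper end of the layer is paired with the superlevel set at
      its lower end.\<close>
    define f where "f = (\<lambda>j::nat. \<lambda>x. ennreal (2 powr ((real j + 1) * m)) * indicator {x. \<bar>u x\<bar> > 2 ^ j} x)"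
    have f_meas[measurable]: "f j \<in> borel_measurable lborel" for j unfolding f_def by measurable
    have pw: "ennreal (\<bar>u x\<bar> powr m) \<le> indicator {x. u x \<noteq> 0} x + (\<Sum>j. f j x)" for x
    proof (cases "\<bar>u x\<bar> \<le> 1")
      case True
      show ?thesis
      proof (cases "u x = 0")
        case False
        have "\<bar>u x\<bar> powr m \<le> 1" using True m powr_mono2[of m "\<bar>u x\<bar>" 1] by simp
        then have "ennreal (\<bar>u x\<bar> powr m) \<le> 1" by (simp add: ennreal_le_1)
        then show ?thesis using False by (simp add: add_increasing2)
      qed simp
    next
      case False
      define k where "k = (LEAST k. \<bar>u x\<bar> \<le> 2 ^ k)"
      have ex: "\<exists>k. \<bar>u x\<bar> \<le> 2 ^ k" using real_arch_pow[of 2 "\<bar>u x\<bar>"] less_imp_le by auto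
      have k: "\<bar>u x\<bar> \<le> 2 ^ k" unfolding k_def using LeastI_ex[OF ex] .
      then have "k \<noteq> 0" using False by (cases k) auto
      then obtain j where j: "k = Suc j" by (cases k) auto
      have "\<not> \<bar>u x\<bar> \<le> 2 ^ j" using not_less_Least[of j "\<lambda>k. \<bar>u x\<bar> \<le> 2 ^ k"] j unfolding k_def by simp
      then have fj: "f j x = ennreal (2 powr ((real j + 1) * m))" by (simp add: f_def)
      have "\<bar>u x\<bar> powr m \<le> (2 ^ k) powr m" using k m by (intro powr_mono2) auto
      also have "(2::real) ^ k = 2 powr (real j + 1)" unfolding j using powr_realpow[of 2 "Suc j"] by (simp add: add.commute)
      also have "(2 powr (real j + 1)) powr m = 2 powr ((real j + 1) * m)" by (rule powr_powr)
      finally have "ennreal (\<bar>u x\<bar> powr m) \<le> f j x" unfolding fj by (rule ennreal_leI)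
      also have "\<dots> = (\<Sum>i\<in>{j}. f i x)" by simp
      also have "\<dots> \<le> (\<Sum>j. f j x)" by (intro sum_le_suminf) auto
      finally show ?thesis by (simp add: add_increasing)
    qed
    have fin: "emeasure lborel {x. \<bar>u x\<bar> > 2 ^ j} \<noteq> \<infinity>" for j :: nat
    proof -
      have "emeasure lborel {x. \<bar>u x\<bar> > 2 ^ j} \<le> emeasure lborel {x. u x \<noteq> 0}"
        by (intro emeasure_mono) (auto simp: not_less intro: less_le_trans)
      also have "\<dots> < \<infinity>" using admissible_support[OF u] emeasure_\<Omega> by (rule le_less_trans)
      finally show ?thesis by simp
    qed
    have fj: "(\<integral>\<^sup>+x. f j x \<partial>lborel) \<le> ennreal (C * 2 powr m * \<kappa> ^ j)" for j
    proof -
      have "(\<integral>\<^sup>+x. f j x \<partial>lborel) = ennreal (2 powr ((real j + 1) * m)) * emeasure lborel {x. \<bar>u x\<bar> > 2 ^ j}"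
        unfolding f_def by (simp add: nn_integral_cmult_indicator)
      also have "\<dots> = ennreal (2 powr ((real j + 1) * m) * measure lborel {x. \<bar>u x\<bar> > 2 ^ j})"
        using fin[of j] by (simp add: emeasure_eq_ennreal_measure ennreal_mult)
      also have "\<dots> \<le> ennreal (2 powr ((real j + 1) * m) * (C * (2 ^ j) powr - \<mu>))"
        using weak[OF u, of "2 ^ j"] by (intro ennreal_leI mult_left_mono) auto
      also have "2 powr ((real j + 1) * m) * (C * (2 ^ j) powr - \<mu>) = C * 2 powr m * \<kappa> ^ j"
      proof -
        have "(2::real) powr ((real j + 1) * m) = 2 powr m * 2 powr (real j * m)" by (simp add: distrib_right powr_add)
        moreover have "((2::real) ^ j) powr - \<mu> = 2 powr (real j * - \<mu>)" by (simp add: powr_powr flip: powr_realpow)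
        moreover have "\<kappa> ^ j = 2 powr (real j * m) * 2 powr (real j * - \<mu>)"
          unfolding \<kappa>_def by (simp add: powr_powr algebra_simps flip: powr_realpow powr_add)
        ultimately show ?thesis by simp
      qed
      finally show ?thesis .
    qed
    have "(\<integral>\<^sup>+x. ennreal (\<bar>u x\<bar> powr m) \<partial>lborel) \<le> (\<integral>\<^sup>+x. indicator {x. u x \<noteq> 0} x + (\<Sum>j. f j x) \<partial>lborel)"
      by (intro nn_integral_mono pw)
    also have "\<dots> = emeasure lborel {x. u x \<noteq> 0} + (\<Sum>j. \<integral>\<^sup>+x. f j x \<partial>lborel)"
      by (subst nn_integral_add) (auto simp: nn_integral_suminf)
    also have "\<dots> \<le> emeasure lborel \<Omega> + (\<Sum>j. ennreal (C * 2 powr m * \<kappa> ^ j))"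
      using fj by (intro add_mono admissible_support[OF u] suminf_le) auto
    also have "(\<Sum>j. ennreal (C * 2 powr m * \<kappa> ^ j)) = ennreal (C * 2 powr m / (1 - \<kappa>))"
    proof -
      have "(\<lambda>j. C * 2 powr m * \<kappa> ^ j) sums (C * 2 powr m * (1 / (1 - \<kappa>)))"
        using \<kappa> by (intro sums_mult geometric_sums) auto
      then show ?thesis using \<mu> \<kappa> by (subst suminf_ennreal_eq) auto
    qed
    also have "emeasure lborel \<Omega> + ennreal (C * 2 powr m / (1 - \<kappa>)) = ennreal D"
      unfolding D_def using emeasure_\<Omega> \<mu> \<kappa> by (subst ennreal_plus) (auto simp: emeasure_eq_ennreal_measure)
    finally show ?thesis .
  qed
  moreover have "D > 0" using \<mu> \<kappa> by (simp add: D_def add_nonneg_pos)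
  ultimately show ?thesis by blast
qed

end


section \<open>The Gagliardo energy of Lebesgue measurable functions\<close>

text \<open>\<open>lebesgue\<close> on pairs is the completion of the product Borel measure and not
  a product of completed measures. A null set of one variable is therefore enlarged to a Borel null
  set first; the cylinder over that is null.\<close>

lemma AE_lebesgue_fst:
  fixes P :: "'a::euclidean_space \<Rightarrow> bool"
  assumes "AE x in lebesgue. P x"
  shows "AE z in (lebesgue :: ('a \<times> 'a) measure). P (fst z)"
proof -
  have "AE x in lborel. P x" using assms by (simp add: AE_completion_iff)
  then obtain N where N: "{x. \<not> P x} \<subseteq> N" "N \<in> null_sets lborel" by (auto elim!: AE_E simp: null_sets_def)
  have "N \<times> (UNIV :: 'a set) \<in> null_sets (lborel \<Otimes>\<^sub>M lborel)" using N(2) by (intro lborel.times_in_null_sets1) auto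
  then have "AE z in (lborel :: ('a \<times> 'a) measure). P (fst z)"
    unfolding lborel_prod using N(1) by (intro AE_I') auto
  then show ?thesis by (simp add: AE_completion_iff)
qed

lemma AE_lebesgue_snd:
  fixes P :: "'a::euclidean_space \<Rightarrow> bool"
  assumes "AE x in lebesgue. P x"
  shows "AE z in (lebesgue :: ('a \<times> 'a) measure). P (snd z)"
proof -
  have "AE x in lborel. P x" using assms by (simp add: AE_completion_iff)
  then obtain N where N: "{x. \<not> P x} \<subseteq> N" "N \<in> null_sets lborel" by (auto elim!: AE_E simp: null_sets_def)
  have "(UNIV :: 'a set) \<times> N \<in> null_sets (lborel \<Otimes>\<^sub>M lborel)" using N(2) by (intro lborel.times_in_null_sets2) auto
  then have "AE z in (lborel :: ('a \<times> 'a) measure). P (snd z)"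
    unfolding lborel_prod using N(1) by (intro AE_I') auto
  then show ?thesis by (simp add: AE_completion_iff)
qed

lemma fst_lebesgue_measurable [measurable]:
  "fst \<in> (lebesgue :: ('a::euclidean_space \<times> 'a) measure) \<rightarrow>\<^sub>M (lebesgue :: 'a measure)"
proof (rule measurableI)
  fix A :: "'a set" assume "A \<in> sets lebesgue"
  then obtain S N N' where A: "A = S \<union> N" "N \<subseteq> N'" "N' \<in> null_sets lborel" "S \<in> sets lborel"
    by (rule sets_completionE)
  have "fst -` A \<inter> space lebesgue = S \<times> (UNIV :: 'a set) \<union> N \<times> UNIV" using A(1) by auto
  moreover have "N' \<times> (UNIV :: 'a set) \<in> null_sets (lborel \<Otimes>\<^sub>M lborel)" using A(3) by (intro lborel.times_in_null_sets1) auto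
  moreover have "S \<times> (UNIV :: 'a set) \<in> sets (lborel \<Otimes>\<^sub>M lborel)" using A(4) by (intro pair_measureI) auto
  ultimately show "fst -` A \<inter> space lebesgue \<in> sets (lebesgue :: ('a \<times> 'a) measure)"
    using A(2) unfolding lborel_prod by (intro sets_completionI[where S = "S \<times> UNIV" and N' = "N' \<times> UNIV"]) auto
qed simp

lemma snd_lebesgue_measurable [measurable]:
  "snd \<in> (lebesgue :: ('a::euclidean_space \<times> 'a) measure) \<rightarrow>\<^sub>M (lebesgue :: 'a measure)"
proof (rule measurableI)
  fix A :: "'a set" assume "A \<in> sets lebesgue"
  then obtain S N N' where A: "A = S \<union> N" "N \<subseteq> N'" "N' \<in> null_sets lborel" "S \<in> sets lborel"
    by (rule sets_completionE)
  have "snd -` A \<inter> space lebesgue = (UNIV :: 'a set) \<times> S \<union> UNIV \<times> N" using A(1) by auto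
  moreover have "(UNIV :: 'a set) \<times> N' \<in> null_sets (lborel \<Otimes>\<^sub>M lborel)" using A(3) by (intro lborel.times_in_null_sets2) auto
  moreover have "(UNIV :: 'a set) \<times> S \<in> sets (lborel \<Otimes>\<^sub>M lborel)" using A(4) by (intro pair_measureI) auto
  ultimately show "snd -` A \<inter> space lebesgue \<in> sets (lebesgue :: ('a \<times> 'a) measure)"
    using A(2) unfolding lborel_prod by (intro sets_completionI[where S = "UNIV \<times> S" and N' = "UNIV \<times> N'"]) auto
qed simp

lemma difference_lebesgue_measurable:
  fixes u :: "'a::euclidean_space \<Rightarrow> real"
  assumes "u \<in> borel_measurable lebesgue"
  shows "(\<lambda>z. u (fst z) - u (snd z)) \<in> borel_measurable lebesgue"
  by (intro borel_measurable_diff measurable_compose[OF fst_lebesgue_measurable assms] measurable_compose[OF snd_lebesgue_measurable assms])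

lemma riesz_kernel_lebesgue_measurable: "riesz_kernel s p \<in> borel_measurable lebesgue"
  using riesz_kernel_measurable by (intro measurable_completion) simp

definition gagliardo_density :: "real \<Rightarrow> real \<Rightarrow> ('a::euclidean_space \<Rightarrow> real) \<Rightarrow> 'a \<times> 'a \<Rightarrow> real" where
  "gagliardo_density s p u z = \<bar>u (fst z) - u (snd z)\<bar> powr p * riesz_kernel s p z"

lemma gagliardo_density_nonneg: "gagliardo_density s p u z \<ge> 0"
  by (simp add: gagliardo_density_def riesz_kernel_nonneg)

lemma gagliardo_density_measurable:
  "u \<in> borel_measurable lebesgue \<Longrightarrow> gagliardo_density s p u \<in> borel_measurable lebesgue"
  unfolding gagliardo_density_def[abs_def]
  by (intro borel_measurable_times powr_real_measurable borel_measurable_abs difference_lebesgue_measurable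
      riesz_kernel_lebesgue_measurable borel_measurable_const)

lemma gagliardo_nn_eq: "gagliardo_nn s p u = (\<integral>\<^sup>+z. ennreal (gagliardo_density s p u z) \<partial>lebesgue)"
  unfolding gagliardo_nn_def gagliardo_density_def by (simp add: nn_integral_completion)

lemma gagliardo_nn_cong_AE:
  assumes "AE x in lebesgue. u x = v x"
  shows "gagliardo_nn s p u = gagliardo_nn s p v"
  unfolding gagliardo_nn_eq
  using AE_lebesgue_fst[OF assms] AE_lebesgue_snd[OF assms]
  by (intro nn_integral_cong_AE) (auto simp: gagliardo_density_def elim!: AE_mp)

lemma lebesgue_ex_borel:
  fixes u :: "'a::euclidean_space \<Rightarrow> real"
  assumes "u \<in> borel_measurable lebesgue"
  obtains v where "v \<in> borel_measurable borel" "AE x in lebesgue. u x = v x"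
  using completion_ex_borel_measurable_real[OF assms] by (auto simp: AE_completion_iff)

lemma powr_sum_le:
  fixes x y :: real
  assumes "p \<ge> 0"
  shows "\<bar>x + y\<bar> powr p \<le> 2 powr p * (\<bar>x\<bar> powr p + \<bar>y\<bar> powr p)"
proof -
  define m where "m = max \<bar>x\<bar> \<bar>y\<bar>"
  have "\<bar>x + y\<bar> powr p \<le> (2 * m) powr p" using assms by (intro powr_mono2) (auto simp: m_def)
  also have "\<dots> = 2 powr p * m powr p" by (simp add: powr_mult m_def)
  also have "m powr p \<le> \<bar>x\<bar> powr p + \<bar>y\<bar> powr p" by (simp add: m_def max_def)
  finally show ?thesis by simp
qed

text \<open>The crude constant \<open>2 powr p\<close> is harmless in approximation arguments, and
  the estimate makes sense before finiteness, hence before a norm is available.\<close>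

lemma gagliardo_nn_add_le:
  assumes "u \<in> borel_measurable lebesgue" "v \<in> borel_measurable lebesgue" "p \<ge> 0"
  shows "gagliardo_nn s p (\<lambda>x. u x + v x) \<le> ennreal (2 powr p) * (gagliardo_nn s p u + gagliardo_nn s p v)"
proof -
  have pw: "gagliardo_density s p (\<lambda>x. u x + v x) z \<le> 2 powr p * (gagliardo_density s p u z + gagliardo_density s p v z)" for z
  proof -
    have "\<bar>u (fst z) + v (fst z) - (u (snd z) + v (snd z))\<bar> powr p
        \<le> 2 powr p * (\<bar>u (fst z) - u (snd z)\<bar> powr p + \<bar>v (fst z) - v (snd z)\<bar> powr p)"
      using powr_sum_le[OF assms(3), of "u (fst z) - u (snd z)" "v (fst z) - v (snd z)"] by (simp add: algebra_simps)
    from mult_right_mono[OF this riesz_kernel_nonneg[of s p z]] show ?thesis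
      unfolding gagliardo_density_def by (simp add: algebra_simps)
  qed
  have "gagliardo_nn s p (\<lambda>x. u x + v x) \<le> (\<integral>\<^sup>+z. ennreal (2 powr p) * (ennreal (gagliardo_density s p u z) + ennreal (gagliardo_density s p v z)) \<partial>lebesgue)"
    unfolding gagliardo_nn_eq
  proof (rule nn_integral_mono)
    fix z
    show "ennreal (gagliardo_density s p (\<lambda>x. u x + v x) z)
        \<le> ennreal (2 powr p) * (ennreal (gagliardo_density s p u z) + ennreal (gagliardo_density s p v z))"
      using ennreal_leI[OF pw[of z]] by (simp add: ennreal_mult ennreal_plus gagliardo_density_nonneg)
  qed
  also have "\<dots> = ennreal (2 powr p) * (gagliardo_nn s p u + gagliardo_nn s p v)"
    unfolding gagliardo_nn_eq
    using gagliardo_density_measurable[OF assms(1), of s p] gagliardo_density_measurable[OF assms(2), of s p]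
    by (simp add: nn_integral_cmult nn_integral_add)
  finally show ?thesis .
qed

lemma gagliardo_nn_scale:
  assumes "u \<in> borel_measurable lebesgue"
  shows "gagliardo_nn s p (\<lambda>x. c * u x) = ennreal (\<bar>c\<bar> powr p) * gagliardo_nn s p u"
proof -
  have "gagliardo_density s p (\<lambda>x. c * u x) z = \<bar>c\<bar> powr p * gagliardo_density s p u z" for z
    unfolding gagliardo_density_def by (simp add: powr_mult abs_mult flip: right_diff_distrib)
  then show ?thesis unfolding gagliardo_nn_eq
    using gagliardo_density_measurable[OF assms] by (simp add: ennreal_mult gagliardo_density_nonneg nn_integral_cmult)
qed

lemma nn_integral_fst_times:
  fixes h :: "'a::euclidean_space \<Rightarrow> ennreal"
  assumes h: "h \<in> borel_measurable lebesgue" and B[measurable]: "B \<in> sets borel"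
  shows "(\<integral>\<^sup>+z. h (fst z) * indicator B (snd z) \<partial>(lebesgue :: ('a \<times> 'a) measure)) = (\<integral>\<^sup>+x. h x \<partial>lebesgue) * emeasure lborel B"
    and "(\<integral>\<^sup>+z. h (snd z) * indicator B (fst z) \<partial>(lebesgue :: ('a \<times> 'a) measure)) = (\<integral>\<^sup>+x. h x \<partial>lebesgue) * emeasure lborel B"
proof -
  obtain g where g[measurable]: "g \<in> borel_measurable borel" and ae: "AE x in lborel. h x = g x"
    using completion_ex_borel_measurable[OF h] by auto
  have ae': "AE x in lebesgue. h x = g x" using ae by (simp add: AE_completion_iff)
  have hg: "(\<integral>\<^sup>+x. h x \<partial>lebesgue) = (\<integral>\<^sup>+x. g x \<partial>lborel)"
    using nn_integral_cong_AE[OF ae'] by (simp add: nn_integral_completion)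
  have "(\<integral>\<^sup>+z. h (fst z) * indicator B (snd z) \<partial>(lebesgue :: ('a \<times> 'a) measure)) = (\<integral>\<^sup>+z. g (fst z) * indicator B (snd z) \<partial>lebesgue)"
    using AE_lebesgue_fst[OF ae'] by (intro nn_integral_cong_AE) (auto elim!: AE_mp)
  also have "\<dots> = (\<integral>\<^sup>+z. g (fst z) * indicator B (snd z) \<partial>(lborel \<Otimes>\<^sub>M lborel))"
    by (simp add: nn_integral_completion lborel_prod)
  also have "\<dots> = (\<integral>\<^sup>+x. \<integral>\<^sup>+y. g x * indicator B y \<partial>lborel \<partial>lborel)"
    by (subst lborel.nn_integral_fst[symmetric]) auto
  also have "\<dots> = (\<integral>\<^sup>+x. g x \<partial>lborel) * emeasure lborel B" by (simp add: nn_integral_cmult nn_integral_multc)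
  finally show "(\<integral>\<^sup>+z. h (fst z) * indicator B (snd z) \<partial>(lebesgue :: ('a \<times> 'a) measure)) = (\<integral>\<^sup>+x. h x \<partial>lebesgue) * emeasure lborel B"
    unfolding hg .
  have "(\<integral>\<^sup>+z. h (snd z) * indicator B (fst z) \<partial>(lebesgue :: ('a \<times> 'a) measure)) = (\<integral>\<^sup>+z. g (snd z) * indicator B (fst z) \<partial>lebesgue)"
    using AE_lebesgue_snd[OF ae'] by (intro nn_integral_cong_AE) (auto elim!: AE_mp)
  also have "\<dots> = (\<integral>\<^sup>+z. g (snd z) * indicator B (fst z) \<partial>(lborel \<Otimes>\<^sub>M lborel))"
    by (simp add: nn_integral_completion lborel_prod)
  also have "\<dots> = (\<integral>\<^sup>+y. \<integral>\<^sup>+x. g y * indicator B x \<partial>lborel \<partial>lborel)"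
    by (subst lborel_pair.nn_integral_snd[symmetric]) auto
  also have "\<dots> = (\<integral>\<^sup>+x. g x \<partial>lborel) * emeasure lborel B" by (simp add: nn_integral_cmult nn_integral_multc)
  finally show "(\<integral>\<^sup>+z. h (snd z) * indicator B (fst z) \<partial>(lebesgue :: ('a \<times> 'a) measure)) = (\<integral>\<^sup>+x. h x \<partial>lebesgue) * emeasure lborel B"
    unfolding hg .
qed

section \<open>Finite energy of test functions\<close>

context bounded_open_set
begin

text \<open>Dyadic decomposition around the singularity and at infinity.\<close>

lemma lipschitz_kernel_bound:
  assumes L: "L \<ge> 0" "M \<ge> 0"
  shows "\<exists>C\<ge>0. \<forall>(\<phi> :: 'a \<Rightarrow> real) x. (\<forall>y. \<bar>\<phi> x - \<phi> y\<bar> \<le> L * norm (x - y) \<and> \<bar>\<phi> y\<bar> \<le> M) \<longrightarrow>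
    (\<integral>\<^sup>+y. ennreal (gagliardo_density s p \<phi> (x, y)) \<partial>lborel) \<le> ennreal C"
proof -
  define n where "n = real DIM('a)"
  define \<omega> where "\<omega> = unit_ball_vol n"
  have n: "n > 0" and \<omega>: "\<omega> \<ge> 0" by (auto simp: n_def \<omega>_def)
  \<comment> \<open>\<open>c1 j\<close> bounds the density where 2^-(j+1) \<le> |x - y| < 2^-j, by
    the Lipschitz bound, and \<open>c2 j\<close> where 2^j \<le> |x - y| < 2^(j+1), by the bound
    \<open>M\<close>. Times the volume of the enclosing ball they are geometric in \<open>j\<close>
    with ratios \<open>\<kappa>1 < 1\<close>, because s < 1, and \<open>\<kappa>2 < 1\<close>,
    because ps > 0.\<close>
  define c1 where "c1 = (\<lambda>j::nat. (L * 2 powr - real j) powr p * 2 powr ((real j + 1) * (n + p * s)))"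
  define c2 where "c2 = (\<lambda>j::nat. (2 * M) powr p * 2 powr - (real j * (n + p * s)))"
  define \<kappa>1 where "\<kappa>1 = 2 powr - (p * (1 - s))"
  define \<kappa>2 where "\<kappa>2 = 2 powr - (p * s)"
  have \<kappa>: "0 < \<kappa>1" "\<kappa>1 < 1" "0 < \<kappa>2" "\<kappa>2 < 1"
    using p s powr_less_cancel_iff[of 2 "- (p * (1 - s))" 0] powr_less_cancel_iff[of 2 "- (p * s)" 0]
    by (auto simp: \<kappa>1_def \<kappa>2_def)
  define d1 where "d1 = L powr p * 2 powr (n + p * s) * \<omega>"
  define d2 where "d2 = (2 * M) powr p * 2 powr n * \<omega>"
  have d: "d1 \<ge> 0" "d2 \<ge> 0" using \<omega> by (auto simp: d1_def d2_def)
  have c1_eq: "c1 j * (\<omega> * (2 powr - real j) ^ DIM('a)) = d1 * \<kappa>1 ^ j" for j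
  proof -
    have 1: "(L * 2 powr - real j) powr p = L powr p * 2 powr (- real j * p)" using L by (simp add: powr_mult powr_powr)
    have 2: "((2::real) powr - real j) ^ DIM('a) = 2 powr (- real j * n)"
      by (simp add: n_def powr_powr flip: powr_realpow)
    have 3: "\<kappa>1 ^ j = 2 powr (- (p * (1 - s)) * real j)" by (simp add: \<kappa>1_def powr_powr flip: powr_realpow)
    have "c1 j * (\<omega> * (2 powr - real j) ^ DIM('a)) = L powr p * \<omega> * (2 powr (- real j * p) * 2 powr ((real j + 1) * (n + p * s)) * 2 powr (- real j * n))"
      unfolding c1_def 1 2 by simp
    also have "2 powr (- real j * p) * 2 powr ((real j + 1) * (n + p * s)) * 2 powr (- real j * n) = (2::real) powr (- real j * p + (real j + 1) * (n + p * s) + - real j * n)"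
      by (simp only: powr_add)
    also have "- real j * p + (real j + 1) * (n + p * s) + - real j * n = (n + p * s) + - (p * (1 - s)) * real j" by (simp add: algebra_simps)
    also have "(2::real) powr \<dots> = 2 powr (n + p * s) * \<kappa>1 ^ j" unfolding 3 by (rule powr_add)
    finally show ?thesis by (simp add: d1_def)
  qed
  have c2_eq: "c2 j * (\<omega> * (2 powr (real j + 1)) ^ DIM('a)) = d2 * \<kappa>2 ^ j" for j
  proof -
    have 2: "((2::real) powr (real j + 1)) ^ DIM('a) = 2 powr ((real j + 1) * n)"
      by (simp add: n_def powr_powr flip: powr_realpow)
    have 3: "\<kappa>2 ^ j = 2 powr (- (p * s) * real j)" by (simp add: \<kappa>2_def powr_powr flip: powr_realpow)
    have "c2 j * (\<omega> * (2 powr (real j + 1)) ^ DIM('a)) = (2 * M) powr p * \<omega> * (2 powr - (real j * (n + p * s)) * 2 powr ((real j + 1) * n))"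
      unfolding c2_def 2 by simp
    also have "2 powr - (real j * (n + p * s)) * 2 powr ((real j + 1) * n) = (2::real) powr (- (real j * (n + p * s)) + (real j + 1) * n)"
      by (simp only: powr_add)
    also have "- (real j * (n + p * s)) + (real j + 1) * n = n + - (p * s) * real j" by (simp add: algebra_simps)
    also have "(2::real) powr \<dots> = 2 powr n * \<kappa>2 ^ j" unfolding 3 by (rule powr_add)
    finally show ?thesis by (simp add: d2_def)
  qed
  define C where "C = d1 / (1 - \<kappa>1) + d2 / (1 - \<kappa>2)"
  have "(\<integral>\<^sup>+y. ennreal (gagliardo_density s p \<phi> (x, y)) \<partial>lborel) \<le> ennreal C"
    if lip: "\<And>y. \<bar>\<phi> x - \<phi> y\<bar> \<le> L * norm (x - y)" "\<And>y. \<bar>\<phi> y\<bar> \<le> M" for \<phi> :: "'a \<Rightarrow> real" and x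
  proof -
    define f1 where "f1 = (\<lambda>j y. ennreal (c1 j) * indicator (ball x (2 powr - real j)) y)"
    define f2 where "f2 = (\<lambda>j y. ennreal (c2 j) * indicator (ball x (2 powr (real j + 1))) y)"
    have [measurable]: "f1 j \<in> borel_measurable lborel" "f2 j \<in> borel_measurable lborel" for j
      unfolding f1_def f2_def
      by ((intro borel_measurable_times_ennreal borel_measurable_const borel_measurable_indicator, simp)+)
    have pw: "ennreal (gagliardo_density s p \<phi> (x, y)) \<le> (\<Sum>j. f1 j y) + (\<Sum>j. f2 j y)" for y
    proof (cases "x = y")
      case True
      then show ?thesis by (simp add: gagliardo_density_def)
    next
      case False
      define v where "v = norm (x - y)"
      have v: "v > 0" using False by (simp add: v_def)
      define k where "k = \<lfloor>log 2 v\<rfloor>"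
      have "2 powr (real_of_int k) \<le> 2 powr (log 2 v)" "2 powr (log 2 v) < 2 powr (real_of_int k + 1)"
        unfolding k_def by (auto intro!: powr_mono powr_less_mono)
      then have k: "2 powr (real_of_int k) \<le> v" "v < 2 powr (real_of_int k + 1)" using v by auto
      have ker: "riesz_kernel s p (x, y) \<le> 2 powr (- (real_of_int k * (n + p * s)))"
      proof -
        have "(2 powr real_of_int k) powr (n + p * s) \<le> v powr (n + p * s)" using k n p s by (intro powr_mono2) auto
        then show ?thesis unfolding riesz_kernel_def fst_conv snd_conv v_def[symmetric] n_def[symmetric] powr_powr powr_minus_divide
          using v by (intro divide_left_mono) auto
      qed
      show ?thesis
      proof (cases "k < 0")
        case True
        \<comment> \<open>Here \<open>k = - (j + 1)\<close>: the negative exponents are renumbered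
          from 0.\<close>
        define j where "j = nat (- k - 1)"
        have j: "real_of_int k = - (real j + 1)" using True by (simp add: j_def)
        have "\<bar>\<phi> x - \<phi> y\<bar> \<le> L * 2 powr - real j"
        proof -
          have "L * v \<le> L * 2 powr - real j" using k(2) L unfolding j by (intro mult_left_mono) auto
          then show ?thesis using lip(1)[of y] unfolding v_def by linarith
        qed
        moreover have "riesz_kernel s p (x, y) \<le> 2 powr ((real j + 1) * (n + p * s))"
          using ker unfolding j by (simp only: mult_minus_left minus_minus)
        ultimately have "gagliardo_density s p \<phi> (x, y) \<le> c1 j"
          unfolding gagliardo_density_def c1_def fst_conv snd_conv using L p riesz_kernel_nonneg
          by (intro mult_mono powr_mono2) auto
        moreover have "y \<in> ball x (2 powr - real j)" using k(2) unfolding j by (simp add: dist_norm v_def)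
        ultimately have "ennreal (gagliardo_density s p \<phi> (x, y)) \<le> (\<Sum>i\<in>{j}. f1 i y)" by (simp add: f1_def ennreal_leI)
        also have "\<dots> \<le> (\<Sum>j. f1 j y)" by (intro sum_le_suminf) auto
        finally show ?thesis by (simp add: add_increasing2)
      next
        case False
        define j where "j = nat k"
        have j: "real_of_int k = real j" using False by (simp add: j_def)
        have "\<bar>\<phi> x - \<phi> y\<bar> \<le> 2 * M" using lip(2)[of x] lip(2)[of y] by linarith
        then have "gagliardo_density s p \<phi> (x, y) \<le> c2 j"
          unfolding gagliardo_density_def c2_def fst_conv snd_conv using ker L p riesz_kernel_nonneg unfolding j
          by (intro mult_mono powr_mono2) auto
        moreover have "y \<in> ball x (2 powr (real j + 1))" using k(2) unfolding j by (simp add: dist_norm v_def)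
        ultimately have "ennreal (gagliardo_density s p \<phi> (x, y)) \<le> (\<Sum>i\<in>{j}. f2 i y)" by (simp add: f2_def ennreal_leI)
        also have "\<dots> \<le> (\<Sum>j. f2 j y)" by (intro sum_le_suminf) auto
        finally show ?thesis by (simp add: add_increasing)
      qed
    qed
    have ball: "emeasure lborel (ball x r) = ennreal (\<omega> * r ^ DIM('a))" if "r > 0" for r
      unfolding \<omega>_def n_def using that by (intro emeasure_ball) simp
    have "(\<integral>\<^sup>+y. ennreal (gagliardo_density s p \<phi> (x, y)) \<partial>lborel) \<le> (\<integral>\<^sup>+y. (\<Sum>j. f1 j y) + (\<Sum>j. f2 j y) \<partial>lborel)"
      by (intro nn_integral_mono pw)
    also have "\<dots> = (\<Sum>j. \<integral>\<^sup>+y. f1 j y \<partial>lborel) + (\<Sum>j. \<integral>\<^sup>+y. f2 j y \<partial>lborel)"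
      by (subst nn_integral_add) (auto simp: nn_integral_suminf)
    also have "(\<lambda>j. \<integral>\<^sup>+y. f1 j y \<partial>lborel) = (\<lambda>j. ennreal (d1 * \<kappa>1 ^ j))"
      unfolding f1_def c1_eq[symmetric] using L \<omega> by (auto simp: nn_integral_cmult_indicator ball c1_def simp flip: ennreal_mult)
    also have "(\<lambda>j. \<integral>\<^sup>+y. f2 j y \<partial>lborel) = (\<lambda>j. ennreal (d2 * \<kappa>2 ^ j))"
      unfolding f2_def c2_eq[symmetric] using L \<omega> by (auto simp: nn_integral_cmult_indicator ball c2_def simp flip: ennreal_mult)
    also have "(\<Sum>j. ennreal (d1 * \<kappa>1 ^ j)) = ennreal (d1 * (1 / (1 - \<kappa>1)))"
      using \<kappa> d by (intro suminf_ennreal_eq sums_mult geometric_sums) auto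
    also have "(\<Sum>j. ennreal (d2 * \<kappa>2 ^ j)) = ennreal (d2 * (1 / (1 - \<kappa>2)))"
      using \<kappa> d by (intro suminf_ennreal_eq sums_mult geometric_sums) auto
    finally show ?thesis using \<kappa> d by (simp add: C_def flip: ennreal_plus)
  qed
  note bound = this
  show ?thesis
  proof (intro exI[of _ C] conjI allI impI)
    show "C \<ge> 0" using d \<kappa> by (simp add: C_def)
    fix \<phi> :: "'a \<Rightarrow> real" and x
    assume lip: "\<forall>y. \<bar>\<phi> x - \<phi> y\<bar> \<le> L * norm (x - y) \<and> \<bar>\<phi> y\<bar> \<le> M"
    show "(\<integral>\<^sup>+y. ennreal (gagliardo_density s p \<phi> (x, y)) \<partial>lborel) \<le> ennreal C"
      by (rule bound) (use lip in blast)+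
  qed
qed

lemma test_functions_borel: "\<phi> \<in> test_functions \<Omega> \<Longrightarrow> \<phi> \<in> borel_measurable borel"
  by (rule borel_measurable_continuous_onI[OF smooth_continuous]) (simp add: test_functions_def)

lemma test_functions_lebesgue: "\<phi> \<in> test_functions \<Omega> \<Longrightarrow> \<phi> \<in> borel_measurable lebesgue"
  using test_functions_borel by (intro measurable_completion) simp

lemma test_functions_outside: "\<phi> \<in> test_functions \<Omega> \<Longrightarrow> x \<notin> \<Omega> \<Longrightarrow> \<phi> x = 0"
  by (elim test_functionsD) blast

text \<open>The bound on the inner integral is uniform, but a constant is not integrable over the
  whole space. As \<phi> vanishes outside \<Omega>, the density lives on pairs with an entry in
  \<Omega>, and by symmetry it suffices to integrate the bound over the bounded set
  \<Omega>.\<close>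

lemma gagliardo_nn_test_finite:
  assumes \<phi>: "\<phi> \<in> test_functions \<Omega>"
  shows "gagliardo_nn s p \<phi> < \<infinity>"
proof -
  obtain L M where LM: "L \<ge> 0" "M \<ge> 0" "\<And>x y. \<bar>\<phi> x - \<phi> y\<bar> \<le> L * norm (x - y)" "\<And>x. \<bar>\<phi> x\<bar> \<le> M"
    using test_functions_lipschitz[OF \<phi>] by blast
  have \<phi>_meas: "\<phi> \<in> borel_measurable borel" using test_functions_borel[OF \<phi>] .
  obtain C where C0: "C \<ge> 0" "\<forall>(\<phi> :: 'a \<Rightarrow> real) x. (\<forall>y. \<bar>\<phi> x - \<phi> y\<bar> \<le> L * norm (x - y) \<and> \<bar>\<phi> y\<bar> \<le> M) \<longrightarrow>
      (\<integral>\<^sup>+y. ennreal (gagliardo_density s p \<phi> (x, y)) \<partial>lborel) \<le> ennreal C"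
    using lipschitz_kernel_bound[OF LM(1,2)] by (elim exE conjE) rule
  have C: "(\<integral>\<^sup>+y. ennreal (gagliardo_density s p \<phi> (x, y)) \<partial>lborel) \<le> ennreal C" for x
    by (rule C0(2)[rule_format]) (simp add: LM)
  let ?g = "\<lambda>z. ennreal (gagliardo_density s p \<phi> z)"
  have "?g \<in> borel_measurable borel" unfolding gagliardo_density_def[abs_def]
    by (intro measurable_compose[OF _ measurable_ennreal] borel_measurable_times powr_real_measurable borel_measurable_abs
        difference_borel_measurable riesz_kernel_measurable borel_measurable_const \<phi>_meas)
  then have g[measurable]: "?g \<in> borel_measurable (lborel \<Otimes>\<^sub>M lborel)" unfolding lborel_prod by simp
  have sym: "?g (x, y) = ?g (y, x)" for x y
    unfolding gagliardo_density_def riesz_kernel_def by (simp add: abs_minus_commute norm_minus_commute)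
  have le: "?g z \<le> indicator \<Omega> (fst z) * ?g z + indicator \<Omega> (snd z) * ?g z" for z
    using test_functions_outside[OF \<phi>] by (cases "fst z \<in> \<Omega>"; cases "snd z \<in> \<Omega>") (auto simp: gagliardo_density_def)
  have "gagliardo_nn s p \<phi> = (\<integral>\<^sup>+z. ?g z \<partial>(lborel \<Otimes>\<^sub>M lborel))"
    unfolding gagliardo_nn_def gagliardo_density_def lborel_prod ..
  also have "\<dots> \<le> (\<integral>\<^sup>+z. indicator \<Omega> (fst z) * ?g z + indicator \<Omega> (snd z) * ?g z \<partial>(lborel \<Otimes>\<^sub>M lborel))"
    by (intro nn_integral_mono le)
  also have "\<dots> = (\<integral>\<^sup>+z. indicator \<Omega> (fst z) * ?g z \<partial>(lborel \<Otimes>\<^sub>M lborel)) + (\<integral>\<^sup>+z. indicator \<Omega> (snd z) * ?g z \<partial>(lborel \<Otimes>\<^sub>M lborel))"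
    by (intro nn_integral_add) auto
  also have "(\<integral>\<^sup>+z. indicator \<Omega> (fst z) * ?g z \<partial>(lborel \<Otimes>\<^sub>M lborel)) = (\<integral>\<^sup>+x. \<integral>\<^sup>+y. indicator \<Omega> x * ?g (x, y) \<partial>lborel \<partial>lborel)"
    by (subst lborel.nn_integral_fst[symmetric]) auto
  also have "(\<integral>\<^sup>+z. indicator \<Omega> (snd z) * ?g z \<partial>(lborel \<Otimes>\<^sub>M lborel)) = (\<integral>\<^sup>+y. \<integral>\<^sup>+x. indicator \<Omega> y * ?g (x, y) \<partial>lborel \<partial>lborel)"
    by (subst lborel_pair.nn_integral_snd[symmetric]) auto
  also have "(\<integral>\<^sup>+y. \<integral>\<^sup>+x. indicator \<Omega> y * ?g (x, y) \<partial>lborel \<partial>lborel) = (\<integral>\<^sup>+x. \<integral>\<^sup>+y. indicator \<Omega> x * ?g (x, y) \<partial>lborel \<partial>lborel)"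
    by (simp add: sym)
  also have "(\<integral>\<^sup>+x. \<integral>\<^sup>+y. indicator \<Omega> x * ?g (x, y) \<partial>lborel \<partial>lborel) \<le> (\<integral>\<^sup>+x. ennreal C * indicator \<Omega> x \<partial>lborel)"
    using C by (intro nn_integral_mono) (auto split: split_indicator)
  also have "\<dots> = ennreal C * emeasure lborel \<Omega>" by (simp add: nn_integral_cmult_indicator)
  finally have "gagliardo_nn s p \<phi> \<le> ennreal C * emeasure lborel \<Omega> + ennreal C * emeasure lborel \<Omega>"
    by (meson add_mono order_trans)
  also have "\<dots> < \<infinity>" using emeasure_\<Omega> by (simp add: ennreal_mult_less_top)
  finally show ?thesis .
qed

end


section \<open>The closure of the test functions\<close>

context bounded_open_set
begin

definition vanishing :: "('a \<Rightarrow> real) \<Rightarrow> bool" where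
  "vanishing u \<longleftrightarrow> u \<in> borel_measurable lebesgue \<and> (AE x in lebesgue. x \<notin> \<Omega> \<longrightarrow> u x = 0)"

lemma vanishing_measurable: "vanishing u \<Longrightarrow> u \<in> borel_measurable lebesgue"
  by (simp add: vanishing_def)

lemma vanishing_test: "\<phi> \<in> test_functions \<Omega> \<Longrightarrow> vanishing \<phi>"
  by (simp add: vanishing_def test_functions_lebesgue test_functions_outside)

lemma vanishing_add: "vanishing u \<Longrightarrow> vanishing v \<Longrightarrow> vanishing (\<lambda>x. u x + v x)"
  unfolding vanishing_def by (auto elim!: AE_mp)

lemma vanishing_scale: "vanishing u \<Longrightarrow> vanishing (\<lambda>x. c * u x)"
  unfolding vanishing_def by (auto elim!: AE_mp)

lemma vanishing_diff: "vanishing u \<Longrightarrow> vanishing v \<Longrightarrow> vanishing (\<lambda>x. u x - v x)"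
  using vanishing_add[OF _ vanishing_scale[of v "-1"], of u] by simp

text \<open>Homogeneity reduces the claim to energy at most 1 by passing to \<open>u / t\<close>.
  Stating the hypothesis as a bound by \<open>t powr p\<close> admits \<open>t = 0\<close>, which
  later identifies the functions of zero energy.\<close>

lemma sobolev_scaled:
  assumes m: "0 < m" "m < real DIM('a) * p / (real DIM('a) - p * s)"
  shows "\<exists>C>0. \<forall>u t. vanishing u \<longrightarrow> t \<ge> 0 \<longrightarrow> gagliardo_nn s p u \<le> ennreal (t powr p) \<longrightarrow>
    (\<integral>\<^sup>+x. ennreal (\<bar>u x\<bar> powr m) \<partial>lebesgue) \<le> ennreal (C * t powr m)"
proof -
  obtain C where C: "C > 0" and bd: "\<And>u. admissible u \<Longrightarrow> (\<integral>\<^sup>+x. ennreal (\<bar>u x\<bar> powr m) \<partial>lborel) \<le> ennreal C"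
    using sobolev_bound[of m] m by auto
  have pos: "(\<integral>\<^sup>+x. ennreal (\<bar>u x\<bar> powr m) \<partial>lebesgue) \<le> ennreal (C * t powr m)"
    if u: "vanishing u" and t: "t > 0" and E: "gagliardo_nn s p u \<le> ennreal (t powr p)" for u t
  proof -
    obtain v where v: "v \<in> borel_measurable borel" "AE x in lebesgue. u x = v x"
      using lebesgue_ex_borel[OF vanishing_measurable[OF u]] by blast
    define w where "w = (\<lambda>x. (1 / t) * v x)"
    have vl: "v \<in> borel_measurable lebesgue" using v(1) by (intro measurable_completion) simp
    have "admissible w"
      unfolding admissible_def
    proof (intro conjI)
      show "w \<in> borel_measurable borel" using v(1) unfolding w_def by (intro borel_measurable_times borel_measurable_const)
      have "AE x in lebesgue. x \<notin> \<Omega> \<longrightarrow> w x = 0" using u v(2) unfolding vanishing_def w_def by (auto elim!: AE_mp)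
      then show "AE x in lborel. x \<notin> \<Omega> \<longrightarrow> w x = 0" by (simp add: AE_completion_iff)
      have "gagliardo_nn s p w = ennreal (\<bar>1 / t\<bar> powr p) * gagliardo_nn s p u"
        unfolding w_def gagliardo_nn_scale[OF vl] gagliardo_nn_cong_AE[OF v(2)] ..
      also have "\<dots> \<le> ennreal (\<bar>1 / t\<bar> powr p) * ennreal (t powr p)" using E by (intro mult_left_mono) auto
      also have "\<dots> = 1" using t by (simp add: powr_divide flip: ennreal_mult)
      finally show "gagliardo_nn s p w \<le> 1" .
    qed
    from bd[OF this] have w: "(\<integral>\<^sup>+x. ennreal (\<bar>w x\<bar> powr m) \<partial>lebesgue) \<le> ennreal C" by (simp add: nn_integral_completion)
    have "(\<integral>\<^sup>+x. ennreal (\<bar>u x\<bar> powr m) \<partial>lebesgue) = (\<integral>\<^sup>+x. ennreal (t powr m) * ennreal (\<bar>w x\<bar> powr m) \<partial>lebesgue)"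
    proof (rule nn_integral_cong_AE)
      have "\<bar>v x\<bar> powr m = t powr m * \<bar>w x\<bar> powr m" for x
        unfolding w_def using t by (simp add: abs_mult flip: powr_mult)
      then have "ennreal (\<bar>v x\<bar> powr m) = ennreal (t powr m) * ennreal (\<bar>w x\<bar> powr m)" for x by (simp add: ennreal_mult)
      then show "AE x in lebesgue. ennreal (\<bar>u x\<bar> powr m) = ennreal (t powr m) * ennreal (\<bar>w x\<bar> powr m)"
        using v(2) by (auto elim!: AE_mp)
    qed
    also have "\<dots> = ennreal (t powr m) * (\<integral>\<^sup>+x. ennreal (\<bar>w x\<bar> powr m) \<partial>lebesgue)"
      using vl unfolding w_def by (intro nn_integral_cmult) measurable
    also have "\<dots> \<le> ennreal (t powr m) * ennreal C" using w by (intro mult_left_mono) auto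
    finally show ?thesis using C by (simp add: mult.commute flip: ennreal_mult)
  qed
  have bound: "(\<integral>\<^sup>+x. ennreal (\<bar>u x\<bar> powr m) \<partial>lebesgue) \<le> ennreal (C * t powr m)"
    if u: "vanishing u" and t: "t \<ge> 0" and E: "gagliardo_nn s p u \<le> ennreal (t powr p)" for u t
  proof (cases "t = 0")
    case True
    \<comment> \<open>For \<open>t = 0\<close> every positive \<tau> gives an admissible bound, so
      the integral is below every positive number.\<close>
    have eps: "(\<integral>\<^sup>+x. ennreal (\<bar>u x\<bar> powr m) \<partial>lebesgue) \<le> 0 + ennreal e" if e: "e > 0" for e
    proof -
      define \<tau> where "\<tau> = (e / C) powr (1 / m)"
      have "\<tau> > 0" using e C by (simp add: \<tau>_def)
      moreover have "gagliardo_nn s p u \<le> ennreal (\<tau> powr p)" using E True by (metis ennreal_0 le_zero_eq powr_0 zero_le)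
      ultimately have "(\<integral>\<^sup>+x. ennreal (\<bar>u x\<bar> powr m) \<partial>lebesgue) \<le> ennreal (C * \<tau> powr m)" by (rule pos[OF u])
      also have "C * \<tau> powr m = e" using e C m by (simp add: \<tau>_def powr_powr)
      finally show ?thesis by simp
    qed
    have "(\<integral>\<^sup>+x. ennreal (\<bar>u x\<bar> powr m) \<partial>lebesgue) \<le> 0" by (rule ennreal_le_epsilon) (rule eps)
    then show ?thesis by simp
  next
    case False
    then show ?thesis using pos[OF u _ E] t by simp
  qed
  show ?thesis by (intro exI[of _ C] conjI allI impI C) (rule bound)
qed

lemma p_subcritical: "p < real DIM('a) * p / (real DIM('a) - p * s)"
proof -
  have "p * (real DIM('a) - p * s) < real DIM('a) * p" using p s by (simp add: algebra_simps)
  then show ?thesis using subcritical by (simp add: pos_less_divide_eq)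
qed

text \<open>The instance \<open>t = 0\<close> of the Sobolev inequality: zero energy forces a zero
  L^p norm.\<close>

lemma gagliardo_nn_zero_iff:
  assumes u: "vanishing u"
  shows "gagliardo_nn s p u = 0 \<longleftrightarrow> (AE x in lebesgue. u x = 0)"
proof
  assume E: "gagliardo_nn s p u = 0"
  obtain C where "(\<integral>\<^sup>+x. ennreal (\<bar>u x\<bar> powr p) \<partial>lebesgue) \<le> ennreal (C * 0 powr p)"
    using sobolev_scaled[OF _ p_subcritical] u E p by force
  then have "(\<integral>\<^sup>+x. ennreal (\<bar>u x\<bar> powr p) \<partial>lebesgue) = 0" by simp
  moreover have "(\<lambda>x. ennreal (\<bar>u x\<bar> powr p)) \<in> borel_measurable lebesgue"
    using vanishing_measurable[OF u] by measurable
  ultimately have "AE x in lebesgue. ennreal (\<bar>u x\<bar> powr p) = 0" by (simp add: nn_integral_0_iff_AE)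
  then show "AE x in lebesgue. u x = 0" by (rule AE_mp) (auto simp: ennreal_eq_0_iff)
next
  assume "AE x in lebesgue. u x = 0"
  then have "gagliardo_nn s p u = gagliardo_nn s p (\<lambda>x::'a. 0)" by (intro gagliardo_nn_cong_AE) simp
  then show "gagliardo_nn s p u = 0" by (simp add: gagliardo_nn_def)
qed

text \<open>The working description of \<open>X0_space\<close>: vanishing outside \<Omega> is made
  explicit, and the closure is taken with respect to the energy over all pairs alone.
  \<open>X0_space_eq\<close> shows that the two sets agree.\<close>

definition closure_space :: "('a \<Rightarrow> real) set" where
  "closure_space = {u. vanishing u \<and> (\<forall>\<epsilon>>0. \<exists>\<phi>\<in>test_functions \<Omega>. gagliardo_nn s p (\<lambda>x. u x - \<phi> x) < ennreal \<epsilon>)}"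

lemma closure_spaceD: "u \<in> closure_space \<Longrightarrow> vanishing u"
  by (simp add: closure_space_def)

lemma closure_spaceE:
  assumes "u \<in> closure_space" "\<epsilon> > 0"
  obtains \<phi> where "\<phi> \<in> test_functions \<Omega>" "gagliardo_nn s p (\<lambda>x. u x - \<phi> x) < ennreal \<epsilon>"
  using assms unfolding closure_space_def by auto

lemma closure_space_finite:
  assumes "u \<in> closure_space"
  shows "gagliardo_nn s p u < \<infinity>"
proof -
  obtain \<phi> where \<phi>: "\<phi> \<in> test_functions \<Omega>" "gagliardo_nn s p (\<lambda>x. u x - \<phi> x) < ennreal 1"
    using closure_spaceE[OF assms zero_less_one] .
  have u: "u \<in> borel_measurable lebesgue" using vanishing_measurable[OF closure_spaceD[OF assms]] .
  have "gagliardo_nn s p (\<lambda>x. (u x - \<phi> x) + \<phi> x) \<le> ennreal (2 powr p) * (gagliardo_nn s p (\<lambda>x. u x - \<phi> x) + gagliardo_nn s p \<phi>)"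
    using u test_functions_lebesgue[OF \<phi>(1)] p by (intro gagliardo_nn_add_le borel_measurable_diff) auto
  also have "\<dots> < \<infinity>" using \<phi>(2) gagliardo_nn_test_finite[OF \<phi>(1)]
    by (simp add: ennreal_mult_less_top less_top order.strict_trans[OF \<phi>(2)])
  finally show ?thesis by simp
qed

lemma test_functions_closure_space: "\<phi> \<in> test_functions \<Omega> \<Longrightarrow> \<phi> \<in> closure_space"
  unfolding closure_space_def using vanishing_test by (auto simp: gagliardo_nn_def intro!: bexI[of _ \<phi>])

lemma closure_space_add:
  assumes u: "u \<in> closure_space" and v: "v \<in> closure_space"
  shows "(\<lambda>x. u x + v x) \<in> closure_space"
  unfolding closure_space_def
proof (intro CollectI conjI allI impI)
  show "vanishing (\<lambda>x. u x + v x)" using closure_spaceD[OF u] closure_spaceD[OF v] by (rule vanishing_add)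
  fix \<epsilon> :: real assume "\<epsilon> > 0"
  define e where "e = \<epsilon> / (2 * 2 powr p)"
  have e: "e > 0" using \<open>\<epsilon> > 0\<close> by (simp add: e_def)
  obtain \<phi> where \<phi>: "\<phi> \<in> test_functions \<Omega>" "gagliardo_nn s p (\<lambda>x. u x - \<phi> x) < ennreal e"
    using closure_spaceE[OF u e] .
  obtain \<psi> where \<psi>: "\<psi> \<in> test_functions \<Omega>" "gagliardo_nn s p (\<lambda>x. v x - \<psi> x) < ennreal e"
    using closure_spaceE[OF v e] .
  have "gagliardo_nn s p (\<lambda>x. (u x - \<phi> x) + (v x - \<psi> x))
      \<le> ennreal (2 powr p) * (gagliardo_nn s p (\<lambda>x. u x - \<phi> x) + gagliardo_nn s p (\<lambda>x. v x - \<psi> x))"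
    using vanishing_measurable[OF closure_spaceD[OF u]] vanishing_measurable[OF closure_spaceD[OF v]]
      test_functions_lebesgue[OF \<phi>(1)] test_functions_lebesgue[OF \<psi>(1)] p
    by (intro gagliardo_nn_add_le borel_measurable_diff) auto
  also have "\<dots> < ennreal (2 powr p) * (ennreal e + ennreal e)"
    using \<phi>(2) \<psi>(2) by (intro ennreal_mult_strict_left_mono add_strict_mono) auto
  also have "\<dots> = ennreal \<epsilon>" using e by (simp add: e_def flip: ennreal_plus ennreal_mult)
  finally have "gagliardo_nn s p (\<lambda>x. u x + v x - (\<phi> x + \<psi> x)) < ennreal \<epsilon>" by (simp add: algebra_simps)
  then show "\<exists>\<phi>\<in>test_functions \<Omega>. gagliardo_nn s p (\<lambda>x. u x + v x - \<phi> x) < ennreal \<epsilon>"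
    by (intro bexI[of _ "\<lambda>x. \<phi> x + \<psi> x"] test_functions_add[OF \<phi>(1) \<psi>(1)])
qed

lemma closure_space_scale:
  assumes u: "u \<in> closure_space"
  shows "(\<lambda>x. c * u x) \<in> closure_space"
  unfolding closure_space_def
proof (intro CollectI conjI allI impI)
  show "vanishing (\<lambda>x. c * u x)" using closure_spaceD[OF u] by (rule vanishing_scale)
  fix \<epsilon> :: real assume "\<epsilon> > 0"
  define e where "e = \<epsilon> / (\<bar>c\<bar> powr p + 1)"
  have c1: "\<bar>c\<bar> powr p + 1 > 0" by (simp add: add_nonneg_pos)
  have e: "e > 0" using \<open>\<epsilon> > 0\<close> c1 by (simp add: e_def)
  obtain \<phi> where \<phi>: "\<phi> \<in> test_functions \<Omega>" "gagliardo_nn s p (\<lambda>x. u x - \<phi> x) < ennreal e"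
    using closure_spaceE[OF u e] .
  have "gagliardo_nn s p (\<lambda>x. c * (u x - \<phi> x)) = ennreal (\<bar>c\<bar> powr p) * gagliardo_nn s p (\<lambda>x. u x - \<phi> x)"
    using vanishing_measurable[OF closure_spaceD[OF u]] test_functions_lebesgue[OF \<phi>(1)]
    by (intro gagliardo_nn_scale borel_measurable_diff)
  also have "\<dots> \<le> ennreal (\<bar>c\<bar> powr p) * ennreal e" using \<phi>(2) by (intro mult_left_mono) (auto intro: less_imp_le)
  also have "\<dots> = ennreal (\<bar>c\<bar> powr p * e)" using e by (simp add: ennreal_mult)
  also have "\<dots> < ennreal ((\<bar>c\<bar> powr p + 1) * e)" using e c1 by (intro ennreal_lessI mult_pos_pos mult_strict_right_mono) auto
  also have "(\<bar>c\<bar> powr p + 1) * e = \<epsilon>"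
  proof -
    have "y * (\<epsilon> / y) = \<epsilon>" if "y > 0" for y :: real using that by simp
    from this[OF c1] show ?thesis unfolding e_def .
  qed
  finally have "gagliardo_nn s p (\<lambda>x. c * u x - c * \<phi> x) < ennreal \<epsilon>" by (simp add: right_diff_distrib)
  then show "\<exists>\<phi>\<in>test_functions \<Omega>. gagliardo_nn s p (\<lambda>x. c * u x - \<phi> x) < ennreal \<epsilon>"
    by (intro bexI[of _ "\<lambda>x. c * \<phi> x"] test_functions_scale[OF \<phi>(1)])
qed

section \<open>Comparison with X and its norm\<close>

lemma Qset_complement_density:
  assumes "vanishing u"
  shows "AE z in lebesgue. z \<notin> Qset \<Omega> \<longrightarrow> u (fst z) - u (snd z) = 0"
proof -
  have "AE x in lebesgue. x \<notin> \<Omega> \<longrightarrow> u x = 0" using assms by (simp add: vanishing_def)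
  from AE_lebesgue_fst[OF this] AE_lebesgue_snd[OF this] show ?thesis
    by eventually_elim (auto simp: Qset_def mem_Times_iff)
qed

lemma gagliardo_integrand:
  fixes z :: "'a \<times> 'a"
  shows "\<bar>u (fst z) - u (snd z)\<bar> powr p / norm (fst z - snd z) powr (real DIM('a) + p * s) = gagliardo_density s p u z"
  by (simp add: gagliardo_density_def riesz_kernel_def)

lemma Qset_measurable: "Qset \<Omega> \<in> sets lebesgue"
proof -
  have "Qset \<Omega> \<in> sets (borel :: ('a \<times> 'a) measure)"
    unfolding Qset_def using open_\<Omega> by (intro sets.Diff borel_closed closed_Times) (auto simp: closed_def Compl_eq_Diff_UNIV[symmetric])
  then show ?thesis by simp
qed

lemma gagliardo_eq:
  assumes "vanishing u"
  shows "gagliardo s p \<Omega> u = (LINT z|lebesgue. gagliardo_density s p u z)"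
    and "gagliardo s p \<Omega> u = enn2real (gagliardo_nn s p u)"
proof -
  have m: "gagliardo_density s p u \<in> borel_measurable lebesgue"
    using gagliardo_density_measurable[OF vanishing_measurable[OF assms]] .
  show 1: "gagliardo s p \<Omega> u = (LINT z|lebesgue. gagliardo_density s p u z)"
    unfolding gagliardo_def set_lebesgue_integral_def gagliardo_integrand
  proof (rule integral_cong_AE)
    show "(\<lambda>z. indicat_real (Qset \<Omega>) z *\<^sub>R gagliardo_density s p u z) \<in> borel_measurable lebesgue"
      using m Qset_measurable by (intro borel_measurable_scaleR borel_measurable_indicator)
    show "AE z in lebesgue. indicat_real (Qset \<Omega>) z *\<^sub>R gagliardo_density s p u z = gagliardo_density s p u z"
      using Qset_complement_density[OF assms] by eventually_elim (auto simp: gagliardo_density_def split: split_indicator)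
  qed (rule m)
  show "gagliardo s p \<Omega> u = enn2real (gagliardo_nn s p u)"
    unfolding 1 gagliardo_nn_eq by (rule integral_eq_nn_integral[OF m AE_I2[OF gagliardo_density_nonneg]])
qed

lemma gagliardo_density_integrable:
  assumes "vanishing u" "gagliardo_nn s p u < \<infinity>"
  shows "integrable lebesgue (gagliardo_density s p u)"
  by (rule integrableI_nonneg[OF gagliardo_density_measurable[OF vanishing_measurable[OF assms(1)]]
        AE_I2[OF gagliardo_density_nonneg] assms(2)[unfolded gagliardo_nn_eq]])

text \<open>The p-th power of the norm of X, extended-valued, so that for measurable functions
  membership in \<open>X_space\<close> is finiteness of one quantity.\<close>

definition X_nn :: "('a \<Rightarrow> real) \<Rightarrow> ennreal" where
  "X_nn u = (\<integral>\<^sup>+x. ennreal (\<bar>u x\<bar> powr p) * indicator \<Omega> x \<partial>lebesgue)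
    + (\<integral>\<^sup>+z. ennreal (gagliardo_density s p u z) * indicator (Qset \<Omega>) z \<partial>lebesgue)"

lemma X_space_iff: "u \<in> X_space s p \<Omega> \<longleftrightarrow> u \<in> borel_measurable lebesgue \<and> X_nn u < \<infinity>"
  and X_norm_eq: "u \<in> X_space s p \<Omega> \<Longrightarrow> X_nn u = ennreal (X_norm s p \<Omega> u powr p)"
proof -
  have *: "set_integrable M S f \<longleftrightarrow> (\<integral>\<^sup>+x. ennreal (f x) * indicator S x \<partial>M) < \<infinity>"
    "set_integrable M S f \<Longrightarrow> (\<integral>\<^sup>+x. ennreal (f x) * indicator S x \<partial>M) = ennreal (LINT x:S|M. f x)"
    if "f \<in> borel_measurable M" "S \<in> sets M" "\<And>x. f x \<ge> 0" for M :: "'b measure" and f :: "'b \<Rightarrow> real" and S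
  proof -
    have m: "(\<lambda>x. indicat_real S x *\<^sub>R f x) \<in> borel_measurable M" using that by (intro borel_measurable_scaleR borel_measurable_indicator)
    have eq: "ennreal (indicat_real S x *\<^sub>R f x) = ennreal (f x) * indicator S x" for x by (simp split: split_indicator)
    have nn: "0 \<le> indicat_real S x *\<^sub>R f x" for x using that by simp
    show "set_integrable M S f \<longleftrightarrow> (\<integral>\<^sup>+x. ennreal (f x) * indicator S x \<partial>M) < \<infinity>"
      unfolding set_integrable_def integrable_iff_bounded eq[symmetric] using m nn by simp
    show "set_integrable M S f \<Longrightarrow> (\<integral>\<^sup>+x. ennreal (f x) * indicator S x \<partial>M) = ennreal (LINT x:S|M. f x)"
      unfolding set_integrable_def set_lebesgue_integral_def eq[symmetric] using nn by (intro nn_integral_eq_integral) auto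
  qed
  have dens: "\<bar>(u (fst z) - u (snd z)) / norm (fst z - snd z) powr (real DIM('a) / p + s)\<bar> powr p = gagliardo_density s p u z" for u :: "'a \<Rightarrow> real" and z
  proof -
    have "\<bar>(u (fst z) - u (snd z)) / norm (fst z - snd z) powr (real DIM('a) / p + s)\<bar> powr p
        = \<bar>u (fst z) - u (snd z)\<bar> powr p / norm (fst z - snd z) powr ((real DIM('a) / p + s) * p)"
      by (simp add: powr_divide powr_powr)
    also have "(real DIM('a) / p + s) * p = real DIM('a) + p * s" using p by (simp add: field_simps)
    finally show ?thesis unfolding gagliardo_integrand .
  qed
  have meas: "(\<lambda>x. \<bar>u x\<bar> powr p) \<in> borel_measurable lebesgue" "gagliardo_density s p u \<in> borel_measurable lebesgue"
    if "u \<in> borel_measurable lebesgue" for u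
    using that gagliardo_density_measurable by (auto intro: powr_real_measurable borel_measurable_abs)
  have I: "u \<in> X_space s p \<Omega> \<longleftrightarrow> u \<in> borel_measurable lebesgue \<and> set_integrable lebesgue \<Omega> (\<lambda>x. \<bar>u x\<bar> powr p) \<and> set_integrable lebesgue (Qset \<Omega>) (gagliardo_density s p u)" for u
  proof -
    have "set_borel_measurable lebesgue \<Omega> u" "set_borel_measurable lebesgue (Qset \<Omega>)
        (\<lambda>z. (u (fst z) - u (snd z)) / norm (fst z - snd z) powr (real DIM('a) / p + s))" if u: "u \<in> borel_measurable lebesgue"
    proof -
      show "set_borel_measurable lebesgue \<Omega> u" unfolding set_borel_measurable_def
        using u by (intro borel_measurable_scaleR borel_measurable_indicator) auto
      have "(\<lambda>z::'a \<times> 'a. norm (fst z - snd z)) \<in> borel_measurable borel"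
        by (intro borel_measurable_continuous_onI continuous_intros)
      then have "(\<lambda>z::'a \<times> 'a. norm (fst z - snd z)) \<in> borel_measurable lebesgue" by (intro measurable_completion) simp
      then show "set_borel_measurable lebesgue (Qset \<Omega>)
        (\<lambda>z. (u (fst z) - u (snd z)) / norm (fst z - snd z) powr (real DIM('a) / p + s))"
        unfolding set_borel_measurable_def using difference_lebesgue_measurable[OF u] Qset_measurable
        by (intro borel_measurable_scaleR borel_measurable_indicator borel_measurable_divide powr_real_measurable borel_measurable_const)
    qed
    then show ?thesis unfolding X_space_def Lp_on_def mem_Collect_eq dens by blast
  qed
  show iff: "u \<in> X_space s p \<Omega> \<longleftrightarrow> u \<in> borel_measurable lebesgue \<and> X_nn u < \<infinity>"
    unfolding I X_nn_def ennreal_add_less_top infinity_ennreal_def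
    using *(1)[OF meas(1), of u \<Omega>] *(1)[OF meas(2) Qset_measurable gagliardo_density_nonneg, of u] by auto
  show "u \<in> X_space s p \<Omega> \<Longrightarrow> X_nn u = ennreal (X_norm s p \<Omega> u powr p)"
  proof -
    assume u: "u \<in> X_space s p \<Omega>"
    then have u': "u \<in> borel_measurable lebesgue" "set_integrable lebesgue \<Omega> (\<lambda>x. \<bar>u x\<bar> powr p)" "set_integrable lebesgue (Qset \<Omega>) (gagliardo_density s p u)"
      using I by auto
    have nn1: "(LINT x:\<Omega>|lebesgue. \<bar>u x\<bar> powr p) \<ge> 0"
      unfolding set_lebesgue_integral_def by (rule Bochner_Integration.integral_nonneg) simp
    have nn2: "gagliardo s p \<Omega> u \<ge> 0"
      unfolding gagliardo_def gagliardo_integrand set_lebesgue_integral_def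
      by (rule Bochner_Integration.integral_nonneg, rule scaleR_nonneg_nonneg) (simp_all add: gagliardo_density_nonneg)
    note nn = nn1 nn2
    have "X_nn u = ennreal (LINT x:\<Omega>|lebesgue. \<bar>u x\<bar> powr p) + ennreal (gagliardo s p \<Omega> u)"
      unfolding X_nn_def gagliardo_def gagliardo_integrand
      using *(2)[OF meas(1)[OF u'(1)] _ _ u'(2)] *(2)[OF meas(2)[OF u'(1)] Qset_measurable gagliardo_density_nonneg u'(3)] by simp
    also have "\<dots> = ennreal (X_norm s p \<Omega> u powr p)"
      unfolding X_norm_def using nn p by (simp add: powr_powr flip: ennreal_plus)
    finally show ?thesis .
  qed
qed

lemma X_nn_vanishing:
  assumes "vanishing u"
  shows "X_nn u = (\<integral>\<^sup>+x. ennreal (\<bar>u x\<bar> powr p) \<partial>lebesgue) + gagliardo_nn s p u"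
proof -
  have "AE x in lebesgue. x \<notin> \<Omega> \<longrightarrow> u x = 0" using assms by (simp add: vanishing_def)
  then have "(\<integral>\<^sup>+x. ennreal (\<bar>u x\<bar> powr p) * indicator \<Omega> x \<partial>lebesgue) = (\<integral>\<^sup>+x. ennreal (\<bar>u x\<bar> powr p) \<partial>lebesgue)"
    by (intro nn_integral_cong_AE) (auto elim!: AE_mp split: split_indicator)
  moreover have "(\<integral>\<^sup>+z. ennreal (gagliardo_density s p u z) * indicator (Qset \<Omega>) z \<partial>lebesgue) = gagliardo_nn s p u"
    unfolding gagliardo_nn_eq using Qset_complement_density[OF assms]
    by (intro nn_integral_cong_AE) (auto simp: gagliardo_density_def elim!: AE_mp split: split_indicator)
  ultimately show ?thesis unfolding X_nn_def by simp
qed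

lemma X_space_add:
  assumes "u \<in> X_space s p \<Omega>" "v \<in> X_space s p \<Omega>"
  shows "(\<lambda>x. u x + v x) \<in> X_space s p \<Omega>"
proof -
  have m: "u \<in> borel_measurable lebesgue" "v \<in> borel_measurable lebesgue" "X_nn u < \<infinity>" "X_nn v < \<infinity>"
    using assms by (auto simp: X_space_iff)
  have sum_finite: "(\<integral>\<^sup>+x. ennreal (h x) * indicator S x \<partial>M) < \<infinity>"
    if "\<And>x. h x \<le> 2 powr p * (f x + g x)" "\<And>x. 0 \<le> f x" "\<And>x. 0 \<le> g x" "f \<in> borel_measurable M" "g \<in> borel_measurable M" "S \<in> sets M"
      "(\<integral>\<^sup>+x. ennreal (f x) * indicator S x \<partial>M) < \<infinity>" "(\<integral>\<^sup>+x. ennreal (g x) * indicator S x \<partial>M) < \<infinity>"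
    for h f g :: "'b \<Rightarrow> real" and S and M :: "'b measure"
  proof -
    note [measurable] = that(4-6)
    have "(\<integral>\<^sup>+x. ennreal (h x) * indicator S x \<partial>M) \<le> (\<integral>\<^sup>+x. ennreal (2 powr p) * (ennreal (f x) * indicator S x + ennreal (g x) * indicator S x) \<partial>M)"
    proof (rule nn_integral_mono)
      fix x
      show "ennreal (h x) * indicator S x \<le> ennreal (2 powr p) * (ennreal (f x) * indicator S x + ennreal (g x) * indicator S x)"
        using ennreal_leI[OF that(1)[of x]] by (simp add: ennreal_mult ennreal_plus that(2,3) split: split_indicator)
    qed
    also have "\<dots> = ennreal (2 powr p) * ((\<integral>\<^sup>+x. ennreal (f x) * indicator S x \<partial>M) + (\<integral>\<^sup>+x. ennreal (g x) * indicator S x \<partial>M))"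
      by (simp add: nn_integral_cmult nn_integral_add)
    also have "\<dots> < \<infinity>" using that(7,8) by (simp add: ennreal_mult_less_top)
    finally show ?thesis .
  qed
  have dens: "gagliardo_density s p (\<lambda>x. u x + v x) z \<le> 2 powr p * (gagliardo_density s p u z + gagliardo_density s p v z)" for z
  proof -
    have "\<bar>u (fst z) + v (fst z) - (u (snd z) + v (snd z))\<bar> powr p
        \<le> 2 powr p * (\<bar>u (fst z) - u (snd z)\<bar> powr p + \<bar>v (fst z) - v (snd z)\<bar> powr p)"
      using powr_sum_le[of p "u (fst z) - u (snd z)" "v (fst z) - v (snd z)"] p by (simp add: algebra_simps)
    from mult_right_mono[OF this riesz_kernel_nonneg[of s p z]] show ?thesis
      unfolding gagliardo_density_def by (simp add: algebra_simps)
  qed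
  have fin: "(\<integral>\<^sup>+x. ennreal (\<bar>w x\<bar> powr p) * indicator \<Omega> x \<partial>lebesgue) < \<infinity>"
    "(\<integral>\<^sup>+z. ennreal (gagliardo_density s p w z) * indicator (Qset \<Omega>) z \<partial>lebesgue) < \<infinity>" if "X_nn w < \<infinity>" for w
    using that by (simp_all add: X_nn_def)
  have pm: "(\<lambda>x. \<bar>w x\<bar> powr p) \<in> borel_measurable lebesgue" if "w \<in> borel_measurable lebesgue" for w :: "'a \<Rightarrow> real"
    using that by measurable
  have p0: "p \<ge> 0" using p by simp
  have "(\<integral>\<^sup>+z. ennreal (gagliardo_density s p (\<lambda>x. u x + v x) z) * indicator (Qset \<Omega>) z \<partial>lebesgue) < \<infinity>"
    by (rule sum_finite[OF dens gagliardo_density_nonneg gagliardo_density_nonneg gagliardo_density_measurable[OF m(1)]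
          gagliardo_density_measurable[OF m(2)] Qset_measurable fin(2)[OF m(3)] fin(2)[OF m(4)]])
  moreover have "(\<integral>\<^sup>+x. ennreal (\<bar>u x + v x\<bar> powr p) * indicator \<Omega> x \<partial>lebesgue) < \<infinity>"
    by (rule sum_finite[OF powr_sum_le[OF p0] powr_ge_zero powr_ge_zero pm[OF m(1)] pm[OF m(2)]
          measurable_\<Omega>(2) fin(1)[OF m(3)] fin(1)[OF m(4)]])
  ultimately show ?thesis using m by (simp add: X_space_iff X_nn_def)
qed

lemma X_space_scale:
  assumes "u \<in> X_space s p \<Omega>"
  shows "(\<lambda>x. c * u x) \<in> X_space s p \<Omega>"
proof -
  have m[measurable]: "u \<in> borel_measurable lebesgue" and fin: "X_nn u < \<infinity>" using assms by (auto simp: X_space_iff)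
  have d: "gagliardo_density s p (\<lambda>x. c * u x) z = \<bar>c\<bar> powr p * gagliardo_density s p u z" for z
    unfolding gagliardo_density_def by (simp add: powr_mult abs_mult flip: right_diff_distrib)
  have "(\<integral>\<^sup>+z. ennreal (gagliardo_density s p (\<lambda>x. c * u x) z) * indicator (Qset \<Omega>) z \<partial>lebesgue)
      = ennreal (\<bar>c\<bar> powr p) * (\<integral>\<^sup>+z. ennreal (gagliardo_density s p u z) * indicator (Qset \<Omega>) z \<partial>lebesgue)"
    unfolding d ennreal_mult[OF powr_ge_zero gagliardo_density_nonneg] mult.assoc
    using gagliardo_density_measurable[OF m] Qset_measurable
    by (intro nn_integral_cmult borel_measurable_times_ennreal borel_measurable_indicator measurable_compose[OF _ measurable_ennreal])
  moreover have "(\<integral>\<^sup>+x. ennreal (\<bar>c * u x\<bar> powr p) * indicator \<Omega> x \<partial>lebesgue)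
      = ennreal (\<bar>c\<bar> powr p) * (\<integral>\<^sup>+x. ennreal (\<bar>u x\<bar> powr p) * indicator \<Omega> x \<partial>lebesgue)"
    unfolding abs_mult powr_mult ennreal_mult[OF powr_ge_zero powr_ge_zero] mult.assoc
    by (intro nn_integral_cmult) measurable
  ultimately show ?thesis using fin by (simp add: X_space_iff X_nn_def ennreal_mult_less_top)
qed

text \<open>The L^p part is finite by the Sobolev inequality with exponent \<open>p\<close>, which
  is subcritical.\<close>

lemma vanishing_X_space:
  assumes "vanishing u" "gagliardo_nn s p u < \<infinity>"
  shows "u \<in> X_space s p \<Omega>"
proof -
  obtain C where C: "\<And>u t. vanishing u \<Longrightarrow> t \<ge> 0 \<Longrightarrow> gagliardo_nn s p u \<le> ennreal (t powr p) \<Longrightarrow>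
      (\<integral>\<^sup>+x. ennreal (\<bar>u x\<bar> powr p) \<partial>lebesgue) \<le> ennreal (C * t powr p)"
    using sobolev_scaled[OF _ p_subcritical] p by auto
  have "gagliardo_nn s p u = ennreal ((enn2real (gagliardo_nn s p u) powr (1 / p)) powr p)"
    using assms(2) p by (simp add: powr_powr)
  then have "(\<integral>\<^sup>+x. ennreal (\<bar>u x\<bar> powr p) \<partial>lebesgue) \<le> ennreal (C * (enn2real (gagliardo_nn s p u) powr (1 / p)) powr p)"
    by (intro C[OF assms(1)]) auto
  also have "\<dots> < \<infinity>" by simp
  finally show ?thesis using assms vanishing_measurable by (simp add: X_space_iff X_nn_vanishing)
qed

text \<open>Average \<open>\<bar>u y\<bar> powr p \<le> 2 powr p * (\<bar>u x - u y\<bar> powr p + \<bar>u x\<bar> powr p)\<close> over \<open>x \<in> \<Omega>\<close>.\<close>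

lemma X_nn_outside:
  assumes u: "u \<in> borel_measurable lebesgue" and R: "R > 0" "\<Omega> \<subseteq> ball 0 R"
  shows "(\<integral>\<^sup>+y. ennreal (\<bar>u y\<bar> powr p) * indicator (ball 0 R - \<Omega>) y \<partial>lebesgue) * emeasure lborel \<Omega>
    \<le> ennreal (2 powr p * ((2 * R) powr (real DIM('a) + p * s) + measure lborel (ball (0::'a) R))) * X_nn u"
proof -
  \<comment> \<open>Points of the ball of radius \<open>R\<close> are at distance at most
    \<open>2 * R\<close>, so \<open>?D\<close> times the kernel is at least 1 at distinct
    points.\<close>
  let ?B = "ball 0 R - \<Omega>" and ?D = "(2 * R) powr (real DIM('a) + p * s)"
  have [measurable]: "?B \<in> sets borel" "?B \<in> sets lebesgue" using measurable_\<Omega> by auto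
  let ?I1 = "\<lambda>z. ennreal (gagliardo_density s p u z) * indicator (Qset \<Omega>) z"
  let ?I2 = "\<lambda>z. (ennreal (\<bar>u (fst z)\<bar> powr p) * indicator \<Omega> (fst z)) * indicator ?B (snd z)"
  have um: "(\<lambda>x. ennreal (\<bar>u x\<bar> powr p)) \<in> borel_measurable lebesgue" using u by measurable
  have "(\<integral>\<^sup>+y. ennreal (\<bar>u y\<bar> powr p) * indicator ?B y \<partial>lebesgue) * emeasure lborel \<Omega>
      = (\<integral>\<^sup>+z. (ennreal (\<bar>u (snd z)\<bar> powr p) * indicator ?B (snd z)) * indicator \<Omega> (fst z) \<partial>(lebesgue :: ('a \<times> 'a) measure))"
    using um by (intro nn_integral_fst_times(2)[symmetric] borel_measurable_times_ennreal borel_measurable_indicator) auto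
  also have "\<dots> \<le> (\<integral>\<^sup>+z. ennreal (2 powr p * ?D) * ?I1 z + ennreal (2 powr p) * ?I2 z \<partial>lebesgue)"
  proof (rule nn_integral_mono)
    fix z :: "'a \<times> 'a"
    show "(ennreal (\<bar>u (snd z)\<bar> powr p) * indicator ?B (snd z)) * indicator \<Omega> (fst z) \<le> ennreal (2 powr p * ?D) * ?I1 z + ennreal (2 powr p) * ?I2 z"
    proof (cases "snd z \<in> ?B \<and> fst z \<in> \<Omega>")
      case True
      then have Q: "z \<in> Qset \<Omega>" by (auto simp: Qset_def mem_Times_iff)
      have "norm (fst z - snd z) \<le> norm (fst z) + norm (snd z)" by (rule norm_triangle_ineq4)
      also have "\<dots> \<le> 2 * R" using True R by (auto simp: subset_iff)
      finally have nz: "norm (fst z - snd z) \<le> 2 * R" .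
      have "fst z \<noteq> snd z" using True by auto
      then have "?D * riesz_kernel s p (fst z, snd z) \<ge> ?D * (2 * R) powr - (real DIM('a) + p * s)"
        using nz p s by (intro mult_left_mono riesz_kernel_ge) auto
      also have "?D * (2 * R) powr - (real DIM('a) + p * s) = 1" using R by (simp flip: powr_add)
      finally have ker: "1 \<le> ?D * riesz_kernel s p z" by simp
      have "\<bar>u (snd z)\<bar> powr p \<le> 2 powr p * (\<bar>- (u (fst z) - u (snd z))\<bar> powr p + \<bar>u (fst z)\<bar> powr p)"
        using powr_sum_le[of p "- (u (fst z) - u (snd z))" "u (fst z)"] p by simp
      also have "\<bar>- (u (fst z) - u (snd z))\<bar> powr p = \<bar>u (fst z) - u (snd z)\<bar> powr p * 1"
        by (simp only: abs_minus_cancel mult_1_right)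
      also have "\<dots> \<le> \<bar>u (fst z) - u (snd z)\<bar> powr p * (?D * riesz_kernel s p z)" using ker by (intro mult_left_mono) auto
      finally have "\<bar>u (snd z)\<bar> powr p \<le> 2 powr p * ?D * gagliardo_density s p u z + 2 powr p * \<bar>u (fst z)\<bar> powr p"
        by (simp add: gagliardo_density_def algebra_simps)
      then have "ennreal (\<bar>u (snd z)\<bar> powr p) \<le> ennreal (2 powr p * ?D * gagliardo_density s p u z + 2 powr p * \<bar>u (fst z)\<bar> powr p)"
        by (rule ennreal_leI)
      then show ?thesis using True Q by (simp add: ennreal_mult ennreal_plus gagliardo_density_nonneg)
    qed (auto split: split_indicator)
  qed
  also have "\<dots> = ennreal (2 powr p * ?D) * (\<integral>\<^sup>+z. ?I1 z \<partial>lebesgue) + ennreal (2 powr p) * (\<integral>\<^sup>+z. ?I2 z \<partial>lebesgue)"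
  proof -
    have 1: "?I1 \<in> borel_measurable lebesgue" using gagliardo_density_measurable[OF u] Qset_measurable
      by (intro borel_measurable_times_ennreal borel_measurable_indicator measurable_compose[OF _ measurable_ennreal])
    have 2: "?I2 \<in> borel_measurable lebesgue"
      using um by (intro borel_measurable_times_ennreal measurable_compose[OF fst_lebesgue_measurable um]
          measurable_compose[OF fst_lebesgue_measurable borel_measurable_indicator] measurable_compose[OF snd_lebesgue_measurable borel_measurable_indicator]) auto
    show ?thesis using 1 2 by (simp add: nn_integral_add nn_integral_cmult)
  qed
  also have "(\<integral>\<^sup>+z. ?I2 z \<partial>lebesgue) = (\<integral>\<^sup>+x. ennreal (\<bar>u x\<bar> powr p) * indicator \<Omega> x \<partial>lebesgue) * emeasure lborel ?B"
    using um by (intro nn_integral_fst_times(1) borel_measurable_times_ennreal borel_measurable_indicator) auto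
  also have "ennreal (2 powr p * ?D) * (\<integral>\<^sup>+z. ?I1 z \<partial>lebesgue) + ennreal (2 powr p) * \<dots>
      \<le> ennreal (2 powr p * ?D) * X_nn u + ennreal (2 powr p) * (X_nn u * ennreal (measure lborel (ball (0::'a) R)))"
  proof (intro add_mono mult_left_mono mult_mono)
    have "emeasure lborel ?B \<le> emeasure lborel (ball (0::'a) R)" by (intro emeasure_mono) auto
    also have "\<dots> = ennreal (measure lborel (ball (0::'a) R))"
      using emeasure_bounded_finite[of "ball (0::'a) R"] by (intro emeasure_eq_ennreal_measure) auto
    finally show "emeasure lborel ?B \<le> ennreal (measure lborel (ball (0::'a) R))" .
  qed (simp_all add: X_nn_def)
  also have "\<dots> = ennreal (2 powr p * (?D + measure lborel (ball (0::'a) R))) * X_nn u"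
    by (simp add: ennreal_mult ennreal_plus algebra_simps)
  finally show ?thesis .
qed

lemma emeasure_\<Omega>_pos: "emeasure lborel \<Omega> > 0"
proof -
  have "\<not> negligible \<Omega>" using open_\<Omega> nonempty_\<Omega> open_not_negligible by blast
  then have "\<Omega> \<notin> null_sets lborel" using negligible_iff_null_sets null_sets_completionI by blast
  then show ?thesis using measurable_\<Omega> by (auto simp: null_sets_def zero_less_iff_neq_zero)
qed

text \<open>The substantial inclusion is that X-limits of test functions vanish outside \<Omega>,
  which membership in X does not imply. Outside \<Omega> the function equals its difference from any
  test function, and \<open>X_nn_outside\<close> bounds the integral of that difference over bounded
  parts of the complement by its X norm. Conversely, for functions vanishing outside \<Omega> the
  Sobolev inequality bounds the L^p part by the energy, so approximation in energy is approximation
  in X.\<close>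

theorem X0_space_eq: "X0_space s p \<Omega> = closure_space"
proof (intro equalityI subsetI)
  fix u assume u: "u \<in> X0_space s p \<Omega>"
  then have uX: "u \<in> X_space s p \<Omega>" by (simp add: X0_space_def)
  then have um: "u \<in> borel_measurable lebesgue" by (simp add: X_space_iff)
  have approx: "\<exists>\<phi>\<in>test_functions \<Omega>. X_nn (\<lambda>x. u x - \<phi> x) < ennreal \<epsilon>" if \<epsilon>: "\<epsilon> > 0" for \<epsilon>
  proof -
    have "\<epsilon> powr (1 / p) > 0" using \<epsilon> by simp
    then obtain \<phi> where \<phi>: "\<phi> \<in> test_functions \<Omega>" "X_norm s p \<Omega> (\<lambda>x. u x - \<phi> x) < \<epsilon> powr (1 / p)"
      using u unfolding X0_space_def by blast
    have "\<phi> \<in> X_space s p \<Omega>" using vanishing_X_space[OF vanishing_test[OF \<phi>(1)] gagliardo_nn_test_finite[OF \<phi>(1)]] .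
    then have "(\<lambda>x. u x + -1 * \<phi> x) \<in> X_space s p \<Omega>" by (intro X_space_add[OF uX] X_space_scale)
    then have "X_nn (\<lambda>x. u x - \<phi> x) = ennreal (X_norm s p \<Omega> (\<lambda>x. u x - \<phi> x) powr p)" by (intro X_norm_eq) simp
    also have "\<dots> < ennreal ((\<epsilon> powr (1 / p)) powr p)"
      using \<phi>(2) p \<epsilon> by (intro ennreal_lessI powr_less_mono2) (auto simp: X_norm_def)
    also have "(\<epsilon> powr (1 / p)) powr p = \<epsilon>" using p \<epsilon> by (simp add: powr_powr)
    finally show ?thesis using \<phi>(1) by blast
  qed
  have zero: "AE y in lebesgue. y \<in> ball 0 R - \<Omega> \<longrightarrow> u y = 0" if R: "R > 0" "\<Omega> \<subseteq> ball 0 R" for R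
  proof -
    define K where "K = 2 powr p * ((2 * R) powr (real DIM('a) + p * s) + measure lborel (ball (0::'a) R))"
    have K: "K > 0" unfolding K_def using R by (intro mult_pos_pos add_pos_nonneg) auto
    have [measurable]: "ball 0 R - \<Omega> \<in> sets lebesgue" using measurable_\<Omega> by auto
    let ?J = "\<integral>\<^sup>+y. ennreal (\<bar>u y\<bar> powr p) * indicator (ball 0 R - \<Omega>) y \<partial>lebesgue"
    have le: "?J * emeasure lborel \<Omega> \<le> 0 + ennreal e" if e: "e > 0" for e
    proof -
      have "e / K > 0" using e K by simp
      then obtain \<phi> where \<phi>: "\<phi> \<in> test_functions \<Omega>" "X_nn (\<lambda>x. u x - \<phi> x) < ennreal (e / K)" using approx by blast
      have "?J = (\<integral>\<^sup>+y. ennreal (\<bar>u y - \<phi> y\<bar> powr p) * indicator (ball 0 R - \<Omega>) y \<partial>lebesgue)"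
        using test_functions_outside[OF \<phi>(1)] by (intro nn_integral_cong) (auto split: split_indicator)
      then have "?J * emeasure lborel \<Omega> \<le> ennreal K * X_nn (\<lambda>x. u x - \<phi> x)"
        unfolding K_def using X_nn_outside[OF borel_measurable_diff[OF um test_functions_lebesgue[OF \<phi>(1)]] R] by simp
      also have "\<dots> \<le> ennreal K * ennreal (e / K)" using \<phi>(2) by (intro mult_left_mono) auto
      also have "\<dots> = ennreal e" using K e by (simp flip: ennreal_mult)
      finally show ?thesis by simp
    qed
    have "?J * emeasure lborel \<Omega> \<le> 0" by (rule ennreal_le_epsilon) (rule le)
    then have "?J = 0" using emeasure_\<Omega>_pos by auto
    moreover have "(\<lambda>y. ennreal (\<bar>u y\<bar> powr p) * indicator (ball 0 R - \<Omega>) y) \<in> borel_measurable lebesgue"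
      using um by measurable
    ultimately have "AE y in lebesgue. ennreal (\<bar>u y\<bar> powr p) * indicator (ball 0 R - \<Omega>) y = 0"
      by (simp add: nn_integral_0_iff_AE)
    then show ?thesis by eventually_elim (auto simp: ennreal_eq_0_iff split: split_indicator_asm)
  qed
  obtain R0 where R0: "R0 > 0" "\<Omega> \<subseteq> ball 0 R0" using bounded_subset_ballD[OF bounded_\<Omega>, of 0] by blast
  \<comment> \<open>The constant in \<open>X_nn_outside\<close> depends on the radius, so the
    complement is exhausted by countably many balls.\<close>
  have "AE y in lebesgue. \<forall>k::nat. y \<in> ball 0 (R0 + real k) - \<Omega> \<longrightarrow> u y = 0"
  proof (subst AE_all_countable, intro allI)
    fix k :: nat
    show "AE y in lebesgue. y \<in> ball 0 (R0 + real k) - \<Omega> \<longrightarrow> u y = 0"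
      using R0 subset_ball[of R0 "R0 + real k" "0::'a"] by (intro zero) auto
  qed
  then have "AE y in lebesgue. y \<notin> \<Omega> \<longrightarrow> u y = 0"
  proof eventually_elim
    case (elim y)
    obtain k :: nat where "norm y < real k" using reals_Archimedean2 by blast
    then have "y \<in> ball 0 (R0 + real k)" using R0 by simp
    then show ?case using elim by blast
  qed
  then have van: "vanishing u" using um by (simp add: vanishing_def)
  have "\<exists>\<phi>\<in>test_functions \<Omega>. gagliardo_nn s p (\<lambda>x. u x - \<phi> x) < ennreal \<epsilon>" if "\<epsilon> > 0" for \<epsilon>
  proof -
    obtain \<phi> where \<phi>: "\<phi> \<in> test_functions \<Omega>" "X_nn (\<lambda>x. u x - \<phi> x) < ennreal \<epsilon>" using approx[OF \<open>\<epsilon> > 0\<close>] by blast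
    have "gagliardo_nn s p (\<lambda>x. u x - \<phi> x) \<le> X_nn (\<lambda>x. u x - \<phi> x)"
      unfolding X_nn_vanishing[OF vanishing_diff[OF van vanishing_test[OF \<phi>(1)]]] by simp
    then show ?thesis using \<phi> by (intro bexI[of _ \<phi>]) (auto elim: le_less_trans)
  qed
  then show "u \<in> closure_space" using van by (simp add: closure_space_def)
next
  fix u assume u: "u \<in> closure_space"
  obtain C where C0: "C > 0" and C: "\<And>u t. vanishing u \<Longrightarrow> t \<ge> 0 \<Longrightarrow> gagliardo_nn s p u \<le> ennreal (t powr p) \<Longrightarrow>
      (\<integral>\<^sup>+x. ennreal (\<bar>u x\<bar> powr p) \<partial>lebesgue) \<le> ennreal (C * t powr p)"
    using sobolev_scaled[OF _ p_subcritical] p by auto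
  have "\<exists>\<phi>\<in>test_functions \<Omega>. X_norm s p \<Omega> (\<lambda>x. u x - \<phi> x) < \<epsilon>" if \<epsilon>: "\<epsilon> > 0" for \<epsilon>
  proof -
    \<comment> \<open>Solved from (C + 1) t^p = \<epsilon>^p / 2, the left side being the bound for
      the p-th power of the X norm of the difference.\<close>
    define t where "t = (\<epsilon> powr p / (2 * (C + 1))) powr (1 / p)"
    have t: "t > 0" "t powr p = \<epsilon> powr p / (2 * (C + 1))" using \<epsilon> C0 p by (auto simp: t_def powr_powr)
    have "t powr p > 0" using t(1) by simp
    from closure_spaceE[OF u this] obtain \<phi> where \<phi>: "\<phi> \<in> test_functions \<Omega>" "gagliardo_nn s p (\<lambda>x. u x - \<phi> x) < ennreal (t powr p)" .
    let ?w = "\<lambda>x. u x - \<phi> x"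
    have w: "vanishing ?w" using vanishing_diff[OF closure_spaceD[OF u] vanishing_test[OF \<phi>(1)]] .
    have wX: "?w \<in> X_space s p \<Omega>" using \<phi>(2) by (intro vanishing_X_space[OF w]) (auto elim: less_trans)
    have "ennreal (X_norm s p \<Omega> ?w powr p) \<le> ennreal (C * t powr p) + ennreal (t powr p)"
      unfolding X_norm_eq[OF wX, symmetric] X_nn_vanishing[OF w] using \<phi>(2) t
      by (intro add_mono C[OF w]) (auto intro: less_imp_le)
    also have "\<dots> = ennreal ((C + 1) * t powr p)" using C0 by (simp add: distrib_right flip: ennreal_plus)
    finally have "X_norm s p \<Omega> ?w powr p \<le> (C + 1) * t powr p" using C0 by (simp add: ennreal_le_iff)
    also have "\<dots> = \<epsilon> powr p / 2" unfolding t(2) using C0 by (simp add: field_simps)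
    also have "\<dots> < \<epsilon> powr p" using \<epsilon> by simp
    finally have "X_norm s p \<Omega> ?w < \<epsilon>" using \<epsilon> p by (meson not_le powr_mono2 order.strict_trans1 less_le_not_le less_eq_real_def zero_le_numeral order_trans)
    then show ?thesis using \<phi>(1) by blast
  qed
  then show "u \<in> X0_space s p \<Omega>"
    unfolding X0_space_def using vanishing_X_space[OF closure_spaceD[OF u] closure_space_finite[OF u]] by blast
qed

end


section \<open>Closedness under almost everywhere limits\<close>

lemma powr_superadditive:
  fixes x y :: real
  assumes "x \<ge> 0" "y \<ge> 0" "q \<ge> 1"
  shows "x powr q + y powr q \<le> (x + y) powr q"
proof -
  have *: "z powr q \<le> z * (x + y) powr (q - 1)" if "0 \<le> z" "z \<le> x + y" for z
  proof -
    have "z powr q = z powr (q - 1) * z" using powr_minus_one_mult[OF that(1)] by simp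
    also have "\<dots> \<le> (x + y) powr (q - 1) * z" using that assms by (intro mult_right_mono powr_mono2) auto
    finally show ?thesis by (simp add: mult.commute)
  qed
  have "x powr q + y powr q \<le> x * (x + y) powr (q - 1) + y * (x + y) powr (q - 1)"
    using *[of x] *[of y] assms by simp
  also have "\<dots> = (x + y) powr (q - 1) * (x + y)" by (simp add: algebra_simps)
  also have "\<dots> = (x + y) powr q" using assms by (intro powr_minus_one_mult) auto
  finally show ?thesis .
qed

lemma powr_convex:
  fixes x y :: real
  assumes "t > 1" "\<alpha> \<ge> 0" "\<beta> \<ge> 0" "\<alpha> + \<beta> = 1"
  shows "\<bar>\<alpha> * x + \<beta> * y\<bar> powr t \<le> \<alpha> * \<bar>x\<bar> powr t + \<beta> * \<bar>y\<bar> powr t"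
proof -
  define m where "m = \<alpha> * x + \<beta> * y"
  define S where "S = t * (\<bar>m\<bar> powr (t - 2) * m)"
  have "\<alpha> * (S * (x - m)) \<le> \<alpha> * (\<bar>x\<bar> powr t - \<bar>m\<bar> powr t)" "\<beta> * (S * (y - m)) \<le> \<beta> * (\<bar>y\<bar> powr t - \<bar>m\<bar> powr t)"
    using powr_tangent[OF assms(1), of m x] powr_tangent[OF assms(1), of m y] assms
    unfolding S_def by (auto intro: mult_left_mono)
  moreover have "\<alpha> * (S * (x - m)) + \<beta> * (S * (y - m)) = S * (m - (\<alpha> + \<beta>) * m)" unfolding m_def by (simp add: algebra_simps)
  then have "\<alpha> * (S * (x - m)) + \<beta> * (S * (y - m)) = 0" using assms by simp
  ultimately have "(\<alpha> + \<beta>) * \<bar>m\<bar> powr t \<le> \<alpha> * \<bar>x\<bar> powr t + \<beta> * \<bar>y\<bar> powr t" by (simp add: algebra_simps)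
  then show ?thesis using assms unfolding m_def by simp
qed

text \<open>Clarkson's inequality, reduced to the parallelogram law for squares.\<close>

lemma clarkson:
  fixes x y :: real
  assumes "p \<ge> 2"
  shows "\<bar>(x + y) / 2\<bar> powr p + \<bar>(x - y) / 2\<bar> powr p \<le> (\<bar>x\<bar> powr p + \<bar>y\<bar> powr p) / 2"
proof -
  have sq: "\<bar>z\<bar> powr p = (z\<^sup>2) powr (p / 2)" for z :: real
    using powr_powr[of "\<bar>z\<bar>" 2 "p / 2"] by (cases "z = 0") (simp_all add: powr_realpow[of "\<bar>z\<bar>" 2, simplified])
  have "\<bar>(x + y) / 2\<bar> powr p + \<bar>(x - y) / 2\<bar> powr p \<le> (((x + y) / 2)\<^sup>2 + ((x - y) / 2)\<^sup>2) powr (p / 2)"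
    unfolding sq using assms by (intro powr_superadditive) auto
  also have "((x + y) / 2)\<^sup>2 + ((x - y) / 2)\<^sup>2 = (1 / 2) * x\<^sup>2 + (1 / 2) * y\<^sup>2" by (simp add: power2_eq_square field_simps)
  also have "((1 / 2) * x\<^sup>2 + (1 / 2) * y\<^sup>2) powr (p / 2) \<le> (1 / 2) * (x\<^sup>2) powr (p / 2) + (1 / 2) * (y\<^sup>2) powr (p / 2)"
  proof (cases "p = 2")
    case False
    then show ?thesis using powr_convex[of "p / 2" "1 / 2" "1 / 2" "x\<^sup>2" "y\<^sup>2"] assms by simp
  qed simp
  finally show ?thesis unfolding sq by simp
qed

lemma gagliardo_nn_clarkson:
  assumes "u \<in> borel_measurable lebesgue" "v \<in> borel_measurable lebesgue" "p \<ge> 2"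
  shows "gagliardo_nn s p (\<lambda>x. (u x + v x) / 2) + gagliardo_nn s p (\<lambda>x. (u x - v x) / 2)
    \<le> ennreal (1 / 2) * (gagliardo_nn s p u + gagliardo_nn s p v)"
proof -
  let ?d = "gagliardo_density s p"
  have pw: "?d (\<lambda>x. (u x + v x) / 2) z + ?d (\<lambda>x. (u x - v x) / 2) z \<le> 1 / 2 * (?d u z + ?d v z)" for z
  proof -
    define A where "A = u (fst z) - u (snd z)"
    define B where "B = v (fst z) - v (snd z)"
    have e: "(u (fst z) + v (fst z)) / 2 - (u (snd z) + v (snd z)) / 2 = (A + B) / 2"
      "(u (fst z) - v (fst z)) / 2 - (u (snd z) - v (snd z)) / 2 = (A - B) / 2"
      by (simp_all add: A_def B_def field_simps)
    show ?thesis
      unfolding gagliardo_density_def e A_def[symmetric] B_def[symmetric]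
      using mult_right_mono[OF clarkson[OF assms(3), of A B] riesz_kernel_nonneg[of s p z]]
      by (simp add: distrib_right add_divide_distrib)
  qed
  have m: "(\<lambda>x. (u x + v x) / 2) \<in> borel_measurable lebesgue" "(\<lambda>x. (u x - v x) / 2) \<in> borel_measurable lebesgue"
    using assms by (auto intro: borel_measurable_divide borel_measurable_add borel_measurable_diff)
  note [measurable] = gagliardo_density_measurable[OF m(1), of s p] gagliardo_density_measurable[OF m(2), of s p]
    gagliardo_density_measurable[OF assms(1), of s p] gagliardo_density_measurable[OF assms(2), of s p]
  have "gagliardo_nn s p (\<lambda>x. (u x + v x) / 2) + gagliardo_nn s p (\<lambda>x. (u x - v x) / 2)
     = (\<integral>\<^sup>+z. ennreal (?d (\<lambda>x. (u x + v x) / 2) z) + ennreal (?d (\<lambda>x. (u x - v x) / 2) z) \<partial>lebesgue)"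
    unfolding gagliardo_nn_eq by (intro nn_integral_add[symmetric]) measurable
  also have "\<dots> \<le> (\<integral>\<^sup>+z. ennreal (1 / 2) * (ennreal (?d u z) + ennreal (?d v z)) \<partial>lebesgue)"
  proof (rule nn_integral_mono)
    fix z
    show "ennreal (?d (\<lambda>x. (u x + v x) / 2) z) + ennreal (?d (\<lambda>x. (u x - v x) / 2) z) \<le> ennreal (1 / 2) * (ennreal (?d u z) + ennreal (?d v z))"
      using ennreal_leI[OF pw[of z]] by (simp only: ennreal_mult ennreal_plus gagliardo_density_nonneg add_nonneg_nonneg zero_le_divide_1_iff zero_le_numeral)
  qed
  also have "\<dots> = ennreal (1 / 2) * (gagliardo_nn s p u + gagliardo_nn s p v)"
    unfolding gagliardo_nn_eq by (simp add: nn_integral_cmult nn_integral_add)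
  finally show ?thesis .
qed

lemma gagliardo_nn_fatou:
  assumes m: "\<And>k. v k \<in> borel_measurable lebesgue" and lim: "AE x in lebesgue. (\<lambda>k. v k x) \<longlonglongrightarrow> w x"
    and bd: "\<forall>\<^sub>F k in sequentially. gagliardo_nn s p (v k) \<le> c" and p: "p > 0"
  shows "gagliardo_nn s p w \<le> c"
proof -
  have "AE z in lebesgue. ennreal (gagliardo_density s p w z) = liminf (\<lambda>k. ennreal (gagliardo_density s p (v k) z))"
    using AE_lebesgue_fst[OF lim] AE_lebesgue_snd[OF lim]
  proof eventually_elim
    case (elim z)
    have "(\<lambda>k. \<bar>v k (fst z) - v k (snd z)\<bar> powr p * riesz_kernel s p z) \<longlonglongrightarrow> \<bar>w (fst z) - w (snd z)\<bar> powr p * riesz_kernel s p z"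
      using p by (intro tendsto_mult tendsto_const tendsto_powr' tendsto_rabs tendsto_diff elim) auto
    then have "(\<lambda>k. ennreal (gagliardo_density s p (v k) z)) \<longlonglongrightarrow> ennreal (gagliardo_density s p w z)"
      unfolding gagliardo_density_def by (rule tendsto_ennrealI)
    then show ?case by (rule lim_imp_Liminf[OF trivial_limit_sequentially, symmetric])
  qed
  then have "gagliardo_nn s p w = (\<integral>\<^sup>+z. liminf (\<lambda>k. ennreal (gagliardo_density s p (v k) z)) \<partial>lebesgue)"
    unfolding gagliardo_nn_eq by (rule nn_integral_cong_AE)
  also have "\<dots> \<le> liminf (\<lambda>k. gagliardo_nn s p (v k))"
    unfolding gagliardo_nn_eq by (intro nn_integral_liminf measurable_compose[OF gagliardo_density_measurable[OF m] measurable_ennreal])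
  also have "\<dots> \<le> liminf (\<lambda>k::nat. c)" using bd by (rule Liminf_mono)
  finally show ?thesis by (simp add: Liminf_const)
qed

text \<open>Only midpoints are adjoined since Clarkson's inequality compares two functions with
  their midpoint. Pointwise closeness to a limit and membership in \<open>closure_space\<close> both
  pass through the induction.\<close>

inductive_set midpoint_hull :: "('a \<Rightarrow> real) set \<Rightarrow> ('a \<Rightarrow> real) set" for S where
  base: "u \<in> S \<Longrightarrow> u \<in> midpoint_hull S"
| midpoint: "u \<in> midpoint_hull S \<Longrightarrow> v \<in> midpoint_hull S \<Longrightarrow> (\<lambda>x. (u x + v x) / 2) \<in> midpoint_hull S"

lemma midpoint_hull_mono:
  assumes "S \<subseteq> T" "u \<in> midpoint_hull S"
  shows "u \<in> midpoint_hull T"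
  using assms(2) by induction (use assms(1) in \<open>auto intro: midpoint_hull.intros\<close>)

section \<open>Almost everywhere limits and moduli of elements\<close>

context bounded_open_set
begin

lemma closure_space_closed:
  assumes u: "vanishing u" and approx: "\<And>\<epsilon>. \<epsilon> > 0 \<Longrightarrow> \<exists>w\<in>closure_space. gagliardo_nn s p (\<lambda>x. u x - w x) \<le> ennreal \<epsilon>"
  shows "u \<in> closure_space"
  unfolding closure_space_def
proof (intro CollectI conjI allI impI u)
  fix \<epsilon> :: real assume \<epsilon>: "\<epsilon> > 0"
  define e where "e = \<epsilon> / (2 powr p * 2)"
  have e: "e > 0" using \<epsilon> by (simp add: e_def)
  obtain w where w: "w \<in> closure_space" "gagliardo_nn s p (\<lambda>x. u x - w x) \<le> ennreal e" using approx[OF e] by blast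
  obtain \<phi> where \<phi>: "\<phi> \<in> test_functions \<Omega>" "gagliardo_nn s p (\<lambda>x. w x - \<phi> x) < ennreal e" using closure_spaceE[OF w(1) e] .
  have "gagliardo_nn s p (\<lambda>x. (u x - w x) + (w x - \<phi> x)) \<le> ennreal (2 powr p) * (gagliardo_nn s p (\<lambda>x. u x - w x) + gagliardo_nn s p (\<lambda>x. w x - \<phi> x))"
    using vanishing_measurable[OF u] vanishing_measurable[OF closure_spaceD[OF w(1)]] test_functions_lebesgue[OF \<phi>(1)] p
    by (intro gagliardo_nn_add_le borel_measurable_diff) auto
  also have "\<dots> < ennreal (2 powr p) * (ennreal e + ennreal e)"
  proof (intro ennreal_mult_strict_left_mono)
    have "gagliardo_nn s p (\<lambda>x. u x - w x) + gagliardo_nn s p (\<lambda>x. w x - \<phi> x) \<le> ennreal e + gagliardo_nn s p (\<lambda>x. w x - \<phi> x)"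
      using w(2) by (intro add_right_mono)
    also have "\<dots> < ennreal e + ennreal e" using \<phi>(2) by (simp add: ennreal_add_left_cancel_less)
    finally show "gagliardo_nn s p (\<lambda>x. u x - w x) + gagliardo_nn s p (\<lambda>x. w x - \<phi> x) < ennreal e + ennreal e" .
  qed auto
  also have "\<dots> = ennreal \<epsilon>" using e by (simp add: e_def flip: ennreal_plus ennreal_mult)
  finally show "\<exists>\<phi>\<in>test_functions \<Omega>. gagliardo_nn s p (\<lambda>x. u x - \<phi> x) < ennreal \<epsilon>"
    using \<phi>(1) by (intro bexI[of _ \<phi>]) simp_all
qed

text \<open>Nearly minimal elements of the midpoint hulls of the tails form a Cauchy sequence by
  Clarkson's inequality, and they still converge almost everywhere to the same limit.\<close>

theorem closure_space_AE_limit: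
  assumes U: "\<And>k. U k \<in> closure_space" and bd: "\<And>k. gagliardo_nn s p (U k) \<le> ennreal B"
    and u: "u \<in> borel_measurable lebesgue" and lim: "AE x in lebesgue. (\<lambda>k. U k x) \<longlonglongrightarrow> u x"
  shows "u \<in> closure_space"
proof -
  let ?E = "gagliardo_nn s p"
  define H where "H = (\<lambda>k. midpoint_hull (U ` {k..}))"
  have H_mono: "w \<in> H k" if "w \<in> H j" "k \<le> j" for w j k
  proof -
    have "U ` {j..} \<subseteq> U ` {k..}" using that(2) by auto
    then show ?thesis using midpoint_hull_mono that(1) unfolding H_def by blast
  qed
  have H_closure: "w \<in> closure_space" if "w \<in> H k" for w k
    using that unfolding H_def
  proof induction
    case (base u)
    then show ?case using U by auto
  next
    case (midpoint u v)
    then show ?case using closure_space_scale[OF closure_space_add, of u v "1 / 2"] by simp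
  qed
  have H_meas: "w \<in> borel_measurable lebesgue" if "w \<in> H k" for w k
    using vanishing_measurable[OF closure_spaceD[OF H_closure[OF that]]] .
  have UH: "U k \<in> H k" for k unfolding H_def by (intro midpoint_hull.base) auto
  \<comment> \<open>The infimum of the energy over the hull of the tail from \<open>k\<close> on.
    The hulls shrink, so \<open>d\<close> increases; it is bounded through \<open>B\<close> and
    therefore converges.\<close>
  define d where "d = (\<lambda>k. INF w\<in>H k. ?E w)"
  have d_le: "d k \<le> ?E w" if "w \<in> H k" for k w unfolding d_def using that by (rule INF_lower)
  have dB: "d k \<le> ennreal B" for k using d_le[OF UH] bd order_trans by blast
  have d_fin: "d k < \<infinity>" for k using dB[of k] by (simp add: le_less_trans)
  define e where "e = (\<lambda>k. enn2real (d k))"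
  have de: "d k = ennreal (e k)" for k unfolding e_def using d_fin[of k] by simp
  have e_inc: "incseq e"
  proof (rule incseq_SucI)
    fix k
    have "d k \<le> d (Suc k)" unfolding d_def using H_mono by (intro INF_superset_mono) auto
    then show "e k \<le> e (Suc k)" unfolding e_def using d_fin[of "Suc k"] by (intro enn2real_mono) auto
  qed
  have "e k \<le> max B 0" for k
  proof -
    have "ennreal B \<le> ennreal (max B 0)" by (rule ennreal_leI) simp
    then have "ennreal (e k) \<le> ennreal (max B 0)" using dB[of k] unfolding de by (rule order_trans[rotated])
    then show ?thesis by (simp add: ennreal_le_iff)
  qed
  then obtain L where L: "e \<longlonglongrightarrow> L" using incseq_convergent[OF e_inc] by metis
  have eL: "e k \<le> L" for k using incseq_le[OF e_inc L] .
  have "\<exists>w\<in>H k. ?E w < d k + ennreal (1 / Suc k)" for k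
  proof -
    have e0: "e k \<ge> 0" by (simp add: e_def)
    have "ennreal (e k) < ennreal (e k + 1 / Suc k)" using e0 by (intro ennreal_lessI add_nonneg_pos) auto
    also have "\<dots> = ennreal (e k) + ennreal (1 / Suc k)" using e0 by (intro ennreal_plus) auto
    finally have "d k < d k + ennreal (1 / Suc k)" unfolding de .
    then show ?thesis unfolding d_def INF_less_iff by simp
  qed
  then obtain w where w: "\<And>k. w k \<in> H k" "\<And>k. ?E (w k) < d k + ennreal (1 / Suc k)" by metis
  have wE: "?E (w k) = ennreal (enn2real (?E (w k)))" "enn2real (?E (w k)) \<le> e k + 1 / Suc k" for k
  proof -
    have *: "?E (w k) < ennreal (e k + 1 / Suc k)" using w(2)[of k] unfolding de by (simp add: e_def flip: ennreal_plus)
    then show "?E (w k) = ennreal (enn2real (?E (w k)))" by (metis ennreal_enn2real less_top top.extremum_strict order.strict_trans)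
    show "enn2real (?E (w k)) \<le> e k + 1 / Suc k" using * by (intro enn2real_leI) (auto simp: e_def intro: less_imp_le)
  qed
  \<comment> \<open>By Clarkson the energy of half the difference of \<open>w k\<close> and
    \<open>w j\<close> is at most the mean of their energies minus that of their midpoint, which
    lies in the hull of tail \<open>k\<close> and so has energy at least \<open>e k\<close>. With
    \<open>e j \<le> L\<close> this leaves at most \<open>\<eta> k\<close>, which tends to
    0.\<close>
  define \<eta> where "\<eta> = (\<lambda>k. (L - e k) / 2 + 1 / Suc k)"
  have diff: "?E (\<lambda>x. w k x - w j x) \<le> ennreal (2 powr p * \<eta> k)" if "k \<le> j" for k j
  proof -
    have wm: "w k \<in> borel_measurable lebesgue" "w j \<in> borel_measurable lebesgue" using H_meas w(1) by auto
    have "(\<lambda>x. (w k x + w j x) / 2) \<in> H k"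
      unfolding H_def using w(1)[of k] H_mono[OF w(1)[of j] that] by (intro midpoint_hull.midpoint) (auto simp: H_def)
    then have "ennreal (e k) \<le> ?E (\<lambda>x. (w k x + w j x) / 2)" unfolding de[symmetric] by (rule d_le)
    then have "ennreal (e k) + ?E (\<lambda>x. (w k x - w j x) / 2) \<le> ?E (\<lambda>x. (w k x + w j x) / 2) + ?E (\<lambda>x. (w k x - w j x) / 2)"
      by (rule add_right_mono)
    also have "\<dots> \<le> ennreal (1 / 2) * (?E (w k) + ?E (w j))" by (rule gagliardo_nn_clarkson[OF wm p])
    also have "\<dots> = ennreal (1 / 2 * (enn2real (?E (w k)) + enn2real (?E (w j))))"
    proof -
      have "ennreal (1 / 2) * (ennreal a + ennreal b) = ennreal (1 / 2 * (a + b))" if "a \<ge> 0" "b \<ge> 0" for a b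
        using that by (simp only: ennreal_mult ennreal_plus add_nonneg_nonneg zero_le_divide_1_iff zero_le_numeral)
      then show ?thesis by (subst wE(1)[of k], subst wE(1)[of j]) simp
    qed
    also have "\<dots> \<le> ennreal (e k + \<eta> k)"
    proof (rule ennreal_leI)
      have "1 / real (Suc j) \<le> 1 / real (Suc k)" using that by (intro divide_left_mono) auto
      then show "1 / 2 * (enn2real (?E (w k)) + enn2real (?E (w j))) \<le> e k + \<eta> k"
        using wE(2)[of k] wE(2)[of j] eL[of j] unfolding \<eta>_def by argo
    qed
    also have "\<dots> = ennreal (e k) + ennreal (\<eta> k)" using eL[of k] by (intro ennreal_plus) (auto simp: e_def \<eta>_def)
    finally have half: "?E (\<lambda>x. (w k x - w j x) / 2) \<le> ennreal (\<eta> k)" by (simp add: ennreal_add_left_cancel_le)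
    have h: "x = 2 * (x / 2)" for x :: real by simp
    have "?E (\<lambda>x. w k x - w j x) = ?E (\<lambda>x. 2 * ((w k x - w j x) / 2))" by (rule arg_cong[of _ _ ?E], rule ext, rule h)
    also have "\<dots> = ennreal (2 powr p) * ?E (\<lambda>x. (w k x - w j x) / 2)"
      using wm by (subst gagliardo_nn_scale) (auto intro: borel_measurable_divide borel_measurable_diff)
    also have "\<dots> \<le> ennreal (2 powr p) * ennreal (\<eta> k)" using half by (intro mult_left_mono) auto
    finally have le: "?E (\<lambda>x. w k x - w j x) \<le> ennreal (2 powr p) * ennreal (\<eta> k)" by simp
    have "\<eta> k \<ge> 0" using eL[of k] by (simp add: \<eta>_def)
    then show ?thesis using le by (simp add: ennreal_mult)
  qed
  have w_lim: "AE x in lebesgue. (\<lambda>k. w k x) \<longlonglongrightarrow> u x"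
    using lim
  proof eventually_elim
    case (elim x)
    \<comment> \<open>Being within \<epsilon> of \<open>u x\<close> is stable under midpoints, so
      closeness of the tail at \<open>x\<close> passes to its whole hull.\<close>
    have close: "\<bar>v x - u x\<bar> \<le> \<epsilon>" if "v \<in> H k" "\<And>j. j \<ge> k \<Longrightarrow> \<bar>U j x - u x\<bar> \<le> \<epsilon>" for v k \<epsilon>
      using that(1) unfolding H_def
    proof induction
      case (base v)
      then show ?case using that(2) by auto
    next
      case (midpoint v1 v2)
      then show ?case by (simp add: abs_le_iff field_simps)
    qed
    show ?case
    proof (rule LIMSEQ_I)
      fix r :: real assume r: "r > 0"
      obtain K where K: "\<And>j. j \<ge> K \<Longrightarrow> norm (U j x - u x) < r / 2" using LIMSEQ_D[OF elim, of "r / 2"] r by auto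
      have "norm (w k x - u x) < r" if "k \<ge> K" for k
        using close[OF w(1)[of k], of "r / 2"] K that r by (force simp: less_imp_le)
      then show "\<exists>K. \<forall>k\<ge>K. norm (w k x - u x) < r" by blast
    qed
  qed
  \<comment> \<open>Fatou's lemma in \<open>j\<close>, with \<open>k\<close> fixed, turns the Cauchy
    estimate into an estimate against the limit.\<close>
  have conv: "?E (\<lambda>x. w k x - u x) \<le> ennreal (2 powr p * \<eta> k)" for k
  proof (rule gagliardo_nn_fatou)
    show "(\<lambda>x. w k x - w j x) \<in> borel_measurable lebesgue" for j using H_meas[OF w(1)] by (intro borel_measurable_diff)
    show "AE x in lebesgue. (\<lambda>j. w k x - w j x) \<longlonglongrightarrow> w k x - u x"
      using w_lim by eventually_elim (intro tendsto_intros)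
    show "\<forall>\<^sub>F j in sequentially. ?E (\<lambda>x. w k x - w j x) \<le> ennreal (2 powr p * \<eta> k)"
      using diff by (auto simp: eventually_sequentially)
  qed (use p in simp)
  have "vanishing u"
  proof -
    have "AE x in lebesgue. \<forall>k. x \<notin> \<Omega> \<longrightarrow> U k x = 0"
      unfolding AE_all_countable using closure_spaceD[OF U] by (auto simp: vanishing_def)
    with lim have "AE x in lebesgue. x \<notin> \<Omega> \<longrightarrow> u x = 0"
      by eventually_elim (auto simp: LIMSEQ_const_iff)
    then show ?thesis using u by (simp add: vanishing_def)
  qed
  then show ?thesis
  proof (rule closure_space_closed)
    fix \<epsilon> :: real assume \<epsilon>: "\<epsilon> > 0"
    have "(\<lambda>k. 2 powr p * ((L - e k) / 2 + 1 / Suc k)) \<longlonglongrightarrow> 2 powr p * ((L - L) / 2 + 0)"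
      by (intro tendsto_intros L LIMSEQ_Suc[OF lim_1_over_n])  auto
    then have "\<forall>\<^sub>F k in sequentially. 2 powr p * \<eta> k < \<epsilon>" unfolding \<eta>_def using \<epsilon> by (intro order_tendstoD(2)) auto
    then obtain k where k: "2 powr p * \<eta> k < \<epsilon>" by (auto simp: eventually_sequentially)
    have "?E (\<lambda>x. u x - w k x) = ?E (\<lambda>x. w k x - u x)"
      unfolding gagliardo_nn_eq gagliardo_density_def by (simp add: abs_minus_commute algebra_simps)
    also have "\<dots> \<le> ennreal \<epsilon>" using conv[of k] k ennreal_leI[of "2 powr p * \<eta> k" \<epsilon>] by (meson less_imp_le order_trans)
    finally show "\<exists>w\<in>closure_space. ?E (\<lambda>x. u x - w x) \<le> ennreal \<epsilon>" using H_closure[OF w(1)] by blast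
  qed
qed

lemma gagliardo_nn_mono:
  assumes "\<And>x y. \<bar>v x - v y\<bar> \<le> \<bar>u x - u y\<bar>"
  shows "gagliardo_nn s p v \<le> gagliardo_nn s p u"
  unfolding gagliardo_nn_eq gagliardo_density_def using assms p
  by (intro nn_integral_mono ennreal_leI mult_right_mono powr_mono2) (auto simp: riesz_kernel_nonneg)

lemma gagliardo_nn_abs: "gagliardo_nn s p (\<lambda>x. \<bar>u x\<bar>) \<le> gagliardo_nn s p u"
  by (intro gagliardo_nn_mono) (auto simp: abs_triangle_ineq3)

text \<open>The modulus of a test function need not be smooth, so
  \<open>sqrt (\<phi>\<^sup>2 + \<delta>\<^sup>2) - \<delta>\<close> takes its place; its energy
  does not exceed that of \<phi>. Along a subsequence the test functions converge to
  \<open>u\<close> almost everywhere, hence these substitutes converge to the modulus of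
  \<open>u\<close>, and their bounded energies place the limit in the space by
  \<open>closure_space_AE_limit\<close>.\<close>

theorem closure_space_abs:
  assumes u: "u \<in> closure_space"
  shows "(\<lambda>x. \<bar>u x\<bar>) \<in> closure_space"
proof -
  let ?E = "gagliardo_nn s p"
  have um: "u \<in> borel_measurable lebesgue" using vanishing_measurable[OF closure_spaceD[OF u]] .
  obtain C where C0: "C > 0" and C: "\<And>u t. vanishing u \<Longrightarrow> t \<ge> 0 \<Longrightarrow> ?E u \<le> ennreal (t powr p) \<Longrightarrow>
      (\<integral>\<^sup>+x. ennreal (\<bar>u x\<bar> powr p) \<partial>lebesgue) \<le> ennreal (C * t powr p)"
    using sobolev_scaled[OF _ p_subcritical] p by auto
  define t where "t = (\<lambda>k::nat. (1 / Suc k) powr (1 / p))"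
  have t: "t k \<ge> 0" "t k powr p = 1 / Suc k" for k using p by (auto simp: t_def powr_powr)
  have "\<exists>\<phi>\<in>test_functions \<Omega>. ?E (\<lambda>x. u x - \<phi> x) < ennreal (1 / Suc k)" for k
    using closure_spaceE[OF u, of "1 / Suc k"] by (metis of_nat_0_less_iff zero_less_Suc zero_less_divide_1_iff)
  then obtain \<phi> where \<phi>: "\<And>k. \<phi> k \<in> test_functions \<Omega>" "\<And>k. ?E (\<lambda>x. u x - \<phi> k x) < ennreal (1 / Suc k)" by metis
  have \<phi>m: "\<phi> k \<in> borel_measurable lebesgue" for k using test_functions_lebesgue[OF \<phi>(1)] .
  have I: "(\<integral>\<^sup>+x. ennreal (\<bar>u x - \<phi> k x\<bar> powr p) \<partial>lebesgue) \<le> ennreal (C * (1 / Suc k))" for k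
    using C[OF vanishing_diff[OF closure_spaceD[OF u] vanishing_test[OF \<phi>(1)]] t(1)[of k]] \<phi>(2)[of k] t(2)[of k] by simp
  define f where "f = (\<lambda>k x. \<bar>u x - \<phi> k x\<bar> powr p)"
  have fm: "f k \<in> borel_measurable lebesgue" for k unfolding f_def using um \<phi>m[of k] by measurable
  have f_int: "integrable lebesgue (f k)" for k
    using I[of k] by (intro integrableI_nonneg fm) (auto simp: f_def elim: le_less_trans)
  have f_lim: "(\<lambda>k. \<integral>x. norm (f k x) \<partial>lebesgue) \<longlonglongrightarrow> 0"
  proof (rule tendsto_sandwich[OF _ _ tendsto_const])
    show "\<forall>\<^sub>F k in sequentially. 0 \<le> (\<integral>x. norm (f k x) \<partial>lebesgue)" by simp
    have "(\<integral>x. norm (f k x) \<partial>lebesgue) \<le> C * (1 / Suc k)" for k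
    proof -
      have "ennreal (\<integral>x. f k x \<partial>lebesgue) \<le> ennreal (C * (1 / Suc k))"
        using I[of k] nn_integral_eq_integral[OF f_int, of k] by (simp add: f_def)
      then have "(\<integral>x. f k x \<partial>lebesgue) \<le> C * (1 / Suc k)" using C0 by (subst (asm) ennreal_le_iff) auto
      then show ?thesis by (simp add: f_def)
    qed
    then show "\<forall>\<^sub>F k in sequentially. (\<integral>x. norm (f k x) \<partial>lebesgue) \<le> C * (1 / Suc k)" by simp
    have "(\<lambda>k. C * (1 / real (Suc k))) \<longlonglongrightarrow> C * 0" by (intro tendsto_intros LIMSEQ_Suc[OF lim_1_over_n])
    then show "(\<lambda>k. C * (1 / real (Suc k))) \<longlonglongrightarrow> 0" by simp
  qed
  obtain \<sigma> where \<sigma>: "strict_mono \<sigma>" "AE x in lebesgue. (\<lambda>k. f (\<sigma> k) x) \<longlonglongrightarrow> 0"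
    using tendsto_L1_AE_subseq[OF f_int f_lim] by blast
  define \<delta> where "\<delta> = (\<lambda>k::nat. 1 / real (Suc k))"
  have \<delta>: "\<delta> k > 0" "\<delta> \<longlonglongrightarrow> 0" for k unfolding \<delta>_def using LIMSEQ_Suc[OF lim_1_over_n] by auto
  define W where "W = (\<lambda>k x. sqrt ((\<phi> (\<sigma> k) x)\<^sup>2 + (\<delta> k)\<^sup>2) - \<delta> k)"
  have W_lip: "\<bar>W k x - W k y\<bar> \<le> \<bar>\<phi> (\<sigma> k) x - \<phi> (\<sigma> k) y\<bar>" for k x y
  proof -
    \<comment> \<open>Up to the constant \<open>\<delta> k\<close>, \<open>W k x\<close> is the
      Euclidean norm of a point in the plane, so the reverse triangle inequality gives the Lipschitz
      bound.\<close>
    have "norm (\<phi> (\<sigma> k) x, \<delta> k) - norm (\<phi> (\<sigma> k) y, \<delta> k) = W k x - W k y" by (simp add: W_def norm_Pair)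
    moreover have "\<bar>norm (\<phi> (\<sigma> k) x, \<delta> k) - norm (\<phi> (\<sigma> k) y, \<delta> k)\<bar> \<le> norm ((\<phi> (\<sigma> k) x, \<delta> k) - (\<phi> (\<sigma> k) y, \<delta> k))"
      by (rule norm_triangle_ineq3)
    ultimately show ?thesis by (simp add: norm_Pair)
  qed
  have W_abs: "\<bar>W k x - \<bar>\<phi> (\<sigma> k) x\<bar>\<bar> \<le> \<delta> k" for k x
  proof -
    have "\<bar>\<phi> (\<sigma> k) x\<bar> \<le> sqrt ((\<phi> (\<sigma> k) x)\<^sup>2 + (\<delta> k)\<^sup>2)" by (rule real_le_rsqrt) simp
    moreover have "sqrt ((\<phi> (\<sigma> k) x)\<^sup>2 + (\<delta> k)\<^sup>2) \<le> \<bar>\<phi> (\<sigma> k) x\<bar> + \<delta> k"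
      using sqrt_sum_squares_le_sum_abs[of "\<phi> (\<sigma> k) x" "\<delta> k"] \<delta>(1)[of k] by simp
    ultimately show ?thesis using \<delta>(1)[of k] by (simp add: W_def)
  qed
  obtain B0 where B0: "?E u = ennreal B0" "B0 \<ge> 0" using closure_space_finite[OF u] by (cases "?E u") auto
  show ?thesis
  proof (rule closure_space_AE_limit)
    show "W k \<in> closure_space" for k
      unfolding W_def by (intro test_functions_closure_space test_functions_sqrt \<delta> \<phi>)
    show "?E (W k) \<le> ennreal (2 powr p * (B0 + 1))" for k
    proof -
      have "?E (W k) \<le> ?E (\<phi> (\<sigma> k))" by (rule gagliardo_nn_mono[OF W_lip])
      also have "\<phi> (\<sigma> k) = (\<lambda>x. u x + (-1) * (u x - \<phi> (\<sigma> k) x))" by auto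
      also have "?E \<dots> \<le> ennreal (2 powr p) * (?E u + ?E (\<lambda>x. (-1) * (u x - \<phi> (\<sigma> k) x)))"
        using um \<phi>m p by (intro gagliardo_nn_add_le borel_measurable_times borel_measurable_diff) auto
      also have "?E (\<lambda>x. (-1) * (u x - \<phi> (\<sigma> k) x)) = ?E (\<lambda>x. u x - \<phi> (\<sigma> k) x)"
        using um \<phi>m by (subst gagliardo_nn_scale) auto
      also have "ennreal (2 powr p) * (?E u + \<dots>) \<le> ennreal (2 powr p) * (ennreal B0 + ennreal 1)"
      proof (intro mult_left_mono add_mono)
        have "ennreal (1 / Suc (\<sigma> k)) \<le> ennreal 1" by (intro ennreal_leI) simp
        then show "?E (\<lambda>x. u x - \<phi> (\<sigma> k) x) \<le> ennreal 1" using \<phi>(2)[of "\<sigma> k"] by (meson less_imp_le order_trans)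
      qed (auto simp: B0)
      finally show ?thesis using B0 by (simp add: ennreal_mult ennreal_plus)
    qed
    show "(\<lambda>x. \<bar>u x\<bar>) \<in> borel_measurable lebesgue" using um by measurable
    show "AE x in lebesgue. (\<lambda>k. W k x) \<longlonglongrightarrow> \<bar>u x\<bar>"
      using \<sigma>(2)
    proof eventually_elim
      case (elim x)
      have "(\<lambda>k. (f (\<sigma> k) x) powr (1 / p)) \<longlonglongrightarrow> 0 powr (1 / p)"
        using p by (intro tendsto_powr' elim tendsto_const) (auto simp: f_def)
      then have "(\<lambda>k. \<bar>u x - \<phi> (\<sigma> k) x\<bar>) \<longlonglongrightarrow> 0" using p by (simp add: f_def powr_powr)
      then have "(\<lambda>k. u x - \<phi> (\<sigma> k) x) \<longlonglongrightarrow> 0" by (simp add: tendsto_rabs_zero_iff)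
      then have "(\<lambda>k. u x - (u x - \<phi> (\<sigma> k) x)) \<longlonglongrightarrow> u x - 0" by (intro tendsto_diff tendsto_const)
      then have 1: "(\<lambda>k. \<bar>\<phi> (\<sigma> k) x\<bar>) \<longlonglongrightarrow> \<bar>u x\<bar>" by (intro tendsto_rabs) simp
      have "(\<lambda>k. W k x - \<bar>\<phi> (\<sigma> k) x\<bar>) \<longlonglongrightarrow> 0"
        by (rule tendsto_rabs_zero_cancel, rule tendsto_sandwich[OF _ _ tendsto_const \<delta>(2)]) (auto simp: W_abs)
      from tendsto_add[OF this 1] show ?case by simp
    qed
  qed
qed

end


section \<open>Compactness\<close>

text \<open>The classes are the half-open dyadic cubes of side 2^-i. As a relation between points it
  is jointly measurable, which makes averages over the cell of \<open>x\<close> measurable in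
  \<open>x\<close>.\<close>

definition same_cell :: "nat \<Rightarrow> 'a::euclidean_space \<Rightarrow> 'a \<Rightarrow> bool" where
  "same_cell i x y \<longleftrightarrow> (\<forall>b\<in>Basis. \<lfloor>2 ^ i * (x \<bullet> b)\<rfloor> = \<lfloor>2 ^ i * (y \<bullet> b)\<rfloor>)"

lemma same_cell_measurable [measurable]:
  "Measurable.pred (borel :: ('a::euclidean_space \<times> 'a) measure) (\<lambda>z. same_cell i (fst z) (snd z))"
proof -
  have f: "(\<lambda>z::'a \<times> 'a. \<lfloor>2 ^ i * (fst z \<bullet> b)\<rfloor>) \<in> borel \<rightarrow>\<^sub>M count_space UNIV" for b
    by (rule measurable_compose[OF _ measurable_real_floor]) (intro borel_measurable_continuous_onI continuous_intros)
  have s: "(\<lambda>z::'a \<times> 'a. \<lfloor>2 ^ i * (snd z \<bullet> b)\<rfloor>) \<in> borel \<rightarrow>\<^sub>M count_space UNIV" for b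
    by (rule measurable_compose[OF _ measurable_real_floor]) (intro borel_measurable_continuous_onI continuous_intros)
  note [measurable] = f s
  show ?thesis unfolding same_cell_def by measurable
qed

lemma same_cell_sets [measurable]: "{y. same_cell i x y} \<in> sets (borel :: 'a::euclidean_space measure)"
proof -
  have "(\<lambda>y::'a. \<lfloor>2 ^ i * (y \<bullet> b)\<rfloor>) \<in> borel \<rightarrow>\<^sub>M count_space UNIV" for b
    by (rule measurable_compose[OF _ measurable_real_floor]) (intro borel_measurable_continuous_onI continuous_intros)
  note [measurable] = this
  have "Measurable.pred borel (\<lambda>y::'a. same_cell i x y)" unfolding same_cell_def by measurable
  then show ?thesis by (simp add: pred_def)
qed

lemma emeasure_same_cell:
  "emeasure lborel {y::'a::euclidean_space. same_cell i x y} = ennreal (1 / 2 ^ (i * DIM('a)))"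
proof -
  define h :: real where "h = 1 / 2 ^ i"
  define a :: 'a where "a = (\<Sum>b\<in>Basis. (of_int \<lfloor>2 ^ i * (x \<bullet> b)\<rfloor> * h) *\<^sub>R b)"
  define c where "c = a + (\<Sum>b\<in>Basis. h *\<^sub>R b)"
  have h: "h > 0" "2 ^ i * h = 1" by (auto simp: h_def)
  have ab: "a \<bullet> b = of_int \<lfloor>2 ^ i * (x \<bullet> b)\<rfloor> * h" "c \<bullet> b = a \<bullet> b + h" if "b \<in> Basis" for b
    using that by (auto simp: a_def c_def inner_add_left)
  have cell: "same_cell i x y \<longleftrightarrow> (\<forall>b\<in>Basis. a \<bullet> b \<le> y \<bullet> b \<and> y \<bullet> b < c \<bullet> b)" for y
  proof -
    have "\<lfloor>2 ^ i * (x \<bullet> b)\<rfloor> = \<lfloor>2 ^ i * (y \<bullet> b)\<rfloor> \<longleftrightarrow> a \<bullet> b \<le> y \<bullet> b \<and> y \<bullet> b < c \<bullet> b" if b: "b \<in> Basis" for b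
    proof -
      let ?m = "real_of_int \<lfloor>2 ^ i * (x \<bullet> b)\<rfloor>"
      have "\<lfloor>2 ^ i * (x \<bullet> b)\<rfloor> = \<lfloor>2 ^ i * (y \<bullet> b)\<rfloor> \<longleftrightarrow> ?m \<le> 2 ^ i * (y \<bullet> b) \<and> 2 ^ i * (y \<bullet> b) < ?m + 1"
        unfolding floor_eq_iff[symmetric] by (rule eq_commute)
      also have "\<dots> \<longleftrightarrow> a \<bullet> b \<le> y \<bullet> b \<and> y \<bullet> b < c \<bullet> b"
        unfolding ab[OF b] h_def by (simp add: field_simps)
      finally show ?thesis .
    qed
    then show ?thesis by (simp add: same_cell_def)
  qed
  have m: "{y. same_cell i x y} \<in> sets lborel" by simp
  have "emeasure lborel (box a c) \<le> emeasure lborel {y. same_cell i x y}"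
    using m by (intro emeasure_mono) (auto simp: cell box_def intro: less_imp_le)
  moreover have "emeasure lborel {y. same_cell i x y} \<le> emeasure lborel (cbox a c)"
    by (intro emeasure_mono) (auto simp: cell cbox_def intro: less_imp_le)
  moreover have "emeasure lborel (box a c) = ennreal (h ^ DIM('a))"
    using h by (subst emeasure_lborel_box) (auto simp: ab inner_diff_left)
  moreover have "emeasure lborel (cbox a c) = ennreal (h ^ DIM('a))"
    using h by (subst emeasure_lborel_cbox) (auto simp: ab inner_diff_left)
  moreover have "h ^ DIM('a) = 1 / 2 ^ (i * DIM('a))" by (simp add: h_def power_divide flip: power_mult)
  ultimately show ?thesis by simp
qed

lemma same_cell_norm:
  fixes x y :: "'a::euclidean_space"
  assumes "same_cell i x y"
  shows "norm (x - y) \<le> real DIM('a) / 2 ^ i"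
proof -
  have "norm (x - y) \<le> (\<Sum>b\<in>Basis. \<bar>(x - y) \<bullet> b\<bar>)" by (rule norm_le_l1)
  also have "\<dots> \<le> (\<Sum>b\<in>(Basis::'a set). 1 / 2 ^ i)"
  proof (rule sum_mono)
    fix b :: 'a assume "b \<in> Basis"
    then have "\<lfloor>2 ^ i * (x \<bullet> b)\<rfloor> = \<lfloor>2 ^ i * (y \<bullet> b)\<rfloor>" using assms by (simp add: same_cell_def)
    then have "\<bar>2 ^ i * (x \<bullet> b) - 2 ^ i * (y \<bullet> b)\<bar> \<le> 1" by linarith
    then have "2 ^ i * \<bar>(x - y) \<bullet> b\<bar> \<le> 1" by (simp add: inner_diff_left abs_mult flip: right_diff_distrib)
    then show "\<bar>(x - y) \<bullet> b\<bar> \<le> 1 / 2 ^ i" by (simp add: field_simps)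
  qed
  finally show ?thesis by simp
qed

lemma countable_cells: "countable {{y::'a::euclidean_space. same_cell i x y} | i x. True}"
proof -
  have "{{y::'a. same_cell i x y} | i x. True} \<subseteq>
      (\<lambda>(i, m). {y. \<forall>b\<in>Basis. \<lfloor>2 ^ i * (y \<bullet> b)\<rfloor> = m b}) ` (UNIV \<times> PiE Basis (\<lambda>_. UNIV :: int set))"
  proof
    fix c assume "c \<in> {{y::'a. same_cell i x y} | i x. True}"
    then obtain i and x :: 'a where c: "c = {y. same_cell i x y}" by blast
    show "c \<in> (\<lambda>(i, m). {y. \<forall>b\<in>Basis. \<lfloor>2 ^ i * (y \<bullet> b)\<rfloor> = m b}) ` (UNIV \<times> PiE Basis (\<lambda>_. UNIV :: int set))"
      by (rule image_eqI[where x = "(i, restrict (\<lambda>b. \<lfloor>2 ^ i * (x \<bullet> b)\<rfloor>) Basis)"])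
        (auto simp: c same_cell_def)
  qed
  moreover have "countable (PiE (Basis :: 'a set) (\<lambda>_. UNIV :: int set))" by (intro countable_PiE) auto
  ultimately show ?thesis by (meson countable_SIGMA countable_image countable_subset countableI_type)
qed

lemma diagonal_convergent:
  fixes S :: "nat \<Rightarrow> nat \<Rightarrow> real"
  assumes "\<And>n k. \<bar>S n k\<bar> \<le> C"
  shows "\<exists>\<sigma>. strict_mono \<sigma> \<and> (\<forall>n. convergent (\<lambda>k. S n (\<sigma> k)))"
proof -
  interpret subseqs "\<lambda>n s. convergent (\<lambda>k. S n (s k))"
  proof
    fix n and t :: "nat \<Rightarrow> nat" assume "strict_mono t"
    have "bounded (range (\<lambda>k. S n (t k)))" using assms unfolding bounded_iff by auto
    then obtain l r where "strict_mono r" "((\<lambda>k. S n (t k)) \<circ> r) \<longlonglongrightarrow> l"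
      using bounded_imp_convergent_subsequence by blast
    then show "\<exists>r'. strict_mono r' \<and> convergent (\<lambda>k. S n ((t \<circ> r') k))"
      by (auto simp: convergent_def o_def)
  qed
  have "convergent (\<lambda>k. S n (diagseq k))" for n
  proof -
    have "convergent (\<lambda>k. S n ((diagseq \<circ> (+) (Suc n)) k))"
    proof (rule diagseq_holds)
      fix r s :: "nat \<Rightarrow> nat" and n assume "strict_mono r" "convergent (\<lambda>k. S n (s k))"
      then show "convergent (\<lambda>k. S n ((s \<circ> r) k))"
        using convergent_subseq_convergent[of "\<lambda>k. S n (s k)" r] by (simp add: o_def)
    qed
    then have "convergent (\<lambda>k. S n (diagseq (k + Suc n)))" by (simp add: o_def add.commute)
    then show ?thesis by (rule convergent_ignore_initial_segment[THEN iffD1])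
  qed
  then show ?thesis using subseq_diagseq by blast
qed

section \<open>Cell averages and convergent subsequences\<close>

context bounded_open_set
begin

definition cell_average :: "nat \<Rightarrow> ('a \<Rightarrow> real) \<Rightarrow> 'a \<Rightarrow> real" where
  "cell_average i v x = 2 ^ (i * DIM('a)) * (LINT y|lborel. indicator {y. same_cell i x y} y * v y)"

lemma cell_average_measurable:
  assumes v: "v \<in> borel_measurable borel"
  shows "cell_average i v \<in> borel_measurable borel"
proof -
  have "(\<lambda>z::'a \<times> 'a. indicator {y. same_cell i (fst z) y} (snd z) * v (snd z)) \<in> borel_measurable borel"
  proof -
    have "(\<lambda>z::'a \<times> 'a. indicator {z. same_cell i (fst z) (snd z)} z * v (snd z)) \<in> borel_measurable borel"
      using same_cell_measurable[of i]
      by (intro borel_measurable_times borel_measurable_indicator measurable_compose[OF snd_borel_measurable v]) (simp add: pred_def)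
    then show ?thesis by (simp add: indicator_def)
  qed
  moreover have "sets ((borel :: 'a measure) \<Otimes>\<^sub>M (lborel :: 'a measure)) = sets (borel :: ('a \<times> 'a) measure)"
    by (metis borel_prod sets_lborel sets_pair_measure_cong)
  ultimately have "(\<lambda>(x, y). indicator {y. same_cell i x y} y * v y) \<in> borel_measurable ((borel :: 'a measure) \<Otimes>\<^sub>M (lborel :: 'a measure))"
    unfolding case_prod_beta' using measurable_cong_sets by blast
  then show ?thesis unfolding cell_average_def[abs_def]
    by (intro borel_measurable_times borel_measurable_const lborel.borel_measurable_lebesgue_integral)
qed

text \<open>The deviation from the average is the mean over the cell of \<open>v x - v y\<close>.
  Differences up to \<eta> contribute at most \<eta>; larger ones are at most \<eta>^(1-p) times
  their p-th power, and inside a cell the kernel is bounded below, so the energy controls them. The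
  choice \<eta> = 2^(-is) makes both contributions of the same order, and the bound tends to 0 in
  \<open>i\<close> uniformly for bounded energy.\<close>

lemma cell_average_estimate:
  assumes v: "v \<in> borel_measurable borel" "integrable lborel v" and E: "gagliardo_nn s p v \<le> ennreal B" and B: "B \<ge> 0"
  shows "(\<integral>\<^sup>+x. ennreal \<bar>v x - cell_average i v x\<bar> * indicator \<Omega> x \<partial>lborel)
    \<le> ennreal (2 powr - (real i * s) * (measure lborel \<Omega> + real DIM('a) powr (real DIM('a) + p * s) * B))"
proof -
  define n where "n = real DIM('a)"
  have n: "n > 0" by (simp add: n_def)
  define H :: real where "H = 2 ^ (i * DIM('a))"
  have H: "H > 0" "H = 2 powr (real i * n)" by (auto simp: H_def n_def simp flip: powr_realpow)
  define D where "D = n / 2 ^ i"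
  have D: "D > 0" using n by (simp add: D_def)
  define \<eta> where "\<eta> = 2 powr - (real i * s)"
  have \<eta>: "\<eta> > 0" by (simp add: \<eta>_def)
  define A where "A = \<eta> powr (1 - p) * D powr (n + p * s)"
  have A: "A > 0" using \<eta> D by (simp add: A_def)
  have m: "emeasure lborel {y::'a. same_cell i x y} = ennreal (1 / H)" for x unfolding H_def by (rule emeasure_same_cell)
  have pw: "\<bar>v x - v y\<bar> * indicator {y. same_cell i x y} y \<le> \<eta> * indicator {y. same_cell i x y} y + A * gagliardo_density s p v (x, y)" for x y
  proof (cases "same_cell i x y")
    case True
    show ?thesis
    proof (cases "\<bar>v x - v y\<bar> \<le> \<eta>")
      case True
      then show ?thesis using A gagliardo_density_nonneg[of s p v "(x, y)"] by (simp add: indicator_def add_increasing2)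
    next
      case False
      let ?d = "\<bar>v x - v y\<bar>"
      have xy: "x \<noteq> y" using False \<eta> by auto
      have "norm (x - y) \<le> D" using same_cell_norm[OF True] by (simp add: D_def n_def)
      then have "D powr - (n + p * s) \<le> riesz_kernel s p (x, y)" unfolding n_def using xy p s by (intro riesz_kernel_ge) auto
      then have "D powr (n + p * s) * D powr - (n + p * s) \<le> D powr (n + p * s) * riesz_kernel s p (x, y)" by (intro mult_left_mono) auto
      moreover have "D powr (n + p * s) * D powr - (n + p * s) = 1" using D by (simp flip: powr_add)
      ultimately have ker: "1 \<le> D powr (n + p * s) * riesz_kernel s p (x, y)" by simp
      have "?d = ?d powr p * ?d powr (1 - p)" using False \<eta> by (simp flip: powr_add)
      also have "\<dots> \<le> ?d powr p * \<eta> powr (1 - p)" using False \<eta> p by (intro mult_left_mono powr_mono2') auto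
      also have "\<dots> \<le> ?d powr p * \<eta> powr (1 - p) * (D powr (n + p * s) * riesz_kernel s p (x, y))"
        using mult_left_mono[OF ker, of "?d powr p * \<eta> powr (1 - p)"] by simp
      also have "\<dots> = A * gagliardo_density s p v (x, y)" by (simp add: A_def gagliardo_density_def)
      finally show ?thesis using True \<eta> by (simp add: add_increasing)
    qed
  qed (use A gagliardo_density_nonneg[of s p v] in simp)
  have ind_int: "integrable lborel (\<lambda>y. indicator {y. same_cell i x y} y * c)" for x :: 'a and c :: real
    using m[of x] by (intro integrable_mult_left integrable_real_indicator) auto
  have indv_int: "integrable lborel (\<lambda>y. indicator {y. same_cell i x y} y * v y)" for x
  proof (rule Bochner_Integration.integrable_bound[OF v(2)])
    show "(\<lambda>y. indicator {y. same_cell i x y} y * v y) \<in> borel_measurable lborel"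
      using v(1) by (intro borel_measurable_times borel_measurable_indicator) auto
  qed (simp add: indicator_def)
  define g where "g = (\<lambda>x. \<integral>\<^sup>+y. ennreal (gagliardo_density s p v (x, y)) \<partial>lborel)"
  have dens: "(\<lambda>z. ennreal (gagliardo_density s p v z)) \<in> borel_measurable borel" unfolding gagliardo_density_def[abs_def]
    by (intro measurable_compose[OF _ measurable_ennreal] borel_measurable_times powr_real_measurable borel_measurable_abs
        difference_borel_measurable riesz_kernel_measurable borel_measurable_const v(1))
  then have dens': "(\<lambda>z. ennreal (gagliardo_density s p v z)) \<in> borel_measurable (lborel \<Otimes>\<^sub>M lborel)" unfolding lborel_prod by simp
  have gm[measurable]: "g \<in> borel_measurable lborel" unfolding g_def using lborel.borel_measurable_nn_integral_fst[OF dens'] .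
  have ym: "(\<lambda>y. ennreal (gagliardo_density s p v (x, y))) \<in> borel_measurable lborel" for x
    using measurable_compose[OF measurable_Pair1' dens'] by simp
  have ptw: "ennreal \<bar>v x - cell_average i v x\<bar> \<le> ennreal \<eta> + ennreal (H * A) * g x" for x
  proof -
    have "v x - cell_average i v x = H * (LINT y|lborel. indicator {y. same_cell i x y} y * v x) - H * (LINT y|lborel. indicator {y. same_cell i x y} y * v y)"
      unfolding cell_average_def H_def[symmetric] using H m[of x] by (simp add: measure_def)
    also have "\<dots> = H * (LINT y|lborel. indicator {y. same_cell i x y} y * (v x - v y))"
      using ind_int[of x "v x"] indv_int[of x] by (simp add: right_diff_distrib)
    finally have "ennreal \<bar>v x - cell_average i v x\<bar> = ennreal H * ennreal \<bar>LINT y|lborel. indicator {y. same_cell i x y} y * (v x - v y)\<bar>"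
      using H by (simp add: abs_mult ennreal_mult)
    also have "\<dots> \<le> ennreal H * (\<integral>\<^sup>+y. ennreal (norm (indicator {y. same_cell i x y} y * (v x - v y))) \<partial>lborel)"
    proof (rule mult_left_mono)
      have "integrable lborel (\<lambda>y. indicator {y. same_cell i x y} y * (v x - v y))"
        using Bochner_Integration.integrable_diff[OF ind_int[of x "v x"] indv_int[of x]] by (simp add: right_diff_distrib)
      from integral_norm_bound_ennreal[OF this] show "ennreal \<bar>LINT y|lborel. indicator {y. same_cell i x y} y * (v x - v y)\<bar>
          \<le> (\<integral>\<^sup>+y. ennreal (norm (indicator {y. same_cell i x y} y * (v x - v y))) \<partial>lborel)" by simp
    qed simp
    also have "\<dots> \<le> ennreal H * (\<integral>\<^sup>+y. ennreal \<eta> * indicator {y. same_cell i x y} y + ennreal A * ennreal (gagliardo_density s p v (x, y)) \<partial>lborel)"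
    proof (intro mult_left_mono nn_integral_mono)
      fix y
      have "ennreal (norm (indicator {y. same_cell i x y} y * (v x - v y))) \<le> ennreal (\<eta> * indicator {y. same_cell i x y} y + A * gagliardo_density s p v (x, y))"
        using pw[of x y] by (intro ennreal_leI) (simp add: abs_mult mult.commute)
      also have "\<dots> = ennreal \<eta> * indicator {y. same_cell i x y} y + ennreal A * ennreal (gagliardo_density s p v (x, y))"
        using \<eta> A gagliardo_density_nonneg[of s p v "(x, y)"]
        by (subst ennreal_plus) (auto simp: ennreal_mult indicator_def)
      finally show "ennreal (norm (indicator {y. same_cell i x y} y * (v x - v y)))
          \<le> ennreal \<eta> * indicator {y. same_cell i x y} y + ennreal A * ennreal (gagliardo_density s p v (x, y))" .
    qed simp
    also have "(\<integral>\<^sup>+y. ennreal \<eta> * indicator {y. same_cell i x y} y + ennreal A * ennreal (gagliardo_density s p v (x, y)) \<partial>lborel)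
        = ennreal \<eta> * ennreal (1 / H) + ennreal A * g x"
      unfolding g_def using ym[of x] by (subst nn_integral_add) (auto simp: nn_integral_cmult nn_integral_cmult_indicator m)
    also have "ennreal H * \<dots> = ennreal \<eta> + ennreal (H * A) * g x"
    proof -
      have "ennreal H * (ennreal \<eta> * ennreal (1 / H)) = ennreal \<eta>" using H \<eta> by (simp flip: ennreal_mult)
      then show ?thesis using H A by (simp add: distrib_left ennreal_mult mult.assoc)
    qed
    finally show ?thesis .
  qed
  have "(\<integral>\<^sup>+x. ennreal \<bar>v x - cell_average i v x\<bar> * indicator \<Omega> x \<partial>lborel)
      \<le> (\<integral>\<^sup>+x. ennreal \<eta> * indicator \<Omega> x + ennreal (H * A) * g x \<partial>lborel)"
    using ptw by (intro nn_integral_mono) (auto split: split_indicator)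
  also have "\<dots> = ennreal \<eta> * emeasure lborel \<Omega> + ennreal (H * A) * (\<integral>\<^sup>+x. g x \<partial>lborel)"
    by (subst nn_integral_add) (auto simp: nn_integral_cmult nn_integral_cmult_indicator)
  also have "(\<integral>\<^sup>+x. g x \<partial>lborel) = gagliardo_nn s p v"
    unfolding gagliardo_nn_fubini[OF v(1)] g_def gagliardo_density_def by simp
  also have "ennreal \<eta> * emeasure lborel \<Omega> + ennreal (H * A) * gagliardo_nn s p v
      \<le> ennreal \<eta> * ennreal (measure lborel \<Omega>) + ennreal (H * A) * ennreal B"
    using E emeasure_\<Omega> by (intro add_mono mult_left_mono) (auto simp: emeasure_eq_ennreal_measure)
  also have "\<dots> = ennreal (\<eta> * measure lborel \<Omega> + H * A * B)"
    using \<eta> H A B by (simp flip: ennreal_mult ennreal_plus)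
  \<comment> \<open>The exponents of 2 in \<open>H\<close>, in \<eta>^(1-p) and in D^(n+ps) are i n,
    i s (p - 1) and -i (n + p s); their sum is -i s.\<close>
  also have "H * A = \<eta> * n powr (n + p * s)"
  proof -
    have "D powr (n + p * s) = n powr (n + p * s) * 2 powr - (real i * (n + p * s))"
      unfolding D_def using n by (simp add: powr_divide powr_powr powr_minus_divide flip: powr_realpow)
    moreover have "\<eta> powr (1 - p) = 2 powr (- (real i * s) * (1 - p))" unfolding \<eta>_def by (rule powr_powr)
    ultimately have "H * A = n powr (n + p * s) * (2 powr (real i * n) * 2 powr (- (real i * s) * (1 - p)) * 2 powr - (real i * (n + p * s)))"
      unfolding A_def H(2) by simp
    also have "2 powr (real i * n) * 2 powr (- (real i * s) * (1 - p)) * 2 powr - (real i * (n + p * s))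
        = (2::real) powr (real i * n + - (real i * s) * (1 - p) + - (real i * (n + p * s)))" by (simp only: powr_add)
    also have "real i * n + - (real i * s) * (1 - p) + - (real i * (n + p * s)) = - (real i * s)" by (simp add: algebra_simps)
    finally show ?thesis by (simp add: \<eta>_def)
  qed
  finally show ?thesis by (simp add: \<eta>_def n_def distrib_left mult.assoc)
qed

text \<open>The integrals over the countably many dyadic cells are bounded, so one subsequence makes
  all of them converge. At a fixed level the averages then converge pointwise and boundedly, while
  the estimate for cell averages is uniform along the sequence; together they make the subsequence
  Cauchy in L^1, hence convergent almost everywhere along a further one.\<close>

theorem compact_AE_subsequence:
  assumes U: "\<And>k::nat. vanishing (U k)" and E: "\<And>k. gagliardo_nn s p (U k) \<le> ennreal B"
  shows "\<exists>\<sigma> u. strict_mono \<sigma> \<and> u \<in> borel_measurable lebesgue \<and> (AE x in lebesgue. (\<lambda>k. U (\<sigma> k) x) \<longlonglongrightarrow> u x)"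
proof -
  have "\<exists>v. v \<in> borel_measurable borel \<and> (AE x in lebesgue. U k x = v x)" for k
    using lebesgue_ex_borel[OF vanishing_measurable[OF U]] by metis
  then obtain V where V: "\<And>k. V k \<in> borel_measurable borel" "\<And>k. AE x in lebesgue. U k x = V k x" by metis
  \<comment> \<open>Borel representatives that vanish identically outside \<Omega>, so that averages
    and L^1 norms can be formed with \<open>lborel\<close>.\<close>
  define v where "v = (\<lambda>k x. indicator \<Omega> x * V k x)"
  have vm[measurable]: "v k \<in> borel_measurable borel" for k unfolding v_def using V(1)[of k] by measurable
  have v_out: "v k x = 0" if "x \<notin> \<Omega>" for k x using that by (simp add: v_def)
  have vU: "AE x in lebesgue. U k x = v k x" for k
  proof -
    have "AE x in lebesgue. x \<notin> \<Omega> \<longrightarrow> U k x = 0" using U[of k] by (simp add: vanishing_def)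
    with V(2)[of k] show ?thesis by eventually_elim (auto simp: v_def indicator_def)
  qed
  define B' where "B' = max B 0"
  have B': "B' \<ge> 0" "ennreal B \<le> ennreal B'" by (auto simp: B'_def ennreal_leI)
  have Ev: "gagliardo_nn s p (v k) \<le> ennreal B'" for k
    using E[of k] B'(2) gagliardo_nn_cong_AE[OF vU[of k]] by (metis order_trans)
  \<comment> \<open>The Sobolev inequality with exponent 1 supplies the L^1 bound on which the
    averages rely.\<close>
  have "1 < real DIM('a) * p / (real DIM('a) - p * s)" using p_subcritical p by linarith
  then obtain C where C0: "C > 0" and C: "\<And>u t. vanishing u \<Longrightarrow> t \<ge> 0 \<Longrightarrow> gagliardo_nn s p u \<le> ennreal (t powr p) \<Longrightarrow>
      (\<integral>\<^sup>+x. ennreal (\<bar>u x\<bar> powr 1) \<partial>lebesgue) \<le> ennreal (C * t powr 1)"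
    using sobolev_scaled[of 1] by auto
  define C1 where "C1 = C * B' powr (1 / p)"
  have C1: "(\<integral>\<^sup>+x. ennreal \<bar>v k x\<bar> \<partial>lborel) \<le> ennreal C1" for k
  proof -
    have "vanishing (v k)" unfolding vanishing_def using v_out by (auto intro: measurable_completion)
    moreover have "gagliardo_nn s p (v k) \<le> ennreal ((B' powr (1 / p)) powr p)"
      using Ev[of k] B' p by (simp add: powr_powr)
    ultimately have "(\<integral>\<^sup>+x. ennreal (\<bar>v k x\<bar> powr 1) \<partial>lebesgue) \<le> ennreal (C * (B' powr (1 / p)) powr 1)"
      by (intro C) auto
    then show ?thesis by (simp add: C1_def nn_integral_completion)
  qed
  have C1_nonneg: "C1 \<ge> 0" using C0 by (simp add: C1_def)
  have v_int: "integrable lborel (v k)" for k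
    using C1[of k] by (intro integrableI_bounded) (auto elim: le_less_trans)
  have part_le: "\<bar>LINT y|lborel. indicator c y * v k y\<bar> \<le> C1" if [measurable]: "c \<in> sets borel" for c k
  proof -
    have "ennreal \<bar>LINT y|lborel. indicator c y * v k y\<bar> \<le> (\<integral>\<^sup>+y. ennreal (norm (indicator c y * v k y)) \<partial>lborel)"
    proof -
      have "integrable lborel (\<lambda>y. indicator c y * v k y)"
        by (rule Bochner_Integration.integrable_bound[OF v_int[of k]]) (auto simp: indicator_def)
      from integral_norm_bound_ennreal[OF this] show ?thesis by simp
    qed
    also have "\<dots> \<le> (\<integral>\<^sup>+y. ennreal \<bar>v k y\<bar> \<partial>lborel)" by (intro nn_integral_mono) (auto simp: indicator_def)
    also have "\<dots> \<le> ennreal C1" by (rule C1)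
    finally show ?thesis using C1_nonneg by (simp add: ennreal_le_iff)
  qed
  define \<C> where "\<C> = {{y::'a. same_cell i x y} | i x. True}"
  have \<C>: "countable \<C>" "\<C> \<noteq> {}" unfolding \<C>_def using countable_cells by auto
  have \<C>_sets: "c \<in> sets borel" if "c \<in> \<C>" for c using that unfolding \<C>_def by auto
  obtain \<tau> where \<tau>: "strict_mono \<tau>" "\<And>n. convergent (\<lambda>k. LINT y|lborel. indicator (from_nat_into \<C> n) y * v (\<tau> k) y)"
    using diagonal_convergent[of "\<lambda>n k. LINT y|lborel. indicator (from_nat_into \<C> n) y * v k y" C1]
      part_le[OF \<C>_sets[OF from_nat_into[OF \<C>(2)]]] by auto
  define w where "w = (\<lambda>k. v (\<tau> k))"
  have wm[measurable]: "w k \<in> borel_measurable borel" for k by (simp add: w_def)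
  have conv: "convergent (\<lambda>k. cell_average i (w k) x)" for i x
  proof -
    have "{y. same_cell i x y} \<in> \<C>" unfolding \<C>_def by blast
    then obtain n where "from_nat_into \<C> n = {y. same_cell i x y}" using from_nat_into_surj[OF \<C>(1)] by blast
    then have "convergent (\<lambda>k. LINT y|lborel. indicator {y. same_cell i x y} y * w k y)" using \<tau>(2)[of n] by (simp add: w_def)
    then show ?thesis unfolding cell_average_def by (intro convergent_mult convergent_const)
  qed
  have av_m[measurable]: "cell_average i (w k) \<in> borel_measurable borel" for i k by (rule cell_average_measurable[OF wm])
  have av_le: "\<bar>cell_average i (w k) x\<bar> \<le> 2 ^ (i * DIM('a)) * C1" for i k x
    unfolding cell_average_def abs_mult w_def using part_le[OF same_cell_sets] by (simp add: mult_left_mono)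
  have ind_int: "integrable lborel (\<lambda>x. c * indicator \<Omega> x)" for c :: real
    using emeasure_\<Omega> by (intro integrable_mult_right integrable_real_indicator) auto
  have av_int: "integrable lborel (\<lambda>x. cell_average i (w k) x * indicator \<Omega> x)" for i k
    by (rule Bochner_Integration.integrable_bound[OF ind_int[of "2 ^ (i * DIM('a)) * C1"]])
      (use av_le C1_nonneg in \<open>auto simp: indicator_def\<close>)
  have cauchy: "\<exists>K. \<forall>k\<ge>K. \<forall>l\<ge>K. (LINT x|lborel. norm (w k x - w l x)) < e" if e: "e > 0" for e
  proof -
    define Q where "Q = measure lborel \<Omega> + real DIM('a) powr (real DIM('a) + p * s) * B'"
    have Q: "Q \<ge> 0" using B' by (simp add: Q_def)
    have "(\<lambda>i. (2 powr - s) ^ i * Q) \<longlonglongrightarrow> 0 * Q"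
      using s powr_less_cancel_iff[of 2 "- s" 0] by (intro tendsto_mult tendsto_const LIMSEQ_power_zero) auto
    then have "\<forall>\<^sub>F i in sequentially. (2 powr - s) ^ i * Q < e / 4" using e by (intro order_tendstoD(2)) auto
    then obtain i where "(2 powr - s) ^ i * Q < e / 4" by (auto simp: eventually_sequentially)
    moreover have "(2 powr - s) ^ i = (2::real) powr - (real i * s)"
      by (simp add: powr_powr mult.commute flip: powr_realpow)
    ultimately have i: "2 powr - (real i * s) * Q < e / 4" by simp
    let ?a = "\<lambda>k x. cell_average i (w k) x * indicator \<Omega> x"
    have near: "(LINT x|lborel. norm (w k x - ?a k x)) < e / 4" for k
    proof -
      have "(\<integral>\<^sup>+x. ennreal (norm (w k x - ?a k x)) \<partial>lborel) = (\<integral>\<^sup>+x. ennreal \<bar>w k x - cell_average i (w k) x\<bar> * indicator \<Omega> x \<partial>lborel)"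
        using v_out by (intro nn_integral_cong) (auto simp: w_def indicator_def)
      also have "\<dots> \<le> ennreal (2 powr - (real i * s) * Q)"
        unfolding Q_def w_def using vm v_int Ev B' by (intro cell_average_estimate) auto
      finally have "(\<integral>\<^sup>+x. ennreal (norm (w k x - ?a k x)) \<partial>lborel) \<le> ennreal (2 powr - (real i * s) * Q)" .
      then have "(LINT x|lborel. norm (w k x - ?a k x)) \<le> 2 powr - (real i * s) * Q"
        using Q by (subst integral_eq_nn_integral) (auto intro!: enn2real_leI)
      then show ?thesis using i by linarith
    qed
    define A where "A = (\<lambda>x. lim (\<lambda>k. cell_average i (w k) x))"
    have A_lim: "(\<lambda>k. cell_average i (w k) x) \<longlonglongrightarrow> A x" for x
      unfolding A_def using conv[of i x] by (simp add: convergent_LIMSEQ_iff)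
    have Am[measurable]: "A \<in> borel_measurable borel" by (rule borel_measurable_LIMSEQ_real[OF A_lim av_m])
    have A_le: "\<bar>A x\<bar> \<le> 2 ^ (i * DIM('a)) * C1" for x
      by (rule LIMSEQ_le_const2[OF tendsto_rabs[OF A_lim]]) (use av_le in auto)
    have "(\<lambda>k. LINT x|lborel. \<bar>cell_average i (w k) x - A x\<bar> * indicator \<Omega> x) \<longlonglongrightarrow> (LINT x|(lborel :: 'a measure). (0::real))"
    proof (rule integral_dominated_convergence[where w = "\<lambda>x. 2 * (2 ^ (i * DIM('a)) * C1) * indicator \<Omega> x"])
      show "integrable lborel (\<lambda>x. 2 * (2 ^ (i * DIM('a)) * C1) * indicator \<Omega> x)" by (rule ind_int)
      show "AE x in lborel. (\<lambda>k. \<bar>cell_average i (w k) x - A x\<bar> * indicator \<Omega> x) \<longlonglongrightarrow> 0"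
      proof (rule AE_I2)
        fix x
        have "(\<lambda>k. \<bar>cell_average i (w k) x - A x\<bar> * indicator \<Omega> x) \<longlonglongrightarrow> \<bar>A x - A x\<bar> * indicator \<Omega> x"
          by (intro tendsto_intros A_lim)
        then show "(\<lambda>k. \<bar>cell_average i (w k) x - A x\<bar> * indicator \<Omega> x) \<longlonglongrightarrow> 0" by simp
      qed
      show "AE x in lborel. norm (\<bar>cell_average i (w k) x - A x\<bar> * indicator \<Omega> x) \<le> 2 * (2 ^ (i * DIM('a)) * C1) * indicator \<Omega> x" for k
      proof (rule AE_I2)
        fix x
        have "\<bar>cell_average i (w k) x - A x\<bar> \<le> 2 * (2 ^ (i * DIM('a)) * C1)"
          using av_le[of i k x] A_le[of x] by linarith
        then show "norm (\<bar>cell_average i (w k) x - A x\<bar> * indicator \<Omega> x) \<le> 2 * (2 ^ (i * DIM('a)) * C1) * indicator \<Omega> x"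
          by (simp add: indicator_def)
      qed
    qed measurable
    then have "\<forall>\<^sub>F k in sequentially. (LINT x|lborel. \<bar>cell_average i (w k) x - A x\<bar> * indicator \<Omega> x) < e / 4"
      using e by (intro order_tendstoD(2)) auto
    then obtain K where K: "\<And>k. k \<ge> K \<Longrightarrow> (LINT x|lborel. \<bar>cell_average i (w k) x - A x\<bar> * indicator \<Omega> x) < e / 4"
      by (auto simp: eventually_sequentially)
    have A_int: "integrable lborel (\<lambda>x. A x * indicator \<Omega> x)"
      by (rule Bochner_Integration.integrable_bound[OF ind_int[of "2 ^ (i * DIM('a)) * C1"]])
        (use A_le C1_nonneg in \<open>auto simp: indicator_def\<close>)
    have "(LINT x|lborel. norm (w k x - w l x)) < e" if kl: "k \<ge> K" "l \<ge> K" for k l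
    proof -
      have wi: "integrable lborel (w k)" for k using v_int by (simp add: w_def)
      have n1: "integrable lborel (\<lambda>x. norm (w k x - ?a k x))" for k
        by (intro integrable_norm Bochner_Integration.integrable_diff wi av_int)
      have n2: "integrable lborel (\<lambda>x. \<bar>cell_average i (w k) x - A x\<bar> * indicator \<Omega> x)" for k
      proof -
        have "integrable lborel (\<lambda>x. \<bar>?a k x - A x * indicator \<Omega> x\<bar>)"
          by (intro integrable_abs Bochner_Integration.integrable_diff av_int A_int)
        moreover have "\<bar>?a k x - A x * indicator \<Omega> x\<bar> = \<bar>cell_average i (w k) x - A x\<bar> * indicator \<Omega> x" for x
          by (simp add: indicator_def)
        ultimately show ?thesis by simp
      qed
      have "(LINT x|lborel. norm (w k x - w l x)) \<le> (LINT x|lborel. norm (w k x - ?a k x) + \<bar>cell_average i (w k) x - A x\<bar> * indicator \<Omega> x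
          + \<bar>cell_average i (w l) x - A x\<bar> * indicator \<Omega> x + norm (w l x - ?a l x))"
      proof (rule integral_mono)
        show "integrable lborel (\<lambda>x. norm (w k x - w l x))" by (intro integrable_norm Bochner_Integration.integrable_diff wi)
        show "integrable lborel (\<lambda>x. norm (w k x - ?a k x) + \<bar>cell_average i (w k) x - A x\<bar> * indicator \<Omega> x
          + \<bar>cell_average i (w l) x - A x\<bar> * indicator \<Omega> x + norm (w l x - ?a l x))"
          by (intro Bochner_Integration.integrable_add n1 n2)
        show "norm (w k x - w l x) \<le> norm (w k x - ?a k x) + \<bar>cell_average i (w k) x - A x\<bar> * indicator \<Omega> x
          + \<bar>cell_average i (w l) x - A x\<bar> * indicator \<Omega> x + norm (w l x - ?a l x)" for x
          using v_out[of x] by (cases "x \<in> \<Omega>") (auto simp: w_def)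
      qed
      also have "\<dots> = (LINT x|lborel. norm (w k x - ?a k x)) + (LINT x|lborel. \<bar>cell_average i (w k) x - A x\<bar> * indicator \<Omega> x)
          + (LINT x|lborel. \<bar>cell_average i (w l) x - A x\<bar> * indicator \<Omega> x) + (LINT x|lborel. norm (w l x - ?a l x))"
        using n1 n2 by (simp add: Bochner_Integration.integral_add Bochner_Integration.integrable_add)
      also have "\<dots> < e" using near[of k] near[of l] K[OF kl(1)] K[OF kl(2)] by linarith
      finally show ?thesis .
    qed
    then show ?thesis by blast
  qed
  have "integrable lborel (w k)" for k using v_int by (simp add: w_def)
  from cauchy_L1_AE_cauchy_subseq[OF this cauchy]
  obtain r where r: "strict_mono r" "AE x in lborel. Cauchy (\<lambda>k. w (r k) x)" by blast
  define u where "u = (\<lambda>x. lim (\<lambda>k. w (r k) x))"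
  have um: "u \<in> borel_measurable borel" unfolding u_def by measurable
  have "AE x in lebesgue. (\<lambda>k. w (r k) x) \<longlonglongrightarrow> u x"
    unfolding AE_completion_iff using r(2)
    by eventually_elim (simp add: u_def Cauchy_convergent_iff convergent_LIMSEQ_iff)
  moreover have "AE x in lebesgue. \<forall>k. U k x = v k x" unfolding AE_all_countable using vU by blast
  ultimately have "AE x in lebesgue. (\<lambda>k. U ((\<tau> \<circ> r) k) x) \<longlonglongrightarrow> u x"
    by eventually_elim (simp add: w_def)
  moreover have "strict_mono (\<tau> \<circ> r)" using \<tau>(1) r(1) by (rule strict_mono_o)
  moreover have "u \<in> borel_measurable lebesgue" using um by (intro measurable_completion) simp
  ultimately show ?thesis by blast
qed

end


section \<open>Positivity of the nonlinear terms\<close>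

lemma smooth_inner_self: "smooth (\<lambda>x::'a::euclidean_space. x \<bullet> x)"
  unfolding smooth_def
proof
  fix k
  show "Ck k (\<lambda>x::'a. x \<bullet> x)"
  proof (cases k)
    case 0
    then show ?thesis by (auto intro!: continuous_intros)
  next
    case (Suc j)
    have "Ck j (\<lambda>x::'a. 2 * (x \<bullet> v))" for v
      by (intro Ck_mult Ck_const Ck_linear bounded_linear_inner_left)
    then have "Ck (Suc j) (\<lambda>x::'a. x \<bullet> x)"
      by (intro Ck_SucI[where D = "\<lambda>x v. 2 * (x \<bullet> v)"]) (auto intro!: derivative_eq_intros simp: inner_commute)
    then show ?thesis using Suc by simp
  qed
qed

text \<open>As the scale \<open>c\<close> tends to infinity the bump tends to 1 inside the ball,
  like exp(-1/(ct)) for fixed t > 0, while its support stays in the closed ball.\<close>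

definition ball_bump :: "'a::euclidean_space \<Rightarrow> real \<Rightarrow> real \<Rightarrow> 'a \<Rightarrow> real" where
  "ball_bump a R c x = exp_bump 0 (c * (R\<^sup>2 - (dist x a)\<^sup>2))"

lemma ball_bump_smooth: "smooth (ball_bump a R c)"
proof -
  have "smooth (\<lambda>x::'a. c * (R\<^sup>2 - (x \<bullet> x + (-2 * (x \<bullet> a) + a \<bullet> a))))"
    by (intro smooth_mult smooth_diff smooth_add smooth_const smooth_inner_self smooth_linear bounded_linear_inner_left)
  moreover have "x \<bullet> x + (-2 * (x \<bullet> a) + a \<bullet> a) = (dist x a)\<^sup>2" for x :: 'a
    by (simp add: dist_norm power2_norm_eq_inner inner_diff_left inner_diff_right inner_commute)
  ultimately show ?thesis unfolding ball_bump_def[abs_def] by (intro smooth_exp_bump) simp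
qed

lemma ball_bump_bounds: "0 \<le> ball_bump a R c x" "ball_bump a R c x \<le> 1"
  by (auto simp: ball_bump_def exp_bump_def)

lemma ball_bump_outside:
  assumes "c > 0" "R > 0" "x \<notin> ball a R"
  shows "ball_bump a R c x = 0"
proof -
  have "R\<^sup>2 \<le> (dist x a)\<^sup>2" using assms by (intro power_mono) (auto simp: dist_commute)
  then have "c * (R\<^sup>2 - (dist x a)\<^sup>2) \<le> 0" using assms by (simp add: mult_nonneg_nonpos)
  then show ?thesis by (simp add: ball_bump_def exp_bump_def)
qed

lemma ball_bump_tendsto:
  assumes "x \<in> ball a R"
  shows "(\<lambda>k. ball_bump a R (real (Suc k)) x) \<longlonglongrightarrow> 1"
proof -
  define t where "t = R\<^sup>2 - (dist x a)\<^sup>2"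
  have "(dist x a)\<^sup>2 < R\<^sup>2" using assms by (intro power_strict_mono) (auto simp: dist_commute)
  then have t: "t > 0" by (simp add: t_def)
  have "(\<lambda>k. exp (- (1 / real (Suc k) * (1 / t)))) \<longlonglongrightarrow> exp (- (0 * (1 / t)))"
    by (intro tendsto_intros LIMSEQ_Suc[OF lim_1_over_n])
  moreover have "ball_bump a R (real (Suc k)) x = exp (- (1 / real (Suc k) * (1 / t)))" for k
    using t unfolding ball_bump_def t_def[symmetric] by (simp add: exp_bump_def)
  ultimately show ?thesis by simp
qed

text \<open>A smooth substitute for the maximum of finitely many functions with values in [0,1]: it
  is 0 where all of them vanish and close to 1 where one of them is.\<close>

lemma test_functions_union:
  assumes "finite I" "\<And>i. i \<in> I \<Longrightarrow> \<psi> i \<in> test_functions \<Omega>"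
  shows "(\<lambda>x. 1 - (\<Prod>i\<in>I. 1 - \<psi> i x)) \<in> test_functions \<Omega>"
  using assms
proof (induction I rule: finite_induct)
  case empty
  then show ?case by (simp add: test_functions_zero)
next
  case (insert j I)
  let ?P = "\<lambda>x. 1 - (\<Prod>i\<in>I. 1 - \<psi> i x)"
  have P: "?P \<in> test_functions \<Omega>" and j: "\<psi> j \<in> test_functions \<Omega>" using insert by auto
  have "smooth (\<psi> j)" using j by (simp add: test_functions_def)
  then have "(\<lambda>x. ?P x + (\<psi> j x + -1 * (\<psi> j x * ?P x))) \<in> test_functions \<Omega>"
    by (intro test_functions_add P j test_functions_scale test_functions_mult_smooth)
  moreover have "(\<lambda>x. ?P x + (\<psi> j x + -1 * (\<psi> j x * ?P x))) = (\<lambda>x. 1 - (\<Prod>i\<in>insert j I. 1 - \<psi> i x))"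
    using insert by (auto simp: algebra_simps)
  ultimately show ?case by simp
qed

text \<open>By Lindelof, an open set is a countable union of balls whose closures it contains. The
  k-th function combines the first k bumps with scale k + 1, so the number of balls and the
  sharpness grow together while the support stays compact in the set.\<close>

lemma test_functions_approximate_open:
  fixes G \<Omega> :: "'a::euclidean_space set"
  assumes "open G" "G \<subseteq> \<Omega>"
  shows "\<exists>\<phi>. (\<forall>k::nat. \<phi> k \<in> test_functions \<Omega>) \<and> (\<forall>k x. 0 \<le> \<phi> k x \<and> \<phi> k x \<le> 1) \<and> (\<forall>x. (\<lambda>k. \<phi> k x) \<longlonglongrightarrow> indicat_real G x)"
proof (cases "G = {}")
  case True
  then show ?thesis by (intro exI[of _ "\<lambda>k x. 0"]) (simp add: test_functions_zero)
next
  case False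
  define \<F> where "\<F> = {B. \<exists>a R. R > 0 \<and> cball a R \<subseteq> G \<and> B = ball (a::'a) R}"
  have cover: "\<Union>\<F> = G"
  proof
    show "\<Union>\<F> \<subseteq> G" using ball_subset_cball by (fastforce simp: \<F>_def)
    show "G \<subseteq> \<Union>\<F>"
    proof
      fix x assume "x \<in> G"
      then obtain e where e: "e > 0" "cball x e \<subseteq> G" using assms(1) open_contains_cball by blast
      then show "x \<in> \<Union>\<F>" unfolding \<F>_def using centre_in_ball by blast
    qed
  qed
  obtain \<F>' where \<F>': "\<F>' \<subseteq> \<F>" "countable \<F>'" "\<Union>\<F>' = G"
  proof -
    have "open S" if "S \<in> \<F>" for S using that by (auto simp: \<F>_def)
    from Lindelof[OF this] show ?thesis using that cover by metis
  qed
  have ne: "\<F>' \<noteq> {}" using \<F>'(3) False by auto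
  have "\<exists>a R. R > 0 \<and> cball a R \<subseteq> G \<and> from_nat_into \<F>' i = ball a R" for i
    using from_nat_into[OF ne, of i] \<F>'(1) unfolding \<F>_def by blast
  then obtain a R where aR: "\<And>i. R i > 0" "\<And>i. cball (a i) (R i) \<subseteq> G" "\<And>i. from_nat_into \<F>' i = ball (a i) (R i)" by metis
  define \<psi> where "\<psi> = (\<lambda>k i. ball_bump (a i) (R i) (real (Suc k)))"
  have \<psi>: "\<psi> k i \<in> test_functions \<Omega>" for k i
  proof (rule test_functionsI)
    show "smooth (\<psi> k i)" unfolding \<psi>_def by (rule ball_bump_smooth)
    show "cball (a i) (R i) \<subseteq> \<Omega>" using aR(2)[of i] assms(2) by blast
    show "\<psi> k i x = 0" if "x \<notin> cball (a i) (R i)" for x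
      unfolding \<psi>_def using aR(1)[of i] that by (intro ball_bump_outside) auto
  qed simp
  define \<phi> where "\<phi> = (\<lambda>k x. 1 - (\<Prod>i<k. 1 - \<psi> k i x))"
  have b: "0 \<le> 1 - \<psi> k i x" "1 - \<psi> k i x \<le> 1" for k i x
    using ball_bump_bounds[of "a i" "R i" "real (Suc k)" x] by (auto simp: \<psi>_def)
  have prod_b: "0 \<le> (\<Prod>i\<in>I. 1 - \<psi> k i x)" "(\<Prod>i\<in>I. 1 - \<psi> k i x) \<le> 1" for k x I
    using b by (auto intro: prod_nonneg prod_le_1)
  have "(\<lambda>k. \<phi> k x) \<longlonglongrightarrow> indicat_real G x" for x
  proof (cases "x \<in> G")
    case True
    then obtain B where "B \<in> \<F>'" "x \<in> B" using \<F>'(3) by blast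
    then obtain i where i: "x \<in> ball (a i) (R i)" using from_nat_into_surj[OF \<F>'(2)] aR(3) by metis
    have "(\<lambda>k. 1 - \<psi> k i x) \<longlonglongrightarrow> 1 - 1" unfolding \<psi>_def by (intro tendsto_diff tendsto_const ball_bump_tendsto i)
    then have lim: "(\<lambda>k. 1 - \<psi> k i x) \<longlonglongrightarrow> 0" by simp
    have "(\<lambda>k. \<Prod>i<k. 1 - \<psi> k i x) \<longlonglongrightarrow> 0"
    proof (rule tendsto_sandwich[OF _ _ tendsto_const lim])
      show "\<forall>\<^sub>F k in sequentially. 0 \<le> (\<Prod>i<k. 1 - \<psi> k i x)" using prod_b by simp
      \<comment> \<open>All factors lie in [0,1], so the product is at most the single factor that
        tends to 0.\<close>
      have "(\<Prod>j<k. 1 - \<psi> k j x) \<le> 1 - \<psi> k i x" if "k \<ge> Suc i" for k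
      proof -
        have "(\<Prod>j<k. 1 - \<psi> k j x) = (1 - \<psi> k i x) * (\<Prod>j\<in>{..<k} - {i}. 1 - \<psi> k j x)"
          using that by (intro prod.remove) auto
        also have "\<dots> \<le> (1 - \<psi> k i x) * 1" using b prod_b by (intro mult_left_mono) auto
        finally show ?thesis by simp
      qed
      then show "\<forall>\<^sub>F k in sequentially. (\<Prod>j<k. 1 - \<psi> k j x) \<le> 1 - \<psi> k i x"
        unfolding eventually_sequentially by blast
    qed
    then have "(\<lambda>k. 1 - (\<Prod>i<k. 1 - \<psi> k i x)) \<longlonglongrightarrow> 1 - 0" by (intro tendsto_diff tendsto_const)
    then show ?thesis using True by (simp add: \<phi>_def)
  next
    case False
    have "x \<notin> ball (a i) (R i)" for i using aR(2)[of i] False ball_subset_cball by blast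
    then have "\<psi> k i x = 0" for k i
      unfolding \<psi>_def using aR(1)[of i] by (intro ball_bump_outside) auto
    then show ?thesis using False by (simp add: \<phi>_def)
  qed
  moreover have "\<phi> k \<in> test_functions \<Omega>" for k unfolding \<phi>_def by (intro test_functions_union \<psi>) simp
  moreover have "0 \<le> \<phi> k x \<and> \<phi> k x \<le> 1" for k x unfolding \<phi>_def using prod_b by simp
  ultimately show ?thesis by blast
qed

text \<open>If all these integrals were at most 0, dominated convergence would give the same for the
  integral of \<open>w\<close> over every open subset of \<Omega>, and then over the part of
  \<Omega> where \<open>w > 0\<close>, approximated by open sets. The power \<open>t\<close>
  disappears in the limit because an indicator is unchanged by positive powers.\<close>

lemma exists_test_function_integral_pos:
  fixes w :: "'a::euclidean_space \<Rightarrow> real"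
  assumes \<Omega>: "open \<Omega>" and w: "integrable lebesgue w" and pos: "\<not> (AE x in lebesgue. x \<in> \<Omega> \<longrightarrow> w x \<le> 0)" and t: "t > 0"
  shows "\<exists>\<phi>\<in>test_functions \<Omega>. (LINT x|lebesgue. w x * \<bar>\<phi> x\<bar> powr t) > 0"
proof (rule ccontr)
  assume neg: "\<not> ?thesis"
  have wm[measurable]: "w \<in> borel_measurable lebesgue" using w by simp
  have \<Omega>m[measurable]: "\<Omega> \<in> sets lebesgue" using \<Omega> by simp
  have open_le: "(LINT x|lebesgue. w x * indicat_real G x) \<le> 0" if G: "open G" "G \<subseteq> \<Omega>" for G
  proof -
    obtain \<phi> where \<phi>: "\<And>k::nat. \<phi> k \<in> test_functions \<Omega>" "\<And>k x. 0 \<le> \<phi> k x" "\<And>k x. \<phi> k x \<le> 1"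
        "\<And>x. (\<lambda>k. \<phi> k x) \<longlonglongrightarrow> indicat_real G x"
      using test_functions_approximate_open[OF G] by blast
    have "continuous_on UNIV (\<phi> k)" for k using \<phi>(1)[of k] smooth_continuous by (auto simp: test_functions_def)
    then have "\<phi> k \<in> borel_measurable borel" for k by (rule borel_measurable_continuous_onI)
    then have \<phi>m[measurable]: "\<phi> k \<in> borel_measurable lebesgue" for k by (intro measurable_completion) simp
    have [measurable]: "G \<in> sets lebesgue" using G by simp
    have "(\<lambda>k. LINT x|lebesgue. w x * \<bar>\<phi> k x\<bar> powr t) \<longlonglongrightarrow> (LINT x|lebesgue. w x * indicat_real G x)"
    proof (rule integral_dominated_convergence[where w = "\<lambda>x. \<bar>w x\<bar>"])
      show "integrable lebesgue (\<lambda>x. \<bar>w x\<bar>)" using w by (rule integrable_abs)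
      show "AE x in lebesgue. (\<lambda>k. w x * \<bar>\<phi> k x\<bar> powr t) \<longlonglongrightarrow> w x * indicat_real G x"
      proof (rule AE_I2)
        fix x
        have "(\<lambda>k. w x * \<bar>\<phi> k x\<bar> powr t) \<longlonglongrightarrow> w x * \<bar>indicat_real G x\<bar> powr t"
          using t by (intro tendsto_mult tendsto_const tendsto_powr' tendsto_rabs \<phi>(4)) auto
        moreover have "\<bar>indicat_real G x\<bar> powr t = indicat_real G x" using t by (simp add: indicator_def)
        ultimately show "(\<lambda>k. w x * \<bar>\<phi> k x\<bar> powr t) \<longlonglongrightarrow> w x * indicat_real G x" by simp
      qed
      show "AE x in lebesgue. norm (w x * \<bar>\<phi> k x\<bar> powr t) \<le> \<bar>w x\<bar>" for k
      proof (rule AE_I2)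
        fix x
        have "\<bar>\<phi> k x\<bar> powr t \<le> 1 powr t" using \<phi>(2,3)[of k x] t by (intro powr_mono2) auto
        then show "norm (w x * \<bar>\<phi> k x\<bar> powr t) \<le> \<bar>w x\<bar>" by (simp add: abs_mult mult_left_le)
      qed
    qed measurable
    moreover have "(LINT x|lebesgue. w x * \<bar>\<phi> k x\<bar> powr t) \<le> 0" for k using neg \<phi>(1)[of k] by (auto simp: not_less)
    ultimately show ?thesis by (intro LIMSEQ_le_const2) auto
  qed
  define A where "A = {x \<in> \<Omega>. w x > 0}"
  have Am: "A \<in> sets lebesgue"
  proof -
    have "w -` {0<..} \<inter> space lebesgue \<in> sets lebesgue" by (rule measurable_sets[OF wm]) simp
    then have "{x. w x > 0} \<in> sets lebesgue" by (simp add: vimage_def)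
    moreover have "A = \<Omega> \<inter> {x. w x > 0}" by (auto simp: A_def)
    ultimately show ?thesis by simp
  qed
  \<comment> \<open>The set \<open>A\<close> differs from a G-delta set by a null set; intersecting
    \<Omega> with finitely many of the open sets that define it gives open sets whose indicators
    converge.\<close>
  obtain C T where CT: "gdelta C" "T \<in> null_sets lebesgue" "A \<union> T = C" "disjnt A T" using lebesgue_set_almost_gdelta[OF Am] .
  obtain F :: "nat \<Rightarrow> 'a set" where F: "\<And>n. open (F n)" "C = \<Inter>(range F)"
    using CT(1) by (auto elim: gdelta.cases)
  define O' where "O' = (\<lambda>n. \<Omega> \<inter> (\<Inter>i\<le>n. F i))"
  have O': "open (O' n)" "O' n \<subseteq> \<Omega>" for n unfolding O'_def using \<Omega> F(1) by (auto intro: open_Int open_INT)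
  have lim: "(\<lambda>n. indicat_real (O' n) x) \<longlonglongrightarrow> indicat_real (\<Omega> \<inter> C) x" for x
  proof (cases "x \<in> \<Omega> \<inter> C")
    case True
    then have "x \<in> O' n" for n unfolding O'_def F(2) by auto
    then show ?thesis using True by simp
  next
    case False
    then obtain m where "x \<notin> \<Omega> \<or> x \<notin> F m" unfolding F(2) by auto
    then have "x \<notin> O' n" if "n \<ge> m" for n unfolding O'_def using that by auto
    then have "\<forall>\<^sub>F n in sequentially. indicat_real (O' n) x = indicat_real (\<Omega> \<inter> C) x"
      using False unfolding eventually_sequentially by (auto intro!: exI[of _ m])
    then show ?thesis by (rule tendsto_eventually)
  qed
  have Om[measurable]: "O' n \<in> sets lebesgue" for n using O' by simp
  have AE_eq: "AE x in lebesgue. indicat_real (\<Omega> \<inter> C) x = indicat_real A x"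
  proof -
    have "AE x in lebesgue. x \<notin> T" using CT(2) by (rule AE_not_in)
    then show ?thesis by eventually_elim (use CT(3) in \<open>auto simp: A_def indicator_def\<close>)
  qed
  have "(\<lambda>n. LINT x|lebesgue. w x * indicat_real (O' n) x) \<longlonglongrightarrow> (LINT x|lebesgue. w x * indicat_real A x)"
  proof (rule integral_dominated_convergence[where w = "\<lambda>x. \<bar>w x\<bar>"])
    show "integrable lebesgue (\<lambda>x. \<bar>w x\<bar>)" using w by (rule integrable_abs)
    show "AE x in lebesgue. (\<lambda>n. w x * indicat_real (O' n) x) \<longlonglongrightarrow> w x * indicat_real A x"
      using AE_eq
    proof eventually_elim
      case (elim x)
      have "(\<lambda>n. w x * indicat_real (O' n) x) \<longlonglongrightarrow> w x * indicat_real (\<Omega> \<inter> C) x" by (intro tendsto_mult tendsto_const lim)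
      then show ?case unfolding elim .
    qed
    show "AE x in lebesgue. norm (w x * indicat_real (O' n) x) \<le> \<bar>w x\<bar>" for n
      by (rule AE_I2) (simp add: indicator_def)
  qed (use Am in measurable)
  then have le: "(LINT x|lebesgue. w x * indicat_real A x) \<le> 0" using open_le[OF O'] by (intro LIMSEQ_le_const2) auto
  have nn: "0 \<le> w x * indicat_real A x" for x by (simp add: A_def indicator_def)
  have int: "integrable lebesgue (\<lambda>x. w x * indicat_real A x)"
  proof (rule Bochner_Integration.integrable_bound[OF w])
    show "(\<lambda>x. w x * indicat_real A x) \<in> borel_measurable lebesgue" using wm Am by measurable
  qed (simp add: indicator_def)
  have "(LINT x|lebesgue. w x * indicat_real A x) = 0" using le nn by (intro antisym Bochner_Integration.integral_nonneg) auto
  then have "AE x in lebesgue. w x * indicat_real A x = 0"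
    using integral_nonneg_eq_0_iff_AE[OF int] nn by auto
  then have "AE x in lebesgue. x \<in> \<Omega> \<longrightarrow> w x \<le> 0" by eventually_elim (auto simp: A_def indicator_def split: if_splits)
  then show False using pos by blast
qed


section \<open>The functionals of the problem\<close>

lemma C1_functional_cong_on:
  assumes "C1_functional V N U \<Phi> D" "\<And>u. u \<in> U \<Longrightarrow> \<Phi> u = \<Phi>' u"
  shows "C1_functional V N U \<Phi>' D"
  using assms(1) unfolding C1_functional_def using assms(2) by simp

text \<open>Minkowski's inequality from convexity: with \<alpha> and \<beta> slightly above the two
  norms and \<gamma> their sum, x + y is \<gamma> times the convex combination of x/\<alpha> and
  y/\<beta> with weights \<alpha>/\<gamma> and \<beta>/\<gamma>. Strictly larger numbers avoid
  division by a vanishing norm.\<close>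

lemma powr_norm_triangle:
  fixes x y :: "'b \<Rightarrow> real" and w :: "'b \<Rightarrow> real"
  assumes t: "t > 1" and w: "\<And>z. w z \<ge> 0"
    and x: "integrable M (\<lambda>z. w z * \<bar>x z\<bar> powr t)" and y: "integrable M (\<lambda>z. w z * \<bar>y z\<bar> powr t)"
    and m: "(\<lambda>z. w z * \<bar>x z + y z\<bar> powr t) \<in> borel_measurable M"
  shows "(LINT z|M. w z * \<bar>x z + y z\<bar> powr t) powr (1 / t)
    \<le> (LINT z|M. w z * \<bar>x z\<bar> powr t) powr (1 / t) + (LINT z|M. w z * \<bar>y z\<bar> powr t) powr (1 / t)"
proof -
  let ?X = "LINT z|M. w z * \<bar>x z\<bar> powr t" and ?Y = "LINT z|M. w z * \<bar>y z\<bar> powr t"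
    and ?S = "LINT z|M. w z * \<bar>x z + y z\<bar> powr t"
  have nn: "?X \<ge> 0" "?Y \<ge> 0" "?S \<ge> 0" using w by (auto intro!: Bochner_Integration.integral_nonneg)
  have *: "?S powr (1 / t) \<le> \<alpha> + \<beta>" if \<alpha>: "\<alpha> > ?X powr (1 / t)" and \<beta>: "\<beta> > ?Y powr (1 / t)" for \<alpha> \<beta>
  proof -
    have pos: "\<alpha> > 0" "\<beta> > 0" using \<alpha> \<beta> by (auto intro: le_less_trans[OF powr_ge_zero])
    define \<gamma> where "\<gamma> = \<alpha> + \<beta>"
    have \<gamma>: "\<gamma> > 0" using pos by (simp add: \<gamma>_def)
    have X1: "?X \<le> \<alpha> powr t" and Y1: "?Y \<le> \<beta> powr t"
      using powr_mono2[of t "?X powr (1 / t)" \<alpha>] powr_mono2[of t "?Y powr (1 / t)" \<beta>] \<alpha> \<beta> t nn by (auto simp: powr_powr)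
    have pw: "w z * \<bar>x z + y z\<bar> powr t \<le> \<gamma> powr t * (\<alpha> / \<gamma> * (w z * \<bar>x z\<bar> powr t / \<alpha> powr t) + \<beta> / \<gamma> * (w z * \<bar>y z\<bar> powr t / \<beta> powr t))" for z
    proof -
      have "x z + y z = \<gamma> * (\<alpha> / \<gamma> * (x z / \<alpha>) + \<beta> / \<gamma> * (y z / \<beta>))" using pos \<gamma> by (simp add: field_simps)
      then have "\<bar>x z + y z\<bar> powr t = \<gamma> powr t * \<bar>\<alpha> / \<gamma> * (x z / \<alpha>) + \<beta> / \<gamma> * (y z / \<beta>)\<bar> powr t"
        using \<gamma> by (simp only: abs_mult powr_mult abs_of_pos)
      also have "\<dots> \<le> \<gamma> powr t * (\<alpha> / \<gamma> * \<bar>x z / \<alpha>\<bar> powr t + \<beta> / \<gamma> * \<bar>y z / \<beta>\<bar> powr t)"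
        using t pos \<gamma> by (intro mult_left_mono powr_convex) (auto simp: \<gamma>_def simp flip: add_divide_distrib)
      also have "\<dots> = \<gamma> powr t * (\<alpha> / \<gamma> * (\<bar>x z\<bar> powr t / \<alpha> powr t) + \<beta> / \<gamma> * (\<bar>y z\<bar> powr t / \<beta> powr t))"
        using pos by (simp add: powr_divide abs_divide)
      finally have "w z * \<bar>x z + y z\<bar> powr t \<le> w z * (\<gamma> powr t * (\<alpha> / \<gamma> * (\<bar>x z\<bar> powr t / \<alpha> powr t) + \<beta> / \<gamma> * (\<bar>y z\<bar> powr t / \<beta> powr t)))"
        by (intro mult_left_mono w)
      then show ?thesis by (simp add: algebra_simps)
    qed
    have int: "integrable M (\<lambda>z. \<gamma> powr t * (\<alpha> / \<gamma> * (w z * \<bar>x z\<bar> powr t / \<alpha> powr t) + \<beta> / \<gamma> * (w z * \<bar>y z\<bar> powr t / \<beta> powr t)))"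
      by (intro integrable_mult_right Bochner_Integration.integrable_add integrable_divide x y)
    have "?S \<le> (LINT z|M. \<gamma> powr t * (\<alpha> / \<gamma> * (w z * \<bar>x z\<bar> powr t / \<alpha> powr t) + \<beta> / \<gamma> * (w z * \<bar>y z\<bar> powr t / \<beta> powr t)))"
    proof (rule integral_mono[OF _ int pw])
      show "integrable M (\<lambda>z. w z * \<bar>x z + y z\<bar> powr t)"
      proof (rule Bochner_Integration.integrable_bound[OF int m], rule AE_I2)
        fix z
        have "0 \<le> w z * \<bar>x z + y z\<bar> powr t" using w[of z] by simp
        then show "norm (w z * \<bar>x z + y z\<bar> powr t) \<le> norm (\<gamma> powr t * (\<alpha> / \<gamma> * (w z * \<bar>x z\<bar> powr t / \<alpha> powr t) + \<beta> / \<gamma> * (w z * \<bar>y z\<bar> powr t / \<beta> powr t)))"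
          using pw[of z] unfolding real_norm_def by linarith
      qed
    qed
    also have "\<dots> = \<gamma> powr t * (\<alpha> / \<gamma> * (?X / \<alpha> powr t) + \<beta> / \<gamma> * (?Y / \<beta> powr t))"
      using x y by simp
    also have "\<dots> \<le> \<gamma> powr t * (\<alpha> / \<gamma> * 1 + \<beta> / \<gamma> * 1)"
      using X1 Y1 pos \<gamma> by (intro mult_left_mono add_mono) (auto simp: pos_divide_le_eq)
    also have "\<dots> = \<gamma> powr t" using \<gamma> by (simp add: \<gamma>_def flip: add_divide_distrib)
    finally have "?S powr (1 / t) \<le> (\<gamma> powr t) powr (1 / t)" using nn t by (intro powr_mono2) auto
    then show ?thesis using \<gamma> t by (simp add: powr_powr \<gamma>_def)
  qed
  show ?thesis
  proof (rule field_le_epsilon)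
    fix e :: real assume "e > 0"
    then show "?S powr (1 / t) \<le> ?X powr (1 / t) + ?Y powr (1 / t) + e"
      using *[of "?X powr (1 / t) + e / 2" "?Y powr (1 / t) + e / 2"] by simp
  qed
qed

context power_functional
begin

text \<open>Convergence of the weighted power integrals is assumed in place of convergence in
  \<open>N\<close>: along minimising sequences the seminorm is merely lower semicontinuous, whereas
  the lower order integrals converge.\<close>

lemma \<Phi>_tendsto:
  assumes U: "\<And>k::nat. U k \<in> V" "u \<in> V" and lim: "(\<lambda>k. LINT z|M. \<bar>w z\<bar> * \<bar>T (\<lambda>x. U k x - u x) z\<bar> powr t) \<longlonglongrightarrow> 0"
  shows "(\<lambda>k. \<Phi> (U k)) \<longlonglongrightarrow> \<Phi> u"
proof (rule LIMSEQ_I)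
  fix r :: real assume r: "r > 0"
  define A where "A = (LINT z|M. \<bar>w z\<bar> * \<bar>T u z\<bar> powr t)"
  have A: "A \<ge> 0" unfolding A_def by (intro Bochner_Integration.integral_nonneg) simp
  define e where "e = r / 2 / (A + 1)"
  have A1: "A + 1 > 0" using A by simp
  have e: "e > 0" using r A1 by (simp add: e_def)
  have eA: "e * A \<le> r / 2"
  proof -
    have "e * A \<le> e * (A + 1)" using e by simp
    also have "\<dots> = r / 2" unfolding e_def using A1 by (rule pos_divide_mult_cancel)
    finally show ?thesis .
  qed
  obtain C' where C': "C' \<ge> 0" "\<And>x y::real. \<bar>\<bar>y\<bar> powr t - \<bar>x\<bar> powr t\<bar> \<le> e * \<bar>x\<bar> powr t + C' * \<bar>y - x\<bar> powr t"
    using abs_powr_modulus[of t e] t e by auto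
  let ?I = "\<lambda>k. LINT z|M. \<bar>w z\<bar> * \<bar>T (\<lambda>x. U k x - u x) z\<bar> powr t"
  have bd: "\<bar>\<Phi> (U k) - \<Phi> u\<bar> \<le> e * A + C' * ?I k" for k
  proof -
    have d: "(\<lambda>x. U k x - u x) \<in> V" using U by (simp add: diff_mem)
    have "\<bar>\<Phi> (U k) - \<Phi> u\<bar> = \<bar>LINT z|M. w z * \<bar>T (U k) z\<bar> powr t - w z * \<bar>T u z\<bar> powr t\<bar>"
      unfolding \<Phi>_def using integrable_power[OF U(1)[of k]] integrable_power[OF U(2)] by simp
    also have "\<dots> \<le> (LINT z|M. \<bar>w z * \<bar>T (U k) z\<bar> powr t - w z * \<bar>T u z\<bar> powr t\<bar>)" by (rule integral_abs_bound)
    also have "\<dots> \<le> (LINT z|M. e * (\<bar>w z\<bar> * \<bar>T u z\<bar> powr t) + C' * (\<bar>w z\<bar> * \<bar>T (\<lambda>x. U k x - u x) z\<bar> powr t))"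
    proof (rule integral_mono)
      show "integrable M (\<lambda>z. \<bar>w z * \<bar>T (U k) z\<bar> powr t - w z * \<bar>T u z\<bar> powr t\<bar>)"
        by (intro integrable_abs Bochner_Integration.integrable_diff integrable_power U)
      show "integrable M (\<lambda>z. e * (\<bar>w z\<bar> * \<bar>T u z\<bar> powr t) + C' * (\<bar>w z\<bar> * \<bar>T (\<lambda>x. U k x - u x) z\<bar> powr t))"
        by (intro Bochner_Integration.integrable_add integrable_mult_right integrable_abs_power U d)
      show "\<bar>w z * \<bar>T (U k) z\<bar> powr t - w z * \<bar>T u z\<bar> powr t\<bar> \<le> e * (\<bar>w z\<bar> * \<bar>T u z\<bar> powr t) + C' * (\<bar>w z\<bar> * \<bar>T (\<lambda>x. U k x - u x) z\<bar> powr t)" for z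
      proof -
        have "\<bar>w z * \<bar>T (U k) z\<bar> powr t - w z * \<bar>T u z\<bar> powr t\<bar> = \<bar>w z\<bar> * \<bar>\<bar>T (U k) z\<bar> powr t - \<bar>T u z\<bar> powr t\<bar>"
          by (simp only: abs_mult flip: right_diff_distrib)
        also have "\<dots> \<le> \<bar>w z\<bar> * (e * \<bar>T u z\<bar> powr t + C' * \<bar>T (U k) z - T u z\<bar> powr t)"
          by (intro mult_left_mono C') simp
        also have "\<dots> = e * (\<bar>w z\<bar> * \<bar>T u z\<bar> powr t) + C' * (\<bar>w z\<bar> * \<bar>T (\<lambda>x. U k x - u x) z\<bar> powr t)"
          unfolding T_diff by (simp only: distrib_left mult.left_commute)
        finally show ?thesis .
      qed
    qed
    also have "\<dots> = e * A + C' * ?I k"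
      unfolding A_def using integrable_abs_power[OF U(2)] integrable_abs_power[OF d] by simp
    finally show ?thesis .
  qed
  have "(\<lambda>k. C' * ?I k) \<longlonglongrightarrow> C' * 0" by (intro tendsto_mult tendsto_const lim)
  then have "\<forall>\<^sub>F k in sequentially. C' * ?I k < r / 2" using r by (intro order_tendstoD(2)) auto
  then obtain K where K: "\<And>k. k \<ge> K \<Longrightarrow> C' * ?I k < r / 2" by (auto simp: eventually_sequentially)
  have "norm (\<Phi> (U k) - \<Phi> u) < r" if "k \<ge> K" for k
    using bd[of k] eA K[OF that] unfolding real_norm_def by linarith
  then show "\<exists>K. \<forall>k\<ge>K. norm (\<Phi> (U k) - \<Phi> u) < r" by blast
qed

end

section \<open>The seminorm and convergence of lower order integrals\<close>

context bounded_open_set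
begin

lemma X0_norm_powr: "u \<in> closure_space \<Longrightarrow> X0_norm s p \<Omega> u powr p = (LINT z|lebesgue. riesz_kernel s p z * \<bar>u (fst z) - u (snd z)\<bar> powr p)"
  and gagliardo_nn_norm: "u \<in> closure_space \<Longrightarrow> gagliardo_nn s p u = ennreal (X0_norm s p \<Omega> u powr p)"
proof -
  assume u: "u \<in> closure_space"
  note g = gagliardo_eq[OF closure_spaceD[OF u]]
  have nn: "gagliardo s p \<Omega> u \<ge> 0" unfolding g(2) by simp
  then have e: "X0_norm s p \<Omega> u powr p = gagliardo s p \<Omega> u" using p by (simp add: X0_norm_def powr_powr)
  show "X0_norm s p \<Omega> u powr p = (LINT z|lebesgue. riesz_kernel s p z * \<bar>u (fst z) - u (snd z)\<bar> powr p)"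
    unfolding e g(1) gagliardo_density_def by (simp add: mult.commute)
  show "gagliardo_nn s p u = ennreal (X0_norm s p \<Omega> u powr p)"
    unfolding e g(2) using closure_space_finite[OF u] by simp
qed

lemma kernel_integrable:
  assumes "u \<in> closure_space"
  shows "integrable lebesgue (\<lambda>z. riesz_kernel s p z * \<bar>u (fst z) - u (snd z)\<bar> powr p)"
  using gagliardo_density_integrable[OF closure_spaceD[OF assms] closure_space_finite[OF assms]]
  unfolding gagliardo_density_def[abs_def] by (simp add: mult.commute)

lemma X0_norm_nonneg: "X0_norm s p \<Omega> u \<ge> 0"
  by (simp add: X0_norm_def)

lemma X0_norm_eq:
  assumes "u \<in> closure_space"
  shows "X0_norm s p \<Omega> u = (LINT z|lebesgue. riesz_kernel s p z * \<bar>u (fst z) - u (snd z)\<bar> powr p) powr (1 / p)"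
  unfolding X0_norm_powr[OF assms, symmetric] using p X0_norm_nonneg[of u] by (simp add: powr_powr)

sublocale seminormed_functions closure_space "X0_norm s p \<Omega>"
proof
  show "(\<lambda>x. 0) \<in> closure_space" by (rule test_functions_closure_space[OF test_functions_zero])
  show "(\<lambda>x. u x + v x) \<in> closure_space" if "u \<in> closure_space" "v \<in> closure_space" for u v
    using that by (rule closure_space_add)
  show "(\<lambda>x. c * u x) \<in> closure_space" if "u \<in> closure_space" for u c using that by (rule closure_space_scale)
  show "X0_norm s p \<Omega> u \<ge> 0" for u by (rule X0_norm_nonneg)
  show "X0_norm s p \<Omega> (\<lambda>x. u x + v x) \<le> X0_norm s p \<Omega> u + X0_norm s p \<Omega> v" if uv: "u \<in> closure_space" "v \<in> closure_space" for u v
  proof -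
    have e: "u x + v x - (u y + v y) = (u x - u y) + (v x - v y)" for x y by simp
    have m: "(\<lambda>z. riesz_kernel s p z * \<bar>(u (fst z) - u (snd z)) + (v (fst z) - v (snd z))\<bar> powr p) \<in> borel_measurable lebesgue"
      using vanishing_measurable[OF closure_spaceD[OF uv(1)]] vanishing_measurable[OF closure_spaceD[OF uv(2)]]
      by (intro borel_measurable_times powr_real_measurable borel_measurable_abs borel_measurable_add difference_lebesgue_measurable
          riesz_kernel_lebesgue_measurable borel_measurable_const)
    show ?thesis
      unfolding X0_norm_eq[OF closure_space_add[OF uv]] X0_norm_eq[OF uv(1)] X0_norm_eq[OF uv(2)] e
      using p by (intro powr_norm_triangle riesz_kernel_nonneg kernel_integrable uv m) auto
  qed
  show "X0_norm s p \<Omega> (\<lambda>x. c * u x) = \<bar>c\<bar> * X0_norm s p \<Omega> u" if u: "u \<in> closure_space" for u c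
  proof -
    have "riesz_kernel s p z * \<bar>c * u (fst z) - c * u (snd z)\<bar> powr p = \<bar>c\<bar> powr p * (riesz_kernel s p z * \<bar>u (fst z) - u (snd z)\<bar> powr p)" for z
      by (simp add: abs_mult powr_mult flip: right_diff_distrib)
    then have "(LINT z|lebesgue. riesz_kernel s p z * \<bar>c * u (fst z) - c * u (snd z)\<bar> powr p)
        = \<bar>c\<bar> powr p * (LINT z|lebesgue. riesz_kernel s p z * \<bar>u (fst z) - u (snd z)\<bar> powr p)" by (simp only: integral_mult_right_zero)
    then show ?thesis
      unfolding X0_norm_eq[OF closure_space_scale[OF u]] X0_norm_eq[OF u] using p
      by (simp add: powr_mult powr_powr)
  qed
qed

lemma sobolev_norm:
  assumes "0 < m" "m < real DIM('a) * p / (real DIM('a) - p * s)"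
  shows "\<exists>C>0. \<forall>u\<in>closure_space. (\<integral>\<^sup>+x. ennreal (\<bar>u x\<bar> powr m) \<partial>lebesgue) \<le> ennreal (C * X0_norm s p \<Omega> u powr m)"
proof -
  obtain C where C: "C > 0" "\<And>u t. vanishing u \<Longrightarrow> t \<ge> 0 \<Longrightarrow> gagliardo_nn s p u \<le> ennreal (t powr p) \<Longrightarrow>
      (\<integral>\<^sup>+x. ennreal (\<bar>u x\<bar> powr m) \<partial>lebesgue) \<le> ennreal (C * t powr m)"
    using sobolev_scaled[OF assms] by auto
  have "(\<integral>\<^sup>+x. ennreal (\<bar>u x\<bar> powr m) \<partial>lebesgue) \<le> ennreal (C * X0_norm s p \<Omega> u powr m)" if u: "u \<in> closure_space" for u
    by (rule C(2)[OF closure_spaceD[OF u] X0_norm_nonneg]) (simp add: gagliardo_nn_norm[OF u])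
  then show ?thesis using C(1) by blast
qed

lemma X0_norm_zero_iff:
  assumes u: "u \<in> closure_space"
  shows "X0_norm s p \<Omega> u = 0 \<longleftrightarrow> (AE x in lebesgue. u x = 0)"
proof -
  have "gagliardo_nn s p u = 0 \<longleftrightarrow> X0_norm s p \<Omega> u = 0" unfolding gagliardo_nn_norm[OF u] using p by (simp add: ennreal_eq_0_iff)
  then show ?thesis using gagliardo_nn_zero_iff[OF closure_spaceD[OF u]] by simp
qed

interpretation E: power_functional closure_space "X0_norm s p \<Omega>" lebesgue "riesz_kernel s p" "\<lambda>u z. u (fst z) - u (snd z)" p 1
proof
  fix u assume u: "u \<in> closure_space"
  show "(\<lambda>z. u (fst z) - u (snd z)) \<in> borel_measurable lebesgue"
    by (rule difference_lebesgue_measurable[OF vanishing_measurable[OF closure_spaceD[OF u]]])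
  show "integrable lebesgue (\<lambda>z. riesz_kernel s p z * \<bar>u (fst z) - u (snd z)\<bar> powr p)" by (rule kernel_integrable[OF u])
  show "(LINT z|lebesgue. \<bar>riesz_kernel s p z\<bar> * \<bar>u (fst z) - u (snd z)\<bar> powr p) \<le> 1 * X0_norm s p \<Omega> u powr p"
    unfolding X0_norm_powr[OF u] abs_of_nonneg[OF riesz_kernel_nonneg] by simp
qed (use p riesz_kernel_lebesgue_measurable in \<open>auto simp: right_diff_distrib\<close>)

definition D_norm :: "('a \<Rightarrow> real) \<Rightarrow> ('a \<Rightarrow> real) \<Rightarrow> real" where
  "D_norm u h = p * (LINT z|lebesgue. riesz_kernel s p z * (\<bar>u (fst z) - u (snd z)\<bar> powr (p - 2) * (u (fst z) - u (snd z))) * (h (fst z) - h (snd z)))"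

lemma C1_norm_powr: "C1_functional closure_space (X0_norm s p \<Omega>) closure_space (\<lambda>u. X0_norm s p \<Omega> u powr p) D_norm"
proof (rule C1_functional_cong_on)
  show "C1_functional closure_space (X0_norm s p \<Omega>) closure_space E.\<Phi> D_norm"
    using E.C1_\<Phi> unfolding E.D\<Phi>_def[abs_def] D_norm_def[abs_def] .
  show "E.\<Phi> u = X0_norm s p \<Omega> u powr p" if "u \<in> closure_space" for u
    unfolding E.\<Phi>_def X0_norm_powr[OF that] ..
qed

lemma integral_le_of_nn:
  assumes f: "f \<in> borel_measurable M" "\<And>x. f x \<ge> (0::real)" and le: "(\<integral>\<^sup>+x. ennreal (f x) \<partial>M) \<le> ennreal c" "c \<ge> 0"
  shows "integrable M f" "(LINT x|M. f x) \<le> c"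
proof -
  show i: "integrable M f" by (rule integrableI_nonneg[OF f(1) AE_I2[OF f(2)]]) (use le in \<open>auto elim: le_less_trans\<close>)
  have "ennreal (LINT x|M. f x) \<le> ennreal c" using nn_integral_eq_integral[OF i AE_I2[OF f(2)]] le(1) by simp
  then show "(LINT x|M. f x) \<le> c" using le(2) by (simp add: ennreal_le_iff)
qed

text \<open>Young's inequality up to the constant, by comparing \<open>x\<close> with
  \<open>y powr (r - q)\<close>: in either case the smaller quantity is replaced by the larger
  one.\<close>

lemma young_weight:
  fixes x y :: real
  assumes "x \<ge> 0" "y \<ge> 0" "0 < q" "q < r"
  shows "x * y powr q \<le> x powr (r / (r - q)) + y powr r"
proof (cases "x \<le> y powr (r - q)")
  case True
  then have "x * y powr q \<le> y powr (r - q) * y powr q" by (intro mult_right_mono) auto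
  also have "\<dots> = y powr r" by (simp flip: powr_add)
  finally show ?thesis by (simp add: add_increasing)
next
  case False
  then have x: "x > 0" using assms(1) powr_ge_zero[of y "r - q"] by linarith
  have "y = (y powr (r - q)) powr (1 / (r - q))" using assms by (simp add: powr_powr)
  also have "\<dots> \<le> x powr (1 / (r - q))" using False assms by (intro powr_mono2) auto
  finally have "y powr q \<le> (x powr (1 / (r - q))) powr q" using assms by (intro powr_mono2) auto
  then have "x * y powr q \<le> x * x powr (q / (r - q))" using x by (simp add: powr_powr mult.commute)
  also have "\<dots> = x powr (1 + q / (r - q))" using x by (simp add: powr_add)
  also have "1 + q / (r - q) = r / (r - q)" using assms by (simp add: field_simps)
  finally show ?thesis by (simp add: add_increasing2)
qed

lemma powr_truncate:
  fixes y L :: real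
  assumes "y \<ge> 0" "L > 0" "0 < r" "r < m"
  shows "y powr r \<le> (min y L) powr r + L powr (r - m) * y powr m"
proof (cases "y \<le> L")
  case False
  then have "y powr r = y powr (r - m) * y powr m" using assms by (simp flip: powr_add)
  also have "\<dots> \<le> L powr (r - m) * y powr m" using False assms by (intro mult_right_mono powr_mono2') auto
  finally show ?thesis by (simp add: add_increasing)
qed (use assms in \<open>simp add: min_def\<close>)

text \<open>Truncate at height \<open>L\<close>: the truncated part is dominated on the bounded set, the tail is at most
  \<open>L powr (r - m) * K\<close>.\<close>

lemma AE_limit_integral_tendsto:
  assumes v: "\<And>k::nat. vanishing (v k)" and lim: "AE x in lebesgue. (\<lambda>k. v k x) \<longlonglongrightarrow> 0"
    and r: "0 < r" "r < m" and bd: "\<And>k. (\<integral>\<^sup>+x. ennreal (\<bar>v k x\<bar> powr m) \<partial>lebesgue) \<le> ennreal K" and K: "K \<ge> 0"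
  shows "(\<lambda>k. LINT x|lebesgue. \<bar>v k x\<bar> powr r) \<longlonglongrightarrow> 0"
proof (rule LIMSEQ_I)
  fix e :: real assume e: "e > 0"
  have vm: "v k \<in> borel_measurable lebesgue" for k using vanishing_measurable[OF v] .
  \<comment> \<open>Solved so that \<open>L powr (r - m)\<close> times \<open>K + 1\<close> equals
    \<open>e / 2\<close>; the exponent \<open>r - m\<close> is negative, so small \<open>e\<close>
    means large \<open>L\<close>.\<close>
  define L where "L = (e / 2 / (K + 1)) powr (1 / (r - m))"
  have base: "e / 2 / (K + 1) > 0" using e K by simp
  have L: "L > 0" using less_imp_neq[OF base] unfolding L_def powr_gt_zero by (rule not_sym)
  have Lp: "L powr (r - m) = e / 2 / (K + 1)"
  proof -
    have "1 / (r - m) * (r - m) = 1" using r by simp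
    then show ?thesis unfolding L_def powr_powr using base by (simp only: powr_one less_imp_le)
  qed
  have m_int: "integrable lebesgue (\<lambda>x. \<bar>v k x\<bar> powr m)" and m_le: "(LINT x|lebesgue. \<bar>v k x\<bar> powr m) \<le> K" for k
    using integral_le_of_nn[OF _ _ bd[of k] K] powr_real_measurable[OF borel_measurable_abs[OF vm] borel_measurable_const] by auto
  have ind_int: "integrable lebesgue (\<lambda>x. c * indicat_real \<Omega> x)" for c
    using emeasure_\<Omega> by (intro integrable_mult_right integrable_real_indicator) auto
  let ?t = "\<lambda>k x. (min \<bar>v k x\<bar> L) powr r"
  have t_meas: "?t k \<in> borel_measurable lebesgue" for k using vm[of k] by measurable
  have t_bd: "AE x in lebesgue. norm (?t k x) \<le> L powr r * indicat_real \<Omega> x" for k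
  proof -
    have "AE x in lebesgue. x \<notin> \<Omega> \<longrightarrow> v k x = 0" using v[of k] by (simp add: vanishing_def)
    then show ?thesis by eventually_elim (use L r in \<open>auto simp: indicator_def intro!: powr_mono2\<close>)
  qed
  have t_int: "integrable lebesgue (?t k)" for k
    by (rule Bochner_Integration.integrable_bound[OF ind_int[of "L powr r"] t_meas]) (use t_bd[of k] in \<open>auto elim!: AE_mp\<close>)
  have "(\<lambda>k. LINT x|lebesgue. ?t k x) \<longlonglongrightarrow> (LINT x|(lebesgue :: 'a measure). (0::real))"
  proof (rule integral_dominated_convergence[where w = "\<lambda>x. L powr r * indicat_real \<Omega> x"])
    show "AE x in lebesgue. (\<lambda>k. ?t k x) \<longlonglongrightarrow> 0"
      using lim
    proof eventually_elim
      case (elim x)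
      have "(\<lambda>k. ?t k x) \<longlonglongrightarrow> (min \<bar>0\<bar> L) powr r"
        using r L by (intro tendsto_powr' tendsto_min tendsto_rabs elim tendsto_const) auto
      then show ?case using L r by simp
    qed
  qed (use t_meas t_bd ind_int in auto)
  then have "\<forall>\<^sub>F k in sequentially. (LINT x|lebesgue. ?t k x) < e / 2" using e by (intro order_tendstoD(2)) auto
  then obtain k0 where k0: "\<And>k. k \<ge> k0 \<Longrightarrow> (LINT x|lebesgue. ?t k x) < e / 2" by (auto simp: eventually_sequentially)
  have "norm ((LINT x|lebesgue. \<bar>v k x\<bar> powr r) - 0) < e" if k: "k \<ge> k0" for k
  proof -
    have rm: "(\<lambda>x. \<bar>v k x\<bar> powr r) \<in> borel_measurable lebesgue"
      by (intro powr_real_measurable borel_measurable_abs vm borel_measurable_const)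
    have pw: "\<bar>v k x\<bar> powr r \<le> ?t k x + L powr (r - m) * \<bar>v k x\<bar> powr m" for x using powr_truncate[of "\<bar>v k x\<bar>" L r m] L r by simp
    have int: "integrable lebesgue (\<lambda>x. ?t k x + L powr (r - m) * \<bar>v k x\<bar> powr m)"
      by (intro Bochner_Integration.integrable_add t_int integrable_mult_right m_int)
    have r_int: "integrable lebesgue (\<lambda>x. \<bar>v k x\<bar> powr r)"
      by (rule Bochner_Integration.integrable_bound[OF int rm], rule AE_I2) (use pw in \<open>auto intro: order_trans[OF _ abs_ge_self]\<close>)
    have "(LINT x|lebesgue. \<bar>v k x\<bar> powr r) \<le> (LINT x|lebesgue. ?t k x + L powr (r - m) * \<bar>v k x\<bar> powr m)"
      by (rule integral_mono[OF r_int int pw])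
    also have "\<dots> = (LINT x|lebesgue. ?t k x) + L powr (r - m) * (LINT x|lebesgue. \<bar>v k x\<bar> powr m)"
      using t_int m_int by simp
    also have "L powr (r - m) * (LINT x|lebesgue. \<bar>v k x\<bar> powr m) \<le> e / 2 / (K + 1) * (K + 1)"
      unfolding Lp using m_le[of k] base K by (intro mult_mono) (auto intro!: Bochner_Integration.integral_nonneg)
    also have "e / 2 / (K + 1) * (K + 1) = e / 2" using K by (intro pos_divide_mult_cancel) simp
    finally have "(LINT x|lebesgue. \<bar>v k x\<bar> powr r) < e" using k0[OF k] by linarith
    moreover have "(LINT x|lebesgue. \<bar>v k x\<bar> powr r) \<ge> 0" by (intro Bochner_Integration.integral_nonneg) simp
    ultimately show ?thesis by simp
  qed
  then show "\<exists>k0. \<forall>k\<ge>k0. norm ((LINT x|lebesgue. \<bar>v k x\<bar> powr r) - 0) < e" by blast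
qed

end


section \<open>The Kirchhoff problem\<close>

context bounded_open_set
begin

text \<open>Adds to the almost everywhere convergent subsequence what is known of its limit:
  membership in the space, lower semicontinuity by Fatou's lemma, and convergence in L^r. The
  seminorms themselves converge after a first extraction, but their limit may exceed the seminorm of
  \<open>u\<close>.\<close>

lemma bounded_subsequence:
  assumes U: "\<And>k::nat. U k \<in> closure_space" and B: "\<And>k. X0_norm s p \<Omega> (U k) \<le> B"
    and r: "0 < r" "r < real DIM('a) * p / (real DIM('a) - p * s)"
  shows "\<exists>u\<in>closure_space. \<exists>\<sigma> l. strict_mono \<sigma> \<and> (\<lambda>k. X0_norm s p \<Omega> (U (\<sigma> k))) \<longlonglongrightarrow> l \<and> X0_norm s p \<Omega> u \<le> l \<and>
    (\<lambda>k. LINT x|lebesgue. \<bar>U (\<sigma> k) x - u x\<bar> powr r) \<longlonglongrightarrow> 0"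
proof -
  let ?N = "X0_norm s p \<Omega>"
  have "?N (U k) \<in> {0..B}" for k using B[of k] X0_norm_nonneg by simp
  then obtain l \<sigma>1 where \<sigma>1: "strict_mono (\<sigma>1 :: nat \<Rightarrow> nat)" "(\<lambda>k. ?N (U (\<sigma>1 k))) \<longlonglongrightarrow> l"
    using compact_Icc[of 0 B] unfolding compact_def o_def by meson
  have E: "gagliardo_nn s p (U k) \<le> ennreal (B powr p)" for k
    unfolding gagliardo_nn_norm[OF U] using B[of k] X0_norm_nonneg p by (intro ennreal_leI powr_mono2) auto
  obtain \<sigma>2 u where \<sigma>2: "strict_mono (\<sigma>2 :: nat \<Rightarrow> nat)" and um: "u \<in> borel_measurable lebesgue"
    and lim: "AE x in lebesgue. (\<lambda>k. U (\<sigma>1 (\<sigma>2 k)) x) \<longlonglongrightarrow> u x"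
    using compact_AE_subsequence[of "\<lambda>k. U (\<sigma>1 k)", OF closure_spaceD[OF U] E] by auto
  define \<sigma> where "\<sigma> = (\<lambda>k. \<sigma>1 (\<sigma>2 k))"
  have mono: "strict_mono \<sigma>" using \<sigma>1(1) \<sigma>2 unfolding \<sigma>_def strict_mono_def by blast
  have lim: "AE x in lebesgue. (\<lambda>k. U (\<sigma> k) x) \<longlonglongrightarrow> u x" using lim by (simp add: \<sigma>_def)
  have u: "u \<in> closure_space" by (rule closure_space_AE_limit[OF U E um lim])
  have Nl: "(\<lambda>k. ?N (U (\<sigma> k))) \<longlonglongrightarrow> l"
    using LIMSEQ_subseq_LIMSEQ[OF \<sigma>1(2) \<sigma>2] by (simp add: \<sigma>_def o_def)
  have le: "?N u \<le> l"
  proof (rule field_le_epsilon)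
    fix e :: real assume e: "e > 0"
    have l0: "l \<ge> 0" by (rule LIMSEQ_le_const[OF Nl]) (simp add: X0_norm_nonneg)
    have "\<forall>\<^sub>F k in sequentially. ?N (U (\<sigma> k)) < l + e" using e by (intro order_tendstoD(2)[OF Nl]) simp
    then have "\<forall>\<^sub>F k in sequentially. gagliardo_nn s p (U (\<sigma> k)) \<le> ennreal ((l + e) powr p)"
    proof eventually_elim
      case (elim k)
      show ?case unfolding gagliardo_nn_norm[OF U] using elim X0_norm_nonneg[of "U (\<sigma> k)"] p by (intro ennreal_leI powr_mono2) auto
    qed
    then have "gagliardo_nn s p u \<le> ennreal ((l + e) powr p)"
      using p by (intro gagliardo_nn_fatou[OF vanishing_measurable[OF closure_spaceD[OF U]] lim]) auto
    then have *: "?N u powr p \<le> (l + e) powr p" unfolding gagliardo_nn_norm[OF u] by (simp add: ennreal_le_iff)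
    show "?N u \<le> l + e"
    proof (rule ccontr)
      assume "\<not> ?N u \<le> l + e"
      then have "(l + e) powr p < ?N u powr p" using p l0 e by (intro powr_less_mono2) auto
      then show False using * by simp
    qed
  qed
  \<comment> \<open>This uses the room between \<open>r\<close> and the critical exponent:
    boundedness in L^m with m > r upgrades almost everywhere convergence to convergence in
    L^r.\<close>
  obtain m where m: "r < m" "m < real DIM('a) * p / (real DIM('a) - p * s)" using dense[OF r(2)] by blast
  have m0: "0 < m" using r m by simp
  obtain C where C: "C > 0" "\<And>v. v \<in> closure_space \<Longrightarrow> (\<integral>\<^sup>+x. ennreal (\<bar>v x\<bar> powr m) \<partial>lebesgue) \<le> ennreal (C * ?N v powr m)"
    using sobolev_norm[OF m0 m(2)] by auto
  have d: "(\<lambda>x. U k x - u x) \<in> closure_space" for k by (rule diff_mem[OF U u])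
  have "(\<lambda>k. LINT x|lebesgue. \<bar>(\<lambda>k x. U (\<sigma> k) x - u x) k x\<bar> powr r) \<longlonglongrightarrow> 0"
  proof (rule AE_limit_integral_tendsto[OF closure_spaceD[OF d] _ r(1) m(1)])
    show "AE x in lebesgue. (\<lambda>k. U (\<sigma> k) x - u x) \<longlonglongrightarrow> 0"
      using lim
    proof eventually_elim
      case (elim x)
      show ?case using tendsto_diff[OF elim tendsto_const[of "u x"]] by simp
    qed
    fix k
    have "?N (\<lambda>x. U (\<sigma> k) x + (-1) * u x) \<le> ?N (U (\<sigma> k)) + ?N (\<lambda>x. (-1) * u x)" by (intro N_triangle U scale_mem u)
    also have "\<dots> \<le> B + ?N u" using B[of "\<sigma> k"] N_scale[OF u, of "-1"] by simp
    finally have "?N (\<lambda>x. U (\<sigma> k) x - u x) \<le> B + ?N u" by simp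
    then have "C * ?N (\<lambda>x. U (\<sigma> k) x - u x) powr m \<le> C * (B + ?N u) powr m"
      using C(1) m0 by (intro mult_left_mono powr_mono2 X0_norm_nonneg) auto
    then show "(\<integral>\<^sup>+x. ennreal (\<bar>U (\<sigma> k) x - u x\<bar> powr m) \<partial>lebesgue) \<le> ennreal (C * (B + ?N u) powr m)"
      using C(2)[OF d] by (meson ennreal_leI order_trans)
  qed (use C in auto)
  then show ?thesis using u mono Nl le by blast
qed

text \<open>The common property of the two coefficients: integrating
  \<open>\<bar>u x\<bar> powr t\<close> against the weight costs at most a power of the L^r norm. It
  holds with \<open>t = r\<close> for bounded weights and with \<open>t = q\<close> for weights in
  L^(r/(r-q)), so one exponent \<open>r\<close> governs both nonlinear terms.\<close>

definition controlled :: "real \<Rightarrow> ('a \<Rightarrow> real) \<Rightarrow> real \<Rightarrow> real \<Rightarrow> bool" where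
  "controlled r w t K \<longleftrightarrow> w \<in> borel_measurable lebesgue \<and> K \<ge> 0 \<and>
     (\<forall>u\<in>closure_space. integrable lebesgue (\<lambda>x. w x * \<bar>u x\<bar> powr t) \<and>
        (LINT x|lebesgue. \<bar>w x\<bar> * \<bar>u x\<bar> powr t) \<le> K * (LINT x|lebesgue. \<bar>u x\<bar> powr r) powr (t / r))"

lemma integrable_powr:
  assumes r: "0 < r" "r < real DIM('a) * p / (real DIM('a) - p * s)" and u: "u \<in> closure_space"
  shows "integrable lebesgue (\<lambda>x. \<bar>u x\<bar> powr r)"
proof -
  obtain C where C: "C > 0" "\<And>v. v \<in> closure_space \<Longrightarrow> (\<integral>\<^sup>+x. ennreal (\<bar>v x\<bar> powr r) \<partial>lebesgue) \<le> ennreal (C * X0_norm s p \<Omega> v powr r)"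
    using sobolev_norm[OF r] by auto
  show ?thesis
    by (rule integral_le_of_nn(1)[OF _ _ C(2)[OF u]])
      (use C(1) in \<open>auto intro!: powr_real_measurable borel_measurable_abs vanishing_measurable[OF closure_spaceD[OF u]]\<close>)
qed

lemma integral_powr_le:
  assumes r: "0 < r" "r < real DIM('a) * p / (real DIM('a) - p * s)"
  shows "\<exists>C>0. \<forall>u\<in>closure_space. (LINT x|lebesgue. \<bar>u x\<bar> powr r) \<le> C * X0_norm s p \<Omega> u powr r"
proof -
  obtain C where C: "C > 0" "\<And>v. v \<in> closure_space \<Longrightarrow> (\<integral>\<^sup>+x. ennreal (\<bar>v x\<bar> powr r) \<partial>lebesgue) \<le> ennreal (C * X0_norm s p \<Omega> v powr r)"
    using sobolev_norm[OF r] by auto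
  have "(LINT x|lebesgue. \<bar>u x\<bar> powr r) \<le> C * X0_norm s p \<Omega> u powr r" if u: "u \<in> closure_space" for u
    by (rule integral_le_of_nn(2)[OF _ _ C(2)[OF u]])
      (use C(1) in \<open>auto intro!: powr_real_measurable borel_measurable_abs vanishing_measurable[OF closure_spaceD[OF u]]\<close>)
  then show ?thesis using C(1) by blast
qed

lemma controlled_power_functional:
  assumes w: "controlled r w t K" and t: "1 < t" and r: "0 < r" "r < real DIM('a) * p / (real DIM('a) - p * s)"
  shows "\<exists>C\<ge>0. power_functional closure_space (X0_norm s p \<Omega>) lebesgue w (\<lambda>u. u) t C"
proof -
  have K: "K \<ge> 0" using w by (simp add: controlled_def)
  obtain C where C: "C > 0" "\<And>u. u \<in> closure_space \<Longrightarrow> (LINT x|lebesgue. \<bar>u x\<bar> powr r) \<le> C * X0_norm s p \<Omega> u powr r"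
    using integral_powr_le[OF r] by auto
  have "power_functional closure_space (X0_norm s p \<Omega>) lebesgue w (\<lambda>u. u) t (K * C powr (t / r))"
  proof
    fix u assume u: "u \<in> closure_space"
    have "(LINT x|lebesgue. \<bar>w x\<bar> * \<bar>u x\<bar> powr t) \<le> K * (LINT x|lebesgue. \<bar>u x\<bar> powr r) powr (t / r)"
      using w u by (simp add: controlled_def)
    also have "\<dots> \<le> K * (C * X0_norm s p \<Omega> u powr r) powr (t / r)"
      using K C(2)[OF u] t r by (intro mult_left_mono powr_mono2) (auto intro!: Bochner_Integration.integral_nonneg)
    also have "\<dots> = K * C powr (t / r) * X0_norm s p \<Omega> u powr t" using r C(1) by (simp add: powr_mult powr_powr)
    finally show "(LINT x|lebesgue. \<bar>w x\<bar> * \<bar>u x\<bar> powr t) \<le> K * C powr (t / r) * X0_norm s p \<Omega> u powr t" .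
    show "u \<in> borel_measurable lebesgue" by (rule vanishing_measurable[OF closure_spaceD[OF u]])
    show "integrable lebesgue (\<lambda>x. w x * \<bar>u x\<bar> powr t)" using w u by (simp add: controlled_def)
  qed (use w t K in \<open>auto simp: controlled_def\<close>)
  then show ?thesis using K by (intro exI[of _ "K * C powr (t / r)"]) simp
qed

lemma controlled_tendsto:
  assumes w: "controlled r w t K" and t: "1 < t" and r: "0 < r" "r < real DIM('a) * p / (real DIM('a) - p * s)"
    and U: "\<And>k::nat. U k \<in> closure_space" "u \<in> closure_space" and lim: "(\<lambda>k. LINT x|lebesgue. \<bar>U k x - u x\<bar> powr r) \<longlonglongrightarrow> 0"
  shows "(\<lambda>k. LINT x|lebesgue. w x * \<bar>U k x\<bar> powr t) \<longlonglongrightarrow> (LINT x|lebesgue. w x * \<bar>u x\<bar> powr t)"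
proof -
  obtain C where "power_functional closure_space (X0_norm s p \<Omega>) lebesgue w (\<lambda>u. u) t C"
    using controlled_power_functional[OF w t r] by auto
  then interpret P: power_functional closure_space "X0_norm s p \<Omega>" lebesgue w "\<lambda>u. u" t C .
  have "(\<lambda>k. LINT x|lebesgue. \<bar>w x\<bar> * \<bar>U k x - u x\<bar> powr t) \<longlonglongrightarrow> 0"
  proof (rule tendsto_sandwich[where f = "\<lambda>_. 0" and h = "\<lambda>k. K * (LINT x|lebesgue. \<bar>U k x - u x\<bar> powr r) powr (t / r)"])
    have "(\<lambda>k. K * (LINT x|lebesgue. \<bar>U k x - u x\<bar> powr r) powr (t / r)) \<longlonglongrightarrow> K * 0 powr (t / r)"
      using t r by (intro tendsto_mult tendsto_const tendsto_powr' lim) (auto intro!: always_eventually Bochner_Integration.integral_nonneg)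
    then show "(\<lambda>k. K * (LINT x|lebesgue. \<bar>U k x - u x\<bar> powr r) powr (t / r)) \<longlonglongrightarrow> 0" by simp
    show "\<forall>\<^sub>F k in sequentially. (LINT x|lebesgue. \<bar>w x\<bar> * \<bar>U k x - u x\<bar> powr t) \<le> K * (LINT x|lebesgue. \<bar>U k x - u x\<bar> powr r) powr (t / r)"
      using w diff_mem[OF U(1) U(2)] by (intro always_eventually allI) (simp add: controlled_def)
  qed (auto intro!: always_eventually Bochner_Integration.integral_nonneg)
  then show ?thesis by (rule P.\<Phi>_tendsto[of U u, unfolded P.\<Phi>_def, OF U])
qed

lemma controlled_bounded:
  assumes w: "w \<in> borel_measurable lebesgue" and bd: "AE x in lebesgue. \<bar>w x\<bar> \<le> K"
    and r: "0 < r" "r < real DIM('a) * p / (real DIM('a) - p * s)"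
  shows "controlled r w r \<bar>K\<bar>"
  unfolding controlled_def
proof (intro conjI ballI w abs_ge_zero)
  fix u assume u: "u \<in> closure_space"
  note i = integrable_powr[OF r u]
  have um: "u \<in> borel_measurable lebesgue" by (rule vanishing_measurable[OF closure_spaceD[OF u]])
  have m: "(\<lambda>x. w x * \<bar>u x\<bar> powr r) \<in> borel_measurable lebesgue"
    by (intro borel_measurable_times w powr_real_measurable borel_measurable_abs um borel_measurable_const)
  have K: "AE x in lebesgue. norm (w x * \<bar>u x\<bar> powr r) \<le> norm (\<bar>K\<bar> * \<bar>u x\<bar> powr r)"
    using bd
  proof eventually_elim
    case (elim x)
    then have "\<bar>w x\<bar> * \<bar>u x\<bar> powr r \<le> \<bar>K\<bar> * \<bar>u x\<bar> powr r" by (intro mult_right_mono) auto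
    then show ?case by (simp add: abs_mult)
  qed
  show int: "integrable lebesgue (\<lambda>x. w x * \<bar>u x\<bar> powr r)"
    by (rule Bochner_Integration.integrable_bound[OF integrable_mult_right[OF i] m K])
  have "(LINT x|lebesgue. \<bar>w x\<bar> * \<bar>u x\<bar> powr r) \<le> (LINT x|lebesgue. \<bar>K\<bar> * \<bar>u x\<bar> powr r)"
  proof (rule integral_mono_AE)
    show "integrable lebesgue (\<lambda>x. \<bar>w x\<bar> * \<bar>u x\<bar> powr r)" using integrable_abs[OF int] by (simp add: abs_mult)
    show "integrable lebesgue (\<lambda>x. \<bar>K\<bar> * \<bar>u x\<bar> powr r)" by (rule integrable_mult_right[OF i])
    show "AE x in lebesgue. \<bar>w x\<bar> * \<bar>u x\<bar> powr r \<le> \<bar>K\<bar> * \<bar>u x\<bar> powr r" using K by (simp add: abs_mult)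
  qed
  also have "\<dots> = \<bar>K\<bar> * (LINT x|lebesgue. \<bar>u x\<bar> powr r) powr (r / r)"
    using r by (simp add: Bochner_Integration.integral_nonneg)
  finally show "(LINT x|lebesgue. \<bar>w x\<bar> * \<bar>u x\<bar> powr r) \<le> \<bar>K\<bar> * (LINT x|lebesgue. \<bar>u x\<bar> powr r) powr (r / r)" .
qed

text \<open>Hoelder's inequality with exponents r/(r-q) and r/q, up to a constant:
  \<open>young_weight\<close> is applied to \<open>u\<close> divided by its L^r norm.\<close>

lemma controlled_integrable:
  assumes w: "w \<in> borel_measurable lebesgue" and wi: "integrable lebesgue (\<lambda>x. \<bar>w x\<bar> powr (r / (r - q)))" and q: "0 < q" "q < r"
    and r: "r < real DIM('a) * p / (real DIM('a) - p * s)"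
  shows "controlled r w q ((LINT x|lebesgue. \<bar>w x\<bar> powr (r / (r - q))) + 1)"
  unfolding controlled_def
proof (intro conjI ballI w)
  let ?K = "LINT x|lebesgue. \<bar>w x\<bar> powr (r / (r - q))"
  show "0 \<le> ?K + 1" by (intro add_nonneg_nonneg Bochner_Integration.integral_nonneg) auto
  fix u assume u: "u \<in> closure_space"
  have r0: "r > 0" using q by simp
  note i = integrable_powr[OF r0 r u]
  have um: "u \<in> borel_measurable lebesgue" by (rule vanishing_measurable[OF closure_spaceD[OF u]])
  have m: "(\<lambda>x. w x * \<bar>u x\<bar> powr q) \<in> borel_measurable lebesgue"
    by (intro borel_measurable_times w powr_real_measurable borel_measurable_abs um borel_measurable_const)
  show int: "integrable lebesgue (\<lambda>x. w x * \<bar>u x\<bar> powr q)"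
  proof (rule Bochner_Integration.integrable_bound[OF Bochner_Integration.integrable_add[OF wi i] m], rule AE_I2)
    show "norm (w x * \<bar>u x\<bar> powr q) \<le> norm (\<bar>w x\<bar> powr (r / (r - q)) + \<bar>u x\<bar> powr r)" for x
      using young_weight[of "\<bar>w x\<bar>" "\<bar>u x\<bar>" q r] q by (simp add: abs_mult)
  qed
  then have int': "integrable lebesgue (\<lambda>x. \<bar>w x\<bar> * \<bar>u x\<bar> powr q)" using integrable_abs[OF int] by (simp add: abs_mult)
  define J where "J = (LINT x|lebesgue. \<bar>u x\<bar> powr r)"
  have J: "J \<ge> 0" unfolding J_def by (intro Bochner_Integration.integral_nonneg) simp
  show "(LINT x|lebesgue. \<bar>w x\<bar> * \<bar>u x\<bar> powr q) \<le> (?K + 1) * J powr (q / r)"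
  proof (cases "J = 0")
    case True
    then have "AE x in lebesgue. \<bar>u x\<bar> powr r = 0"
      using integral_nonneg_eq_0_iff_AE[OF i] unfolding J_def by simp
    then have "AE x in lebesgue. \<bar>w x\<bar> * \<bar>u x\<bar> powr q = 0" by eventually_elim simp
    then have "(LINT x|lebesgue. \<bar>w x\<bar> * \<bar>u x\<bar> powr q) = 0" by (rule integral_eq_zero_AE)
    then show ?thesis using True by simp
  next
    case False
    define d where "d = J powr (1 / r)"
    have d: "d > 0" using False J by (simp add: d_def)
    have dr: "d powr r = J" and dq: "d powr q = J powr (q / r)" using J r0 by (auto simp: d_def powr_powr)
    have pw: "\<bar>w x\<bar> * \<bar>u x\<bar> powr q \<le> d powr q * (\<bar>w x\<bar> powr (r / (r - q)) + \<bar>u x\<bar> powr r / J)" for x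
    proof -
      have "\<bar>w x\<bar> * (\<bar>u x\<bar> / d) powr q \<le> \<bar>w x\<bar> powr (r / (r - q)) + (\<bar>u x\<bar> / d) powr r"
        using d q by (intro young_weight) auto
      then have "d powr q * (\<bar>w x\<bar> * (\<bar>u x\<bar> / d) powr q) \<le> d powr q * (\<bar>w x\<bar> powr (r / (r - q)) + (\<bar>u x\<bar> / d) powr r)"
        by (intro mult_left_mono) auto
      moreover have "d powr q * (\<bar>w x\<bar> * (\<bar>u x\<bar> / d) powr q) = \<bar>w x\<bar> * \<bar>u x\<bar> powr q"
        using d by (simp add: powr_divide)
      moreover have "(\<bar>u x\<bar> / d) powr r = \<bar>u x\<bar> powr r / J" using d dr by (simp add: powr_divide)
      ultimately show ?thesis by simp
    qed
    have "(LINT x|lebesgue. \<bar>w x\<bar> * \<bar>u x\<bar> powr q) \<le> (LINT x|lebesgue. d powr q * (\<bar>w x\<bar> powr (r / (r - q)) + \<bar>u x\<bar> powr r / J))"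
      using wi i by (intro integral_mono[OF int' _ pw]) auto
    also have "\<dots> = d powr q * (?K + J / J)" using wi i by (simp add: J_def)
    also have "\<dots> = (?K + 1) * J powr (q / r)" using False dq by (simp add: mult.commute)
    finally show ?thesis .
  qed
qed

text \<open>On \<Omega>, which has finite measure, the modulus of \<open>w\<close> is at most 1 or
  at most its own power with exponent \<open>t\<close>.\<close>

lemma indicator_weight_integrable:
  fixes w :: "'a \<Rightarrow> real"
  assumes w: "w \<in> borel_measurable lebesgue" and supp: "\<And>x. x \<notin> \<Omega> \<Longrightarrow> w x = 0" and t: "t \<ge> 1"
    and i: "integrable lebesgue (\<lambda>x. \<bar>w x\<bar> powr t)"
  shows "integrable lebesgue w"
proof -
  have ind: "integrable lebesgue (indicat_real \<Omega>)"
    using emeasure_\<Omega> by (intro integrable_real_indicator) auto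
  show ?thesis
  proof (rule Bochner_Integration.integrable_bound[OF Bochner_Integration.integrable_add[OF ind i] w], rule AE_I2)
    fix x
    have "\<bar>w x\<bar> \<le> indicat_real \<Omega> x + \<bar>w x\<bar> powr t"
    proof (cases "\<bar>w x\<bar> \<le> 1")
      case True
      then show ?thesis using supp[of x] by (cases "x \<in> \<Omega>") (auto simp: add_increasing2)
    next
      case False
      then have "\<bar>w x\<bar> powr 1 \<le> \<bar>w x\<bar> powr t" using t by (intro powr_mono) auto
      then show ?thesis by (simp add: add_increasing)
    qed
    then show "norm (w x) \<le> norm (indicat_real \<Omega> x + \<bar>w x\<bar> powr t)" by simp
  qed
qed

theorem two_solutions:
  assumes exps: "1 < q" "q < p" "2 * p < r" "r < real DIM('a) * p / (real DIM('a) - p * s)" and ab: "a > 0" "b > 0"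
    and f: "f \<in> Lp_on (r / (r - q)) \<Omega>" and g: "g \<in> Linf_on \<Omega>"
    and f_pos: "\<not> (AE x in lebesgue. x \<in> \<Omega> \<longrightarrow> max (f x) 0 = 0)"
    and g_pos: "\<not> (AE x in lebesgue. x \<in> \<Omega> \<longrightarrow> max (g x) 0 = 0)"
  shows "\<exists>lam0>0. \<forall>lam\<in>{0<..<lam0}.
     C1_submanifold (X0_space s p \<Omega>) (X0_norm s p \<Omega>) (nehari s p q r a b \<Omega> f g lam) \<and>
     (\<exists>u v. weak_solution s p q r a b \<Omega> f g lam u \<and>
            weak_solution s p q r a b \<Omega> f g lam v \<and>
            \<not> (AE x in lebesgue. u x = v x))"
proof -
  let ?V = closure_space and ?N = "X0_norm s p \<Omega>"
  have powers: "0 < q" "q < r" "0 < r" "1 < r" "p < r" "p > 0" using exps p by auto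
  \<comment> \<open>Extending the coefficients by 0 turns integrals over \<Omega> into integrals
    over the whole space, the form in which \<open>power_functional\<close> is set up.\<close>
  define wf where "wf = (\<lambda>x. indicat_real \<Omega> x * f x)"
  define wg where "wg = (\<lambda>x. indicat_real \<Omega> x * g x)"
  have wf_m: "wf \<in> borel_measurable lebesgue" and wg_m: "wg \<in> borel_measurable lebesgue"
    using f g by (simp_all add: Lp_on_def Linf_on_def set_borel_measurable_def wf_def wg_def)
  have "(\<lambda>x. \<bar>wf x\<bar> powr (r / (r - q))) = (\<lambda>x. indicat_real \<Omega> x *\<^sub>R \<bar>f x\<bar> powr (r / (r - q)))"
    by (auto simp: wf_def indicator_def)
  then have wf_i: "integrable lebesgue (\<lambda>x. \<bar>wf x\<bar> powr (r / (r - q)))"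
    using f by (simp add: Lp_on_def set_integrable_def)
  obtain B where B: "AE x in lebesgue. x \<in> \<Omega> \<longrightarrow> \<bar>g x\<bar> \<le> B" using g by (auto simp: Linf_on_def)
  have wg_bd: "AE x in lebesgue. \<bar>wg x\<bar> \<le> \<bar>B\<bar>" using B by eventually_elim (auto simp: wg_def indicator_def)
  note cf = controlled_integrable[OF wf_m wf_i powers(1,2) exps(4)]
  note cg = controlled_bounded[OF wg_m wg_bd powers(3) exps(4)]
  obtain Cf where Cf: "Cf \<ge> 0" "power_functional ?V ?N lebesgue wf (\<lambda>u. u) q Cf"
    using controlled_power_functional[OF cf exps(1) powers(3) exps(4)] by auto
  obtain Cg where Cg: "Cg \<ge> 0" "power_functional ?V ?N lebesgue wg (\<lambda>u. u) r Cg"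
    using controlled_power_functional[OF cg powers(4) powers(3) exps(4)] by auto
  interpret F: power_functional ?V ?N lebesgue wf "\<lambda>u. u" q Cf by (rule Cf(2))
  interpret G: power_functional ?V ?N lebesgue wg "\<lambda>u. u" r Cg by (rule Cg(2))
  have wf_int: "integrable lebesgue wf"
    using powers by (intro indicator_weight_integrable[OF wf_m _ _ wf_i]) (auto simp: wf_def)
  have wg_int: "integrable lebesgue wg"
  proof (rule indicator_weight_integrable[OF wg_m])
    have ind: "integrable lebesgue (\<lambda>x. \<bar>B\<bar> * indicat_real \<Omega> x)"
      using emeasure_\<Omega> by (intro integrable_mult_right integrable_real_indicator) auto
    have "integrable lebesgue wg"
    proof (rule Bochner_Integration.integrable_bound[OF ind wg_m])
      show "AE x in lebesgue. norm (wg x) \<le> norm (\<bar>B\<bar> * indicat_real \<Omega> x)"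
        using B by eventually_elim (auto simp: wg_def indicator_def)
    qed
    then show "integrable lebesgue (\<lambda>x. \<bar>wg x\<bar> powr 1)" by simp
  qed (auto simp: wg_def)
  have test: "\<exists>u\<in>?V. (LINT x|lebesgue. indicat_real \<Omega> x * h x * \<bar>u x\<bar> powr t) > 0"
    if i: "integrable lebesgue (\<lambda>x. indicat_real \<Omega> x * h x)" and n: "\<not> (AE x in lebesgue. x \<in> \<Omega> \<longrightarrow> max (h x) 0 = 0)" and t: "t > 0" for h t
  proof -
    have "(x \<in> \<Omega> \<longrightarrow> indicat_real \<Omega> x * h x \<le> 0) = (x \<in> \<Omega> \<longrightarrow> max (h x) 0 = 0)" for x by (auto simp: max_def)
    then have "\<not> (AE x in lebesgue. x \<in> \<Omega> \<longrightarrow> indicat_real \<Omega> x * h x \<le> 0)" using n by simp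
    from exists_test_function_integral_pos[OF open_\<Omega> i this t] show ?thesis
      using test_functions_closure_space by blast
  qed
  \<comment> \<open>1 is added to the constants because the locale requires them to be
    positive.\<close>
  have "kirchhoff_functional ?V ?N F.\<Phi> G.\<Phi> D_norm F.D\<Phi> G.D\<Phi> p q r a b (Cf + 1) (Cg + 1)"
  proof
    show "C1_functional ?V ?N ?V (\<lambda>u. ?N u powr p) D_norm" by (rule C1_norm_powr)
    show "C1_functional ?V ?N ?V F.\<Phi> F.D\<Phi>" by (rule F.C1_\<Phi>)
    show "C1_functional ?V ?N ?V G.\<Phi> G.D\<Phi>" by (rule G.C1_\<Phi>)
    show "F.\<Phi> (\<lambda>x. c * u x) = \<bar>c\<bar> powr q * F.\<Phi> u" "G.\<Phi> (\<lambda>x. c * u x) = \<bar>c\<bar> powr r * G.\<Phi> u" for c u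
      by (rule F.\<Phi>_scale G.\<Phi>_scale)+
    show "\<bar>F.\<Phi> u\<bar> \<le> (Cf + 1) * ?N u powr q" "\<bar>G.\<Phi> u\<bar> \<le> (Cg + 1) * ?N u powr r" if "u \<in> ?V" for u
      using F.abs_\<Phi>_le[OF that] G.abs_\<Phi>_le[OF that] by (simp_all add: distrib_right add_increasing2)
    show "(\<lambda>x. \<bar>u x\<bar>) \<in> ?V" if "u \<in> ?V" for u using that by (rule closure_space_abs)
    show "?N (\<lambda>x. \<bar>u x\<bar>) \<le> ?N u" if u: "u \<in> ?V" for u
    proof -
      have "ennreal (?N (\<lambda>x. \<bar>u x\<bar>) powr p) \<le> ennreal (?N u powr p)"
        using gagliardo_nn_abs[of u] unfolding gagliardo_nn_norm[OF closure_space_abs[OF u]] gagliardo_nn_norm[OF u] .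
      then have *: "?N (\<lambda>x. \<bar>u x\<bar>) powr p \<le> ?N u powr p" by (simp add: ennreal_le_iff)
      show ?thesis
      proof (rule ccontr)
        assume "\<not> ?thesis"
        then have "?N u powr p < ?N (\<lambda>x. \<bar>u x\<bar>) powr p" using powers X0_norm_nonneg by (intro powr_less_mono2) auto
        then show False using * by simp
      qed
    qed
    show "F.\<Phi> (\<lambda>x. \<bar>u x\<bar>) = F.\<Phi> u" "G.\<Phi> (\<lambda>x. \<bar>u x\<bar>) = G.\<Phi> u" for u by (simp_all add: F.\<Phi>_def G.\<Phi>_def)
    show "\<exists>u\<in>?V. 0 < F.\<Phi> u" using test[OF wf_int[unfolded wf_def] f_pos powers(1)] unfolding F.\<Phi>_def by (simp add: wf_def)
    show "\<exists>u\<in>?V. 0 < G.\<Phi> u" using test[OF wg_int[unfolded wg_def] g_pos powers(3)] unfolding G.\<Phi>_def by (simp add: wg_def)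
    fix U :: "nat \<Rightarrow> 'a \<Rightarrow> real" and b
    assume U: "\<And>k. U k \<in> ?V" and bd: "\<And>k. ?N (U k) \<le> b"
    obtain u \<sigma> l where u: "u \<in> ?V" and \<sigma>: "strict_mono \<sigma>" "(\<lambda>k. ?N (U (\<sigma> k))) \<longlonglongrightarrow> l" "?N u \<le> l"
      and lim: "(\<lambda>k. LINT x|lebesgue. \<bar>U (\<sigma> k) x - u x\<bar> powr r) \<longlonglongrightarrow> 0"
      using bounded_subsequence[of U b r, OF U bd powers(3) exps(4)] by blast
    have "(\<lambda>k. F.\<Phi> (U (\<sigma> k))) \<longlonglongrightarrow> F.\<Phi> u" "(\<lambda>k. G.\<Phi> (U (\<sigma> k))) \<longlonglongrightarrow> G.\<Phi> u"
      unfolding F.\<Phi>_def G.\<Phi>_def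
      by (rule controlled_tendsto[of _ _ _ _ "\<lambda>k. U (\<sigma> k)", OF cf exps(1) powers(3) exps(4) U u lim]
          controlled_tendsto[of _ _ _ _ "\<lambda>k. U (\<sigma> k)", OF cg powers(4) powers(3) exps(4) U u lim])+
    then show "\<exists>u\<in>?V. \<exists>\<sigma> l. strict_mono \<sigma> \<and> (\<lambda>k. ?N (U (\<sigma> k))) \<longlonglongrightarrow> l \<and> ?N u \<le> l \<and>
        (\<lambda>k. F.\<Phi> (U (\<sigma> k))) \<longlonglongrightarrow> F.\<Phi> u \<and> (\<lambda>k. G.\<Phi> (U (\<sigma> k))) \<longlonglongrightarrow> G.\<Phi> u"
      using u \<sigma> by (intro bexI[of _ u] exI[of _ \<sigma>] exI[of _ l] conjI)
  qed (use exps ab Cf Cg in auto)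
  then interpret K: kirchhoff_functional ?V ?N F.\<Phi> G.\<Phi> D_norm F.D\<Phi> G.D\<Phi> p q r a b "Cf + 1" "Cg + 1" .
  have F_eq: "(LINT x:\<Omega>|lebesgue. f x * \<bar>u x\<bar> powr q) = F.\<Phi> u" and G_eq: "(LINT x:\<Omega>|lebesgue. g x * \<bar>u x\<bar> powr r) = G.\<Phi> u" for u
    unfolding set_lebesgue_integral_def F.\<Phi>_def G.\<Phi>_def by (simp_all add: wf_def wg_def mult.assoc)
  have DF_eq: "F.D\<Phi> u h = q * (LINT x:\<Omega>|lebesgue. f x * \<bar>u x\<bar> powr (q - 2) * u x * h x)"
    and DG_eq: "G.D\<Phi> u h = r * (LINT x:\<Omega>|lebesgue. g x * \<bar>u x\<bar> powr (r - 2) * u x * h x)" for u h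
    unfolding set_lebesgue_integral_def F.D\<Phi>_def G.D\<Phi>_def by (simp_all add: wf_def wg_def mult.assoc)
  have DE_eq: "D_norm u h = p * (LINT z|lebesgue. \<bar>u (fst z) - u (snd z)\<bar> powr (p - 2) * (u (fst z) - u (snd z)) * (h (fst z) - h (snd z))
      / norm (fst z - snd z) powr (real DIM('a) + p * s))" for u h
    by (simp add: D_norm_def riesz_kernel_def)
  have weak: "weak_solution s p q r a b \<Omega> f g lam u"
    if u: "u \<in> ?V" "\<And>x. u x \<ge> 0" "K.energy lam u \<noteq> 0" "\<And>h. h \<in> ?V \<Longrightarrow> K.Denergy lam u h = 0" for lam u
    unfolding weak_solution_def X0_space_eq kirchhoff_def
  proof (intro conjI ballI u(1))
    show "AE x in lebesgue. x \<in> \<Omega> \<longrightarrow> u x \<ge> 0" using u(2) by simp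
    \<comment> \<open>A function vanishing almost everywhere has energy 0, so nonzero energy
      excludes the trivial solution.\<close>
    show "\<not> (AE x in lebesgue. x \<in> \<Omega> \<longrightarrow> u x = 0)"
    proof
      assume *: "AE x in lebesgue. x \<in> \<Omega> \<longrightarrow> u x = 0"
      have "AE x in lebesgue. x \<notin> \<Omega> \<longrightarrow> u x = 0" using closure_spaceD[OF u(1)] by (simp add: vanishing_def)
      with * have "AE x in lebesgue. u x = 0" by eventually_elim auto
      then have N: "?N u = 0" using X0_norm_zero_iff[OF u(1)] by simp
      have "F.\<Phi> u = 0" "G.\<Phi> u = 0" using K.F_le[OF u(1)] K.G_le[OF u(1)] N by simp_all
      then show False using u(3) N by (simp add: K.energy_def)
    qed
    fix h assume h: "h \<in> ?V"
    \<comment> \<open>The derivatives carry the factors p, q and r of their powers, which cancel the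
      coefficients of the energy.\<close>
    have scale: "x / p * (p * A) = x * A" "x / q * (q * A) = x * A" "1 / r * (r * A) = A" for x A
      using powers by auto
    show "(a + b * ?N u powr p) * (LINT z|lebesgue. \<bar>u (fst z) - u (snd z)\<bar> powr (p - 2) * (u (fst z) - u (snd z)) * (h (fst z) - h (snd z))
        / norm (fst z - snd z) powr (real DIM('a) + p * s))
      = lam * (LINT x:\<Omega>|lebesgue. f x * \<bar>u x\<bar> powr (q - 2) * u x * h x) + (LINT x:\<Omega>|lebesgue. g x * \<bar>u x\<bar> powr (r - 2) * u x * h x)"
      using u(4)[OF h] unfolding K.Denergy_def DE_eq DF_eq DG_eq scale by linarith
  qed
  have energy_cong: "K.energy lam u = K.energy lam v" if u: "u \<in> ?V" and v: "v \<in> ?V" and eq: "AE x in lebesgue. u x = v x" for lam u v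
  proof -
    have "ennreal (?N u powr p) = ennreal (?N v powr p)"
      unfolding gagliardo_nn_norm[OF u, symmetric] gagliardo_nn_norm[OF v, symmetric] by (rule gagliardo_nn_cong_AE[OF eq])
    then have N: "?N u powr p = ?N v powr p" by simp
    have cong: "(LINT x|lebesgue. w x * \<bar>u x\<bar> powr t) = (LINT x|lebesgue. w x * \<bar>v x\<bar> powr t)"
      if "integrable lebesgue (\<lambda>x. w x * \<bar>u x\<bar> powr t)" "integrable lebesgue (\<lambda>x. w x * \<bar>v x\<bar> powr t)" for w t
      using that eq by (intro integral_cong_AE) (auto elim!: AE_mp)
    have "F.\<Phi> u = F.\<Phi> v" "G.\<Phi> u = G.\<Phi> v"
      unfolding F.\<Phi>_def G.\<Phi>_def by (intro cong F.integrable_power G.integrable_power u v)+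
    then show ?thesis by (simp add: K.energy_def K.powr_double N)
  qed
  show ?thesis
  proof (intro exI[of _ K.lam0] conjI ballI K.lam0_pos)
    fix lam assume "lam \<in> {0<..<K.lam0}"
    then have lam: "0 < lam" "lam < K.lam0" by auto
    obtain e where e: "e \<in> ?V" "G.\<Phi> e > 0" using K.G_pos by auto
    have Ne: "?N e powr p > 0" using K.N_pos[OF e] by simp
    \<comment> \<open>A functional with \<open>l e = 1\<close> for the model space: the derivative
      of the p-th power of the norm at \<open>e\<close>, normalised by its value at
      \<open>e\<close>, which Euler's identity gives.\<close>
    define l where "l = (\<lambda>h. 1 / (p * ?N e powr p) * D_norm e h)"
    have "D_norm e e = p * ?N e powr p"
      by (rule C1_functional_homogeneous[OF C1_norm_powr e(1)]) (simp add: N_scale[OF e(1)] powr_mult X0_norm_nonneg)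
    then have le: "l e = 1" using Ne powers by (simp add: l_def)
    have De: "bounded_functional ?V ?N (D_norm e)" using C1_norm_powr e(1) by (simp add: C1_functional_def)
    have lb: "bounded_functional ?V ?N l"
      using bounded_functional_lincomb[OF De De, of "1 / (p * ?N e powr p)" 0] by (simp add: l_def)
    have "(\<not> (AE x in lebesgue. u x = 0)) = (?N u > 0)" if "u \<in> ?V" for u
      using X0_norm_zero_iff[OF that] X0_norm_nonneg[of u] by auto
    then have "nehari s p q r a b \<Omega> f g lam = {u \<in> ?V. ?N u > 0 \<and> K.nehari_functional lam u = 0}"
      unfolding nehari_def X0_space_eq F_eq G_eq K.nehari_functional_def
      by (intro Collect_cong conj_cong refl) simp_all
    then show "C1_submanifold (X0_space s p \<Omega>) ?N (nehari s p q r a b \<Omega> f g lam)"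
      unfolding X0_space_eq
      by (simp only:) (rule level_set_C1_submanifold[OF K.C1_nehari lb e(1) le K.nehari_regular[OF _ _ _ lam]])
    obtain u v where uv: "u \<in> ?V" "v \<in> ?V" "\<And>x. u x \<ge> 0" "\<And>x. v x \<ge> 0" "K.energy lam u < 0" "K.energy lam v > 0"
        "\<And>h. h \<in> ?V \<Longrightarrow> K.Denergy lam u h = 0" "\<And>h. h \<in> ?V \<Longrightarrow> K.Denergy lam v h = 0"
      using K.two_critical_points[OF lam] by blast
    show "\<exists>u v. weak_solution s p q r a b \<Omega> f g lam u \<and> weak_solution s p q r a b \<Omega> f g lam v \<and> \<not> (AE x in lebesgue. u x = v x)"
    proof (intro exI conjI)
      show "weak_solution s p q r a b \<Omega> f g lam u" using uv by (intro weak) auto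
      show "weak_solution s p q r a b \<Omega> f g lam v" using uv by (intro weak) auto
      show "\<not> (AE x in lebesgue. u x = v x)" using energy_cong[OF uv(1,2)] uv(5,6) by fastforce
    qed
  qed
qed

end

theorem theorem1p2:
  fixes \<Omega> :: "(real ^ 'n) set"
    and f g :: "real ^ 'n \<Rightarrow> real"
    and s p q r a b :: real
  assumes "0 < s" and "s < 1"
    and "2 \<le> p"
    and "p * s < real CARD('n)" and "real CARD('n) < 2 * p * s"
    and "1 < q" and "q < p"
    and "2 * p < r" and "r < real CARD('n) * p / (real CARD('n) - p * s)"
    and "bounded_smooth_domain \<Omega>"
    and "a > 0" and "b > 0"
    and "f \<in> Lp_on (r / (r - q)) \<Omega>"
    and "g \<in> Linf_on \<Omega>"
    and "\<not> (AE x in lebesgue. x \<in> \<Omega> \<longrightarrow> max (f x) 0 = 0)"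
    and "\<not> (AE x in lebesgue. x \<in> \<Omega> \<longrightarrow> max (g x) 0 = 0)"
  shows "\<exists>lam0>0. \<forall>lam\<in>{0<..<lam0}.
     C1_submanifold (X0_space s p \<Omega>) (X0_norm s p \<Omega>) (nehari s p q r a b \<Omega> f g lam) \<and>
     (\<exists>u v. weak_solution s p q r a b \<Omega> f g lam u \<and>
            weak_solution s p q r a b \<Omega> f g lam v \<and>
            \<not> (AE x in lebesgue. u x = v x))"
proof -
  interpret bounded_open_set \<Omega> s p
    using assms by unfold_locales (auto simp: bounded_smooth_domain_def)
  show ?thesis
    using assms by (intro two_solutions) auto
qed

end
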